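(* The measure $\|T\|\llcorner\Omega$ is absolutely continuous with respect to the one-dimensional Hausdorff measure $\mathcal{H}^1$. Moreover, for every $\|T\|$-measurable set $A\subseteq\Omega$ with $\mathcal{H}^1(A)<\infty$, the measure $\|T\|\llcorner A$ is countably $1$-rectifiable, and at $\|T\|$-almost every $x\in A$ its approximate tangent space contains the vectors $\vec T_1(x),\dots,\vec T_N(x)$.
   Context: Let $n,N\in\mathbb{N}$, $\Omega\subseteq\mathbb{R}^n$ a bounded domain with smooth boundary, $u_0\colon\mathbb{R}^n\to\mathbb{R}^N$ Lipschitz, $e_\infty=\inf\{\operatorname{ess\,sup}_\Omega|Du|:u\in u_0+W^{1,\infty}_0(\Omega;\mathbb{R}^N)\}$, assumed $>0$ (Frobenius norm $|\cdot|$, inner product $A:B$). For $2\le p<\infty$, $u_p$ is the unique minimiser of $E_p(u)=(\frac{1}{\mathcal{L}^n(\Omega)}\int_\Omega|Du|^p)^{1/p}$ in $u_0+W^{1,p}_0(\Omega;\mathbb{R}^N)$, $e_p=E_p(u_p)$, $\mu_p=\frac{|Du_p|^{p-2}}{e_p^{p-2}\mathcal{L}^n(\Omega)}\mathcal{L}^n\llcorner\Omega$, $M_p=(\mu_p,Du_p)$. Measure-function pair over $\overline\Omega$: $(\mu,F)$ with $\mu$ finite Radon on $\overline\Omega$, $F\in L^2(\mu;\mathbb{R}^{N\times n})$; weak convergence $(\mu_\ell,F_\ell)\rightharpoonup(\mu,F)$ means $\int(\eta+F_\ell:\phi)d\mu_\ell\to\int(\eta+F:\phi)d\mu$ for all $\eta\in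 C^0(\overline\Omega)$, $\phi\in C^0(\overline\Omega;\mathbb{R}^{N\times n})$, and $\limsup_\ell\int(1+|F_\ell|^2)d\mu_\ell<\infty$. Fix $p_\ell\to\infty$ with $u_{p_\ell}\rightharpoonup u_\infty$ weakly in $W^{1,q}$ for all $q<\infty$ and $M_{p_\ell}\rightharpoonup(\mu_\infty,F_\infty)$ weakly. Let $T=[\mu_\infty,F_\infty]$, i.e. $T_k(\omega)=\int_{\overline\Omega}\omega(F_{k\infty})\,d\mu_\infty$ with $F_{k\infty}$ the $k$-th row of $F_\infty$; write $T_k(\omega)=\int\omega(\vec T_k)\,d\|T\|$ with $\|T\|$ a finite Radon measure and $\vec T_k\colon\mathbb{R}^n\to\mathbb{R}^n$ with $\sum_k|\vec T_k|^2=1$ $\|T\|$-a.e. (unique representation). Countable $1$-rectifiability of a measure and approximate tangent spaces are in the standard sense of geometric measure theory (e.g. Mattila, Definition 16.6). *)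

theory Defs
  imports "HOL-Analysis.Analysis"
begin

definition smooth_fun :: "('a::euclidean_space \<Rightarrow> real) \<Rightarrow> bool" where
  "smooth_fun f \<longleftrightarrow> (\<exists>D :: 'a list \<Rightarrow> 'a \<Rightarrow> real. D [] = f \<and>
      (\<forall>vs. continuous_on UNIV (D vs)) \<and>
      (\<forall>vs v x. ((\<lambda>t. D vs (x + t *\<^sub>R v)) has_real_derivative D (v # vs) x) (at 0)))"

definition partial_deriv :: "'n::finite \<Rightarrow> (real^'n \<Rightarrow> real) \<Rightarrow> real^'n \<Rightarrow> real" where
  "partial_deriv i f x = deriv (\<lambda>t. f (x + t *\<^sub>R axis i 1)) 0"

definition grad :: "(real^'n \<Rightarrow> real) \<Rightarrow> real^'n \<Rightarrow> real^'n" where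
  "grad f x = (\<chi> i. partial_deriv i f x)"

definition grad_mat :: "(real^'n \<Rightarrow> real^'N) \<Rightarrow> real^'n \<Rightarrow> real^'n^'N" where
  "grad_mat f x = (\<chi> k i. partial_deriv i (\<lambda>y. f y $ k) x)"

definition test_fun :: "(real^'n) set \<Rightarrow> (real^'n \<Rightarrow> real) \<Rightarrow> bool" where
  "test_fun \<Omega> \<phi> \<longleftrightarrow> smooth_fun \<phi> \<and> compact (closure {x. \<phi> x \<noteq> 0})
      \<and> closure {x. \<phi> x \<noteq> 0} \<subseteq> \<Omega>"

definition smooth_boundary :: "(real^'n) set \<Rightarrow> bool" where
  "smooth_boundary \<Omega> \<longleftrightarrow> (\<forall>x\<in>frontier \<Omega>. \<exists>r>0. \<exists>\<psi>. smooth_fun \<psi> \<and>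
      (\<forall>y\<in>ball x r. grad \<psi> y \<noteq> 0) \<and> \<Omega> \<inter> ball x r = {y\<in>ball x r. \<psi> y < 0})"

definition bounded_smooth_domain :: "(real^'n) set \<Rightarrow> bool" where
  "bounded_smooth_domain \<Omega> \<longleftrightarrow> open \<Omega> \<and> connected \<Omega> \<and> \<Omega> \<noteq> {} \<and> bounded \<Omega>
      \<and> smooth_boundary \<Omega>"

definition Lp_on :: "(real^'n) set \<Rightarrow> real \<Rightarrow> (real^'n \<Rightarrow> 'b::real_normed_vector) \<Rightarrow> bool" where
  "Lp_on \<Omega> q f \<longleftrightarrow> set_borel_measurable lebesgue \<Omega> f \<and>
      (\<integral>\<^sup>+x\<in>\<Omega>. ennreal (norm (f x) powr q) \<partial>lebesgue) < \<infinity>"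

definition Linf_on :: "(real^'n) set \<Rightarrow> (real^'n \<Rightarrow> 'b::real_normed_vector) \<Rightarrow> bool" where
  "Linf_on \<Omega> f \<longleftrightarrow> set_borel_measurable lebesgue \<Omega> f \<and>
      (\<exists>C. AE x in lebesgue. x \<in> \<Omega> \<longrightarrow> norm (f x) \<le> C)"

definition weak_grad :: "(real^'n) set \<Rightarrow> (real^'n \<Rightarrow> real^'N) \<Rightarrow> (real^'n \<Rightarrow> real^'n^'N) \<Rightarrow> bool" where
  "weak_grad \<Omega> u G \<longleftrightarrow> set_borel_measurable lebesgue \<Omega> u \<and> set_borel_measurable lebesgue \<Omega> G \<and>
     (\<forall>\<phi>. test_fun \<Omega> \<phi> \<longrightarrow> (\<forall>k i.
        (LINT x:\<Omega>|lebesgue. u x $ k * partial_deriv i \<phi> x) = - (LINT x:\<Omega>|lebesgue. G x $ k $ i * \<phi> x)))"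

definition W1p :: "(real^'n) set \<Rightarrow> real \<Rightarrow> (real^'n \<Rightarrow> real^'N) \<Rightarrow> (real^'n \<Rightarrow> real^'n^'N) \<Rightarrow> bool" where
  "W1p \<Omega> q u G \<longleftrightarrow> Lp_on \<Omega> q u \<and> Lp_on \<Omega> q G \<and> weak_grad \<Omega> u G"

definition W1inf :: "(real^'n) set \<Rightarrow> (real^'n \<Rightarrow> real^'N) \<Rightarrow> (real^'n \<Rightarrow> real^'n^'N) \<Rightarrow> bool" where
  "W1inf \<Omega> u G \<longleftrightarrow> Linf_on \<Omega> u \<and> Linf_on \<Omega> G \<and> weak_grad \<Omega> u G"

definition W1p0 :: "(real^'n) set \<Rightarrow> real \<Rightarrow> (real^'n \<Rightarrow> real^'N) \<Rightarrow> (real^'n \<Rightarrow> real^'n^'N) \<Rightarrow> bool" where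
  "W1p0 \<Omega> q v G \<longleftrightarrow> W1p \<Omega> q v G \<and>
     (\<exists>\<phi> :: nat \<Rightarrow> real^'n \<Rightarrow> real^'N. (\<forall>j k. test_fun \<Omega> (\<lambda>x. \<phi> j x $ k)) \<and>
        (\<lambda>j. \<integral>\<^sup>+x\<in>\<Omega>. (ennreal (norm (\<phi> j x - v x) powr q)
                 + ennreal (norm (grad_mat (\<phi> j) x - G x) powr q)) \<partial>lebesgue) \<longlonglongrightarrow> 0)"

definition W1inf0 :: "(real^'n) set \<Rightarrow> (real^'n \<Rightarrow> real^'N) \<Rightarrow> (real^'n \<Rightarrow> real^'n^'N) \<Rightarrow> bool" where
  "W1inf0 \<Omega> v G \<longleftrightarrow> W1inf \<Omega> v G \<and> W1p0 \<Omega> 1 v G"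

definition admissible :: "(real^'n) set \<Rightarrow> (real^'n \<Rightarrow> real^'N) \<Rightarrow> real \<Rightarrow> (real^'n \<Rightarrow> real^'N) \<Rightarrow> (real^'n \<Rightarrow> real^'n^'N) \<Rightarrow> bool" where
  "admissible \<Omega> u0 q u G \<longleftrightarrow> W1p \<Omega> q u G \<and> (\<exists>Gv. W1p0 \<Omega> q (\<lambda>x. u x - u0 x) Gv)"

definition admissible_inf :: "(real^'n) set \<Rightarrow> (real^'n \<Rightarrow> real^'N) \<Rightarrow> (real^'n \<Rightarrow> real^'N) \<Rightarrow> (real^'n \<Rightarrow> real^'n^'N) \<Rightarrow> bool" where
  "admissible_inf \<Omega> u0 u G \<longleftrightarrow> W1inf \<Omega> u G \<and> (\<exists>Gv. W1inf0 \<Omega> (\<lambda>x. u x - u0 x) Gv)"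

text \<open>E_q(u), evaluated through the weak gradient G of u (Frobenius norm).\<close>
definition Ep :: "(real^'n) set \<Rightarrow> real \<Rightarrow> (real^'n \<Rightarrow> real^'n^'N) \<Rightarrow> real" where
  "Ep \<Omega> q G = ((1 / measure lebesgue \<Omega>) * (LINT x:\<Omega>|lebesgue. norm (G x) powr q)) powr (1 / q)"

definition is_minimiser :: "(real^'n) set \<Rightarrow> (real^'n \<Rightarrow> real^'N) \<Rightarrow> real \<Rightarrow> (real^'n \<Rightarrow> real^'N) \<Rightarrow> (real^'n \<Rightarrow> real^'n^'N) \<Rightarrow> bool" where
  "is_minimiser \<Omega> u0 q u G \<longleftrightarrow> admissible \<Omega> u0 q u G \<and>
     (\<forall>u' G'. admissible \<Omega> u0 q u' G' \<longrightarrow> Ep \<Omega> q G \<le> Ep \<Omega> q G')"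

definition e_inf :: "(real^'n) set \<Rightarrow> (real^'n \<Rightarrow> real^'N) \<Rightarrow> real" where
  "e_inf \<Omega> u0 = Inf {c. \<exists>u (G :: real^'n \<Rightarrow> real^'n^'N). admissible_inf \<Omega> u0 u G \<and>
       (AE x in lebesgue. x \<in> \<Omega> \<longrightarrow> norm (G x) \<le> c)}"

text \<open>Power with the convention t^0 = 1 (also for t = 0).\<close>
definition pw :: "real \<Rightarrow> real \<Rightarrow> real" where
  "pw t a = (if a = 0 then 1 else t powr a)"

definition mu_p :: "(real^'n) set \<Rightarrow> real \<Rightarrow> (real^'n \<Rightarrow> real^'n^'N) \<Rightarrow> (real^'n) measure" where
  "mu_p \<Omega> q G = density lebesgue (\<lambda>x. indicator \<Omega> x *
       ennreal (pw (norm (G x)) (q - 2) / (pw (Ep \<Omega> q G) (q - 2) * measure lebesgue \<Omega>)))"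

definition weak_Lq :: "(real^'n) set \<Rightarrow> real \<Rightarrow> (nat \<Rightarrow> real^'n \<Rightarrow> 'b::euclidean_space) \<Rightarrow> (real^'n \<Rightarrow> 'b) \<Rightarrow> bool" where
  "weak_Lq \<Omega> q f g0 \<longleftrightarrow> (\<forall>g :: real^'n \<Rightarrow> 'b.
      (if q = 1 then Linf_on \<Omega> g else Lp_on \<Omega> (q / (q - 1)) g) \<longrightarrow>
      (\<lambda>l. LINT x:\<Omega>|lebesgue. f l x \<bullet> g x) \<longlonglongrightarrow> (LINT x:\<Omega>|lebesgue. g0 x \<bullet> g x))"

text \<open>Measure-function pair over closure Omega (measure on R^n carried by closure Omega).\<close>
definition mf_pair :: "(real^'n) set \<Rightarrow> (real^'n) measure \<Rightarrow> (real^'n \<Rightarrow> real^'n^'N) \<Rightarrow> bool" where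
  "mf_pair \<Omega> M F \<longleftrightarrow> space M = UNIV \<and> sets borel \<subseteq> sets M \<and> emeasure M UNIV < \<infinity> \<and>
      emeasure M (UNIV - closure \<Omega>) = 0 \<and> F \<in> borel_measurable M \<and>
      (\<integral>\<^sup>+x. ennreal ((norm (F x))\<^sup>2) \<partial>M) < \<infinity>"

definition mf_conv :: "(real^'n) set \<Rightarrow> (nat \<Rightarrow> (real^'n) measure) \<Rightarrow> (nat \<Rightarrow> real^'n \<Rightarrow> real^'n^'N)
     \<Rightarrow> (real^'n) measure \<Rightarrow> (real^'n \<Rightarrow> real^'n^'N) \<Rightarrow> bool" where
  "mf_conv \<Omega> M F M0 F0 \<longleftrightarrow> (\<forall>l. mf_pair \<Omega> (M l) (F l)) \<and> mf_pair \<Omega> M0 F0 \<and>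
     (\<forall>(\<eta> :: real^'n \<Rightarrow> real) (\<phi> :: real^'n \<Rightarrow> real^'n^'N).
        continuous_on (closure \<Omega>) \<eta> \<longrightarrow> continuous_on (closure \<Omega>) \<phi> \<longrightarrow>
        (\<lambda>l. LINT x:closure \<Omega>|M l. \<eta> x + F l x \<bullet> \<phi> x) \<longlonglongrightarrow> (LINT x:closure \<Omega>|M0. \<eta> x + F0 x \<bullet> \<phi> x)) \<and>
     limsup (\<lambda>l. \<integral>\<^sup>+x. ennreal (1 + (norm (F l x))\<^sup>2) \<partial>M l) < \<infinity>"

definition hausdorff1 :: "'a::metric_space set \<Rightarrow> ennreal" where
  "hausdorff1 S = (SUP \<delta>\<in>{0::real<..}. INF C\<in>{C :: nat \<Rightarrow> 'a set. S \<subseteq> (\<Union>i. C i) \<and>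
       (\<forall>i. bounded (C i) \<and> diameter (C i) \<le> \<delta>)}. (\<Sum>i. ennreal (diameter (C i))))"

text \<open>Countably 1-rectifiable measure (Mattila): absolutely continuous w.r.t. H^1 and carried
  by a countable union of Lipschitz images of R up to an H^1-null set.\<close>
definition countably_rect1_measure :: "'a::euclidean_space measure \<Rightarrow> bool" where
  "countably_rect1_measure M \<longleftrightarrow>
     (\<forall>B\<in>sets borel. hausdorff1 B = 0 \<longrightarrow> emeasure M B = 0) \<and>
     (\<exists>E0 (f :: nat \<Rightarrow> real \<Rightarrow> 'a). E0 \<in> sets borel \<and> hausdorff1 E0 = 0 \<and>
        (\<forall>i. \<exists>L. L-lipschitz_on UNIV (f i)) \<and>
        UNIV - (E0 \<union> (\<Union>i. range (f i))) \<in> sets M \<and>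
        emeasure M (UNIV - (E0 \<union> (\<Union>i. range (f i)))) = 0)"

text \<open>M has at x an approximate tangent line span{v} with multiplicity theta > 0
  (blow-ups r^-1 (eta_{x,r})_# M converge weakly to theta H^1 on span{v}),
  and this tangent space contains all vectors vs k.\<close>
definition approx_tangent_contains :: "'a::euclidean_space measure \<Rightarrow> 'a \<Rightarrow> ('k \<Rightarrow> 'a) \<Rightarrow> bool" where
  "approx_tangent_contains M x vs \<longleftrightarrow> (\<exists>\<theta>>0. \<exists>v. norm v = 1 \<and>
     (\<forall>\<phi> :: 'a \<Rightarrow> real. continuous_on UNIV \<phi> \<longrightarrow> bounded {y. \<phi> y \<noteq> 0} \<longrightarrow>
        ((\<lambda>r. (1 / r) * (\<integral>y. \<phi> ((1 / r) *\<^sub>R (y - x)) \<partial>M))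
           \<longlongrightarrow> \<theta> * (\<integral>t. \<phi> (t *\<^sub>R v) \<partial>lborel)) (at_right 0)) \<and>
     (\<forall>k. vs k \<in> span {v}))"

end

theory Submission
  imports Defs
begin

text \<open>
  Testing minimality of \<open>u\<^sub>p\<close> against outer variations gives \<open>div (\<mu>\<^sub>p Du\<^sub>p) = 0\<close>, a linear condition that
  survives the weak limit: the rows of \<open>T\<close> are divergence-free in \<open>\<Omega>\<close>. Nothing else about the
  variational problem is used.

  Let \<open>a\<close> be such a row (up to sign) and \<open>\<pi>\<close> the \<open>i\<close>-th coordinate. Testing with \<open>\<zeta> \<Psi>(\<pi>)\<close> shows that the
  pushforward of \<open>\<zeta> a\<^sub>i \<parallel>T\<parallel>\<close> under \<open>\<pi>\<close> is absolutely continuous; hence \<open>\<parallel>T\<parallel>\<close>-almost no point with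
  \<open>a\<^sub>i \<noteq> 0\<close> projects into a given null set, and \<open>\<parallel>T\<parallel>\<close> is absolutely continuous with respect to \<open>\<H>\<^sup>1\<close>. On
  a compact set \<open>K\<close> of finite length almost all fibres of \<open>\<pi>\<close> are finite, so the slices of \<open>T\<close> restricted to \<open>K\<close>
  are atomic. As in the Ambrosio--Kirchheim theory of currents, slices vary in a metrically BV way, so the atoms
  move along countably many Lipschitz graphs. Every exceptional set (unbounded maximal function, positive slab
  density of the complement, missing atom) has null projection, so one-dimensional covering arguments suffice.
  On a graph, \<open>\<parallel>T\<parallel>\<close> has a density in the coordinate \<open>\<pi>\<close>; at Lebesgue points the blow-up is a line, and the
  divergence equation forces the rows of \<open>T\<close> to be parallel to it.
\<close>

subsection \<open>Smooth functions\<close>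

text \<open>Slices are never built as measures. A slice at level \<open>s\<close> is read off from
  integrals over slabs of half-width \<open>d\<close> around \<open>s\<close>, always compared with
  \<open>d\<close>; an atom is a point near which slabs keep mass of order \<open>d\<close>. The
  obstacle is cancellation: the rows are merely measurable and change sign, so a slice can be small
  although it carries much mass. Hence \<open>K\<close> is always a compact piece on which one
  entry, up to sign, is at least \<open>c > 0\<close>, and mass off \<open>K\<close> is tolerated
  only if its slab density is small compared with the atom. That atoms cannot jump comes from one
  test function: for points at maximum-norm distance \<rho>, the bump on the cube of that radius is
  1 at one point and 0 at the other, with gradient of order 1/\<rho>. The slices at the two levels
  then differ by a fixed amount, while the divergence equation allows only a multiple of the
  difference of levels divided by \<rho>; so \<rho> is at most a multiple of that difference.
  Coordinate projections suffice, since a matrix of norm 1 has a nonzero entry. Test functions are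
  assembled from coordinate bumps and polynomials, and Stone-Weierstrass leads from these to
  continuous functions.\<close>

lemma smooth_fun_coinduct:
  assumes "P f" and cont: "\<And>g. P g \<Longrightarrow> continuous_on UNIV g"
    and der: "\<And>g v. P g \<Longrightarrow> \<exists>g'. P g' \<and> (\<forall>x. ((\<lambda>t. g (x + t *\<^sub>R v)) has_real_derivative g' x) (at 0))"
  shows "smooth_fun f"
proof -
  \<comment> \<open>Choosing one derivative per direction inside the class \<open>P\<close> turns
    closure under differentiation into the coherent family that \<open>smooth_fun\<close> asks for:
    list recursion applies the direction at the head last, as \<open>D (v # vs)\<close>
    requires.\<close>
  define d where "d v g = (SOME g'. P g' \<and> (\<forall>x. ((\<lambda>t. g (x + t *\<^sub>R v)) has_real_derivative g' x) (at 0)))" for v g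
  have d: "P (d v g) \<and> (\<forall>x. ((\<lambda>t. g (x + t *\<^sub>R v)) has_real_derivative d v g x) (at 0))" if "P g" for v g
    unfolding d_def by (rule someI_ex[OF der[OF that]])
  define D where "D = rec_list f (\<lambda>v _ g. d v g)"
  have PD: "P (D vs)" for vs
    by (induction vs) (use \<open>P f\<close> d in \<open>auto simp: D_def\<close>)
  show ?thesis
    unfolding smooth_fun_def
    by (rule exI[of _ D]) (use PD cont d in \<open>force simp: D_def\<close>)
qed

lemma smooth_fun_continuous: "smooth_fun f \<Longrightarrow> continuous_on UNIV f"
  unfolding smooth_fun_def by metis

lemma smooth_fun_deriv:
  assumes "smooth_fun f"
  shows "\<exists>f'. smooth_fun f' \<and> (\<forall>x. ((\<lambda>t. f (x + t *\<^sub>R v)) has_real_derivative f' x) (at 0))"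
proof -
  obtain D where D: "D [] = f" "\<And>vs. continuous_on UNIV (D vs)"
    "\<And>vs v x. ((\<lambda>t. D vs (x + t *\<^sub>R v)) has_real_derivative D (v # vs) x) (at 0)"
    using assms unfolding smooth_fun_def by metis
  have "smooth_fun (D [v])"
    by (rule smooth_fun_coinduct[of "\<lambda>g. \<exists>vs. g = D vs"]) (use D in blast)+
  with D(1,3) show ?thesis by metis
qed

lemma smooth_fun_const [simp]: "smooth_fun (\<lambda>x. c)"
  by (rule smooth_fun_coinduct[of "\<lambda>g. \<exists>c. g = (\<lambda>x. c)"]) (auto intro!: exI[of _ "\<lambda>x. 0"])

lemma smooth_fun_add:
  assumes "smooth_fun f" "smooth_fun g" shows "smooth_fun (\<lambda>x. f x + g x)"
proof (rule smooth_fun_coinduct[of "\<lambda>h. \<exists>f g. smooth_fun f \<and> smooth_fun g \<and> h = (\<lambda>x. f x + g x)"])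
  fix h v assume "\<exists>f g. smooth_fun f \<and> smooth_fun g \<and> h = (\<lambda>x. f x + g x)"
  then obtain f g where fg: "smooth_fun f" "smooth_fun g" "h = (\<lambda>x. f x + g x)" by blast
  obtain f' g' where "smooth_fun f'" "smooth_fun g'"
    "\<And>x. ((\<lambda>t. f (x + t *\<^sub>R v)) has_real_derivative f' x) (at 0)"
    "\<And>x. ((\<lambda>t. g (x + t *\<^sub>R v)) has_real_derivative g' x) (at 0)"
    using smooth_fun_deriv[OF fg(1), of v] smooth_fun_deriv[OF fg(2), of v] by blast
  then show "\<exists>h'. (\<exists>f g. smooth_fun f \<and> smooth_fun g \<and> h' = (\<lambda>x. f x + g x)) \<and>
      (\<forall>x. ((\<lambda>t. h (x + t *\<^sub>R v)) has_real_derivative h' x) (at 0))"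
    unfolding fg by (intro exI[of _ "\<lambda>x. f' x + g' x"]) (auto intro!: DERIV_add)
qed (use assms in \<open>auto intro!: continuous_on_add dest: smooth_fun_continuous\<close>)

text \<open>The Leibniz rule turns one product into a sum of two, so single products are not closed
  under differentiation; this is the invariant class for the coinduction.\<close>

inductive prods_sum :: "('a::euclidean_space \<Rightarrow> real) \<Rightarrow> bool" where
  prod: "smooth_fun f \<Longrightarrow> smooth_fun g \<Longrightarrow> prods_sum (\<lambda>x. f x * g x)"
| add: "prods_sum f \<Longrightarrow> prods_sum g \<Longrightarrow> prods_sum (\<lambda>x. f x + g x)"

lemma smooth_fun_mult:
  assumes "smooth_fun f" "smooth_fun g" shows "smooth_fun (\<lambda>x. f x * g x)"
proof (rule smooth_fun_coinduct[of prods_sum])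
  fix h :: "'a \<Rightarrow> real" assume "prods_sum h"
  then show "continuous_on UNIV h"
    by induction (auto intro!: continuous_on_add continuous_on_mult dest: smooth_fun_continuous)
next
  fix h :: "'a \<Rightarrow> real" and v assume "prods_sum h"
  then show "\<exists>h'. prods_sum h' \<and> (\<forall>x. ((\<lambda>t. h (x + t *\<^sub>R v)) has_real_derivative h' x) (at 0))"
  proof induction
    case (prod f g)
    obtain f' g' where "smooth_fun f'" "smooth_fun g'"
      "\<And>x. ((\<lambda>t. f (x + t *\<^sub>R v)) has_real_derivative f' x) (at 0)"
      "\<And>x. ((\<lambda>t. g (x + t *\<^sub>R v)) has_real_derivative g' x) (at 0)"
      using smooth_fun_deriv[OF prod(1), of v] smooth_fun_deriv[OF prod(2), of v] by blast
    with prod show ?case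
      by (intro exI[of _ "\<lambda>x. f' x * g x + g' x * f x"])
         (auto intro!: prods_sum.intros DERIV_mult[THEN DERIV_cong])
  next
    case (add f g)
    then obtain f' g' where "prods_sum f'" "prods_sum g'"
      "\<And>x. ((\<lambda>t. f (x + t *\<^sub>R v)) has_real_derivative f' x) (at 0)"
      "\<And>x. ((\<lambda>t. g (x + t *\<^sub>R v)) has_real_derivative g' x) (at 0)"
      by blast
    then show ?case
      by (intro exI[of _ "\<lambda>x. f' x + g' x"]) (auto intro!: prods_sum.intros DERIV_add)
  qed
qed (use assms in \<open>auto intro: prods_sum.prod\<close>)

lemma smooth_fun_cmult: "smooth_fun f \<Longrightarrow> smooth_fun (\<lambda>x. c * f x)"
  using smooth_fun_mult[OF smooth_fun_const] .

lemma smooth_fun_prod: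
  "finite I \<Longrightarrow> (\<And>i. i \<in> I \<Longrightarrow> smooth_fun (f i)) \<Longrightarrow> smooth_fun (\<lambda>x. \<Prod>i\<in>I. f i x)"
  by (induction I rule: finite_induct) (auto intro: smooth_fun_mult)

lemma smooth_fun_bounded_linear:
  fixes f :: "'a::euclidean_space \<Rightarrow> real"
  assumes "bounded_linear f" shows "smooth_fun f"
proof (rule smooth_fun_coinduct[of "\<lambda>g. g = f \<or> (\<exists>c. g = (\<lambda>x. c))"])
  interpret f: bounded_linear f by fact
  fix g v assume "g = f \<or> (\<exists>c. g = (\<lambda>x. c))"
  then show "\<exists>g'. (g' = f \<or> (\<exists>c. g' = (\<lambda>x. c))) \<and> (\<forall>x. ((\<lambda>t. g (x + t *\<^sub>R v)) has_real_derivative g' x) (at 0))"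
  proof
    assume "g = f"
    then show ?thesis
      by (intro exI[of _ "\<lambda>x. f v"]) (auto simp: f.add f.scaleR intro!: derivative_eq_intros)
  qed (auto intro!: exI[of _ "\<lambda>x. 0"])
qed (use assms in \<open>auto intro: linear_continuous_on\<close>)

lemma smooth_fun_affine_compose:
  fixes L :: "'a::euclidean_space \<Rightarrow> 'b::euclidean_space"
  assumes "smooth_fun h" "bounded_linear L" shows "smooth_fun (\<lambda>x. h (L x + c))"
proof (rule smooth_fun_coinduct[of "\<lambda>g. \<exists>h. smooth_fun h \<and> g = (\<lambda>x. h (L x + c))"])
  interpret L: bounded_linear L by fact
  fix g assume "\<exists>h. smooth_fun h \<and> g = (\<lambda>x. h (L x + c))"
  then obtain h where h: "smooth_fun h" "g = (\<lambda>x. h (L x + c))" by blast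
  show "continuous_on UNIV g"
    unfolding h by (rule continuous_on_compose2[OF smooth_fun_continuous[OF h(1)]])
      (auto intro!: continuous_on_add linear_continuous_on[OF assms(2)])
  fix v
  obtain h' where "smooth_fun h'" "\<And>x. ((\<lambda>t. h (x + t *\<^sub>R L v)) has_real_derivative h' x) (at 0)"
    using smooth_fun_deriv[OF h(1), of "L v"] by blast
  moreover have eq: "L (x + t *\<^sub>R v) + c = (L x + c) + t *\<^sub>R L v" for x t
    by (simp add: L.add L.scaleR)
  ultimately show "\<exists>g'. (\<exists>h. smooth_fun h \<and> g' = (\<lambda>x. h (L x + c))) \<and>
      (\<forall>x. ((\<lambda>t. g (x + t *\<^sub>R v)) has_real_derivative g' x) (at 0))"
    unfolding h
    by (intro exI[of _ "\<lambda>x. h' (L x + c)"]) (auto simp: eq)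
qed (use assms in auto)

lemma smooth_fun_real_polynomial:
  fixes f :: "'a::euclidean_space \<Rightarrow> real"
  assumes "real_polynomial_function f" shows "smooth_fun f"
  using assms by induction (auto intro: smooth_fun_add smooth_fun_mult smooth_fun_bounded_linear)

lemma has_real_derivative_along_line:
  fixes h :: "real \<Rightarrow> real"
  assumes "(h has_real_derivative d) (at x)"
  shows "((\<lambda>t. h (x + t * v)) has_real_derivative v * d) (at 0)"
proof -
  have "((\<lambda>t. x + t * v) has_real_derivative v) (at 0)" by (auto intro!: derivative_eq_intros)
  then show ?thesis using DERIV_chain2[of h d "\<lambda>t. x + t * v" 0 v UNIV] assms by (simp add: mult.commute)
qed

text \<open>Only \<open>h\<close> itself is new to the invariant class: its derivatives along lines
  are multiples of \<open>h'\<close>. This makes antiderivatives of polynomials usable as factors of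
  test functions.\<close>

lemma smooth_fun_real_deriv:
  fixes h h' :: "real \<Rightarrow> real"
  assumes h: "\<And>x. (h has_real_derivative h' x) (at x)" and h': "smooth_fun h'"
  shows "smooth_fun h"
proof (rule smooth_fun_coinduct[of "\<lambda>g. g = h \<or> smooth_fun g"])
  fix g v assume "g = h \<or> smooth_fun g"
  then show "\<exists>g'. (g' = h \<or> smooth_fun g') \<and> (\<forall>x. ((\<lambda>t. g (x + t *\<^sub>R v)) has_real_derivative g' x) (at 0))"
  proof
    assume "g = h"
    have "((\<lambda>t. h (x + t * v)) has_real_derivative v * h' x) (at 0)" for x
      by (rule has_real_derivative_along_line[OF h])
    then show ?thesis
      using smooth_fun_cmult[OF h', of v] \<open>g = h\<close> by (intro exI[of _ "\<lambda>x. v * h' x"]) auto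
  qed (use smooth_fun_deriv in blast)
qed (auto intro: smooth_fun_continuous DERIV_continuous_on has_field_derivative_at_within h)

lemma smooth_fun_real_has_deriv:
  fixes h :: "real \<Rightarrow> real"
  assumes "smooth_fun h"
  shows "\<exists>h'. smooth_fun h' \<and> (\<forall>x. (h has_real_derivative h' x) (at x))"
proof -
  obtain h' where h': "smooth_fun h'" "\<And>x. ((\<lambda>t. h (x + t *\<^sub>R 1)) has_real_derivative h' x) (at 0)"
    using smooth_fun_deriv[OF assms, of 1] by blast
  have "(h has_real_derivative h' x) (at x)" for x
    using h'(2)[of x] DERIV_shift[of h _ 0 x] by (simp add: add.commute)
  with h'(1) show ?thesis by blast
qed

subsection \<open>A smooth bump\<close>

text \<open>The flat function behind the classical bump, with negative powers of \<open>t\<close>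
  built in: differentiation only raises \<open>m\<close>, so the linear span of the family is closed
  under derivatives.\<close>

definition expinv :: "nat \<Rightarrow> real \<Rightarrow> real" where
  "expinv m t = (if t > 0 then exp (- 1 / t) / t ^ m else 0)"

lemma expinv_tendsto_0: "(expinv m \<longlongrightarrow> 0) (at 0)"
proof -
  have "((\<lambda>x::real. x ^ m / exp x) \<longlongrightarrow> 0) at_top" by (rule tendsto_power_div_exp_0)
  then have "((\<lambda>t::real. inverse t ^ m / exp (inverse t)) \<longlongrightarrow> 0) (at_right 0)"
    by (rule filterlim_compose[OF _ filterlim_inverse_at_top_right])
  then have "(expinv m \<longlongrightarrow> 0) (at_right 0)"
    by (rule Lim_transform_eventually)
       (auto simp: eventually_at_right_less expinv_def eventually_at exp_minus field_simps intro!: exI[of _ 1])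
  moreover have "(expinv m \<longlongrightarrow> 0) (at_left 0)"
    by (rule Lim_transform_eventually[of "\<lambda>_. 0"]) (auto simp: expinv_def eventually_at intro!: exI[of _ 1])
  ultimately show ?thesis by (simp add: filterlim_split_at)
qed

lemma expinv_deriv:
  "(expinv m has_real_derivative expinv (Suc (Suc m)) t - m * expinv (Suc m) t) (at t)"
proof (cases "t = 0")
  case True
  \<comment> \<open>At the origin the difference quotient is again a member of the family,
    \<open>expinv (Suc m)\<close>, and tends to 0.\<close>
  have "((\<lambda>y. expinv m y / y) \<longlongrightarrow> 0) (at 0)"
    by (rule Lim_transform_eventually[OF expinv_tendsto_0[of "Suc m"]])
       (auto simp: expinv_def eventually_at intro!: exI[of _ 1])
  then show ?thesis using True by (simp add: has_field_derivative_iff expinv_def)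
next
  case False
  show ?thesis
  proof (cases "t > 0")
    case True
    have "((\<lambda>t. exp (- 1 / t) / t ^ m) has_real_derivative expinv (Suc (Suc m)) t - m * expinv (Suc m) t) (at t)"
      using True
      apply (auto intro!: derivative_eq_intros simp: expinv_def)
      apply (cases m)
       apply (auto simp: field_simps)
      done
    then show ?thesis
      by (rule DERIV_cong_ev[THEN iffD1, OF refl _ refl, rotated])
         (use eventually_nhds_in_open[of "{0<..}" t] True in \<open>auto simp: expinv_def elim!: eventually_mono\<close>)
  next
    case neg: False
    have "((\<lambda>t. 0) has_real_derivative expinv (Suc (Suc m)) t - m * expinv (Suc m) t) (at t)"
      using neg by (auto simp: expinv_def)
    then show ?thesis
      by (rule DERIV_cong_ev[THEN iffD1, OF refl _ refl, rotated])
         (use eventually_nhds_in_open[of "{..<0}" t] neg False in \<open>auto simp: expinv_def elim!: eventually_mono\<close>)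
  qed
qed

inductive expinv_span :: "(real \<Rightarrow> real) \<Rightarrow> bool" where
  base: "expinv_span (\<lambda>t. c * expinv m t)"
| add: "expinv_span f \<Longrightarrow> expinv_span g \<Longrightarrow> expinv_span (\<lambda>x. f x + g x)"

lemma smooth_fun_expinv: "smooth_fun (expinv m)"
proof (rule smooth_fun_coinduct[of expinv_span])
  have der: "\<exists>f'. expinv_span f' \<and> (\<forall>x. (f has_real_derivative c * f' x) (at x))" if "expinv_span f" "c \<noteq> 0" for f c
    using that
  proof induction
    case (base d m)
    have "expinv_span (\<lambda>t. (d / c) * expinv (Suc (Suc m)) t + (- m * d / c) * expinv (Suc m) t)"
      by (intro expinv_span.intros)
    moreover have "((\<lambda>t. d * expinv m t) has_real_derivative
         c * ((d / c) * expinv (Suc (Suc m)) t + (- m * d / c) * expinv (Suc m) t)) (at t)" for t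
      using base by (auto intro!: derivative_eq_intros expinv_deriv simp: field_simps)
    ultimately show ?case by blast
  next
    case (add f g)
    then obtain f' g' where "expinv_span f'" "expinv_span g'"
      "\<And>x. (f has_real_derivative c * f' x) (at x)" "\<And>x. (g has_real_derivative c * g' x) (at x)" by blast
    then show ?case
      by (intro exI[of _ "\<lambda>x. f' x + g' x"]) (auto intro!: expinv_span.intros DERIV_add simp: algebra_simps)
  qed
  show "expinv_span (expinv m)" using expinv_span.base[of 1 m] by simp
  fix g :: "real \<Rightarrow> real" assume g: "expinv_span g"
  obtain g' where g': "expinv_span g'" "\<And>x. (g has_real_derivative 1 * g' x) (at x)"
    using der[OF g, of 1] by auto
  show "continuous_on UNIV g"
    using g'(2) by (intro DERIV_continuous_on) (auto intro: has_field_derivative_at_within)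
  fix v :: real
  have sc: "expinv_span f \<Longrightarrow> expinv_span (\<lambda>x. v * f x)" for f
  proof (induction rule: expinv_span.induct)
    case (base c m)
    then show ?case using expinv_span.base[of "v * c" m] by (simp add: mult.assoc)
  next
    case (add f g)
    then show ?case using expinv_span.add[of "\<lambda>x. v * f x" "\<lambda>x. v * g x"] by (simp add: distrib_left)
  qed
  have "((\<lambda>t. g (x + t *\<^sub>R v)) has_real_derivative v * g' x) (at 0)" for x
    using has_real_derivative_along_line[of g] g'(2) by simp
  with sc[OF g'(1)]
  show "\<exists>g'. expinv_span g' \<and> (\<forall>x. ((\<lambda>t. g (x + t *\<^sub>R v)) has_real_derivative g' x) (at 0))" by blast
qed

text \<open>Two flat functions glued back to back. Each equals \<open>exp (-1)\<close> at argument
  1, so the factor \<open>exp 2\<close> normalises the maximum, attained at 0, to 1.\<close>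

definition bump :: "real \<Rightarrow> real" where
  "bump t = exp 2 * (expinv 0 (1 + t) * expinv 0 (1 - t))"

lemma smooth_fun_bump: "smooth_fun bump"
proof -
  have "smooth_fun (\<lambda>t. expinv 0 (t + 1))" "smooth_fun (\<lambda>t. expinv 0 (- t + 1))"
    by (intro smooth_fun_affine_compose smooth_fun_expinv bounded_linear_ident bounded_linear_minus)+
  then have "smooth_fun (\<lambda>t. exp 2 * (expinv 0 (t + 1) * expinv 0 (- t + 1)))"
    by (intro smooth_fun_cmult smooth_fun_mult)
  then show ?thesis by (simp add: bump_def[abs_def] add.commute)
qed

lemma bump_0 [simp]: "bump 0 = 1"
  by (simp add: bump_def expinv_def flip: exp_add)

lemma bump_nonneg: "0 \<le> bump t" and bump_eq_0: "\<bar>t\<bar> \<ge> 1 \<Longrightarrow> bump t = 0"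
  and bump_pos: "\<bar>t\<bar> < 1 \<Longrightarrow> 0 < bump t"
  by (auto simp: bump_def expinv_def abs_real_def split: if_splits)

lemma bump_le_1: "bump t \<le> 1"
proof (cases "\<bar>t\<bar> < 1")
  case True
  then have t: "1 + t > 0" "1 - t > 0" by auto
  \<comment> \<open>The total exponent of \<open>bump t\<close> is 2 minus this sum, and the sum is
    at least 2 because \<open>1 - t^2\<close> is at most 1.\<close>
  then have "1 / (1 + t) + 1 / (1 - t) = 2 / ((1 + t) * (1 - t))" by (simp add: field_simps)
  moreover have "(1 + t) * (1 - t) \<le> 1" by (simp add: algebra_simps)
  moreover have "(1 + t) * (1 - t) > 0" using t by simp
  ultimately have "1 / (1 + t) + 1 / (1 - t) \<ge> 2" by (simp add: le_divide_eq)
  moreover have "bump t = exp 2 * (exp (- (1 / (1 + t))) * exp (- (1 / (1 - t))))"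
    using t by (simp add: bump_def expinv_def)
  then have "bump t = exp (2 + (- (1 / (1 + t)) + - (1 / (1 - t))))"
    by (simp only: exp_add)
  ultimately show ?thesis by simp
qed (simp add: bump_eq_0)

lemma bump_deriv_bound:
  obtains L bump' where "L > 0" "\<And>t. (bump has_real_derivative bump' t) (at t)" "\<And>t. \<bar>bump' t\<bar> \<le> L"
proof -
  obtain b' where b': "smooth_fun b'" "\<And>t. (bump has_real_derivative b' t) (at t)"
    using smooth_fun_real_has_deriv[OF smooth_fun_bump] by blast
  have out: "b' t = 0" if "\<bar>t\<bar> > 1" for t
  proof -
    have "open {t::real. \<bar>t\<bar> > 1}" by (intro open_Collect_less continuous_intros)
    then have "\<forall>\<^sub>F x in nhds t. bump x = 0"
      using that eventually_nhds_in_open[of "{t::real. \<bar>t\<bar> > 1}" t] by (auto simp: bump_eq_0 elim!: eventually_mono)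
    then have "(bump has_real_derivative 0) (at t)"
      by (subst DERIV_cong_ev[OF refl _ refl]) auto
    then show ?thesis using b'(2) DERIV_unique by blast
  qed
  have "bounded (b' ` {-1..1})"
    by (intro compact_imp_bounded compact_continuous_image continuous_on_subset[OF smooth_fun_continuous[OF b'(1)]]) auto
  then obtain L where L: "\<And>t. t \<in> {-1..1} \<Longrightarrow> \<bar>b' t\<bar> \<le> L" unfolding bounded_iff real_norm_def by blast
  show ?thesis
  proof (rule that[of "\<bar>L\<bar> + 1" b'])
    fix t show "\<bar>b' t\<bar> \<le> \<bar>L\<bar> + 1"
      using L[of t] out[of t] by (cases "\<bar>t\<bar> > 1") (force simp: abs_real_def split: if_splits)+
  qed (use b' in auto)
qed

section \<open>Partial derivatives and supports of test functions\<close>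

lemma partial_deriv_works:
  assumes "smooth_fun f"
  shows "((\<lambda>t. f (x + t *\<^sub>R axis i 1)) has_real_derivative partial_deriv i f x) (at 0)"
  using smooth_fun_deriv[OF assms, of "axis i 1"] unfolding partial_deriv_def
  by (metis DERIV_imp_deriv)

lemma partial_deriv_eqI:
  "((\<lambda>t. f (x + t *\<^sub>R axis i 1)) has_real_derivative d) (at 0) \<Longrightarrow> partial_deriv i f x = d"
  unfolding partial_deriv_def by (rule DERIV_imp_deriv)

lemma smooth_fun_partial_deriv:
  assumes "smooth_fun f" shows "smooth_fun (partial_deriv i f)"
proof -
  obtain f' where "smooth_fun f'" "\<And>x. ((\<lambda>t. f (x + t *\<^sub>R axis i 1)) has_real_derivative f' x) (at 0)"
    using smooth_fun_deriv[OF assms, of "axis i 1"] by blast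
  moreover from this(2) have "partial_deriv i f = f'" by (intro ext partial_deriv_eqI)
  ultimately show ?thesis by simp
qed

lemma partial_deriv_mult:
  assumes "smooth_fun f" "smooth_fun g"
  shows "partial_deriv i (\<lambda>x. f x * g x) x = partial_deriv i f x * g x + f x * partial_deriv i g x"
  using DERIV_mult[OF partial_deriv_works[OF assms(1)] partial_deriv_works[OF assms(2)], of x i x i]
  by (intro partial_deriv_eqI) (simp add: ac_simps)

lemma partial_deriv_coordinate:
  fixes i j :: "'n::finite"
  assumes "\<And>t. (h has_real_derivative h' t) (at t)"
  shows "partial_deriv j (\<lambda>x. h (x $ i)) x = (if i = j then h' (x $ i) else 0)"
  using has_real_derivative_along_line[OF assms, of "x $ i" "if i = j then 1 else 0"]
  by (intro partial_deriv_eqI) (auto simp: axis_def cong: if_cong)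

lemma smooth_fun_coordinate: "smooth_fun h \<Longrightarrow> smooth_fun (\<lambda>x::real^'n. h (x $ i))"
  using smooth_fun_affine_compose[of h "\<lambda>x::real^'n. x $ i" 0] by (simp add: bounded_linear_vec_nth)

lemma continuous_on_grad:
  assumes "smooth_fun f" shows "continuous_on UNIV (grad f)"
  unfolding grad_def[abs_def]
  by (intro continuous_on_vec_lambda smooth_fun_continuous smooth_fun_partial_deriv assms)

lemma test_fun_smooth: "test_fun \<Omega> f \<Longrightarrow> smooth_fun f"
  by (simp add: test_fun_def)

lemma compact_closure_subset:
  fixes A :: "'a::heine_borel set"
  assumes "compact B" "closure A \<subseteq> B" shows "compact (closure A)"
  using assms bounded_subset[of B "closure A"] by (auto simp: compact_eq_bounded_closed)

lemma test_fun_mult: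
  assumes f: "test_fun \<Omega> f" and g: "smooth_fun g"
  shows "test_fun \<Omega> (\<lambda>x. f x * g x)"
proof -
  have "closure {x. f x * g x \<noteq> 0} \<subseteq> closure {x. f x \<noteq> 0}" by (rule closure_mono) auto
  then have "compact (closure {x. f x * g x \<noteq> 0})" "closure {x. f x * g x \<noteq> 0} \<subseteq> \<Omega>"
    using f compact_closure_subset[of "closure {x. f x \<noteq> 0}" "{x. f x * g x \<noteq> 0}"]
    unfolding test_fun_def by blast+
  with f g show ?thesis by (simp add: test_fun_def smooth_fun_mult)
qed

lemma partial_deriv_outside_support:
  assumes "x \<notin> closure {x. f x \<noteq> 0}"
  shows "partial_deriv i f x = 0"
proof (rule partial_deriv_eqI)
  have "open ((\<lambda>t::real. x + t *\<^sub>R axis i 1) -` (- closure {x. f x \<noteq> 0}))"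
    by (intro open_vimage) (auto intro!: continuous_intros)
  from eventually_nhds_in_open[OF this, of 0] assms
  have "\<forall>\<^sub>F t in nhds 0. x + t *\<^sub>R axis i 1 \<notin> closure {x. f x \<noteq> 0}" by auto
  then have "\<forall>\<^sub>F t in nhds 0. f (x + t *\<^sub>R axis i 1) = 0"
    by (rule eventually_mono) (use closure_subset[of "{x. f x \<noteq> 0}"] in auto)
  then show "((\<lambda>t. f (x + t *\<^sub>R axis i 1)) has_real_derivative 0) (at 0)"
    by (subst DERIV_cong_ev[OF refl _ refl, where g="\<lambda>_. 0"]) auto
qed

lemma grad_outside_support: "x \<notin> closure {x. f x \<noteq> 0} \<Longrightarrow> grad f x = 0"
  by (simp add: grad_def vec_eq_iff partial_deriv_outside_support)

lemma bounded_continuous_compact_support: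
  fixes f :: "'a::euclidean_space \<Rightarrow> 'b::real_normed_vector"
  assumes "continuous_on UNIV f" "compact K" "\<And>x. x \<notin> K \<Longrightarrow> f x = 0"
  obtains C where "C > 0" "\<And>x. norm (f x) \<le> C"
proof -
  have "bounded (f ` K)"
    by (intro compact_imp_bounded compact_continuous_image continuous_on_subset[OF assms(1)] assms(2)) auto
  then obtain C where "C > 0" "\<forall>y\<in>f ` K. norm y \<le> C" by (auto simp: bounded_pos)
  moreover from this assms(3) have "norm (f x) \<le> C" for x by (cases "x \<in> K") auto
  ultimately show ?thesis using that by blast
qed

subsection \<open>Bumps on cubes\<close>

definition cube :: "real^'n \<Rightarrow> real \<Rightarrow> (real^'n) set" where
  "cube z \<rho> = {y. \<forall>j. \<bar>y $ j - z $ j\<bar> \<le> \<rho>}"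

lemma compact_cube: "compact (cube z \<rho>)"
proof -
  have "cube z \<rho> = cbox (\<chi> j. z $ j - \<rho>) (\<chi> j. z $ j + \<rho>)"
    by (auto simp: cube_def mem_box_cart abs_le_iff algebra_simps)
  then show ?thesis by simp
qed

lemma cube_subset_cball:
  fixes z :: "real^'n" and \<rho> :: real
  shows "cube z \<rho> \<subseteq> cball z (CARD('n) * \<rho>)"
proof
  fix y assume y: "y \<in> cube z \<rho>"
  have "norm (y - z) \<le> (\<Sum>j\<in>UNIV. \<bar>(y - z) $ j\<bar>)" by (rule norm_le_l1_cart)
  also have "\<dots> \<le> (\<Sum>j\<in>(UNIV::'n set). \<rho>)" using y by (intro sum_mono) (auto simp: cube_def)
  finally show "y \<in> cball z (CARD('n) * \<rho>)" by (simp add: dist_norm norm_minus_commute)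
qed

text \<open>A product over coordinates needs only affine substitutions in \<open>bump\<close>, and
  it vanishes as soon as a single coordinate is off by \<rho>. The latter lets it separate two
  points whose maximum-norm distance is exactly \<rho>.\<close>

definition cube_bump :: "real^'n \<Rightarrow> real \<Rightarrow> real^'n \<Rightarrow> real" where
  "cube_bump z \<rho> x = (\<Prod>j\<in>UNIV. bump ((x $ j - z $ j) / \<rho>))"

lemma smooth_fun_cube_bump: "smooth_fun (cube_bump (z :: real^'n) \<rho>)"
proof -
  have "smooth_fun (\<lambda>x::real^'n. bump (x $ j / \<rho> + - (z $ j / \<rho>)))" for j
    by (intro smooth_fun_affine_compose smooth_fun_bump bounded_linear_divide[THEN bounded_linear_compose] bounded_linear_vec_nth)
  then show ?thesis unfolding cube_bump_def[abs_def]
    by (intro smooth_fun_prod) (auto simp: diff_divide_distrib)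
qed

lemma cube_bump_nonneg: "0 \<le> cube_bump z \<rho> x"
  and cube_bump_le_1: "cube_bump z \<rho> x \<le> 1"
  and cube_bump_center [simp]: "cube_bump z \<rho> z = 1"
  unfolding cube_bump_def by (auto intro!: prod_nonneg prod_le_1 simp: bump_nonneg bump_le_1)

lemma cube_bump_eq_0: "\<rho> > 0 \<Longrightarrow> \<bar>x $ j - z $ j\<bar> \<ge> \<rho> \<Longrightarrow> cube_bump z \<rho> x = 0"
  unfolding cube_bump_def by (rule prod_zero) (auto intro!: bexI[of _ j] bump_eq_0)

lemma cube_bump_pos: "\<rho> > 0 \<Longrightarrow> (\<And>j. \<bar>x $ j - z $ j\<bar> < \<rho>) \<Longrightarrow> cube_bump z \<rho> x > 0"
  unfolding cube_bump_def by (intro prod_pos) (auto intro!: bump_pos)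

lemma cube_bump_support: "\<rho> > 0 \<Longrightarrow> closure {x. cube_bump z \<rho> x \<noteq> 0} \<subseteq> cube z \<rho>"
proof (rule closure_minimal)
  assume "\<rho> > 0"
  then show "{x. cube_bump z \<rho> x \<noteq> 0} \<subseteq> cube z \<rho>"
    unfolding cube_def using cube_bump_eq_0 by (smt (verit) mem_Collect_eq subsetI)
qed (intro compact_imp_closed compact_cube)

lemma test_fun_cube_bump:
  assumes "\<rho> > 0" "cube z \<rho> \<subseteq> \<Omega>" shows "test_fun \<Omega> (cube_bump z \<rho>)"
proof -
  have "compact (closure {x. cube_bump z \<rho> x \<noteq> 0})"
    by (rule compact_closure_subset[OF compact_cube cube_bump_support[OF assms(1)]])
  then show ?thesis
    using cube_bump_support[OF assms(1), of z] assms by (auto simp: test_fun_def smooth_fun_cube_bump)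
qed

lemma cube_bump_partial_bound:
  obtains L where "L > 0" "\<And>(z::real^'n) \<rho> x i. \<rho> > 0 \<Longrightarrow> \<bar>partial_deriv i (cube_bump z \<rho>) x\<bar> \<le> L / \<rho>"
proof -
  obtain L b' where L: "L > 0" "\<And>t. (bump has_real_derivative b' t) (at t)" "\<And>t. \<bar>b' t\<bar> \<le> L"
    using bump_deriv_bound by blast
  have "\<bar>partial_deriv i (cube_bump z \<rho>) x\<bar> \<le> L / \<rho>" if "\<rho> > 0" for z :: "real^'n" and \<rho> x i
  proof -
    let ?P = "\<Prod>j\<in>UNIV - {i}. bump ((x $ j - z $ j) / \<rho>)"
    have eq: "cube_bump z \<rho> (x + t *\<^sub>R axis i 1) = ?P * bump ((x $ i - z $ i) / \<rho> + t * (1 / \<rho>))" for t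
    proof -
      have "cube_bump z \<rho> (x + t *\<^sub>R axis i 1) = bump ((x $ i + t - z $ i) / \<rho>)
         * (\<Prod>j\<in>UNIV - {i}. bump (((x + t *\<^sub>R axis i 1) $ j - z $ j) / \<rho>))"
        unfolding cube_bump_def by (subst prod.remove[of _ i]) auto
      also have "(\<Prod>j\<in>UNIV - {i}. bump (((x + t *\<^sub>R axis i 1) $ j - z $ j) / \<rho>)) = ?P"
        by (intro prod.cong) (auto simp: axis_def)
      finally show ?thesis by (simp add: add_divide_distrib diff_divide_distrib algebra_simps)
    qed
    have "((\<lambda>t. ?P * bump ((x $ i - z $ i) / \<rho> + t * (1 / \<rho>))) has_real_derivative
         ?P * (1 / \<rho> * b' ((x $ i - z $ i) / \<rho>))) (at 0)"
      by (intro DERIV_cmult has_real_derivative_along_line L)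
    then have "partial_deriv i (cube_bump z \<rho>) x = ?P * (1 / \<rho> * b' ((x $ i - z $ i) / \<rho>))"
      by (intro partial_deriv_eqI) (simp add: eq)
    also have "\<bar>\<dots>\<bar> = ?P * (1 / \<rho> * \<bar>b' ((x $ i - z $ i) / \<rho>)\<bar>)"
      using that by (simp add: abs_mult prod_nonneg bump_nonneg)
    also have "\<dots> \<le> 1 * (1 / \<rho> * L)"
      using that L by (intro mult_mono prod_le_1 mult_nonneg_nonneg) (auto simp: bump_nonneg bump_le_1)
    finally show ?thesis by simp
  qed
  with L(1) show ?thesis using that by blast
qed

subsection \<open>The Euler--Lagrange equation\<close>

lemma pw_pos: "t > 0 \<Longrightarrow> pw t a = t powr a"
  by (simp add: pw_def)

lemma pw_nonneg: "0 \<le> pw t a"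
  by (simp add: pw_def)

lemma pw_mult_self: "t \<ge> 0 \<Longrightarrow> pw t (q - 2) * t = t powr (q - 1)"
  using powr_add[of t "q - 2" 1] by (cases "t = 0") (auto simp: pw_pos)

lemma borel_measurable_pw [measurable]: "(\<lambda>t. pw t a) \<in> borel_measurable borel"
  by (cases "a = 0") (auto simp: pw_def)

lemma tendsto_pw:
  assumes "(f \<longlongrightarrow> l) F" "\<forall>\<^sub>F x in F. 0 \<le> f x" "a \<ge> 0"
  shows "((\<lambda>x. pw (f x) a) \<longlongrightarrow> pw l a) F"
  using assms by (cases "a = 0") (auto simp: pw_def intro!: tendsto_powr')

text \<open>Tangent-plane inequality for the convex function \<open>|x|^q\<close>, whose gradient at
  \<open>b\<close> is \<open>q * |b|^(q-2) * b\<close>. Cauchy-Schwarz followed by Young's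
  inequality with exponents \<open>q\<close> and \<open>q / (q - 1)\<close> gives it directly,
  \<open>b = 0\<close> included.\<close>

lemma norm_powr_convex:
  fixes a b :: "'a::real_inner"
  assumes q: "q \<ge> 2"
  shows "norm b powr q + q * (pw (norm b) (q - 2) * (b \<bullet> (a - b))) \<le> norm a powr q"
proof -
  define P where "P = pw (norm b) (q - 2)"
  have P: "P \<ge> 0" by (simp add: P_def pw_nonneg)
  have P1: "P * norm b = norm b powr (q - 1)" unfolding P_def by (simp add: pw_mult_self)
  have P2: "P * (b \<bullet> b) = norm b powr q"
    using powr_add[of "norm b" "q - 1" 1] P1
    by (cases "b = 0") (auto simp: dot_square_norm power2_eq_square simp flip: mult.assoc)
  have conj: "1 / q + 1 / (q / (q - 1)) = 1" "q / (q - 1) > 1" using q by (auto simp: field_simps)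
  have "norm a * norm b powr (q - 1) \<le> norm a powr q / q + (norm b powr (q - 1)) powr (q / (q - 1)) / (q / (q - 1))"
    by (rule Youngs_inequality) (use q conj in auto)
  also have "(norm b powr (q - 1)) powr (q / (q - 1)) = norm b powr q" using q by (simp add: powr_powr)
  finally have Y: "q * (norm a * norm b powr (q - 1)) \<le> norm a powr q + (q - 1) * norm b powr q"
    using q by (simp add: field_simps)
  have "P * (b \<bullet> a) \<le> P * (norm b * norm a)" by (intro mult_left_mono norm_cauchy_schwarz P)
  also have "\<dots> = norm a * norm b powr (q - 1)" using P1 by (simp add: mult.assoc[symmetric])
  finally have "q * (P * (b \<bullet> a)) \<le> norm a powr q + (q - 1) * norm b powr q"
    using Y q mult_left_mono[of "P * (b \<bullet> a)" "norm a * norm b powr (q - 1)" q] by linarith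
  then show ?thesis
    unfolding P_def[symmetric] inner_diff_right right_diff_distrib P2 by (simp add: algebra_simps)
qed

lemma powr_add_le: "0 \<le> a \<Longrightarrow> 0 \<le> b \<Longrightarrow> q \<ge> 0 \<Longrightarrow> (a + b) powr q \<le> 2 powr q * (a powr q + b powr q)" for a b q :: real
proof -
  assume ab: "0 \<le> a" "0 \<le> b" and q: "q \<ge> 0"
  have "(a + b) powr q \<le> (2 * max a b) powr q" using ab q by (intro powr_mono2) auto
  also have "\<dots> = 2 powr q * max a b powr q" using ab by (simp add: powr_mult)
  also have "max a b powr q \<le> a powr q + b powr q" by (simp add: max_def)
  finally show ?thesis by (simp add: mult_left_mono)
qed

lemma powr_le_1_plus: "0 \<le> t \<Longrightarrow> 0 \<le> p \<Longrightarrow> p \<le> q \<Longrightarrow> t powr p \<le> 1 + t powr q" for t p q :: real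
  using powr_mono[of p q t] powr_mono2[of p t 1] powr_ge_zero[of t q] by (cases "t \<le> 1") (smt (verit) powr_one_eq_one)+

text \<open>Convexity is applied at the perturbed field \<open>G + s H\<close> instead of at
  \<open>G\<close>: together with minimality it makes the first-order term there nonnegative for
  every small \<open>s > 0\<close>. Only then does \<open>s\<close> tend to 0, by dominated
  convergence, so nothing is differentiated under the integral.\<close>

lemma (in finite_measure) first_variation_nonneg:
  fixes G H :: "'a \<Rightarrow> 'b::euclidean_space"
  assumes q: "q \<ge> 2" and G [measurable]: "G \<in> borel_measurable M" and H [measurable]: "H \<in> borel_measurable M"
    and C: "\<And>x. norm (H x) \<le> C" and int: "integrable M (\<lambda>x. norm (G x) powr q)"
    and min: "\<And>s. s > 0 \<Longrightarrow> (\<integral>x. norm (G x) powr q \<partial>M) \<le> (\<integral>x. norm (G x + s *\<^sub>R H x) powr q \<partial>M)"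
  shows "0 \<le> (\<integral>x. pw (norm (G x)) (q - 2) * (G x \<bullet> H x) \<partial>M)"
proof -
  have C0: "C \<ge> 0" using C norm_ge_zero order_trans by blast
  define g where "g s x = pw (norm (G x + s *\<^sub>R H x)) (q - 2) * ((G x + s *\<^sub>R H x) \<bullet> H x)" for s x
  define w where "w x = (1 + (norm (G x) + C) powr q) * C" for x
  have [measurable]: "g s \<in> borel_measurable M" for s unfolding g_def[abs_def] by measurable
  have intC: "integrable M (\<lambda>x. (norm (G x) + C) powr q)"
  proof (rule Bochner_Integration.integrable_bound[of _ "\<lambda>x. 2 powr q * (norm (G x) powr q + C powr q)"])
    show "AE x in M. norm ((norm (G x) + C) powr q) \<le> norm (2 powr q * (norm (G x) powr q + C powr q))"
      using powr_add_le[of "norm (G _)" C q] C0 q by (intro AE_I2) simp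
  qed (use int in auto)
  have ns: "norm (G x + s *\<^sub>R H x) \<le> norm (G x) + C" if "0 \<le> s" "s \<le> 1" for s x
  proof -
    have "norm (s *\<^sub>R H x) \<le> 1 * C" unfolding norm_scaleR using that C[of x] by (intro mult_mono) auto
    then show ?thesis using norm_triangle_ineq[of "G x" "s *\<^sub>R H x"] by simp
  qed
  have gw: "norm (g s x) \<le> w x" if "0 \<le> s" "s \<le> 1" for s x
  proof -
    let ?n = "norm (G x + s *\<^sub>R H x)"
    have "norm (g s x) \<le> pw ?n (q - 2) * (?n * norm (H x))"
      unfolding g_def real_norm_def abs_mult abs_of_nonneg[OF pw_nonneg]
      by (intro mult_left_mono Cauchy_Schwarz_ineq2 pw_nonneg)
    also have "\<dots> = ?n powr (q - 1) * norm (H x)" using pw_mult_self[of ?n q] by (simp add: mult.assoc[symmetric])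
    also have "\<dots> \<le> (1 + (norm (G x) + C) powr q) * C"
    proof (intro mult_mono C)
      have "?n powr (q - 1) \<le> (norm (G x) + C) powr (q - 1)" using ns[OF that] q by (intro powr_mono2) auto
      also have "\<dots> \<le> 1 + (norm (G x) + C) powr q" using q C0 by (intro powr_le_1_plus) auto
      finally show "?n powr (q - 1) \<le> 1 + (norm (G x) + C) powr q" .
    qed (auto simp: add_nonneg_nonneg)
    finally show ?thesis by (simp add: w_def)
  qed
  have wint: "integrable M w" unfolding w_def[abs_def]
    by (intro integrable_mult_left Bochner_Integration.integrable_add intC) simp
  have gint: "integrable M (g s)" if "0 \<le> s" "s \<le> 1" for s
    by (rule Bochner_Integration.integrable_bound[OF wint]) (use gw[OF that] in \<open>auto intro!: AE_I2 order_trans[OF _ abs_ge_self]\<close>)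
  have pos: "0 \<le> (\<integral>x. g s x \<partial>M)" if s: "0 < s" "s \<le> 1" for s
  proof -
    have iS: "integrable M (\<lambda>x. norm (G x + s *\<^sub>R H x) powr q)"
    proof (rule Bochner_Integration.integrable_bound[OF intC])
      show "AE x in M. norm (norm (G x + s *\<^sub>R H x) powr q) \<le> norm ((norm (G x) + C) powr q)"
        using ns[of s] s q by (intro AE_I2) (auto intro!: powr_mono2)
    qed measurable
    have "(\<integral>x. norm (G x + s *\<^sub>R H x) powr q \<partial>M) - q * s * (\<integral>x. g s x \<partial>M)
        = (\<integral>x. norm (G x + s *\<^sub>R H x) powr q - q * s * g s x \<partial>M)"
      using iS gint[of s] s by simp
    also have "\<dots> \<le> (\<integral>x. norm (G x) powr q \<partial>M)"
    proof (rule integral_mono)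
      fix x
      have "(G x + s *\<^sub>R H x) \<bullet> (G x - (G x + s *\<^sub>R H x)) = - s * ((G x + s *\<^sub>R H x) \<bullet> H x)"
        by (simp add: inner_simps)
      then show "norm (G x + s *\<^sub>R H x) powr q - q * s * g s x \<le> norm (G x) powr q"
        using norm_powr_convex[OF q, of "G x + s *\<^sub>R H x" "G x"] by (simp add: g_def algebra_simps)
    qed (use iS gint[of s] s int in auto)
    also have "\<dots> \<le> (\<integral>x. norm (G x + s *\<^sub>R H x) powr q \<partial>M)" by (rule min[OF s(1)])
    finally have "0 \<le> q * s * (\<integral>x. g s x \<partial>M)" by simp
    moreover have "q * s > 0" using s q by simp
    ultimately show ?thesis using mult_pos_neg[of "q * s" "\<integral>x. g s x \<partial>M"] by linarith
  qed
  have "(\<lambda>n. \<integral>x. g (inverse (real (Suc n))) x \<partial>M) \<longlonglongrightarrow> (\<integral>x. g 0 x \<partial>M)"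
  proof (rule integral_dominated_convergence[OF _ _ wint])
    show "AE x in M. norm (g (inverse (real (Suc n))) x) \<le> w x" for n
      by (intro AE_I2 gw) (auto simp: field_simps)
    show "AE x in M. (\<lambda>n. g (inverse (real (Suc n))) x) \<longlonglongrightarrow> g 0 x"
    proof (intro AE_I2)
      fix x
      have "(\<lambda>n. G x + inverse (real (Suc n)) *\<^sub>R H x) \<longlonglongrightarrow> G x + 0 *\<^sub>R H x"
        by (intro tendsto_intros LIMSEQ_inverse_real_of_nat)
      then show "(\<lambda>n. g (inverse (real (Suc n))) x) \<longlonglongrightarrow> g 0 x"
        unfolding g_def using q by (intro tendsto_mult tendsto_pw tendsto_norm tendsto_inner tendsto_const) auto
    qed
  qed auto
  then have "0 \<le> (\<integral>x. g 0 x \<partial>M)"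
    by (rule LIMSEQ_le_const) (auto intro!: pos exI[of _ 0] simp: field_simps)
  then show ?thesis by (simp add: g_def)
qed

section \<open>Variations by test functions in the Sobolev class\<close>

lemma integral_translation_lborel:
  fixes g :: "'a::euclidean_space \<Rightarrow> real"
  assumes "g \<in> borel_measurable borel"
  shows "(\<integral>x. g (x + c) \<partial>lborel) = (\<integral>x. g x \<partial>lborel)"
proof -
  have "(\<integral>x. g x \<partial>lborel) = (\<integral>x. g x \<partial>distr lborel borel ((+) c))" by (simp add: lborel_distr_plus)
  also have "\<dots> = (\<integral>x. g (c + x) \<partial>lborel)" using assms by (subst integral_distr) auto
  finally show ?thesis by (simp add: add.commute)
qed

text \<open>Translation invariance makes every difference quotient integrate to 0, and dominated
  convergence passes this to the derivative; no iterated integral enters.\<close>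

lemma integral_partial_deriv_eq_0:
  assumes g: "test_fun UNIV g"
  shows "(\<integral>x. partial_deriv i g x \<partial>lborel) = 0"
proof -
  let ?K = "closure {x. g x \<noteq> 0}"
  have K: "compact ?K" and sm: "smooth_fun g" using g by (auto simp: test_fun_def)
  have gK: "g x = 0" if "x \<notin> ?K" for x using closure_subset[of "{x. g x \<noteq> 0}"] that by auto
  have dK: "partial_deriv i g x = 0" if "x \<notin> ?K" for x using partial_deriv_outside_support[OF that] .
  obtain C where C: "C > 0" "\<And>x. norm (partial_deriv i g x) \<le> C"
    using bounded_continuous_compact_support[OF smooth_fun_continuous[OF smooth_fun_partial_deriv[OF sm]] K dK] by blast
  obtain C1 where C1: "C1 > 0" "\<And>x. norm (g x) \<le> C1"
    using bounded_continuous_compact_support[OF smooth_fun_continuous[OF sm] K gK] by blast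
  obtain R where R: "R > 0" "\<And>x. x \<in> ?K \<Longrightarrow> norm x \<le> R" using compact_imp_bounded[OF K] unfolding bounded_pos by blast
  have [measurable]: "g \<in> borel_measurable borel"
    by (intro borel_measurable_continuous_onI smooth_fun_continuous sm)
  have [measurable]: "partial_deriv i g \<in> borel_measurable borel"
    by (intro borel_measurable_continuous_onI smooth_fun_continuous smooth_fun_partial_deriv sm)
  have iball: "integrable lborel (\<lambda>x::real^'a. B * indicator (cball 0 (R + 1)) x :: real)" for B
  proof (intro integrable_mult_right integrable_real_indicator)
    show "emeasure lborel (cball 0 (R + 1) :: (real^'a) set) < \<infinity>" by (rule emeasure_bounded_finite) simp
  qed simp
  have gi: "integrable lborel g"
  proof (rule Bochner_Integration.integrable_bound[OF iball[of C1]])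
    show "AE x in lborel. norm (g x) \<le> norm (C1 * indicator (cball 0 (R + 1)) x :: real)"
    proof (intro AE_I2)
      fix x show "norm (g x) \<le> norm (C1 * indicator (cball 0 (R + 1)) x :: real)"
        using C1 R(2)[of x] gK[of x] by (cases "x \<in> ?K") auto
    qed
  qed simp
  define t where "t n = inverse (real (Suc n))" for n
  have t: "0 < t n" "t n \<le> 1" for n by (auto simp: t_def field_simps)
  define h where "h n x = (g (x + t n *\<^sub>R axis i 1) - g x) / t n" for n x
  have "(\<integral>x. h n x \<partial>lborel) = 0" for n
  proof -
    have "integrable lborel (\<lambda>x. g (x + t n *\<^sub>R axis i 1))"
    proof -
      have "integrable (distr lborel borel ((+) (t n *\<^sub>R axis i 1))) g" using gi by (simp add: lborel_distr_plus)
      then have "integrable lborel (\<lambda>x. g (t n *\<^sub>R axis i 1 + x))" by (subst (asm) integrable_distr_eq) auto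
      then show ?thesis by (simp add: add.commute)
    qed
    then show ?thesis unfolding h_def using gi integral_translation_lborel[of g] by simp
  qed
  moreover have "(\<lambda>n. \<integral>x. h n x \<partial>lborel) \<longlonglongrightarrow> (\<integral>x. partial_deriv i g x \<partial>lborel)"
  proof (rule integral_dominated_convergence[OF _ _ iball[of C]])
    show "AE x in lborel. norm (h n x) \<le> C * indicator (cball 0 (R + 1)) x" for n
    proof (intro AE_I2)
      fix x
      show "norm (h n x) \<le> C * indicator (cball 0 (R + 1)) x"
      proof (cases "x \<in> cball 0 (R + 1)")
        case True
        have der: "((\<lambda>s. g (x + s *\<^sub>R axis i 1)) has_real_derivative partial_deriv i g (x + s *\<^sub>R axis i 1)) (at s)" for s
        proof -
          have "((\<lambda>u. g ((x + s *\<^sub>R axis i 1) + u *\<^sub>R axis i 1)) has_real_derivative partial_deriv i g (x + s *\<^sub>R axis i 1)) (at 0)"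
            by (rule partial_deriv_works[OF sm])
          then have "((\<lambda>u. g (x + (u + s) *\<^sub>R axis i 1)) has_real_derivative partial_deriv i g (x + s *\<^sub>R axis i 1)) (at 0)"
            by (simp add: scaleR_add_left add.assoc add.commute[of "s *\<^sub>R axis i 1"])
          then show ?thesis using DERIV_shift[of "\<lambda>s. g (x + s *\<^sub>R axis i 1)" _ 0 s] by simp
        qed
        obtain z where "g (x + t n *\<^sub>R axis i 1) - g (x + 0 *\<^sub>R axis i 1) = (t n - 0) * partial_deriv i g (x + z *\<^sub>R axis i 1)"
          using MVT2[OF t(1)[of n], of "\<lambda>s. g (x + s *\<^sub>R axis i 1)" "\<lambda>s. partial_deriv i g (x + s *\<^sub>R axis i 1)"] der by blast
        then have "h n x = partial_deriv i g (x + z *\<^sub>R axis i 1)" using t(1)[of n] by (simp add: h_def)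
        then show ?thesis using C(2) True by simp
      next
        case False
        \<comment> \<open>The increments \<open>t n\<close> are at most 1, so outside radius
          \<open>R + 1\<close> both points of the difference quotient miss the support.\<close>
        have "norm x \<le> norm (x + t n *\<^sub>R axis i 1) + norm (t n *\<^sub>R axis i (1::real))"
          using norm_triangle_ineq4[of "x + t n *\<^sub>R axis i 1" "t n *\<^sub>R axis i 1"] by simp
        then have "norm (x + t n *\<^sub>R axis i 1) > R" using False t[of n] by (simp add: norm_axis_1)
        then have o1: "x + t n *\<^sub>R axis i 1 \<notin> ?K" using R(2)[of "x + t n *\<^sub>R axis i 1"] by (meson not_le)
        have o2: "x \<notin> ?K"
        proof
          assume "x \<in> ?K"
          from R(2)[OF this] False show False by simp
        qed
        show ?thesis using False unfolding h_def gK[OF o1] gK[OF o2] by simp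
      qed
    qed
    show "AE x in lborel. (\<lambda>n. h n x) \<longlonglongrightarrow> partial_deriv i g x"
    proof (intro AE_I2)
      fix x
      have "((\<lambda>s. (g (x + s *\<^sub>R axis i 1) - g x) / s) \<longlongrightarrow> partial_deriv i g x) (at 0)"
        using partial_deriv_works[OF sm, of x i] by (simp add: DERIV_def)
      moreover have "filterlim t (at 0) sequentially"
        unfolding filterlim_at t_def using LIMSEQ_inverse_real_of_nat by simp
      ultimately show "(\<lambda>n. h n x) \<longlonglongrightarrow> partial_deriv i g x" unfolding h_def by (rule filterlim_compose)
    qed
  qed (auto simp: h_def)
  ultimately show ?thesis by (simp add: LIMSEQ_const_iff)
qed

text \<open>With \<open>w = grad \<phi>\<close> this is the gradient matrix of the variation \<phi>
  times the \<open>k\<close>-th unit vector; pairing with it extracts row \<open>k\<close>.\<close>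

definition row_mat :: "'N \<Rightarrow> real^'n \<Rightarrow> real^'n^'N::finite" where
  "row_mat k w = (\<chi> l. if l = k then w else 0)"

lemma inner_row_mat: "A \<bullet> row_mat k w = A $ k \<bullet> w"
proof -
  have "A \<bullet> row_mat k w = (\<Sum>l\<in>UNIV. if l = k then A $ l \<bullet> w else 0)"
    unfolding inner_vec_def[of A] row_mat_def by (intro sum.cong) auto
  then show ?thesis by simp
qed

lemma norm_row_mat: "norm (row_mat k w) = norm w"
proof -
  have "row_mat k w \<bullet> row_mat k w = w \<bullet> w" unfolding inner_row_mat by (simp add: row_mat_def)
  then show ?thesis by (simp add: norm_eq_sqrt_inner)
qed

lemma row_mat_scale: "row_mat k (c *\<^sub>R w) = c *\<^sub>R row_mat k w"
  by (simp add: row_mat_def vec_eq_iff)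

lemma continuous_on_row_mat: "continuous_on S f \<Longrightarrow> continuous_on S (\<lambda>x. row_mat k (f x))"
  unfolding row_mat_def
proof (rule continuous_on_vec_lambda)
  fix l assume "continuous_on S f"
  then show "continuous_on S (\<lambda>x. if l = k then f x else 0)" by (cases "l = k") auto
qed

context
  fixes \<Omega> :: "(real^'n) set" and q :: real
  assumes Om: "open \<Omega>" "bounded \<Omega>" and q: "q \<ge> 1"
begin

abbreviation "leb_Omega \<equiv> restrict_space lebesgue \<Omega>"

lemma Omega_sets: "\<Omega> \<inter> space lebesgue \<in> sets lebesgue"
  using Om(1) by (simp add: borel_open sets_completionI_sets)

lemma finite_measure_leb_Omega: "finite_measure leb_Omega"
proof (rule finite_measureI)
  have "emeasure lborel \<Omega> < \<infinity>" using Om(2) by (rule emeasure_bounded_finite)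
  then show "emeasure leb_Omega (space leb_Omega) \<noteq> \<infinity>"
    using Omega_sets Om(1) by (simp add: space_restrict_space emeasure_restrict_space)
qed

lemma set_borel_measurable_leb_Omega:
  fixes f :: "real^'n \<Rightarrow> 'b::real_normed_vector"
  shows "set_borel_measurable lebesgue \<Omega> f \<longleftrightarrow> f \<in> borel_measurable leb_Omega"
  unfolding set_borel_measurable_def borel_measurable_restrict_space_iff[OF Omega_sets] ..

lemma set_integral_leb_Omega:
  fixes f :: "real^'n \<Rightarrow> real"
  shows "(LINT x:\<Omega>|lebesgue. f x) = (\<integral>x. f x \<partial>leb_Omega)"
  unfolding set_lebesgue_integral_def integral_restrict_space[OF Omega_sets] ..

lemma borel_measurable_leb_Omega:
  "f \<in> borel_measurable borel \<Longrightarrow> f \<in> borel_measurable leb_Omega"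
  by (intro measurable_restrict_space1 measurable_completion) simp

lemma Lp_on_iff:
  fixes f :: "real^'n \<Rightarrow> 'b::euclidean_space"
  shows "Lp_on \<Omega> q f \<longleftrightarrow> f \<in> borel_measurable leb_Omega \<and> integrable leb_Omega (\<lambda>x. norm (f x) powr q)"
proof -
  have "(\<integral>\<^sup>+x\<in>\<Omega>. ennreal (norm (f x) powr q) \<partial>lebesgue) = (\<integral>\<^sup>+x. ennreal (norm (f x) powr q) \<partial>leb_Omega)"
    by (rule nn_integral_restrict_space[OF Omega_sets, symmetric])
  then show ?thesis
    unfolding Lp_on_def set_borel_measurable_leb_Omega integrable_iff_bounded by auto
qed

lemma Lp_on_integrable:
  fixes f :: "real^'n \<Rightarrow> 'b::euclidean_space"
  assumes "Lp_on \<Omega> q f" shows "integrable leb_Omega f"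
proof -
  interpret finite_measure leb_Omega by (rule finite_measure_leb_Omega)
  have f: "f \<in> borel_measurable leb_Omega" "integrable leb_Omega (\<lambda>x. norm (f x) powr q)"
    using assms by (auto simp: Lp_on_iff)
  show ?thesis
  proof (rule Bochner_Integration.integrable_bound[of _ "\<lambda>x. 1 + norm (f x) powr q"])
    show "AE x in leb_Omega. norm (f x) \<le> norm (1 + norm (f x) powr q)"
      using powr_le_1_plus[of "norm (f _)" 1 q] q by (intro AE_I2) (simp add: abs_of_nonneg)
  qed (use f in auto)
qed

lemma Lp_on_add_bounded:
  fixes f g :: "real^'n \<Rightarrow> 'b::euclidean_space"
  assumes f: "Lp_on \<Omega> q f" and g: "g \<in> borel_measurable borel" "\<And>x. norm (g x) \<le> C"
  shows "Lp_on \<Omega> q (\<lambda>x. f x + g x)"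
proof -
  interpret finite_measure leb_Omega by (rule finite_measure_leb_Omega)
  have C: "C \<ge> 0" using g(2) norm_ge_zero order_trans by blast
  have fm [measurable]: "f \<in> borel_measurable leb_Omega" and fi: "integrable leb_Omega (\<lambda>x. norm (f x) powr q)"
    using f by (auto simp: Lp_on_iff)
  have [measurable]: "g \<in> borel_measurable leb_Omega" using g(1) by (rule borel_measurable_leb_Omega)
  have "integrable leb_Omega (\<lambda>x. norm (f x + g x) powr q)"
  proof (rule Bochner_Integration.integrable_bound[of _ "\<lambda>x. 2 powr q * (norm (f x) powr q + C powr q)"])
    show "AE x in leb_Omega. norm (norm (f x + g x) powr q) \<le> norm (2 powr q * (norm (f x) powr q + C powr q))"
    proof (intro AE_I2)
      fix x
      have "norm (f x + g x) \<le> norm (f x) + C" using norm_triangle_ineq[of "f x" "g x"] g(2)[of x] by linarith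
      then have "norm (f x + g x) powr q \<le> (norm (f x) + C) powr q" using q by (intro powr_mono2) auto
      also have "\<dots> \<le> 2 powr q * (norm (f x) powr q + C powr q)" using C q by (intro powr_add_le) auto
      finally show "norm (norm (f x + g x) powr q) \<le> norm (2 powr q * (norm (f x) powr q + C powr q))" by simp
    qed
  qed (use fi in auto)
  then show ?thesis by (simp add: Lp_on_iff)
qed

text \<open>The product is a test function too, so its partial derivative has integral 0. This
  identifies the weak gradient of a smooth perturbation.\<close>

lemma integral_test_by_parts:
  assumes \<phi>: "test_fun \<Omega> \<phi>" and \<psi>: "test_fun \<Omega> \<psi>"
  shows "(\<integral>x. \<phi> x * partial_deriv i \<psi> x \<partial>leb_Omega) = - (\<integral>x. partial_deriv i \<phi> x * \<psi> x \<partial>leb_Omega)"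
proof -
  interpret finite_measure leb_Omega by (rule finite_measure_leb_Omega)
  have s: "smooth_fun \<phi>" "smooth_fun \<psi>" using \<phi> \<psi> by (auto simp: test_fun_def)
  have bd: "integrable leb_Omega (\<lambda>x. f x * g x)"
    if fg: "continuous_on UNIV f" "continuous_on UNIV g" "\<And>x. x \<notin> closure {x. \<phi> x \<noteq> 0} \<Longrightarrow> f x * g x = 0" for f g :: "real^'n \<Rightarrow> real"
  proof -
    have K: "compact (closure {x. \<phi> x \<noteq> 0})" using \<phi> by (simp add: test_fun_def)
    obtain C where "\<And>x. norm (f x * g x) \<le> C"
      using bounded_continuous_compact_support[OF continuous_on_mult[OF fg(1,2)] K fg(3)] by blast
    then show ?thesis
      by (intro integrable_const_bound[of _ C] borel_measurable_leb_Omega borel_measurable_continuous_onI continuous_on_mult fg AE_I2)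
  qed
  have z: "\<phi> x = 0" if "x \<notin> closure {x. \<phi> x \<noteq> 0}" for x using closure_subset[of "{x. \<phi> x \<noteq> 0}"] that by auto
  note z' = partial_deriv_outside_support[of _ \<phi> i]
  have i1: "integrable leb_Omega (\<lambda>x. \<phi> x * partial_deriv i \<psi> x)"
  proof (rule bd[OF smooth_fun_continuous[OF s(1)] smooth_fun_continuous[OF smooth_fun_partial_deriv[OF s(2)]]])
    fix x assume "x \<notin> closure {x. \<phi> x \<noteq> 0}"
    from z[OF this] show "\<phi> x * partial_deriv i \<psi> x = 0" by simp
  qed
  have i2: "integrable leb_Omega (\<lambda>x. partial_deriv i \<phi> x * \<psi> x)"
  proof (rule bd[OF smooth_fun_continuous[OF smooth_fun_partial_deriv[OF s(1)]] smooth_fun_continuous[OF s(2)]])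
    fix x assume "x \<notin> closure {x. \<phi> x \<noteq> 0}"
    from z'[OF this] show "partial_deriv i \<phi> x * \<psi> x = 0" by simp
  qed
  have "(\<integral>x. \<phi> x * partial_deriv i \<psi> x \<partial>leb_Omega) + (\<integral>x. partial_deriv i \<phi> x * \<psi> x \<partial>leb_Omega)
     = (\<integral>x. partial_deriv i (\<lambda>x. \<phi> x * \<psi> x) x \<partial>leb_Omega)"
    unfolding partial_deriv_mult[OF s] using Bochner_Integration.integral_add[OF i2 i1] by simp
  also have "\<dots> = (\<integral>x. indicator \<Omega> x *\<^sub>R partial_deriv i (\<lambda>x. \<phi> x * \<psi> x) x \<partial>lebesgue)"
    by (rule integral_restrict_space[OF Omega_sets])
  also have "\<dots> = (\<integral>x. partial_deriv i (\<lambda>x. \<phi> x * \<psi> x) x \<partial>lebesgue)"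
  proof (rule Bochner_Integration.integral_cong[OF refl])
    fix x
    have "closure {x. \<phi> x * \<psi> x \<noteq> 0} \<subseteq> closure {x. \<phi> x \<noteq> 0}" by (rule closure_mono) auto
    then have "x \<notin> \<Omega> \<Longrightarrow> x \<notin> closure {x. \<phi> x * \<psi> x \<noteq> 0}" using \<phi> unfolding test_fun_def by blast
    then show "indicator \<Omega> x *\<^sub>R partial_deriv i (\<lambda>x. \<phi> x * \<psi> x) x = partial_deriv i (\<lambda>x. \<phi> x * \<psi> x) x"
      using partial_deriv_outside_support[of x "\<lambda>x. \<phi> x * \<psi> x" i] by (cases "x \<in> \<Omega>") auto
  qed
  also have "\<dots> = (\<integral>x. partial_deriv i (\<lambda>x. \<phi> x * \<psi> x) x \<partial>lborel)"
    by (intro integral_completion) (simp add: borel_measurable_continuous_onI smooth_fun_continuous smooth_fun_partial_deriv smooth_fun_mult s)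
  also have "\<dots> = 0"
    by (intro integral_partial_deriv_eq_0) (use test_fun_mult[OF \<phi> s(2)] in \<open>auto simp: test_fun_def\<close>)
  finally show ?thesis by linarith
qed

lemma W1p_add_test:
  fixes v :: "real^'n \<Rightarrow> real^'N"
  assumes W: "W1p \<Omega> q v Gv" and \<phi>: "test_fun \<Omega> \<phi>"
  shows "W1p \<Omega> q (\<lambda>x. v x + \<phi> x *\<^sub>R axis k 1) (\<lambda>x. Gv x + row_mat k (grad \<phi> x))"
proof -
  interpret finite_measure leb_Omega by (rule finite_measure_leb_Omega)
  have s: "smooth_fun \<phi>" and K: "compact (closure {x. \<phi> x \<noteq> 0})" using \<phi> by (auto simp: test_fun_def)
  have z: "\<phi> x = 0" if "x \<notin> closure {x. \<phi> x \<noteq> 0}" for x using closure_subset[of "{x. \<phi> x \<noteq> 0}"] that by auto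
  obtain C1 where C1: "\<And>x. norm (\<phi> x) \<le> C1"
    using bounded_continuous_compact_support[OF smooth_fun_continuous[OF s] K z] by blast
  obtain C2 where C2: "\<And>x. norm (grad \<phi> x) \<le> C2"
    using bounded_continuous_compact_support[OF continuous_on_grad[OF s] K grad_outside_support] by blast
  have L1: "Lp_on \<Omega> q (\<lambda>x. v x + \<phi> x *\<^sub>R axis k 1)"
    by (rule Lp_on_add_bounded[of _ _ C1])
       (use W C1 in \<open>auto simp: W1p_def norm_axis_1 intro!: borel_measurable_continuous_onI continuous_intros smooth_fun_continuous[OF s]\<close>)
  have L2: "Lp_on \<Omega> q (\<lambda>x. Gv x + row_mat k (grad \<phi> x))"
    by (rule Lp_on_add_bounded[of _ _ C2])
       (use W C2 in \<open>auto simp: W1p_def norm_row_mat intro!: borel_measurable_continuous_onI continuous_on_row_mat continuous_on_grad[OF s]\<close>)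
  have "weak_grad \<Omega> (\<lambda>x. v x + \<phi> x *\<^sub>R axis k 1) (\<lambda>x. Gv x + row_mat k (grad \<phi> x))"
    unfolding weak_grad_def
  proof (intro conjI allI impI)
    show "set_borel_measurable lebesgue \<Omega> (\<lambda>x. v x + \<phi> x *\<^sub>R axis k 1)" using L1 by (simp add: Lp_on_def)
    show "set_borel_measurable lebesgue \<Omega> (\<lambda>x. Gv x + row_mat k (grad \<phi> x))" using L2 by (simp add: Lp_on_def)
    fix \<psi> l i assume \<psi>: "test_fun \<Omega> \<psi>"
    have wg: "(\<integral>x. v x $ l * partial_deriv i \<psi> x \<partial>leb_Omega) = - (\<integral>x. Gv x $ l $ i * \<psi> x \<partial>leb_Omega)"
      using W \<psi> unfolding W1p_def weak_grad_def set_integral_leb_Omega by blast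
    show "(LINT x:\<Omega>|lebesgue. (v x + \<phi> x *\<^sub>R axis k 1) $ l * partial_deriv i \<psi> x)
        = - (LINT x:\<Omega>|lebesgue. (Gv x + row_mat k (grad \<phi> x)) $ l $ i * \<psi> x)"
    proof (cases "l = k")
      case False
      then show ?thesis unfolding set_integral_leb_Omega using wg by (simp add: axis_def row_mat_def)
    next
      case True
      have s': "smooth_fun \<psi>" and K': "compact (closure {x. \<psi> x \<noteq> 0})" using \<psi> by (auto simp: test_fun_def)
      have z': "\<psi> x = 0" if "x \<notin> closure {x. \<psi> x \<noteq> 0}" for x using closure_subset[of "{x. \<psi> x \<noteq> 0}"] that by auto
      obtain B1 where B1: "\<And>x. norm (\<psi> x) \<le> B1"
        using bounded_continuous_compact_support[OF smooth_fun_continuous[OF s'] K' z'] by blast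
      obtain B2 where B2: "\<And>x. norm (partial_deriv i \<psi> x) \<le> B2"
        using bounded_continuous_compact_support[OF smooth_fun_continuous[OF smooth_fun_partial_deriv[OF s']] K' partial_deriv_outside_support] by blast
      have prod: "integrable leb_Omega (\<lambda>x. f x * g x)"
        if "integrable leb_Omega f" "continuous_on UNIV g" "\<And>x. norm (g x) \<le> B" for f g :: "real^'n \<Rightarrow> real" and B
      proof (rule Bochner_Integration.integrable_bound[OF integrable_mult_left[OF that(1), of B]])
        show "(\<lambda>x. f x * g x) \<in> borel_measurable leb_Omega"
          by (intro borel_measurable_times borel_measurable_integrable[OF that(1)]
              borel_measurable_leb_Omega[OF borel_measurable_continuous_onI[OF that(2)]])
        show "AE x in leb_Omega. norm (f x * g x) \<le> norm (f x * B)"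
          using that(3) by (intro AE_I2) (auto simp: abs_mult intro!: mult_left_mono order_trans[OF that(3)[unfolded real_norm_def]])
      qed
      have vk: "integrable leb_Omega (\<lambda>x. v x $ k)"
        by (rule integrable_bounded_linear[OF bounded_linear_vec_nth Lp_on_integrable]) (use W in \<open>simp add: W1p_def\<close>)
      have Gk: "integrable leb_Omega (\<lambda>x. Gv x $ k $ i)"
        by (rule integrable_bounded_linear[OF bounded_linear_vec_nth integrable_bounded_linear[OF bounded_linear_vec_nth Lp_on_integrable]])
           (use W in \<open>simp add: W1p_def\<close>)
      have p1: "integrable leb_Omega \<phi>"
        by (rule integrable_const_bound[of _ C1]) (use C1 in \<open>auto intro!: borel_measurable_leb_Omega borel_measurable_continuous_onI smooth_fun_continuous[OF s]\<close>)
      have p2: "integrable leb_Omega (partial_deriv i \<phi>)"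
      proof (rule integrable_const_bound[of _ C2])
        show "AE x in leb_Omega. norm (partial_deriv i \<phi> x) \<le> C2"
        proof (intro AE_I2)
          fix x show "norm (partial_deriv i \<phi> x) \<le> C2"
            using component_le_norm_cart[of "grad \<phi> x" i] C2[of x] by (simp add: grad_def)
        qed
      qed (intro borel_measurable_leb_Omega borel_measurable_continuous_onI smooth_fun_continuous smooth_fun_partial_deriv s)
      note cs = smooth_fun_continuous[OF s'] smooth_fun_continuous[OF smooth_fun_partial_deriv[OF s']]
      have "(\<integral>x. (v x + \<phi> x *\<^sub>R axis k 1) $ l * partial_deriv i \<psi> x \<partial>leb_Omega)
          = (\<integral>x. v x $ k * partial_deriv i \<psi> x \<partial>leb_Omega) + (\<integral>x. \<phi> x * partial_deriv i \<psi> x \<partial>leb_Omega)"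
        using True prod[OF vk cs(2) B2] prod[OF p1 cs(2) B2] by (simp add: axis_def distrib_right)
      also have "\<dots> = - ((\<integral>x. Gv x $ k $ i * \<psi> x \<partial>leb_Omega) + (\<integral>x. partial_deriv i \<phi> x * \<psi> x \<partial>leb_Omega))"
        using wg True integral_test_by_parts[OF \<phi> \<psi>, of i] by simp
      also have "(\<integral>x. Gv x $ k $ i * \<psi> x \<partial>leb_Omega) + (\<integral>x. partial_deriv i \<phi> x * \<psi> x \<partial>leb_Omega)
          = (\<integral>x. (Gv x + row_mat k (grad \<phi> x)) $ l $ i * \<psi> x \<partial>leb_Omega)"
        using True prod[OF Gk cs(1) B1] prod[OF p2 cs(1) B1] by (simp add: row_mat_def grad_def distrib_right)
      finally show ?thesis unfolding set_integral_leb_Omega .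
    qed
  qed
  with L1 L2 show ?thesis by (simp add: W1p_def)
qed

text \<open>Adding the same test function to every member of the approximating sequence leaves the
  differences to the limit unchanged, so the convergence is inherited verbatim.\<close>

lemma W1p0_add_test:
  fixes v :: "real^'n \<Rightarrow> real^'N"
  assumes W: "W1p0 \<Omega> q v Gv" and \<phi>: "test_fun \<Omega> \<phi>"
  shows "W1p0 \<Omega> q (\<lambda>x. v x + \<phi> x *\<^sub>R axis k 1) (\<lambda>x. Gv x + row_mat k (grad \<phi> x))"
proof -
  obtain f :: "nat \<Rightarrow> real^'n \<Rightarrow> real^'N" where f: "\<And>j l. test_fun \<Omega> (\<lambda>x. f j x $ l)"
     "(\<lambda>j. \<integral>\<^sup>+x\<in>\<Omega>. (ennreal (norm (f j x - v x) powr q)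
                 + ennreal (norm (grad_mat (f j) x - Gv x) powr q)) \<partial>lebesgue) \<longlonglongrightarrow> 0"
    using W unfolding W1p0_def by blast
  define g where "g j x = f j x + \<phi> x *\<^sub>R axis k 1" for j x
  have gl: "(\<lambda>x. g j x $ l) = (\<lambda>x. f j x $ l + (if l = k then \<phi> x else 0))" for j l
    by (auto simp: g_def axis_def)
  have gt: "test_fun \<Omega> (\<lambda>x. g j x $ l)" for j l
  proof (cases "l = k")
    case True
    have "closure {x. f j x $ l + \<phi> x \<noteq> 0} \<subseteq> closure ({x. f j x $ l \<noteq> 0} \<union> {x. \<phi> x \<noteq> 0})"
      by (rule closure_mono) auto
    then have sub: "closure {x. f j x $ l + \<phi> x \<noteq> 0} \<subseteq> closure {x. f j x $ l \<noteq> 0} \<union> closure {x. \<phi> x \<noteq> 0}"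
      by (simp add: closure_Un)
    have "compact (closure {x. f j x $ l \<noteq> 0} \<union> closure {x. \<phi> x \<noteq> 0})"
      using f(1)[of j l] \<phi> by (intro compact_Un) (auto simp: test_fun_def)
    from compact_closure_subset[OF this sub] show ?thesis
      using sub f(1)[of j l] \<phi> True unfolding gl by (auto simp: test_fun_def intro!: smooth_fun_add)
  qed (use f(1)[of j l] in \<open>simp add: gl\<close>)
  have gm: "grad_mat (g j) x = grad_mat (f j) x + row_mat k (grad \<phi> x)" for j x
  proof -
    have "partial_deriv i (\<lambda>y. g j y $ l) x = partial_deriv i (\<lambda>y. f j y $ l) x + (if l = k then partial_deriv i \<phi> x else 0)" for l i
      unfolding gl using DERIV_add[OF partial_deriv_works[OF test_fun_smooth[OF f(1)[of j l]], of x i] partial_deriv_works[OF test_fun_smooth[OF \<phi>], of x i]]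
        partial_deriv_works[OF test_fun_smooth[OF f(1)[of j l]], of x i]
      by (cases "l = k") (auto intro!: partial_deriv_eqI)
    then show ?thesis by (simp add: vec_eq_iff grad_mat_def row_mat_def grad_def)
  qed
  have "(\<lambda>j. \<integral>\<^sup>+x\<in>\<Omega>. (ennreal (norm (g j x - (v x + \<phi> x *\<^sub>R axis k 1)) powr q)
       + ennreal (norm (grad_mat (g j) x - (Gv x + row_mat k (grad \<phi> x))) powr q)) \<partial>lebesgue) \<longlonglongrightarrow> 0"
    using f(2) by (simp add: gm g_def)
  with gt W1p_add_test[OF _ \<phi>, of v Gv k] W show ?thesis unfolding W1p0_def by blast
qed

end

text \<open>Both \<phi> and its negative are admissible directions, so the one-sided first variation
  becomes an equality. Minimality of \<open>Ep\<close> passes to the integral of the power because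
  the root is strictly increasing.\<close>

lemma minimiser_euler_lagrange:
  fixes \<Omega> :: "(real^'n) set" and G :: "real^'n \<Rightarrow> real^'n^'N"
  assumes Om: "open \<Omega>" "bounded \<Omega>" "\<Omega> \<noteq> {}" and q: "q \<ge> 2" and min: "is_minimiser \<Omega> u0 q u G"
    and \<phi>: "test_fun \<Omega> \<phi>"
  shows "(LINT x:\<Omega>|lebesgue. pw (norm (G x)) (q - 2) * (G x \<bullet> row_mat k (grad \<phi> x))) = 0"
proof -
  have q1: "q \<ge> 1" using q by simp
  note ctx = Om(1,2) q1
  let ?L = "restrict_space lebesgue \<Omega>"
  interpret finite_measure ?L by (rule finite_measure_leb_Omega[OF ctx])
  have adm: "admissible \<Omega> u0 q u G" and mn: "\<And>u' G'. admissible \<Omega> u0 q u' G' \<Longrightarrow> Ep \<Omega> q G \<le> Ep \<Omega> q G'"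
    using min by (auto simp: is_minimiser_def)
  have GL: "G \<in> borel_measurable ?L" "integrable ?L (\<lambda>x. norm (G x) powr q)"
    using adm by (auto simp: admissible_def W1p_def Lp_on_iff[OF ctx])
  have mpos: "measure lebesgue \<Omega> > 0"
  proof -
    have "emeasure lebesgue \<Omega> \<noteq> 0" using Om(1,3) open_not_negligible[of \<Omega>] by (auto simp: negligible_iff_null_sets null_sets_def)
    moreover have "emeasure lebesgue \<Omega> < \<infinity>" using Om(1,2) emeasure_bounded_finite[of \<Omega>] by simp
    ultimately show ?thesis by (simp add: measure_def enn2real_positive_iff less_top zero_less_iff_neq_zero)
  qed
  have nonneg: "0 \<le> (\<integral>x. pw (norm (G x)) (q - 2) * (G x \<bullet> row_mat k (grad \<psi> x)) \<partial>?L)" if \<psi>: "test_fun \<Omega> \<psi>" for \<psi>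
  proof -
    have s: "smooth_fun \<psi>" and K: "compact (closure {x. \<psi> x \<noteq> 0})" using \<psi> by (auto simp: test_fun_def)
    obtain C where C: "\<And>x. norm (grad \<psi> x) \<le> C"
      using bounded_continuous_compact_support[OF continuous_on_grad[OF s] K grad_outside_support] by blast
    show ?thesis
    proof (rule first_variation_nonneg[OF q GL(1) _ _ GL(2)])
      show "(\<lambda>x. row_mat k (grad \<psi> x)) \<in> borel_measurable ?L"
        by (intro borel_measurable_leb_Omega[OF ctx] borel_measurable_continuous_onI continuous_on_row_mat continuous_on_grad s)
      show "norm (row_mat k (grad \<psi> x)) \<le> C" for x using C by (simp add: norm_row_mat)
      fix r :: real assume "r > 0"
      have sc: "grad (\<lambda>x. \<psi> x * r) x = r *\<^sub>R grad \<psi> x" for x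
        using partial_deriv_mult[OF s smooth_fun_const, of _ r x]
        by (simp add: grad_def vec_eq_iff partial_deriv_def)
      have t: "test_fun \<Omega> (\<lambda>x. \<psi> x * r)" by (rule test_fun_mult[OF \<psi> smooth_fun_const])
      have "admissible \<Omega> u0 q (\<lambda>x. u x + (\<psi> x * r) *\<^sub>R axis k 1) (\<lambda>x. G x + row_mat k (grad (\<lambda>x. \<psi> x * r) x))"
      proof -
        obtain Gv where "W1p0 \<Omega> q (\<lambda>x. u x - u0 x) Gv" using adm by (auto simp: admissible_def)
        from W1p0_add_test[OF ctx this t, of k]
        have "W1p0 \<Omega> q (\<lambda>x. (u x + (\<psi> x * r) *\<^sub>R axis k 1) - u0 x) (\<lambda>x. Gv x + row_mat k (grad (\<lambda>x. \<psi> x * r) x))"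
          by (simp add: algebra_simps)
        moreover have "W1p \<Omega> q (\<lambda>x. u x + (\<psi> x * r) *\<^sub>R axis k 1) (\<lambda>x. G x + row_mat k (grad (\<lambda>x. \<psi> x * r) x))"
          by (rule W1p_add_test[OF ctx _ t]) (use adm in \<open>simp add: admissible_def\<close>)
        ultimately show ?thesis unfolding admissible_def by blast
      qed
      from mn[OF this] have E: "Ep \<Omega> q G \<le> Ep \<Omega> q (\<lambda>x. G x + r *\<^sub>R row_mat k (grad \<psi> x))"
        by (simp add: sc row_mat_scale)
      show "(\<integral>x. norm (G x) powr q \<partial>?L) \<le> (\<integral>x. norm (G x + r *\<^sub>R row_mat k (grad \<psi> x)) powr q \<partial>?L)"
      proof (rule ccontr)
        assume "\<not> ?thesis"
        then have lt: "(\<integral>x. norm (G x + r *\<^sub>R row_mat k (grad \<psi> x)) powr q \<partial>?L) < (\<integral>x. norm (G x) powr q \<partial>?L)" by simp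
        have "(1 / measure lebesgue \<Omega>) * (\<integral>x. norm (G x + r *\<^sub>R row_mat k (grad \<psi> x)) powr q \<partial>?L)
            < (1 / measure lebesgue \<Omega>) * (\<integral>x. norm (G x) powr q \<partial>?L)"
          using mpos lt by (intro mult_strict_left_mono) auto
        then have "Ep \<Omega> q (\<lambda>x. G x + r *\<^sub>R row_mat k (grad \<psi> x)) < Ep \<Omega> q G"
          unfolding Ep_def set_integral_leb_Omega[OF ctx] using q mpos
          by (intro powr_less_mono2) (auto intro!: mult_nonneg_nonneg divide_nonneg_nonneg integral_nonneg_AE)
        with E show False by simp
      qed
    qed
  qed
  have neg: "grad (\<lambda>x. \<phi> x * (-1)) x = - grad \<phi> x" for x
    using partial_deriv_mult[OF test_fun_smooth[OF \<phi>] smooth_fun_const, of _ "-1" x]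
    by (simp add: grad_def vec_eq_iff partial_deriv_def)
  have "row_mat k (- w) = - row_mat k w" for w :: "real^'n" using row_mat_scale[of k "-1" w] by simp
  then have "0 \<le> - (\<integral>x. pw (norm (G x)) (q - 2) * (G x \<bullet> row_mat k (grad \<phi> x)) \<partial>?L)"
    using nonneg[OF test_fun_mult[OF \<phi> smooth_fun_const, of "-1"]] unfolding neg by simp
  with nonneg[OF \<phi>] show ?thesis unfolding set_integral_leb_Omega[OF ctx] by linarith
qed

lemma integral_mu_p_eq_0:
  fixes \<Omega> :: "(real^'n) set" and G :: "real^'n \<Rightarrow> real^'n^'N"
  assumes Om: "open \<Omega>" "bounded \<Omega>" "\<Omega> \<noteq> {}" and q: "q \<ge> 2" and min: "is_minimiser \<Omega> u0 q u G"
    and G: "G \<in> borel_measurable lebesgue" and \<phi>: "test_fun \<Omega> \<phi>"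
  shows "(LINT x:closure \<Omega>|mu_p \<Omega> q G. 0 + G x \<bullet> row_mat k (grad \<phi> x)) = 0"
proof -
  define c where "c = pw (Ep \<Omega> q G) (q - 2) * measure lebesgue \<Omega>"
  define w where "w x = indicator \<Omega> x * (pw (norm (G x)) (q - 2) / c)" for x
  \<comment> \<open>If \<open>c = 0\<close>, real division makes both the density of
    \<open>mu_p\<close> and the factor \<open>1 / c\<close> vanish, so the computation below also
    covers that case.\<close>
  have c: "c \<ge> 0" by (simp add: c_def pw_nonneg)
  have [measurable]: "\<Omega> \<in> sets lebesgue" "closure \<Omega> \<in> sets lebesgue"
    using Om(1) by (auto intro: sets_completionI_sets)
  have [measurable]: "G \<in> borel_measurable lebesgue" by fact
  have [measurable]: "w \<in> borel_measurable lebesgue" unfolding w_def[abs_def] by measurable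
  have "(\<lambda>x. row_mat k (grad \<phi> x)) \<in> borel_measurable lborel"
    using borel_measurable_continuous_onI[OF continuous_on_row_mat[OF continuous_on_grad[OF test_fun_smooth[OF \<phi>]]]] by simp
  then have [measurable]: "(\<lambda>x. row_mat k (grad \<phi> x) :: real^'n^'N) \<in> borel_measurable lebesgue" by (rule measurable_completion)
  have mu: "mu_p \<Omega> q G = density lebesgue (\<lambda>x. ennreal (w x))"
    unfolding mu_p_def w_def c_def by (intro arg_cong[where f="density lebesgue"] ext) (simp split: split_indicator)
  have "(LINT x:closure \<Omega>|mu_p \<Omega> q G. 0 + G x \<bullet> row_mat k (grad \<phi> x))
      = (\<integral>x. w x *\<^sub>R (indicator (closure \<Omega>) x *\<^sub>R (0 + G x \<bullet> row_mat k (grad \<phi> x))) \<partial>lebesgue)"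
    unfolding set_lebesgue_integral_def mu by (rule integral_density) (auto simp: w_def c pw_nonneg)
  also have "\<dots> = (\<integral>x. (1 / c) * (indicator \<Omega> x *\<^sub>R (pw (norm (G x)) (q - 2) * (G x \<bullet> row_mat k (grad \<phi> x)))) \<partial>lebesgue)"
    using closure_subset[of \<Omega>] by (intro Bochner_Integration.integral_cong) (auto simp: w_def split: split_indicator)
  also have "\<dots> = (1 / c) * (LINT x:\<Omega>|lebesgue. pw (norm (G x)) (q - 2) * (G x \<bullet> row_mat k (grad \<phi> x)))"
    unfolding set_lebesgue_integral_def by simp
  also have "\<dots> = 0" using minimiser_euler_lagrange[OF Om q min \<phi>] by simp
  finally show ?thesis .
qed

subsection \<open>Divergence-free vector measures\<close>

lemma continuous_antiderivative:
  fixes f :: "real \<Rightarrow> real"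
  assumes "continuous_on UNIV f"
  obtains F where "\<And>t. (F has_real_derivative f t) (at t)"
proof -
  have "\<exists>F. \<forall>x::real. -\<infinity> < ereal x \<longrightarrow> ereal x < \<infinity> \<longrightarrow> (F has_vector_derivative f x) (at x)"
    using assms by (intro einterval_antiderivative) (auto simp: continuous_on_eq_continuous_at)
  then show ?thesis using that by (auto simp: has_real_derivative_iff_has_vector_derivative)
qed

lemma real_polynomial_antiderivative:
  fixes q :: "real \<Rightarrow> real"
  assumes "real_polynomial_function q"
  obtains Q where "\<And>t. (Q has_real_derivative q t) (at t)" "smooth_fun Q"
proof -
  obtain Q where Q: "\<And>t. (Q has_real_derivative q t) (at t)"
    using continuous_antiderivative[of q] assms continuous_on_polymonial_function real_polynomial_function_eq by metis
  then show ?thesis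
    using that smooth_fun_real_deriv[OF Q smooth_fun_real_polynomial[OF assms]] by blast
qed

lemma (in finite_measure) abs_integral_le_const:
  fixes f :: "'a \<Rightarrow> real"
  assumes "AE x in M. \<bar>f x\<bar> \<le> c" "0 \<le> c"
  shows "\<bar>\<integral>x. f x \<partial>M\<bar> \<le> c * measure M (space M)"
proof (cases "integrable M f")
  case True
  have "\<bar>\<integral>x. f x \<partial>M\<bar> \<le> (\<integral>x. \<bar>f x\<bar> \<partial>M)" using integral_abs_bound by blast
  also have "\<dots> \<le> (\<integral>x. c \<partial>M)"
    by (intro integral_mono_AE integrable_abs True assms) simp
  finally show ?thesis by (simp add: mult.commute)
qed (simp add: not_integrable_integral_eq assms)

lemma borel_measurable_vec_component [measurable]: "(\<lambda>x::real^'n. x $ i) \<in> borel_measurable borel"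
  by (intro borel_measurable_continuous_onI continuous_intros)

locale divfree = finite_measure \<nu>
  for \<nu> :: "(real^'n) measure" +
  fixes \<Omega> :: "(real^'n) set" and a :: "real^'n \<Rightarrow> real^'n"
  assumes sets_nu [measurable_cong]: "sets \<nu> = sets borel"
    and open_Omega: "open \<Omega>"
    and a_meas [measurable]: "a \<in> borel_measurable borel"
    and a_bound: "AE x in \<nu>. norm (a x) \<le> 1"
    and divfree: "\<And>\<phi>. test_fun \<Omega> \<phi> \<Longrightarrow> (\<integral>x. grad \<phi> x \<bullet> a x \<partial>\<nu>) = 0"
begin

lemma space_nu [simp]: "space \<nu> = UNIV"
  using sets_eq_imp_space_eq[OF sets_nu] by simp

lemma borel_nu: "f \<in> borel_measurable borel \<Longrightarrow> f \<in> borel_measurable \<nu>"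
  using measurable_cong_sets[OF sets_nu refl] by blast

lemma integrable_mult_a:
  assumes "g \<in> borel_measurable borel" "\<And>x. \<bar>g x\<bar> \<le> C"
  shows "integrable \<nu> (\<lambda>x. g x * a x $ i)"
proof (rule integrable_const_bound[of _ C])
  show "AE x in \<nu>. norm (g x * a x $ i) \<le> C"
    using a_bound
  proof eventually_elim
    fix x assume "norm (a x) \<le> 1"
    then have "\<bar>a x $ i\<bar> \<le> 1" using component_le_norm_cart[of "a x" i] by linarith
    then have "\<bar>g x * a x $ i\<bar> \<le> C * 1"
      unfolding abs_mult using assms(2)[of x] by (intro mult_mono) auto
    then show "norm (g x * a x $ i) \<le> C" by simp
  qed
qed (intro borel_nu borel_measurable_times assms measurable_compose[OF a_meas] borel_measurable_vec_component)

lemma integrable_inner_a: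
  assumes "g \<in> borel_measurable borel" "\<And>x. norm (g x) \<le> C"
  shows "integrable \<nu> (\<lambda>x. g x \<bullet> a x)"
proof (rule integrable_const_bound[of _ C])
  show "AE x in \<nu>. norm (g x \<bullet> a x) \<le> C"
    using a_bound
  proof eventually_elim
    fix x assume "norm (a x) \<le> 1"
    then have "norm (g x) * norm (a x) \<le> C * 1" using assms(2)[of x] by (intro mult_mono) (auto intro: order_trans[OF norm_ge_zero])
    then show "norm (g x \<bullet> a x) \<le> C" using Cauchy_Schwarz_ineq2[of "g x" "a x"] by simp
  qed
qed (intro borel_nu borel_measurable_inner assms a_meas)

lemma test_fun_bounds:
  assumes "test_fun \<Omega> \<zeta>"
  obtains C R where "C > 0" "R > 0" "\<And>x. \<bar>\<zeta> x\<bar> \<le> C" "\<And>x. norm (grad \<zeta> x) \<le> C"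
    "\<And>x i. \<zeta> x \<noteq> 0 \<or> grad \<zeta> x \<noteq> 0 \<Longrightarrow> \<bar>x $ i\<bar> \<le> R"
proof -
  let ?K = "closure {x. \<zeta> x \<noteq> 0}"
  have K: "compact ?K" and sm: "smooth_fun \<zeta>" using assms by (auto simp: test_fun_def)
  have z1: "\<zeta> x = 0" if "x \<notin> ?K" for x using closure_subset[of "{x. \<zeta> x \<noteq> 0}"] that by auto
  have z2: "grad \<zeta> x = 0" if "x \<notin> ?K" for x using that by (rule grad_outside_support)
  obtain C1 where C1: "C1 > 0" "\<And>x. norm (\<zeta> x) \<le> C1"
    using bounded_continuous_compact_support[OF smooth_fun_continuous[OF sm] K z1] by blast
  obtain C2 where C2: "C2 > 0" "\<And>x. norm (grad \<zeta> x) \<le> C2"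
    using bounded_continuous_compact_support[OF continuous_on_grad[OF sm] K z2] by blast
  obtain R where R: "R > 0" "\<And>x. x \<in> ?K \<Longrightarrow> norm x \<le> R"
    using compact_imp_bounded[OF K] unfolding bounded_pos by blast
  have "\<bar>x $ i\<bar> \<le> R" if "\<zeta> x \<noteq> 0 \<or> grad \<zeta> x \<noteq> 0" for x i
  proof -
    have "x \<in> ?K" using that z1 z2 by blast
    then show ?thesis using R(2) component_le_norm_cart[of x i] by fastforce
  qed
  moreover have "\<bar>\<zeta> x\<bar> \<le> C1 + C2" "norm (grad \<zeta> x) \<le> C1 + C2" for x
    using C1(2)[of x] C2(2)[of x] C1(1) C2(1) by auto
  ultimately show ?thesis
    using that[of "C1 + C2" R] C1(1) C2(1) R(1) by simp
qed

lemma by_parts_smooth: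
  assumes \<zeta>: "test_fun \<Omega> \<zeta>" and \<Psi>: "\<And>t. (\<Psi> has_real_derivative \<psi> t) (at t)" "smooth_fun \<Psi>"
  shows "(\<integral>x. \<zeta> x * \<psi> (x $ i) * a x $ i + \<Psi> (x $ i) * (grad \<zeta> x \<bullet> a x) \<partial>\<nu>) = 0"
proof -
  have "grad (\<lambda>x. \<zeta> x * \<Psi> (x $ i)) x \<bullet> a x = \<zeta> x * \<psi> (x $ i) * a x $ i + \<Psi> (x $ i) * (grad \<zeta> x \<bullet> a x)" for x
  proof -
    have "grad (\<lambda>x. \<zeta> x * \<Psi> (x $ i)) x = \<Psi> (x $ i) *\<^sub>R grad \<zeta> x + (\<zeta> x * \<psi> (x $ i)) *\<^sub>R axis i 1"
      using test_fun_smooth[OF \<zeta>] smooth_fun_coordinate[OF \<Psi>(2), of i]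
      by (simp add: vec_eq_iff grad_def partial_deriv_mult partial_deriv_coordinate[OF \<Psi>(1)] axis_def)
    then show ?thesis by (simp add: inner_add_left inner_axis' )
  qed
  then show ?thesis
    using divfree[OF test_fun_mult[OF \<zeta> smooth_fun_coordinate[OF \<Psi>(2), of i]]] by simp
qed

lemma by_parts_integrable:
  assumes \<zeta>: "test_fun \<Omega> \<zeta>" and \<psi>: "continuous_on UNIV \<psi>" and \<Psi>: "continuous_on UNIV \<Psi>"
  shows "integrable \<nu> (\<lambda>x. \<zeta> x * \<psi> (x $ i) * a x $ i)"
    and "integrable \<nu> (\<lambda>x. \<Psi> (x $ i) * (grad \<zeta> x \<bullet> a x))"
proof -
  obtain C R where CR: "C > 0" "R > 0" "\<And>x. \<bar>\<zeta> x\<bar> \<le> C" "\<And>x. norm (grad \<zeta> x) \<le> C"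
    "\<And>x i. \<zeta> x \<noteq> 0 \<or> grad \<zeta> x \<noteq> 0 \<Longrightarrow> \<bar>x $ i\<bar> \<le> R" using test_fun_bounds[OF \<zeta>] by blast
  have bd: "\<exists>B>0. \<forall>t\<in>{-R..R}. \<bar>f t\<bar> \<le> B" if "continuous_on UNIV f" for f :: "real \<Rightarrow> real"
    using compact_imp_bounded[OF compact_continuous_image[OF continuous_on_subset[OF that]], of "{-R..R}"]
    unfolding bounded_pos by auto
  have [measurable]: "\<zeta> \<in> borel_measurable borel" "grad \<zeta> \<in> borel_measurable borel"
     "\<psi> \<in> borel_measurable borel" "\<Psi> \<in> borel_measurable borel"
    using assms by (auto intro!: borel_measurable_continuous_onI smooth_fun_continuous continuous_on_grad test_fun_smooth[OF \<zeta>])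
  obtain B where B: "B > 0" "\<And>t. \<bar>t\<bar> \<le> R \<Longrightarrow> \<bar>\<psi> t\<bar> \<le> B" using bd[OF \<psi>] by (auto simp: abs_le_iff)
  obtain B' where B': "B' > 0" "\<And>t. \<bar>t\<bar> \<le> R \<Longrightarrow> \<bar>\<Psi> t\<bar> \<le> B'" using bd[OF \<Psi>] by (auto simp: abs_le_iff)
  show "integrable \<nu> (\<lambda>x. \<zeta> x * \<psi> (x $ i) * a x $ i)"
  proof (rule integrable_mult_a)
    show "\<bar>\<zeta> x * \<psi> (x $ i)\<bar> \<le> C * B" for x
      using CR(1,3,5) B by (cases "\<zeta> x = 0") (auto simp: abs_mult intro!: mult_mono)
  qed measurable
  have "integrable \<nu> (\<lambda>x. (\<Psi> (x $ i) *\<^sub>R grad \<zeta> x) \<bullet> a x)"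
  proof (rule integrable_inner_a)
    show "norm (\<Psi> (x $ i) *\<^sub>R grad \<zeta> x) \<le> B' * C" for x
      using CR(1,4,5) B' by (cases "grad \<zeta> x = 0") (auto intro!: mult_mono)
  qed measurable
  then show "integrable \<nu> (\<lambda>x. \<Psi> (x $ i) * (grad \<zeta> x \<bullet> a x))" by simp
qed

text \<open>Extends the identity from smooth \<Psi> to continuously differentiable ones, as the
  distance cutoffs and tents below require. Instead of mollifying, \<psi> is approximated by a
  polynomial on the range of the coordinate over the support: antiderivatives of polynomials are
  smooth, and uniform closeness of \<psi> forces closeness of \<Psi>.\<close>

lemma by_parts_sum:
  assumes \<zeta>: "test_fun \<Omega> \<zeta>" and \<psi>: "continuous_on UNIV \<psi>"
    and \<Psi>: "\<And>t. (\<Psi> has_real_derivative \<psi> t) (at t)"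
  shows "(\<integral>x. \<zeta> x * \<psi> (x $ i) * a x $ i + \<Psi> (x $ i) * (grad \<zeta> x \<bullet> a x) \<partial>\<nu>) = 0" (is "?I \<psi> \<Psi> = 0")
proof -
  obtain C R where CR: "C > 0" "R > 0" "\<And>x. \<bar>\<zeta> x\<bar> \<le> C" "\<And>x. norm (grad \<zeta> x) \<le> C"
    "\<And>x i. \<zeta> x \<noteq> 0 \<or> grad \<zeta> x \<noteq> 0 \<Longrightarrow> \<bar>x $ i\<bar> \<le> R" using test_fun_bounds[OF \<zeta>] by blast
  have cont: "continuous_on UNIV f" if "\<And>t. (f has_real_derivative f' t) (at t)" for f f' :: "real \<Rightarrow> real"
    by (rule DERIV_continuous_on) (use that in \<open>auto intro: has_field_derivative_at_within\<close>)
  have small: "\<bar>?I \<psi> \<Psi>\<bar> \<le> e * (C + R * C) * measure \<nu> UNIV" if "e > 0" for e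
  proof -
    obtain q where q: "real_polynomial_function q" "\<And>t. t \<in> {-R..R} \<Longrightarrow> \<bar>\<psi> t - q t\<bar> < e"
      using Stone_Weierstrass_real_polynomial_function[of "{-R..R}" \<psi> e] continuous_on_subset[OF \<psi>] \<open>e > 0\<close> by auto
    obtain Q0 where Q0: "\<And>t. (Q0 has_real_derivative q t) (at t)" "smooth_fun Q0"
      using real_polynomial_antiderivative[OF q(1)] by blast
    \<comment> \<open>The constant of integration makes \<open>Q\<close> and \<Psi> agree at 0, so
      they differ by at most \<open>e * R\<close> on \<open>{-R..R}\<close>.\<close>
    define Q where "Q t = Q0 t + (\<Psi> 0 - Q0 0)" for t
    have Q: "(Q has_real_derivative q t) (at t)" for t
      unfolding Q_def[abs_def] by (auto intro!: derivative_eq_intros Q0)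
    have Qs: "smooth_fun Q" unfolding Q_def[abs_def] by (intro smooth_fun_add Q0 smooth_fun_const)
    have qc: "continuous_on UNIV q"
      using q(1) continuous_on_polymonial_function real_polynomial_function_eq by metis
    have dif: "\<bar>\<Psi> t - Q t\<bar> \<le> e * R" if "\<bar>t\<bar> \<le> R" for t
    proof -
      have "norm ((\<Psi> t - Q t) - (\<Psi> 0 - Q 0)) \<le> e * norm (t - 0)"
      proof (rule field_differentiable_bound[of "{-R..R}" "\<lambda>t. \<Psi> t - Q t" "\<lambda>t. \<psi> t - q t"])
        show "((\<lambda>t. \<Psi> t - Q t) has_field_derivative \<psi> z - q z) (at z within {- R..R})" for z
          using DERIV_diff[OF \<Psi>[of z] Q[of z]] by (rule has_field_derivative_at_within)
        show "norm (\<psi> z - q z) \<le> e" if "z \<in> {-R..R}" for z using q(2)[OF that] by simp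
      qed (use that \<open>R > 0\<close> in auto)
      also have "\<dots> \<le> e * R" using that \<open>e > 0\<close> by (intro mult_left_mono) auto
      finally show ?thesis by (simp add: Q_def)
    qed
    have I0: "?I q Q = 0" by (rule by_parts_smooth[OF \<zeta> Q Qs])
    have int: "integrable \<nu> (\<lambda>x. \<zeta> x * f (x $ i) * a x $ i + F (x $ i) * (grad \<zeta> x \<bullet> a x))"
      if "continuous_on UNIV f" "\<And>t. (F has_real_derivative f t) (at t)" for f F
      using by_parts_integrable[OF \<zeta> that(1) cont[OF that(2)]] by (rule Bochner_Integration.integrable_add)
    have "?I \<psi> \<Psi> = ?I \<psi> \<Psi> - ?I q Q" using I0 by simp
    also have "\<dots> = (\<integral>x. (\<zeta> x * \<psi> (x $ i) * a x $ i + \<Psi> (x $ i) * (grad \<zeta> x \<bullet> a x))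
         - (\<zeta> x * q (x $ i) * a x $ i + Q (x $ i) * (grad \<zeta> x \<bullet> a x)) \<partial>\<nu>)"
      using int[OF \<psi> \<Psi>] int[OF qc Q] by simp
    also have "\<bar>\<dots>\<bar> \<le> e * (C + R * C) * measure \<nu> (space \<nu>)"
    proof (rule abs_integral_le_const)
      show "AE x in \<nu>. \<bar>(\<zeta> x * \<psi> (x $ i) * a x $ i + \<Psi> (x $ i) * (grad \<zeta> x \<bullet> a x))
         - (\<zeta> x * q (x $ i) * a x $ i + Q (x $ i) * (grad \<zeta> x \<bullet> a x))\<bar> \<le> e * (C + R * C)"
        using a_bound
      proof eventually_elim
        fix x assume a1: "norm (a x) \<le> 1"
        have "\<bar>a x $ i\<bar> \<le> 1" using a1 component_le_norm_cart[of "a x" i] by linarith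
        then have "\<bar>\<zeta> x * (\<psi> (x $ i) - q (x $ i)) * a x $ i\<bar> \<le> C * e * 1"
        proof (cases "\<zeta> x = 0")
          case False
          then have "\<bar>x $ i\<bar> \<le> R" using CR(5) by blast
          then have "x $ i \<in> {-R..R}" by (simp add: abs_le_iff)
          then have "\<bar>\<psi> (x $ i) - q (x $ i)\<bar> \<le> e" using q(2) by (blast intro: less_imp_le)
          then show ?thesis using \<open>\<bar>a x $ i\<bar> \<le> 1\<close> CR(1,3) \<open>e > 0\<close>
            unfolding abs_mult by (intro mult_mono mult_nonneg_nonneg) auto
        qed (use CR \<open>e > 0\<close> in auto)
        moreover have "\<bar>grad \<zeta> x \<bullet> a x\<bar> \<le> C * 1"
          using Cauchy_Schwarz_ineq2[of "grad \<zeta> x" "a x"] mult_mono[OF CR(4)[of x] a1] CR(1) by auto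
        then have "\<bar>(\<Psi> (x $ i) - Q (x $ i)) * (grad \<zeta> x \<bullet> a x)\<bar> \<le> (e * R) * C"
          using CR dif[of "x $ i"] \<open>e > 0\<close> unfolding abs_mult
          by (cases "grad \<zeta> x = 0") (auto intro!: mult_mono)
        ultimately show "\<bar>(\<zeta> x * \<psi> (x $ i) * a x $ i + \<Psi> (x $ i) * (grad \<zeta> x \<bullet> a x))
         - (\<zeta> x * q (x $ i) * a x $ i + Q (x $ i) * (grad \<zeta> x \<bullet> a x))\<bar> \<le> e * (C + R * C)"
          by (simp add: algebra_simps abs_le_iff)
      qed
    qed (use CR \<open>e > 0\<close> in simp)
    finally show ?thesis by simp
  qed
  have "\<bar>?I \<psi> \<Psi>\<bar> \<le> 0"
  proof (rule field_le_epsilon)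
    fix \<epsilon> :: real assume "\<epsilon> > 0"
    define B where "B = (C + R * C) * measure \<nu> UNIV + 1"
    have "B > 0" using CR unfolding B_def by (auto intro!: add_nonneg_pos)
    then have "\<bar>?I \<psi> \<Psi>\<bar> \<le> \<epsilon> / B * (C + R * C) * measure \<nu> UNIV" using \<open>\<epsilon> > 0\<close> by (intro small) auto
    also have "\<dots> = \<epsilon> / B * (B - 1)" by (simp add: B_def)
    also have "\<dots> \<le> \<epsilon>" using \<open>B > 0\<close> \<open>\<epsilon> > 0\<close> by (simp add: field_simps)
    finally show "\<bar>?I \<psi> \<Psi>\<bar> \<le> 0 + \<epsilon>" by simp
  qed
  then show ?thesis by simp
qed

lemma by_parts:
  assumes \<zeta>: "test_fun \<Omega> \<zeta>" and \<psi>: "continuous_on UNIV \<psi>"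
    and \<Psi>: "\<And>t. (\<Psi> has_real_derivative \<psi> t) (at t)"
  shows "(\<integral>x. \<zeta> x * \<psi> (x $ i) * a x $ i \<partial>\<nu>) = - (\<integral>x. \<Psi> (x $ i) * (grad \<zeta> x \<bullet> a x) \<partial>\<nu>)"
proof -
  have "continuous_on UNIV \<Psi>"
    by (rule DERIV_continuous_on) (use \<Psi> in \<open>auto intro: has_field_derivative_at_within\<close>)
  from by_parts_integrable[OF \<zeta> \<psi> this, of i] by_parts_sum[OF assms, of i]
  show ?thesis by simp
qed

end

section \<open>Sets with null projection\<close>

lemma infdist_cutoff_tendsto:
  fixes Z :: "'a::metric_space set"
  assumes "closed Z" "Z \<noteq> {}"
  shows "(\<lambda>m. max 0 (1 - real m * infdist x Z)) \<longlonglongrightarrow> indicator Z x"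
proof (cases "x \<in> Z")
  case False
  then have pos: "infdist x Z > 0"
    using assms in_closed_iff_infdist_zero infdist_nonneg[of x Z] by (metis less_eq_real_def)
  have "\<forall>\<^sub>F m in sequentially. max 0 (1 - real m * infdist x Z) = 0"
    using eventually_ge_at_top[of "nat \<lceil>1 / infdist x Z\<rceil>"]
  proof eventually_elim
    fix m assume "nat \<lceil>1 / infdist x Z\<rceil> \<le> m"
    then have "1 / infdist x Z \<le> m" by linarith
    then show "max 0 (1 - real m * infdist x Z) = 0" using pos by (simp add: field_simps)
  qed
  then show ?thesis using False by (simp add: tendsto_eventually)
qed simp

lemma continuous_on_infdist_cutoff: "continuous_on UNIV (\<lambda>x. max 0 (1 - c * infdist x Z))"
  by (intro continuous_intros)

context divfree
begin

text \<open>After integration by parts the left side is an integral of \<Psi>, and the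
  antiderivative starting from 0 at \<open>-R\<close> is bounded by the integral of \<psi>. So the
  projected signed measure is dominated by a multiple of Lebesgue measure, with constants that do
  not depend on \<psi>.\<close>

lemma slice_estimate:
  assumes \<zeta>: "test_fun \<Omega> \<zeta>"
  obtains C R where "\<And>\<psi> i. continuous_on UNIV \<psi> \<Longrightarrow> (\<And>t. 0 \<le> \<psi> t) \<Longrightarrow>
     \<bar>\<integral>x. \<zeta> x * \<psi> (x $ i) * a x $ i \<partial>\<nu>\<bar> \<le> C * integral {-R..R} \<psi>"
proof -
  obtain C R where CR: "C > 0" "R > 0" "\<And>x. \<bar>\<zeta> x\<bar> \<le> C" "\<And>x. norm (grad \<zeta> x) \<le> C"
    "\<And>x i. \<zeta> x \<noteq> 0 \<or> grad \<zeta> x \<noteq> 0 \<Longrightarrow> \<bar>x $ i\<bar> \<le> R" using test_fun_bounds[OF \<zeta>] by blast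
  have "\<bar>\<integral>x. \<zeta> x * \<psi> (x $ i) * a x $ i \<partial>\<nu>\<bar> \<le> (C * measure \<nu> UNIV) * integral {-R..R} \<psi>"
    if c: "continuous_on UNIV \<psi>" and nn: "\<And>t. 0 \<le> \<psi> t" for \<psi> i
  proof -
    obtain \<Psi>0 where \<Psi>0: "\<And>t. (\<Psi>0 has_real_derivative \<psi> t) (at t)"
      using continuous_antiderivative[OF c] by blast
    define \<Psi> where "\<Psi> t = \<Psi>0 t - \<Psi>0 (-R)" for t
    have \<Psi>: "(\<Psi> has_real_derivative \<psi> t) (at t)" for t
      unfolding \<Psi>_def[abs_def] by (auto intro!: derivative_eq_intros \<Psi>0)
    have int: "(\<psi> has_integral (\<Psi> t - \<Psi> s)) {s..t}" if "s \<le> t" for s t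
      by (rule fundamental_theorem_of_calculus[OF that])
         (use \<Psi> in \<open>auto simp: has_real_derivative_iff_has_vector_derivative intro: has_vector_derivative_at_within\<close>)
    have bd: "\<bar>\<Psi> t\<bar> \<le> integral {-R..R} \<psi>" if "\<bar>t\<bar> \<le> R" for t
    proof -
      have "0 \<le> \<Psi> t - \<Psi> (-R)" "0 \<le> \<Psi> R - \<Psi> t"
        using has_integral_nonneg[OF int] nn that by auto
      moreover have "integral {-R..R} \<psi> = \<Psi> R - \<Psi> (-R)" using int[of "-R" R] \<open>R > 0\<close> by (simp add: integral_unique)
      ultimately show ?thesis by (simp add: \<Psi>_def)
    qed
    have J: "0 \<le> integral {-R..R} \<psi>" using bd[of 0] \<open>R > 0\<close> by simp
    have cP: "continuous_on UNIV \<Psi>"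
      by (rule DERIV_continuous_on) (use \<Psi> in \<open>auto intro: has_field_derivative_at_within\<close>)
    have "\<bar>\<integral>x. \<zeta> x * \<psi> (x $ i) * a x $ i \<partial>\<nu>\<bar> = \<bar>\<integral>x. \<Psi> (x $ i) * (grad \<zeta> x \<bullet> a x) \<partial>\<nu>\<bar>"
      using by_parts[OF \<zeta> c \<Psi>] by simp
    also have "\<dots> \<le> integral {-R..R} \<psi> * C * measure \<nu> (space \<nu>)"
    proof (rule abs_integral_le_const)
      show "AE x in \<nu>. \<bar>\<Psi> (x $ i) * (grad \<zeta> x \<bullet> a x)\<bar> \<le> integral {-R..R} \<psi> * C"
        using a_bound
      proof eventually_elim
        fix x assume a1: "norm (a x) \<le> 1"
        have "\<bar>grad \<zeta> x \<bullet> a x\<bar> \<le> C * 1"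
          using Cauchy_Schwarz_ineq2[of "grad \<zeta> x" "a x"] mult_mono[OF CR(4)[of x] a1] CR(1) by auto
        then show "\<bar>\<Psi> (x $ i) * (grad \<zeta> x \<bullet> a x)\<bar> \<le> integral {-R..R} \<psi> * C"
          using CR bd[of "x $ i"] J unfolding abs_mult
          by (cases "grad \<zeta> x = 0") (auto intro!: mult_mono)
      qed
    qed (use J CR in simp)
    finally show ?thesis by (simp add: mult.commute mult.left_commute)
  qed
  then show ?thesis using that by blast
qed

lemma integral_null_slab_test:
  assumes \<zeta>: "test_fun \<Omega> \<zeta>" and Z: "compact Z" "negligible Z"
  shows "(\<integral>x. \<zeta> x * indicator Z (x $ i) * a x $ i \<partial>\<nu>) = 0"
proof (cases "Z = {}")
  case False
  obtain C R where CR: "\<And>\<psi> i. continuous_on UNIV \<psi> \<Longrightarrow> (\<And>t. 0 \<le> \<psi> t) \<Longrightarrow>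
     \<bar>\<integral>x. \<zeta> x * \<psi> (x $ i) * a x $ i \<partial>\<nu>\<bar> \<le> C * integral {-R..R} \<psi>"
    using slice_estimate[OF \<zeta>] by blast
  define \<psi> where "\<psi> m t = max 0 (1 - real m * infdist t Z)" for m and t :: real
  have \<psi>c: "continuous_on UNIV (\<psi> m)" for m
    unfolding \<psi>_def[abs_def] by (rule continuous_on_infdist_cutoff)
  have \<psi>b: "0 \<le> \<psi> m t" "\<psi> m t \<le> 1" for m t by (auto simp: \<psi>_def infdist_nonneg)
  have \<psi>l: "(\<lambda>m. \<psi> m t) \<longlonglongrightarrow> indicator Z t" for t
    unfolding \<psi>_def using Z False by (intro infdist_cutoff_tendsto compact_imp_closed)
  have "(\<lambda>m. integral {-R..R} (\<psi> m)) \<longlonglongrightarrow> integral {-R..R} (indicator Z)"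
    by (rule dominated_convergence(2)[where h="\<lambda>_. 1"])
       (use \<psi>b \<psi>l in \<open>auto intro!: integrable_continuous_real continuous_on_subset[OF \<psi>c]\<close>)
  moreover have "integral {-R..R} (indicator Z) = (0::real)"
  proof -
    have "(indicator Z has_integral (0::real)) (cbox (-R) R)" using Z(2) unfolding negligible_def by blast
    then show ?thesis by (simp add: integral_unique)
  qed
  ultimately have "(\<lambda>m. C * integral {-R..R} (\<psi> m)) \<longlonglongrightarrow> 0"
    using tendsto_mult_right_zero by auto
  then have 1: "(\<lambda>m. \<integral>x. \<zeta> x * \<psi> m (x $ i) * a x $ i \<partial>\<nu>) \<longlonglongrightarrow> 0"
    by (rule Lim_null_comparison[rotated]) (use CR[OF \<psi>c \<psi>b(1)] in auto)
  obtain B where B: "\<And>x. \<bar>\<zeta> x\<bar> \<le> B" by (rule test_fun_bounds[OF \<zeta>]) (rule that)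
  have [measurable]: "\<zeta> \<in> borel_measurable borel"
    by (intro borel_measurable_continuous_onI smooth_fun_continuous test_fun_smooth[OF \<zeta>])
  have [measurable]: "\<psi> m \<in> borel_measurable borel" for m
    by (intro borel_measurable_continuous_onI \<psi>c)
  have [measurable]: "Z \<in> sets borel" using Z(1) by (rule borel_compact)
  have "(\<lambda>m. \<integral>x. \<zeta> x * \<psi> m (x $ i) * a x $ i \<partial>\<nu>) \<longlonglongrightarrow> (\<integral>x. \<zeta> x * indicator Z (x $ i) * a x $ i \<partial>\<nu>)"
  proof (rule integral_dominated_convergence[where w="\<lambda>_. B"])
    show "AE x in \<nu>. norm (\<zeta> x * \<psi> m (x $ i) * a x $ i) \<le> B" for m
      using a_bound
    proof eventually_elim
      fix x assume "norm (a x) \<le> 1"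
      then have "\<bar>a x $ i\<bar> \<le> 1" using component_le_norm_cart[of "a x" i] by linarith
      then have "\<bar>\<zeta> x\<bar> * \<bar>\<psi> m (x $ i)\<bar> * \<bar>a x $ i\<bar> \<le> B * 1 * 1"
        using B[of x] \<psi>b by (intro mult_mono mult_nonneg_nonneg) auto
      then show "norm (\<zeta> x * \<psi> m (x $ i) * a x $ i) \<le> B" by (simp add: abs_mult)
    qed
    show "AE x in \<nu>. (\<lambda>m. \<zeta> x * \<psi> m (x $ i) * a x $ i) \<longlonglongrightarrow> \<zeta> x * indicator Z (x $ i) * a x $ i"
      by (intro AE_I2 tendsto_intros \<psi>l)
  qed (auto simp: borel_nu)
  with 1 show ?thesis by (rule LIMSEQ_unique[symmetric])
qed simp

text \<open>The continuous weight \<open>g\<close> is there to be shrunk to the indicator of a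
  compact set afterwards. Polynomial weights times the bump are still test functions; uniform
  approximation on the cube reaches all continuous weights.\<close>

lemma integral_null_slab_bump:
  assumes \<rho>: "\<rho> > 0" "cube z \<rho> \<subseteq> \<Omega>" and Z: "compact Z" "negligible Z" and g: "continuous_on UNIV g"
  shows "(\<integral>x. cube_bump z \<rho> x * g x * indicator Z (x $ i) * a x $ i \<partial>\<nu>) = 0" (is "?I g = 0")
proof -
  have [measurable]: "cube_bump z \<rho> \<in> borel_measurable borel"
    by (intro borel_measurable_continuous_onI smooth_fun_continuous smooth_fun_cube_bump)
  have [measurable]: "Z \<in> sets borel" using Z(1) by (rule borel_compact)
  have supp: "cube_bump z \<rho> x = 0" if "x \<notin> cube z \<rho>" for x
    using that cube_bump_support[OF \<rho>(1), of z] closure_subset[of "{x. cube_bump z \<rho> x \<noteq> 0}"] by blast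
  have int: "integrable \<nu> (\<lambda>x. cube_bump z \<rho> x * h x * indicator Z (x $ i) * a x $ i)"
    if hc: "continuous_on UNIV h" for h
  proof -
    obtain B where B: "B > 0" "\<And>x. norm (cube_bump z \<rho> x * h x) \<le> B"
    proof (rule bounded_continuous_compact_support[of "\<lambda>x. cube_bump z \<rho> x * h x" "cube z \<rho>"])
      show "continuous_on UNIV (\<lambda>x. cube_bump z \<rho> x * h x)"
        by (rule continuous_on_mult[OF smooth_fun_continuous[OF smooth_fun_cube_bump] hc])
    qed (use compact_cube supp in auto)
    have [measurable]: "h \<in> borel_measurable borel" using hc by (rule borel_measurable_continuous_onI)
    show ?thesis
      by (rule integrable_mult_a[of _ B]) (use B in \<open>auto simp: indicator_def less_imp_le\<close>)
  qed
  have small: "\<bar>?I g\<bar> \<le> e * measure \<nu> UNIV" if "e > 0" for e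
  proof -
    obtain q where q: "real_polynomial_function q" "\<And>x. x \<in> cube z \<rho> \<Longrightarrow> \<bar>g x - q x\<bar> < e"
      using Stone_Weierstrass_real_polynomial_function[OF compact_cube continuous_on_subset[OF g subset_UNIV] \<open>e > 0\<close>] by metis
    have qc: "continuous_on UNIV q"
      using q(1) by (intro smooth_fun_continuous smooth_fun_real_polynomial)
    have "?I q = 0"
      by (intro integral_null_slab_test test_fun_mult test_fun_cube_bump \<rho> Z smooth_fun_real_polynomial q(1))
    then have "?I g = ?I g - ?I q" by simp
    also have "\<dots> = (\<integral>x. cube_bump z \<rho> x * g x * indicator Z (x $ i) * a x $ i
        - cube_bump z \<rho> x * q x * indicator Z (x $ i) * a x $ i \<partial>\<nu>)"
      using int[OF g] int[OF qc] by simp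
    also have "\<bar>\<dots>\<bar> \<le> e * measure \<nu> (space \<nu>)"
    proof (rule abs_integral_le_const)
      show "AE x in \<nu>. \<bar>cube_bump z \<rho> x * g x * indicator Z (x $ i) * a x $ i
        - cube_bump z \<rho> x * q x * indicator Z (x $ i) * a x $ i\<bar> \<le> e"
        using a_bound
      proof eventually_elim
        fix x assume "norm (a x) \<le> 1"
        then have "\<bar>a x $ i\<bar> \<le> 1" using component_le_norm_cart[of "a x" i] by linarith
        then have "\<bar>cube_bump z \<rho> x\<bar> * \<bar>g x - q x\<bar> * \<bar>indicator Z (x $ i)\<bar> * \<bar>a x $ i\<bar> \<le> 1 * e * 1 * 1" if "x \<in> cube z \<rho>"
          using q(2)[OF that] \<open>e > 0\<close> cube_bump_nonneg[of z \<rho> x] cube_bump_le_1[of z \<rho> x]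
          by (intro mult_mono mult_nonneg_nonneg) (auto simp: indicator_def)
        then have "\<bar>cube_bump z \<rho> x * (g x - q x) * indicator Z (x $ i) * a x $ i\<bar> \<le> e"
          using supp[of x] \<open>e > 0\<close> by (cases "x \<in> cube z \<rho>") (auto simp: abs_mult)
        then show "\<bar>cube_bump z \<rho> x * g x * indicator Z (x $ i) * a x $ i
           - cube_bump z \<rho> x * q x * indicator Z (x $ i) * a x $ i\<bar> \<le> e" by (simp add: algebra_simps)
      qed
    qed (use \<open>e > 0\<close> in simp)
    finally show ?thesis by simp
  qed
  have "\<bar>?I g\<bar> \<le> 0"
  proof (rule field_le_epsilon)
    fix \<epsilon> :: real assume "\<epsilon> > 0"
    have "\<bar>?I g\<bar> \<le> \<epsilon> / (measure \<nu> UNIV + 1) * measure \<nu> UNIV" using \<open>\<epsilon> > 0\<close>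
      by (intro small divide_pos_pos add_nonneg_pos) auto
    also have "\<dots> \<le> \<epsilon> / (measure \<nu> UNIV + 1) * (measure \<nu> UNIV + 1)"
      using \<open>\<epsilon> > 0\<close> by (intro mult_left_mono) auto
    also have "\<dots> = \<epsilon>" by (simp add: add_nonneg_eq_0_iff)
    finally show "\<bar>?I g\<bar> \<le> 0 + \<epsilon>" by simp
  qed
  then show ?thesis by simp
qed

text \<open>Letting \<open>g\<close> shrink to the indicator of \<open>K\<close> leaves a vanishing
  integral over \<open>K\<close> of a bump times \<open>a x $ i\<close>. Both have constant strict
  sign on \<open>K\<close>, so \<open>K\<close> itself must be null.\<close>

lemma measure_compact_null_projection:
  assumes \<rho>: "\<rho> > 0" "cube z \<rho> \<subseteq> \<Omega>"
    and K: "compact K" "\<And>x j. x \<in> K \<Longrightarrow> \<bar>x $ j - z $ j\<bar> < \<rho>" "\<And>x. x \<in> K \<Longrightarrow> s * a x $ i > 0"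
    and Z: "negligible ((\<lambda>x. x $ i) ` K)"
  shows "emeasure \<nu> K = 0"
proof (cases "K = {}")
  case False
  let ?Z = "(\<lambda>x. x $ i) ` K"
  have Zc: "compact ?Z" by (intro compact_continuous_image K continuous_intros)
  define g where "g m x = max 0 (1 - real m * infdist x K)" for m and x :: "real^'n"
  have gc: "continuous_on UNIV (g m)" for m
    unfolding g_def[abs_def] by (rule continuous_on_infdist_cutoff)
  have gb: "0 \<le> g m t" "g m t \<le> 1" for m t by (auto simp: g_def infdist_nonneg)
  have gl: "(\<lambda>m. g m t) \<longlonglongrightarrow> indicator K t" for t
    unfolding g_def using K(1) False by (intro infdist_cutoff_tendsto compact_imp_closed)
  have [measurable]: "cube_bump z \<rho> \<in> borel_measurable borel"
    by (intro borel_measurable_continuous_onI smooth_fun_continuous smooth_fun_cube_bump)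
  have [measurable]: "g m \<in> borel_measurable borel" for m
    by (intro borel_measurable_continuous_onI gc)
  have [measurable]: "?Z \<in> sets borel" using Zc by (rule borel_compact)
  have [measurable]: "K \<in> sets borel" using K(1) by (rule borel_compact)
  have b: "AE x in \<nu>. norm (cube_bump z \<rho> x * G x * indicator ?Z (x $ i) * a x $ i) \<le> 1"
    if "\<And>x. \<bar>G x\<bar> \<le> 1" for G
    using a_bound
  proof eventually_elim
    fix x assume "norm (a x) \<le> 1"
    then have "\<bar>a x $ i\<bar> \<le> 1" using component_le_norm_cart[of "a x" i] by linarith
    then have "\<bar>cube_bump z \<rho> x\<bar> * \<bar>G x\<bar> * \<bar>indicator ?Z (x $ i)\<bar> * \<bar>a x $ i\<bar> \<le> 1 * 1 * 1 * 1"
      using that cube_bump_nonneg[of z \<rho> x] cube_bump_le_1[of z \<rho> x]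
      by (intro mult_mono mult_nonneg_nonneg) (auto simp: indicator_def)
    then show "norm (cube_bump z \<rho> x * G x * indicator ?Z (x $ i) * a x $ i) \<le> 1" by (simp add: abs_mult)
  qed
  have "(\<lambda>m. \<integral>x. cube_bump z \<rho> x * g m x * indicator ?Z (x $ i) * a x $ i \<partial>\<nu>) \<longlonglongrightarrow>
        (\<integral>x. cube_bump z \<rho> x * indicator K x * indicator ?Z (x $ i) * a x $ i \<partial>\<nu>)"
  proof (rule integral_dominated_convergence[where w="\<lambda>_. 1"])
    show "AE x in \<nu>. norm (cube_bump z \<rho> x * g m x * indicator ?Z (x $ i) * a x $ i) \<le> 1" for m
      by (rule b) (use gb in auto)
  qed (auto intro!: tendsto_intros gl borel_nu)
  then have "(\<integral>x. cube_bump z \<rho> x * indicator K x * indicator ?Z (x $ i) * a x $ i \<partial>\<nu>) = 0"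
    using integral_null_slab_bump[OF \<rho> Zc Z gc] by (simp add: LIMSEQ_const_iff)
  then have z0: "(\<integral>x. s * (cube_bump z \<rho> x * indicator K x * indicator ?Z (x $ i) * a x $ i) \<partial>\<nu>) = 0" by simp
  have nn: "0 \<le> s * (cube_bump z \<rho> x * indicator K x * indicator ?Z (x $ i) * a x $ i)" for x
  proof (cases "x \<in> K")
    case True
    then have "0 \<le> cube_bump z \<rho> x * (s * a x $ i)"
      by (intro mult_nonneg_nonneg[OF cube_bump_nonneg] less_imp_le K(3))
    with True show ?thesis by (simp add: mult.left_commute)
  qed simp
  have "integrable \<nu> (\<lambda>x. cube_bump z \<rho> x * indicator K x * indicator ?Z (x $ i) * a x $ i)"
  proof (rule integrable_const_bound[of _ 1])
    show "AE x in \<nu>. norm (cube_bump z \<rho> x * indicator K x * indicator ?Z (x $ i) * a x $ i) \<le> 1"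
      by (rule b) (auto simp: indicator_def)
  qed (auto intro!: borel_nu)
  then have "AE x in \<nu>. s * (cube_bump z \<rho> x * indicator K x * indicator ?Z (x $ i) * a x $ i) = 0"
    using z0 nn by (subst (asm) integral_nonneg_eq_0_iff_AE) auto
  then have "AE x in \<nu>. x \<notin> K"
  proof eventually_elim
    fix x assume e: "s * (cube_bump z \<rho> x * indicator K x * indicator ?Z (x $ i) * a x $ i) = 0"
    show "x \<notin> K"
    proof
      assume x: "x \<in> K"
      have "cube_bump z \<rho> x > 0" using K(2)[OF x] by (intro cube_bump_pos \<rho>)
      with e x K(3)[OF x] show False by auto
    qed
  qed
  then show ?thesis by (subst (asm) AE_iff_measurable[OF _ refl]) (auto simp: sets_nu)
qed simp

text \<open>The gateway through which every later exceptional set of levels is discarded. The sets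
  of fixed sign of \<open>a x $ i\<close> are only Borel, so inner regularity supplies the compact
  sets, inside open cubes where the bump is positive, and Lindelof's theorem patches countably many
  cubes. \<open>Z\<close> is first enlarged to a Borel null set.\<close>

lemma AE_null_projection:
  assumes Z: "negligible Z" shows "AE x in \<nu>. x \<in> \<Omega> \<longrightarrow> a x $ i \<noteq> 0 \<longrightarrow> x $ i \<notin> Z"
proof -
  obtain Z' where Z': "Z \<subseteq> Z'" "Z' \<in> sets borel" "negligible Z'"
  proof -
    have "Z \<in> null_sets lebesgue" using Z by (simp add: negligible_iff_null_sets)
    then obtain N where "N \<in> null_sets lborel" "Z \<subseteq> N" by (auto simp: null_sets_completion_iff2)
    then show ?thesis using that[of N] by (auto simp: negligible_iff_null_sets null_sets_def)
  qed
  have sgn: "AE x in \<nu>. x \<in> \<Omega> \<longrightarrow> s * a x $ i > 0 \<longrightarrow> x $ i \<notin> Z'" for s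
  proof -
    define S where "S = {x\<in>\<Omega>. s * a x $ i > 0 \<and> x $ i \<in> Z'}"
    have [measurable]: "\<Omega> \<in> sets borel" using open_Omega by simp
    have [measurable]: "Z' \<in> sets borel" by fact
    have S [measurable]: "S \<in> sets borel" unfolding S_def by measurable
    define Q where "Q z \<rho> = {x::real^'n. \<forall>j. \<bar>x $ j - z $ j\<bar> < \<rho>}" for z \<rho>
    have Qo: "open (Q z \<rho>)" for z \<rho>
    proof -
      have "Q z \<rho> = (\<Inter>j. {x. \<bar>x $ j - z $ j\<bar> < \<rho>})" by (auto simp: Q_def)
      then show ?thesis by (auto intro!: open_INT open_Collect_less continuous_intros)
    qed
    have null: "emeasure \<nu> (S \<inter> Q z \<rho>) = 0" if "\<rho> > 0" "cube z \<rho> \<subseteq> \<Omega>" for z \<rho>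
    proof -
      have "emeasure \<nu> (S \<inter> Q z \<rho>) = (SUP K \<in> {K. K \<subseteq> S \<inter> Q z \<rho> \<and> compact K}. emeasure \<nu> K)"
        by (rule inner_regular) (use Qo S in \<open>auto simp: sets_nu emeasure_eq_measure\<close>)
      also have "\<dots> = 0"
      proof (rule antisym[OF SUP_least zero_le], clarify)
        fix K assume K: "K \<subseteq> S \<inter> Q z \<rho>" "compact K"
        have "emeasure \<nu> K = 0"
        proof (rule measure_compact_null_projection[OF that K(2)])
          show "negligible ((\<lambda>x. x $ i) ` K)"
            by (rule negligible_subset[OF Z'(3)]) (use K in \<open>auto simp: S_def\<close>)
        qed (use K in \<open>auto simp: S_def Q_def\<close>)
        then show "emeasure \<nu> K \<le> 0" by simp
      qed
      finally show ?thesis .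
    qed
    have "\<exists>\<rho>>0. cube z \<rho> \<subseteq> \<Omega>" if zO: "z \<in> \<Omega>" for z
    proof -
      obtain e where e: "e > 0" "cball z e \<subseteq> \<Omega>" 
        using bspec[OF open_Omega[unfolded open_contains_cball] zO] by blast
      have "CARD('n) * (e / CARD('n)) = e" by simp
      then have "cube z (e / CARD('n)) \<subseteq> cball z e" using cube_subset_cball[of z "e / CARD('n)"] by simp
      moreover have "e / CARD('n) > 0" using e(1) by simp
      ultimately show ?thesis using e(2) by blast
    qed
    then obtain \<rho> where \<rho>: "\<And>z. z \<in> \<Omega> \<Longrightarrow> \<rho> z > 0" "\<And>z. z \<in> \<Omega> \<Longrightarrow> cube z (\<rho> z) \<subseteq> \<Omega>" by metis
    obtain F where F: "F \<subseteq> (\<lambda>z. Q z (\<rho> z)) ` \<Omega>" "countable F" "\<Union>F = (\<Union>z\<in>\<Omega>. Q z (\<rho> z))"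
      using Lindelof[of "(\<lambda>z. Q z (\<rho> z)) ` \<Omega>"] Qo by auto
    have null_UN: "(\<Union>q\<in>F. S \<inter> q) \<in> null_sets \<nu>"
    proof (rule null_sets_UN'[OF F(2)])
      fix q assume "q \<in> F"
      then obtain z where "z \<in> \<Omega>" "q = Q z (\<rho> z)" using F by blast
      then show "S \<inter> q \<in> null_sets \<nu>" using null[OF \<rho>] Qo by (auto simp: null_sets_def sets_nu)
    qed
    have "z \<in> Q z (\<rho> z)" if "z \<in> \<Omega>" for z using \<rho>(1)[OF that] by (simp add: Q_def)
    then have "S \<subseteq> (\<Union>q\<in>F. S \<inter> q)" using F(3) unfolding S_def by blast
    then have "{x\<in>space \<nu>. \<not> (x \<in> \<Omega> \<longrightarrow> s * a x $ i > 0 \<longrightarrow> x $ i \<notin> Z')} \<subseteq> (\<Union>q\<in>F. S \<inter> q)"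
      unfolding S_def by blast
    with null_UN show ?thesis by (rule AE_I')
  qed
  from sgn[of 1] sgn[of "-1"] show ?thesis
  proof eventually_elim
    case (elim x)
    have "a x $ i > 0 \<or> - 1 * a x $ i > 0" if "a x $ i \<noteq> 0" using that by linarith
    with elim show ?case using Z'(1) by auto
  qed
qed

end

subsection \<open>Covering arguments\<close>

text \<open>Vitali's lemma: the fivefold balls of a disjoint subfamily cover \<open>S\<close>, and
  the hypothesis is summed over that subfamily. As \<open>S\<close> may be nonmeasurable, the
  conclusion speaks of a Borel superset. Depending on which of the two measures is Lebesgue measure,
  this yields a maximal inequality or an upper bound for a measure with small density.\<close>

lemma vitali_compare:
  fixes S :: "'a::euclidean_space set" and \<mu>1 \<mu>2 :: "'a measure"
  assumes sets1: "sets \<mu>1 = sets borel" and sets2: "sets \<mu>2 = sets borel"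
    and r: "\<And>s. s \<in> S \<Longrightarrow> 0 < r s \<and> r s \<le> B"
    and le: "\<And>s. s \<in> S \<Longrightarrow> emeasure \<mu>2 (cball s (5 * r s)) \<le> C * emeasure \<mu>1 (cball s (r s))"
    and U: "U \<in> sets borel" "\<And>s. s \<in> S \<Longrightarrow> cball s (r s) \<subseteq> U"
  shows "\<exists>T\<in>sets borel. S \<subseteq> T \<and> emeasure \<mu>2 T \<le> C * emeasure \<mu>1 U"
proof -
  obtain D where D: "countable D" "D \<subseteq> S"
     "pairwise (\<lambda>i j. disjnt (cball i (r i)) (cball j (r j))) D"
     "S \<subseteq> (\<Union>i\<in>D. cball i (5 * r i))"
    using Vitali_covering_lemma_cballs[of S "\<lambda>i. i" r S B] r by (force simp: less_imp_le)
  \<comment> \<open>Indices outside \<open>N\<close> will receive the empty set, so that finite and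
    infinite \<open>D\<close> are summed alike.\<close>
  define N where "N = to_nat_on D ` D"
  define f where "f = from_nat_into D"
  have f: "f n \<in> D" if "n \<in> N" for n using that D(1) unfolding N_def f_def by auto
  have f_inj: "f n \<noteq> f m" if "n \<in> N" "m \<in> N" "n \<noteq> m" for n m
    using that D(1) unfolding N_def f_def by auto
  have f_surj: "\<exists>n\<in>N. f n = i" if "i \<in> D" for i
    using that D(1) unfolding N_def f_def by (intro bexI[of _ "to_nat_on D i"]) auto
  define X where "X n = (if n \<in> N then cball (f n) (r (f n)) else {})" for n
  define Y where "Y n = (if n \<in> N then cball (f n) (5 * r (f n)) else {})" for n
  have "emeasure \<mu>2 (\<Union>n. Y n) \<le> (\<Sum>n. emeasure \<mu>2 (Y n))"
    by (rule emeasure_subadditive_countably) (auto simp: Y_def sets2)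
  also have "\<dots> \<le> (\<Sum>n. C * emeasure \<mu>1 (X n))"
    by (intro suminf_le) (use le f D(2) in \<open>auto simp: X_def Y_def\<close>)
  also have "\<dots> = C * (\<Sum>n. emeasure \<mu>1 (X n))" by simp
  also have "(\<Sum>n. emeasure \<mu>1 (X n)) = emeasure \<mu>1 (\<Union>n. X n)"
  proof (rule suminf_emeasure)
    show "disjoint_family X"
      using D(3) f f_inj unfolding disjoint_family_on_def pairwise_def X_def disjnt_def
      by (simp split: if_splits)
  qed (auto simp: X_def sets1)
  also have "\<dots> \<le> emeasure \<mu>1 U"
    by (rule emeasure_mono) (use U D(2) f in \<open>auto simp: X_def sets1 split: if_splits\<close>)
  finally have "emeasure \<mu>2 (\<Union>n. Y n) \<le> C * emeasure \<mu>1 U" by (simp add: mult_left_mono)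
  moreover have "S \<subseteq> (\<Union>n. Y n)"
  proof
    fix s assume "s \<in> S"
    then obtain i where "i \<in> D" "s \<in> cball i (5 * r i)" using D(4) by blast
    with f_surj[OF this(1)] show "s \<in> (\<Union>n. Y n)" by (auto simp: Y_def)
  qed
  moreover have "(\<Union>n. Y n) \<in> sets borel" by (auto simp: Y_def)
  ultimately show ?thesis by blast
qed

lemma negligibleI_borel:
  fixes S :: "'a::euclidean_space set"
  assumes "\<And>e. e > 0 \<Longrightarrow> \<exists>T\<in>sets borel. S \<subseteq> T \<and> emeasure lborel T \<le> ennreal e"
  shows "negligible S"
  unfolding negligible_outer_le
proof (intro allI impI)
  fix e :: real assume "e > 0"
  then obtain T where T: "T \<in> sets borel" "S \<subseteq> T" "emeasure lborel T \<le> ennreal e" using assms by blast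
  then have fin: "emeasure lborel T < \<infinity>" by (simp add: le_less_trans)
  have "T \<in> lmeasurable"
    using T(1) fin by (intro fmeasurableI) auto
  moreover have "measure lebesgue T \<le> e"
    using T \<open>e > 0\<close> by (auto simp: measure_def intro: enn2real_leI)
  ultimately show "\<exists>T. S \<subseteq> T \<and> T \<in> lmeasurable \<and> measure lebesgue T \<le> e" using T(2) by blast
qed

text \<open>The Hardy-Littlewood weak-type bound. The constant 10 is the length of the fivefold
  interval divided by the radius; the radii are bounded because \<open>c * d\<close> stays below the
  total mass.\<close>

lemma weak_type:
  fixes m :: "real measure"
  assumes "finite_measure m" and sets_m: "sets m = sets borel" and c: "c > 0"
    and S: "\<And>s. s \<in> S \<Longrightarrow> \<exists>d>0. measure m {s - d..s + d} > c * d"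
  shows "\<exists>T\<in>sets borel. S \<subseteq> T \<and> emeasure lborel T \<le> ennreal (10 / c * measure m (space m))"
proof -
  interpret finite_measure m by fact
  obtain d where d: "\<And>s. s \<in> S \<Longrightarrow> d s > 0 \<and> measure m {s - d s..s + d s} > c * d s"
    using S by metis
  have "\<exists>T\<in>sets borel. S \<subseteq> T \<and> emeasure lborel T \<le> ennreal (10 / c) * emeasure m UNIV"
  proof (rule vitali_compare[where r=d])
    fix s assume s: "s \<in> S"
    have "c * d s \<le> measure m (space m)"
      using d[OF s] bounded_measure[of "{s - d s..s + d s}"] by linarith
    then show "0 < d s \<and> d s \<le> measure m (space m) / c" using d[OF s] c by (simp add: field_simps)
    have "emeasure lborel (cball s (5 * d s)) = ennreal (10 * d s)"
      using d[OF s] by (simp add: cball_eq_atLeastAtMost)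
    also have "\<dots> \<le> ennreal (10 / c * measure m (cball s (d s)))"
      using d[OF s] c by (intro ennreal_leI) (simp add: field_simps cball_eq_atLeastAtMost)
    also have "\<dots> = ennreal (10 / c) * emeasure m (cball s (d s))"
      using c by (subst ennreal_mult) (auto simp: emeasure_eq_measure)
    finally show "emeasure lborel (cball s (5 * d s)) \<le> ennreal (10 / c) * emeasure m (cball s (d s))" .
  qed (auto simp: sets_m)
  moreover have "ennreal (10 / c) * emeasure m UNIV = ennreal (10 / c * measure m (space m))"
    using c sets_eq_imp_space_eq[OF sets_m] by (subst ennreal_mult) (auto simp: emeasure_eq_measure)
  ultimately show ?thesis by simp
qed

lemma negligible_infinite_maximal:
  fixes m :: "real measure"
  assumes "finite_measure m" and sets_m: "sets m = sets borel"
  shows "negligible {s. \<forall>M>0. \<exists>d>0. measure m {s - d..s + d} > M * d}"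
proof (rule negligibleI_borel)
  fix e :: real assume "e > 0"
  \<comment> \<open>The summand 1 keeps \<open>c\<close> positive for the zero measure.\<close>
  define c where "c = 10 * (measure m (space m) + 1) / e"
  have "measure m (space m) + 1 > 0" using measure_nonneg[of m "space m"] by linarith
  then have c: "c > 0" unfolding c_def using \<open>e > 0\<close> by simp
  then have "10 / c * measure m (space m) \<le> e"
    using \<open>e > 0\<close> unfolding c_def by (simp add: field_simps)
  moreover obtain T where "T \<in> sets borel" "{s. \<forall>M>0. \<exists>d>0. measure m {s - d..s + d} > M * d} \<subseteq> T"
    "emeasure lborel T \<le> ennreal (10 / c * measure m (space m))"
    using weak_type[OF assms c, of "{s. \<forall>M>0. \<exists>d>0. measure m {s - d..s + d} > M * d}"] c by blast
  ultimately show "\<exists>T\<in>sets borel. {s. \<forall>M>0. \<exists>d>0. measure m {s - d..s + d} > M * d} \<subseteq> T \<and> emeasure lborel T \<le> ennreal e"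
    by (meson ennreal_leI order_trans)
qed

text \<open>The mass of slabs is compared with their width instead of with another measure, because
  atoms of slices also show up as slab mass of order \<open>d\<close>. The ball may depend on
  \<eta>: this localisation is what allows outer regularity to be used.\<close>

definition zero_slab_density :: "'a::metric_space measure \<Rightarrow> ('a \<Rightarrow> real) \<Rightarrow> 'a \<Rightarrow> bool" where
  "zero_slab_density \<kappa> \<pi> x \<longleftrightarrow> (\<forall>\<eta>>0. \<exists>r>0. \<exists>d0>0. \<forall>d. 0 < d \<and> d < d0 \<longrightarrow>
      measure \<kappa> (ball x r \<inter> {y. \<bar>\<pi> y - \<pi> x\<bar> \<le> d}) \<le> \<eta> * d)"

lemma zero_slab_densityE:
  assumes "zero_slab_density \<kappa> \<pi> x" "\<eta> > 0"
  obtains r d0 where "r > 0" "d0 > 0"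
    "\<And>d. 0 < d \<Longrightarrow> d < d0 \<Longrightarrow> measure \<kappa> (ball x r \<inter> {y. \<bar>\<pi> y - \<pi> x\<bar> \<le> d}) \<le> \<eta> * d"
proof -
  have "\<exists>r>0. \<exists>d0>0. \<forall>d. 0 < d \<and> d < d0 \<longrightarrow> measure \<kappa> (ball x r \<inter> {y. \<bar>\<pi> y - \<pi> x\<bar> \<le> d}) \<le> \<eta> * d"
    using assms by (simp add: zero_slab_density_def)
  then show ?thesis using that by blast
qed

lemma emeasure_density_indicator:
  assumes "A \<in> sets M" "B \<in> sets M"
  shows "emeasure (density M (indicator B)) A = emeasure M (A \<inter> B)"
proof -
  have "emeasure (density M (indicator B)) A = (\<integral>\<^sup>+x. indicator (A \<inter> B) x \<partial>M)"
    using assms by (subst emeasure_density) (simp, simp, rule nn_integral_cong, simp split: split_indicator)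
  then show ?thesis using assms by simp
qed

text \<open>A null set \<open>E\<close> has open neighbourhoods \<open>U\<close> of small
  \<kappa>-measure. At a bad point some ball inside \<open>U\<close> already has too heavy slabs, so
  its projection is a point of large maximal function for the projection of \<kappa> restricted to
  \<open>U\<close>; the weak-type bound makes the set of these levels small.\<close>

lemma negligible_projection_not_zero_slab_density:
  fixes \<kappa> :: "'a::euclidean_space measure"
  assumes "finite_measure \<kappa>" and sets_l: "sets \<kappa> = sets borel"
    and \<pi>: "continuous_on UNIV \<pi>" and E: "E \<in> sets borel" "emeasure \<kappa> E = 0"
  shows "negligible (\<pi> ` {x\<in>E. \<not> zero_slab_density \<kappa> \<pi> x})"
proof -
  interpret finite_measure \<kappa> by fact
  have [measurable]: "\<pi> \<in> borel_measurable borel" using \<pi> by (rule borel_measurable_continuous_onI)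
  have space_l: "space \<kappa> = UNIV" using sets_eq_imp_space_eq[OF sets_l] by simp
  define B where "B \<eta> = {x\<in>E. \<forall>r>0. \<forall>d0>0. \<exists>d. 0 < d \<and> d < d0 \<and>
      measure \<kappa> (ball x r \<inter> {y. \<bar>\<pi> y - \<pi> x\<bar> \<le> d}) > \<eta> * d}" for \<eta>
  have "negligible (\<pi> ` B \<eta>)" if \<eta>: "\<eta> > 0" for \<eta>
  proof (rule negligibleI_borel)
    fix e :: real assume "e > 0"
    have "(INF U \<in> {U. E \<subseteq> U \<and> open U}. emeasure \<kappa> U) = 0"
      using outer_regular[OF sets_l _ E(1)] E(2) by (simp add: emeasure_eq_measure)
    \<comment> \<open>Chosen to cancel the factor \<open>10 / \<eta>\<close> of the weak-type bound
      at level \<eta>.\<close>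
    also have "\<dots> < ennreal (e * \<eta> / 10)" using \<open>e > 0\<close> \<eta> by simp
    finally obtain U where U: "E \<subseteq> U" "open U" "emeasure \<kappa> U < ennreal (e * \<eta> / 10)"
      by (auto simp: INF_less_iff)
    have [measurable]: "U \<in> sets borel" using U by simp
    define m where "m = distr (restrict_space \<kappa> U) borel \<pi>"
    have pm: "\<pi> \<in> measurable (restrict_space \<kappa> U) borel"
      by (intro measurable_restrict_space1) (simp add: measurable_cong_sets[OF sets_l refl])
    have em: "emeasure m A = emeasure \<kappa> (U \<inter> \<pi> -` A)" if [measurable]: "A \<in> sets borel" for A
    proof -
      have "\<pi> -` A \<in> sets borel" using measurable_sets[of \<pi> borel borel A] by simp
      then show ?thesis unfolding m_def
        using U by (subst emeasure_distr[OF pm that])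
          (auto simp: space_restrict_space space_l emeasure_restrict_space sets_l Int_commute intro!: arg_cong[where f="emeasure \<kappa>"])
    qed
    have fm: "finite_measure m"
      by (rule finite_measureI) (use em[of UNIV] in \<open>auto simp: m_def emeasure_eq_measure\<close>)
    have "\<exists>T\<in>sets borel. \<pi> ` B \<eta> \<subseteq> T \<and> emeasure lborel T \<le> ennreal (10 / \<eta> * measure m (space m))"
    proof (rule weak_type[OF fm _ \<eta>])
      fix s assume "s \<in> \<pi> ` B \<eta>"
      then obtain x where x: "x \<in> B \<eta>" "s = \<pi> x" by blast
      then have "x \<in> U" using U unfolding B_def by blast
      then obtain r where r: "r > 0" "ball x r \<subseteq> U" using U(2)[unfolded open_contains_ball] by blast
      then obtain d where d: "d > 0" "measure \<kappa> (ball x r \<inter> {y. \<bar>\<pi> y - \<pi> x\<bar> \<le> d}) > \<eta> * d"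
        using x(1) zero_less_one unfolding B_def by blast
      note d(2)
      also have "measure \<kappa> (ball x r \<inter> {y. \<bar>\<pi> y - \<pi> x\<bar> \<le> d}) \<le> measure \<kappa> (U \<inter> \<pi> -` {s - d..s + d})"
        using r by (intro finite_measure_mono) (auto simp: sets_l x(2) abs_le_iff)
      also have "\<dots> = measure m {s - d..s + d}" by (simp add: measure_def em)
      finally show "\<exists>d>0. measure m {s - d..s + d} > \<eta> * d" using d(1) by blast
    qed (simp add: m_def)
    moreover have "10 / \<eta> * measure m (space m) \<le> e"
    proof -
      have "measure m (space m) = measure \<kappa> U" using em[of UNIV] by (simp add: measure_def m_def)
      also have "\<dots> \<le> e * \<eta> / 10" using U(3) by (simp add: emeasure_eq_measure ennreal_less_iff)
      finally show ?thesis using \<eta> by (simp add: field_simps)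
    qed
    ultimately show "\<exists>T\<in>sets borel. \<pi> ` B \<eta> \<subseteq> T \<and> emeasure lborel T \<le> ennreal e"
      by (meson ennreal_leI order_trans)
  qed
  then have "negligible (\<Union>k. \<pi> ` B (1 / Suc k))" by (intro negligible_countable_Union) auto
  moreover have "\<pi> ` {x\<in>E. \<not> zero_slab_density \<kappa> \<pi> x} \<subseteq> (\<Union>k. \<pi> ` B (1 / Suc k))"
  proof clarify
    fix x assume x: "x \<in> E" "\<not> zero_slab_density \<kappa> \<pi> x"
    then obtain \<eta> where \<eta>0: "\<eta> > 0" and n: "\<not> (\<exists>r>0. \<exists>d0>0. \<forall>d. 0 < d \<and> d < d0 \<longrightarrow>
      measure \<kappa> (ball x r \<inter> {y. \<bar>\<pi> y - \<pi> x\<bar> \<le> d}) \<le> \<eta> * d)"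
      unfolding zero_slab_density_def by blast
    have \<eta>: "\<exists>d. 0 < d \<and> d < d0 \<and> measure \<kappa> (ball x r \<inter> {y. \<bar>\<pi> y - \<pi> x\<bar> \<le> d}) > \<eta> * d"
      if "r > 0" "d0 > 0" for r d0 using n that by (simp add: not_le)
    obtain k where k: "1 / Suc k < \<eta>" using nat_approx_posE[OF \<eta>0] by blast
    have "x \<in> B (1 / Suc k)" unfolding B_def
    proof (clarsimp simp: x(1))
      fix r d0 :: real assume "r > 0" "d0 > 0"
      then obtain d where "0 < d \<and> d < d0 \<and> measure \<kappa> (ball x r \<inter> {y. \<bar>\<pi> y - \<pi> x\<bar> \<le> d}) > \<eta> * d" using \<eta> by blast
      moreover from this k have "1 / Suc k * d \<le> \<eta> * d" by (intro mult_right_mono) auto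
      ultimately show "\<exists>d>0. d < d0 \<and> d / (1 + real k) < measure \<kappa> (ball x r \<inter> {y. \<bar>\<pi> y - \<pi> x\<bar> \<le> d})"
        by (intro exI[of _ d]) auto
    qed
    then show "\<pi> x \<in> (\<Union>k. \<pi> ` B (1 / Suc k))" by blast
  qed
  ultimately show ?thesis using negligible_subset by blast
qed

text \<open>Vitali's comparison with the roles of the measures exchanged: where all small intervals
  have mass below \<open>\<epsilon> * d\<close>, the part in a bounded window has
  \<open>m\<close>-measure of order \<epsilon>. Intersecting over \<epsilon> leaves a null
  set.\<close>

lemma AE_positive_upper_density:
  fixes m :: "real measure"
  assumes "finite_measure m" and sets_m: "sets m = sets borel"
  shows "AE s in m. \<exists>\<epsilon>>0. \<forall>d0>0. \<exists>d. 0 < d \<and> d < d0 \<and> measure m {s - d..s + d} \<ge> \<epsilon> * d"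
proof -
  interpret finite_measure m by fact
  have space_m: "space m = UNIV" using sets_eq_imp_space_eq[OF sets_m] by simp
  define D where "D \<epsilon> = {s. \<exists>d0>0. \<forall>d. 0 < d \<and> d < d0 \<longrightarrow> measure m {s - d..s + d} < \<epsilon> * d}" for \<epsilon>
  have cov: "\<exists>T\<in>sets borel. D \<epsilon> \<inter> {-real R<..<R} \<subseteq> T \<and> emeasure m T \<le> ennreal (5 * \<epsilon> * R)"
    if "\<epsilon> > 0" for \<epsilon> R
  proof -
    have "\<exists>r>0. r \<le> 1 \<and> measure m {s - 5 * r..s + 5 * r} < \<epsilon> * (5 * r) \<and> {s - r..s + r} \<subseteq> {-real R<..<R}"
      if s: "s \<in> D \<epsilon> \<inter> {-real R<..<R}" for s
    proof -
      obtain d0 where d0: "d0 > 0" "\<And>d. 0 < d \<and> d < d0 \<Longrightarrow> measure m {s - d..s + d} < \<epsilon> * d" using s unfolding D_def by blast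
      \<comment> \<open>Keeps \<open>5 * r\<close> below \<open>d0\<close>, since the density bound
        is applied to the fivefold interval, and keeps the interval itself inside the
        window.\<close>
      define r where "r = min 1 (min (d0 / 10) (min ((R - s) / 2) ((R + s) / 2)))"
      have "r > 0" "r \<le> 1" "5 * r < d0" "r < R - s" "r < R + s" using s d0(1) by (auto simp: r_def min_def)
      then show ?thesis using d0(2)[of "5 * r"] by (intro exI[of _ r]) auto
    qed
    then obtain r where r: "\<And>s. s \<in> D \<epsilon> \<inter> {-real R<..<R} \<Longrightarrow> r s > 0 \<and> r s \<le> 1 \<and>
       measure m {s - 5 * r s..s + 5 * r s} < \<epsilon> * (5 * r s) \<and> {s - r s..s + r s} \<subseteq> {-real R<..<R}" by metis
    have "\<exists>T\<in>sets borel. D \<epsilon> \<inter> {-real R<..<R} \<subseteq> T \<and> emeasure m T \<le> ennreal (5 * \<epsilon> / 2) * emeasure lborel {-real R<..<R}"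
    proof (rule vitali_compare[where r=r])
      fix s assume s: "s \<in> D \<epsilon> \<inter> {-real R<..<R}"
      have "emeasure m (cball s (5 * r s)) \<le> ennreal (\<epsilon> * (5 * r s))"
        using r[OF s] by (simp add: cball_eq_atLeastAtMost emeasure_eq_measure ennreal_leI)
      also have "\<dots> = ennreal (5 * \<epsilon> / 2) * emeasure lborel (cball s (r s))"
        using r[OF s] \<open>\<epsilon> > 0\<close> by (simp add: cball_eq_atLeastAtMost flip: ennreal_mult)
      finally show "emeasure m (cball s (5 * r s)) \<le> ennreal (5 * \<epsilon> / 2) * emeasure lborel (cball s (r s))" .
    qed (use r in \<open>auto simp: sets_m cball_eq_atLeastAtMost\<close>)
    moreover have "ennreal (5 * \<epsilon> / 2) * emeasure lborel {-real R<..<R} = ennreal (5 * \<epsilon> * R)"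
      using \<open>\<epsilon> > 0\<close> by (simp flip: ennreal_mult)
    ultimately show ?thesis by simp
  qed
  have "AE s in m. s \<in> {-real R<..<R} \<longrightarrow> s \<notin> (\<Inter>k. D (1 / Suc k))" for R
  proof -
    obtain T where T: "\<And>k. T k \<in> sets borel" "\<And>k. D (1 / Suc k) \<inter> {-real R<..<R} \<subseteq> T k"
      "\<And>k. emeasure m (T k) \<le> ennreal (5 * (1 / Suc k) * R)"
      using cov[of "1 / Suc _" R] by (metis zero_less_divide_1_iff of_nat_0_less_iff zero_less_Suc)
    have "emeasure m (\<Inter>k. T k) \<le> ennreal e" if "e > 0" for e
    proof -
      have pos: "0 < e / (5 * R + 1)" using that by (intro divide_pos_pos) auto
      obtain k where k: "1 / Suc k < e / (5 * R + 1)" using nat_approx_posE[OF pos] by blast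
      have "emeasure m (\<Inter>k. T k) \<le> emeasure m (T k)" by (rule emeasure_mono) (auto simp: T sets_m)
      also have "\<dots> \<le> ennreal (5 * (1 / Suc k) * R)" by (rule T)
      also have "\<dots> \<le> ennreal e"
      proof (rule ennreal_leI)
        have "5 * (1 / Suc k) * R \<le> (5 * R + 1) * (1 / Suc k)" by (simp add: field_simps)
        also have "\<dots> \<le> (5 * R + 1) * (e / (5 * R + 1))" using k by (intro mult_left_mono) auto
        also have "\<dots> = e" by (simp add: add_nonneg_eq_0_iff)
        finally show "5 * (1 / Suc k) * R \<le> e" .
      qed
      finally show ?thesis .
    qed
    then have "emeasure m (\<Inter>k. T k) \<le> 0 + ennreal e" if "0 < e" for e using that by simp
    then have "emeasure m (\<Inter>k. T k) \<le> 0" by (rule ennreal_le_epsilon)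
    then have "(\<Inter>k. T k) \<in> null_sets m" by (auto simp: null_sets_def sets_m T)
    then show ?thesis by (rule AE_I') (use T(2) in blast)
  qed
  then have "AE s in m. \<forall>R. s \<in> {-real R<..<R} \<longrightarrow> s \<notin> (\<Inter>k. D (1 / Suc k))" 
    unfolding AE_all_countable by blast
  then show ?thesis
  proof eventually_elim
    case (elim s)
    obtain R where "\<bar>s\<bar> < real R" using reals_Archimedean2 by blast
    with elim obtain k where k: "s \<notin> D (1 / Suc k)" by (auto simp: abs_less_iff)
    then show ?case unfolding D_def
      by (intro exI[of _ "1 / Suc k"]) (auto simp: not_less, metis not_le)
  qed
qed

subsection \<open>Projections and the Hausdorff measure\<close>

lemma hausdorff1_cover:
  fixes S :: "'a::metric_space set"
  assumes "hausdorff1 S < c" "\<delta> > 0"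
  obtains C where "S \<subseteq> (\<Union>i::nat. C i)" "\<And>i. bounded (C i)" "\<And>i. diameter (C i) \<le> \<delta>"
    "(\<Sum>i. ennreal (diameter (C i))) < c"
proof -
  have "(INF C\<in>{C :: nat \<Rightarrow> 'a set. S \<subseteq> (\<Union>i. C i) \<and>
       (\<forall>i. bounded (C i) \<and> diameter (C i) \<le> \<delta>)}. (\<Sum>i. ennreal (diameter (C i)))) \<le> hausdorff1 S"
    unfolding hausdorff1_def using assms(2) by (intro SUP_upper) auto
  then have "(INF C\<in>{C :: nat \<Rightarrow> 'a set. S \<subseteq> (\<Union>i. C i) \<and>
       (\<forall>i. bounded (C i) \<and> diameter (C i) \<le> \<delta>)}. (\<Sum>i. ennreal (diameter (C i)))) < c"
    using assms(1) by (rule le_less_trans)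
  then show ?thesis using that by (auto simp: INF_less_iff)
qed

text \<open>The interval is centred at the projection of an arbitrary point of \<open>C\<close>, so
  its half-width is the full diameter; this costs the factor 2.\<close>

lemma projection_interval:
  fixes \<pi> :: "'a::metric_space \<Rightarrow> real"
  assumes lip: "\<And>x y. \<bar>\<pi> x - \<pi> y\<bar> \<le> dist x y" and b: "bounded C"
  shows "\<exists>I. I \<in> sets borel \<and> \<pi> ` C \<subseteq> I \<and> emeasure lborel I \<le> 2 * ennreal (diameter C)"
proof (cases "C = {}")
  case True
  then show ?thesis by (intro exI[of _ "{}"]) simp
next
  case False
  then obtain x where x: "x \<in> C" by blast
  show ?thesis
  proof (intro exI[of _ "{\<pi> x - diameter C..\<pi> x + diameter C}"] conjI)
    show "\<pi> ` C \<subseteq> {\<pi> x - diameter C..\<pi> x + diameter C}"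
    proof clarify
      fix y assume "y \<in> C"
      then show "\<pi> y \<in> {\<pi> x - diameter C..\<pi> x + diameter C}"
        using diameter_bounded_bound[OF b x, of y] lip[of x y] by (simp add: abs_le_iff)
    qed
    show "emeasure lborel {\<pi> x - diameter C..\<pi> x + diameter C} \<le> 2 * ennreal (diameter C)"
      using diameter_ge_0[OF b] ennreal_mult[of 2 "diameter C"] by simp
  qed simp
qed

lemma negligible_projection_hausdorff1_null:
  fixes \<pi> :: "'a::metric_space \<Rightarrow> real"
  assumes lip: "\<And>x y. \<bar>\<pi> x - \<pi> y\<bar> \<le> dist x y" and S: "hausdorff1 S = 0"
  shows "negligible (\<pi> ` S)"
proof (rule negligibleI_borel)
  fix e :: real assume "e > 0"
  then have "hausdorff1 S < ennreal (e / 2)" using S by simp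
  then obtain C where C: "S \<subseteq> (\<Union>i::nat. C i)" "\<And>i. bounded (C i)" "\<And>i. diameter (C i) \<le> 1"
    "(\<Sum>i. ennreal (diameter (C i))) < ennreal (e / 2)"
    by (rule hausdorff1_cover[OF _ zero_less_one]) (rule that)
  obtain I where I: "\<And>i. I i \<in> sets borel" "\<And>i. \<pi> ` C i \<subseteq> I i" "\<And>i. emeasure lborel (I i) \<le> 2 * ennreal (diameter (C i))"
    using projection_interval[OF lip C(2)] by metis
  have "emeasure lborel (\<Union>i. I i) \<le> (\<Sum>i. emeasure lborel (I i))"
    by (rule emeasure_subadditive_countably) (use I in auto)
  also have "\<dots> \<le> (\<Sum>i. 2 * ennreal (diameter (C i)))"
    using I(3) by (intro suminf_le) auto
  also have "\<dots> = 2 * (\<Sum>i. ennreal (diameter (C i)))" by simp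
  also have "\<dots> \<le> 2 * ennreal (e / 2)" using C(4) by (intro mult_left_mono) auto
  also have "\<dots> = ennreal e" using \<open>e > 0\<close> by (simp flip: ennreal_numeral ennreal_mult)
  finally have "emeasure lborel (\<Union>i. I i) \<le> ennreal e" .
  moreover have "\<pi> ` S \<subseteq> (\<Union>i. I i)"
    using order_trans[OF image_mono[OF C(1)], of \<pi> "\<Union>i. I i"] I(2) by (simp add: image_UN UN_mono)
  ultimately show "\<exists>T\<in>sets borel. \<pi> ` S \<subseteq> T \<and> emeasure lborel T \<le> ennreal e"
    using I(1) by (intro bexI[of _ "\<Union>i. I i"]) auto
qed

text \<open>Eilenberg's inequality for fibres, with Fatou's lemma in place of the upper integral.\<close>

lemma negligible_infinite_fibres:
  fixes \<pi> :: "'a::metric_space \<Rightarrow> real"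
  assumes lip: "\<And>x y. \<bar>\<pi> x - \<pi> y\<bar> \<le> dist x y" and S: "hausdorff1 S < \<infinity>"
  shows "negligible {t. infinite {x\<in>S. \<pi> x = t}}"
proof -
  obtain B where B: "hausdorff1 S < ennreal B"
  proof -
    obtain h where "hausdorff1 S = ennreal h" "h \<ge> 0" using S by (cases "hausdorff1 S") auto
    then show ?thesis using that[of "h + 1"] by (simp add: ennreal_less_iff)
  qed
  have "\<exists>C I. S \<subseteq> (\<Union>i::nat. C i) \<and> (\<forall>i. bounded (C i)) \<and> (\<forall>i. diameter (C i) \<le> 1 / Suc j) \<and>
    (\<Sum>i. ennreal (diameter (C i))) < ennreal B \<and> (\<forall>i. I i \<in> sets borel \<and> \<pi> ` C i \<subseteq> I i
     \<and> emeasure lborel (I i) \<le> 2 * ennreal (diameter (C i)))" for j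
  proof -
    obtain C where C: "S \<subseteq> (\<Union>i::nat. C i)" "\<And>i. bounded (C i)" "\<And>i. diameter (C i) \<le> 1 / Suc j"
      "(\<Sum>i. ennreal (diameter (C i))) < ennreal B"
      by (rule hausdorff1_cover[OF B, of "1 / Suc j"]) (simp, rule that)
    obtain I where "\<And>i. I i \<in> sets borel" "\<And>i. \<pi> ` C i \<subseteq> I i" "\<And>i. emeasure lborel (I i) \<le> 2 * ennreal (diameter (C i))"
      using projection_interval[OF lip C(2)] by metis
    note I = this
    show ?thesis by (intro exI[of _ C] exI[of _ I] conjI allI C I)
  qed
  then obtain C I where C: "\<And>j. S \<subseteq> (\<Union>i::nat. C j i)" "\<And>j i. bounded (C j i)" "\<And>j i. diameter (C j i) \<le> 1 / Suc j"
      "\<And>j. (\<Sum>i. ennreal (diameter (C j i))) < ennreal B"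
    and I: "\<And>j i. I j i \<in> sets borel" "\<And>j i. \<pi> ` C j i \<subseteq> I j i" "\<And>j i. emeasure lborel (I j i) \<le> 2 * ennreal (diameter (C j i))"
    by metis
  \<comment> \<open>Counts the sets of the \<open>j\<close>-th covering whose projection interval
    contains \<open>t\<close>. Its integral is at most \<open>2 * B\<close>, uniformly in
    \<open>j\<close>, which is what Fatou's lemma needs.\<close>
  define g :: "nat \<Rightarrow> real \<Rightarrow> ennreal" where "g j t = (\<Sum>i. indicator (I j i) t)" for j t
  have [measurable]: "g j \<in> borel_measurable lborel" for j
    unfolding g_def[abs_def] using I(1) by measurable
  have gint: "(\<integral>\<^sup>+t. g j t \<partial>lborel) \<le> 2 * ennreal B" for j
  proof -
    have "(\<integral>\<^sup>+t. g j t \<partial>lborel) = (\<Sum>i. emeasure lborel (I j i))"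
      unfolding g_def using I(1) by (subst nn_integral_suminf) auto
    also have "\<dots> \<le> (\<Sum>i. 2 * ennreal (diameter (C j i)))"
      using I(3) by (intro suminf_le) auto
    also have "\<dots> = 2 * (\<Sum>i. ennreal (diameter (C j i)))" by simp
    also have "\<dots> \<le> 2 * ennreal B" using C(4)[of j] by (intro mult_left_mono) auto
    finally show ?thesis .
  qed
  have "(\<integral>\<^sup>+t. liminf (\<lambda>j. g j t) \<partial>lborel) \<le> liminf (\<lambda>j. \<integral>\<^sup>+t. g j t \<partial>lborel)"
    by (rule nn_integral_liminf) auto
  also have "\<dots> \<le> 2 * ennreal B"
    using gint by (intro Liminf_le) auto
  also have "\<dots> < \<infinity>" by (simp add: ennreal_mult_less_top)
  finally have "AE t in lborel. liminf (\<lambda>j. g j t) \<noteq> \<infinity>"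
    by (intro nn_integral_PInf_AE) auto
  moreover have "finite {x\<in>S. \<pi> x = t}" if "liminf (\<lambda>j. g j t) \<noteq> \<infinity>" for t
  proof (rule ccontr)
    assume inf: "infinite {x\<in>S. \<pi> x = t}"
    have "of_nat N \<le> liminf (\<lambda>j. g j t)" for N
    proof (rule Liminf_bounded)
      obtain P where P: "finite P" "card P = N" "P \<subseteq> {x\<in>S. \<pi> x = t}"
        using infinite_arbitrarily_large[OF inf] by blast
      \<comment> \<open>Once the diameters drop below the least mutual distance of \<open>N\<close>
        points of the fibre, these points lie in \<open>N\<close> different covering sets, so the
        count is at least \<open>N\<close>. The extra element 1 keeps the minimum defined when there
        are no pairs.\<close>
      obtain \<delta> where \<delta>: "\<delta> > 0" "\<And>x y. x \<in> P \<Longrightarrow> y \<in> P \<Longrightarrow> x \<noteq> y \<Longrightarrow> \<delta> \<le> dist x y"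
      proof -
        let ?D = "(\<lambda>(x, y). dist x y) ` ({(x, y). x \<in> P \<and> y \<in> P \<and> x \<noteq> y})"
        have "finite ?D" using finite_subset[of "{(x, y). x \<in> P \<and> y \<in> P \<and> x \<noteq> y}" "P \<times> P"] P(1) by auto
        then have "Min (insert 1 ?D) > 0" "\<And>x y. x \<in> P \<Longrightarrow> y \<in> P \<Longrightarrow> x \<noteq> y \<Longrightarrow> Min (insert 1 ?D) \<le> dist x y"
          by (auto intro!: Min_le)
        then show ?thesis by (rule that)
      qed
      obtain J where J: "1 / Suc J < \<delta>" using nat_approx_posE[OF \<delta>(1)] by blast
      show "\<forall>\<^sub>F j in sequentially. of_nat N \<le> g j t"
        using eventually_ge_at_top[of J]
      proof eventually_elim
        fix j assume "J \<le> j"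
        then have "1 / Suc j \<le> 1 / Suc J" by (intro divide_left_mono) auto
        then have j: "1 / Suc j < \<delta>" using J by simp
        have "\<forall>x\<in>P. \<exists>i. x \<in> C j i" using P(3) C(1)[of j] by blast
        then obtain h where h: "\<And>x. x \<in> P \<Longrightarrow> x \<in> C j (h x)" by metis
        have "inj_on h P"
        proof (rule inj_onI, rule ccontr)
          fix x y assume xy: "x \<in> P" "y \<in> P" "h x = h y" "x \<noteq> y"
          then have "dist x y \<le> diameter (C j (h x))"
            using h[OF xy(1)] h[OF xy(2)] by (intro diameter_bounded_bound C(2)) simp_all
          then show False using C(3)[of j "h x"] j \<delta>(2)[OF xy(1,2,4)] by linarith
        qed
        then have "of_nat N = (\<Sum>i\<in>h ` P. 1 :: ennreal)" using P(2) by (simp add: card_image)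
        also have "\<dots> \<le> (\<Sum>i\<in>h ` P. indicator (I j i) t)"
        proof (rule sum_mono)
          fix i assume "i \<in> h ` P"
          then obtain x where "x \<in> P" "i = h x" by blast
          then have "t \<in> I j i" using h[of x] I(2)[of j i] P(3) by fast
          then show "(1::ennreal) \<le> indicator (I j i) t" by simp
        qed
        also have "\<dots> \<le> g j t" unfolding g_def
          by (rule sum_le_suminf) (auto simp: P(1))
        finally show "of_nat N \<le> g j t" .
      qed
    qed
    then have "liminf (\<lambda>j. g j t) = \<infinity>"
      by (metis ennreal_SUP_of_nat_eq_top SUP_least infinity_ennreal_def top_unique)
    with that show False by simp
  qed
  ultimately have "AE t in lborel. t \<notin> {t. infinite {x\<in>S. \<pi> x = t}}" by (auto elim!: eventually_mono)
  then obtain N where "{t. infinite {x\<in>S. \<pi> x = t}} \<subseteq> N" "N \<in> null_sets lborel"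
    by (auto elim!: AE_E simp: null_sets_def)
  then show ?thesis
    by (meson negligible_iff_null_sets negligible_subset null_sets_completionI)
qed

subsection \<open>Slices of a divergence-free measure\<close>

text \<open>McShane's infimum of cones. The data are indexed by \<open>x\<close> instead of being a
  function of \<open>p x\<close>; the hypothesis already makes values at equal \<open>p x\<close>
  agree.\<close>

lemma mcshane_extension:
  fixes p q :: "'b \<Rightarrow> real"
  assumes L: "L \<ge> 0" and le: "\<And>x y. x \<in> P \<Longrightarrow> y \<in> P \<Longrightarrow> \<bar>q x - q y\<bar> \<le> L * \<bar>p x - p y\<bar>"
  shows "\<exists>f. L-lipschitz_on UNIV f \<and> (\<forall>x\<in>P. f (p x) = q x)"
proof (cases "P = {}")
  case True
  then show ?thesis using lipschitz_on_constant[of UNIV 0] lipschitz_on_le[of 0 UNIV "\<lambda>_. 0" L] L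
    by (intro exI[of _ "\<lambda>_. 0"]) auto
next
  case False
  then obtain x0 where x0: "x0 \<in> P" by blast
  define f where "f t = (INF x\<in>P. q x + L * \<bar>t - p x\<bar>)" for t
  have bdd: "bdd_below ((\<lambda>x. q x + L * \<bar>t - p x\<bar>) ` P)" for t
  proof (rule bdd_belowI2)
    fix x assume x: "x \<in> P"
    have "L * \<bar>p x0 - p x\<bar> \<le> L * (\<bar>t - p x0\<bar> + \<bar>t - p x\<bar>)" using L by (intro mult_left_mono) auto
    then show "q x0 - L * \<bar>t - p x0\<bar> \<le> q x + L * \<bar>t - p x\<bar>"
      using le[OF x0 x] by (simp add: algebra_simps)
  qed
  have ext: "f (p x) = q x" if x: "x \<in> P" for x
  proof (rule antisym)
    show "f (p x) \<le> q x" unfolding f_def using cINF_lower[OF bdd x, of "p x"] by simp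
    show "q x \<le> f (p x)" unfolding f_def
    proof (rule cINF_greatest[OF False])
      fix y assume "y \<in> P"
      then show "q x \<le> q y + L * \<bar>p x - p y\<bar>" using le[OF x, of y] by linarith
    qed
  qed
  have half: "f s \<le> f t + L * \<bar>s - t\<bar>" for s t
  proof -
    have "f s - L * \<bar>s - t\<bar> \<le> (INF x\<in>P. q x + L * \<bar>t - p x\<bar>)"
    proof (rule cINF_greatest[OF False])
      fix x assume "x \<in> P"
      then have "f s \<le> q x + L * \<bar>s - p x\<bar>" unfolding f_def using cINF_lower[OF bdd] by fast
      moreover have "L * \<bar>s - p x\<bar> \<le> L * (\<bar>t - p x\<bar> + \<bar>s - t\<bar>)" using L by (intro mult_left_mono) auto
      ultimately show "f s - L * \<bar>s - t\<bar> \<le> q x + L * \<bar>t - p x\<bar>" by (simp add: algebra_simps)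
    qed
    then show ?thesis by (simp add: f_def)
  qed
  have "L-lipschitz_on UNIV f"
  proof (rule lipschitz_onI[OF _ L])
    fix s t show "dist (f s) (f t) \<le> L * dist s t"
      using half[of s t] half[of t s] by (simp add: dist_real_def abs_le_iff abs_minus_commute[of t s])
  qed
  with ext show ?thesis by blast
qed

text \<open>The coordinates are extended separately, but the \<open>i\<close>-th one is set equal to
  the parameter, so that the curve is an exact graph over that coordinate on the whole line.\<close>

lemma lipschitz_graph_cover:
  fixes P :: "(real^'n) set"
  assumes L: "L \<ge> 0" and le: "\<And>x y. x \<in> P \<Longrightarrow> y \<in> P \<Longrightarrow> norm (x - y) \<le> L * \<bar>x $ i - y $ i\<bar>"
  shows "\<exists>\<gamma> L'. L'-lipschitz_on UNIV \<gamma> \<and> (\<forall>t. \<gamma> t $ i = t) \<and> P \<subseteq> range \<gamma>"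
proof -
  have "\<exists>f. L-lipschitz_on UNIV f \<and> (\<forall>x\<in>P. f (x $ i) = x $ j)" for j
  proof (rule mcshane_extension[OF L])
    fix x y assume "x \<in> P" "y \<in> P"
    then show "\<bar>x $ j - y $ j\<bar> \<le> L * \<bar>x $ i - y $ i\<bar>"
      using le[of x y] component_le_norm_cart[of "x - y" j] by simp
  qed
  then obtain f where f: "\<And>j. L-lipschitz_on UNIV (f j)" "\<And>j x. x \<in> P \<Longrightarrow> f j (x $ i) = x $ j" by metis
  define \<gamma> where "\<gamma> t = (\<chi> j. if j = i then t else f j t)" for t
  have "(CARD('n) * (L + 1))-lipschitz_on UNIV \<gamma>"
  proof (rule lipschitz_onI)
    fix s t :: real
    have "dist (\<gamma> s) (\<gamma> t) \<le> (\<Sum>j\<in>UNIV. \<bar>(\<gamma> s - \<gamma> t) $ j\<bar>)" unfolding dist_norm by (rule norm_le_l1_cart)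
    also have "\<dots> \<le> (\<Sum>j\<in>(UNIV::'n set). (L + 1) * \<bar>s - t\<bar>)"
    proof (rule sum_mono)
      fix j
      have "\<bar>f j s - f j t\<bar> \<le> L * \<bar>s - t\<bar>" using lipschitz_onD[OF f(1)[of j], of s t] by (simp add: dist_real_def)
      then show "\<bar>(\<gamma> s - \<gamma> t) $ j\<bar> \<le> (L + 1) * \<bar>s - t\<bar>" using L by (auto simp: \<gamma>_def algebra_simps)
    qed
    finally show "dist (\<gamma> s) (\<gamma> t) \<le> CARD('n) * (L + 1) * dist s t" by (simp add: dist_real_def)
  qed (use L in simp)
  moreover have "P \<subseteq> range \<gamma>"
  proof
    fix x assume "x \<in> P"
    then have "x = \<gamma> (x $ i)" using f(2) by (simp add: \<gamma>_def vec_eq_iff)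
    then show "x \<in> range \<gamma>" by blast
  qed
  ultimately show ?thesis by (intro exI[of _ \<gamma>]) (auto simp: \<gamma>_def)
qed

text \<open>Upper semicontinuity of fibres: on the compact set \<open>K - V\<close> the distance of
  \<pi> from \<open>s\<close> attains a positive minimum.\<close>

lemma slab_shrink:
  fixes K :: "'a::metric_space set" and \<pi> :: "'a \<Rightarrow> real"
  assumes "compact K" "continuous_on K \<pi>" "open V" "\<And>y. y \<in> K \<Longrightarrow> \<pi> y = s \<Longrightarrow> y \<in> V"
  shows "\<exists>d0>0. \<forall>y\<in>K. \<bar>\<pi> y - s\<bar> < d0 \<longrightarrow> y \<in> V"
proof (cases "K - V = {}")
  case False
  have "compact (K - V)" using assms by (simp add: compact_diff)
  moreover have "continuous_on (K - V) (\<lambda>y. \<bar>\<pi> y - s\<bar>)"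
    by (intro continuous_intros continuous_on_subset[OF assms(2)]) auto
  ultimately obtain y where y: "y \<in> K - V" "\<And>z. z \<in> K - V \<Longrightarrow> \<bar>\<pi> y - s\<bar> \<le> \<bar>\<pi> z - s\<bar>"
    using continuous_attains_inf[of "K - V" "\<lambda>y. \<bar>\<pi> y - s\<bar>"] False by blast
  have "\<bar>\<pi> y - s\<bar> > 0" using y(1) assms(4) by auto
  then show ?thesis using y(2) by (intro exI[of _ "\<bar>\<pi> y - s\<bar>"]) force
qed (auto intro!: exI[of _ 1])

text \<open>Left unnormalised, with height 1, so that integrals against it are directly comparable
  with masses of slabs of width of order \<delta>.\<close>

definition tent :: "real \<Rightarrow> real \<Rightarrow> real \<Rightarrow> real" where
  "tent \<delta> s t = max 0 (1 - \<bar>t - s\<bar> / \<delta>)"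

lemma tent_bounds: "0 \<le> tent \<delta> s t" "\<delta> > 0 \<Longrightarrow> tent \<delta> s t \<le> 1" "\<delta> > 0 \<Longrightarrow> \<bar>t - s\<bar> \<ge> \<delta> \<Longrightarrow> tent \<delta> s t = 0"
  and tent_half: "\<delta> > 0 \<Longrightarrow> \<bar>t - s\<bar> \<le> \<delta> / 2 \<Longrightarrow> tent \<delta> s t \<ge> 1 / 2"
  by (auto simp: tent_def field_simps max_def)

lemma continuous_on_tent: "continuous_on UNIV (tent \<delta> s)"
  unfolding tent_def[abs_def] by (cases "\<delta> = 0") (auto intro!: continuous_intros)

text \<open>Both tents have the same integral, so an antiderivative of the difference can vanish on
  both sides of the two supports, and it never exceeds the integral of a single tent. The bound
  therefore does not grow with the distance of \<open>s\<close> and \<open>t\<close>.\<close>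

lemma tent_difference_antiderivative:
  assumes "\<delta> > 0"
  obtains \<Psi> where "\<And>u. (\<Psi> has_real_derivative tent \<delta> s u - tent \<delta> t u) (at u)"
    "\<And>u. \<bar>\<Psi> u\<bar> \<le> 2 * \<delta>" "\<And>u. \<bar>u - s\<bar> > \<bar>s - t\<bar> + \<delta> \<Longrightarrow> \<Psi> u = 0"
proof -
  obtain \<Theta> where \<Theta>: "\<And>u. (\<Theta> has_real_derivative tent \<delta> 0 u) (at u)"
    using continuous_antiderivative[OF continuous_on_tent] by blast
  have mvt: "\<exists>z. u < z \<and> z < v \<and> \<Theta> v - \<Theta> u = (v - u) * tent \<delta> 0 z" if "u < v" for u v
    using MVT2[OF that, of \<Theta> "tent \<delta> 0"] \<Theta> by blast
  have mono: "\<Theta> u \<le> \<Theta> v" if "u \<le> v" for u v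
  proof (cases "u = v")
    case False
    then obtain z where "\<Theta> v - \<Theta> u = (v - u) * tent \<delta> 0 z" using mvt[of u v] \<open>u \<le> v\<close> by auto
    moreover have "0 \<le> (v - u) * tent \<delta> 0 z" using \<open>u \<le> v\<close> by (intro mult_nonneg_nonneg tent_bounds) auto
    ultimately show ?thesis by linarith
  qed simp
  have right: "\<Theta> u = \<Theta> \<delta>" if "u \<ge> \<delta>" for u
    using mvt[of \<delta> u] that tent_bounds(3)[OF assms, of _ 0] assms by (cases "u = \<delta>") auto
  have left: "\<Theta> u = \<Theta> (-\<delta>)" if "u \<le> -\<delta>" for u
    using mvt[of u "-\<delta>"] that tent_bounds(3)[OF assms, of _ 0] assms by (cases "u = -\<delta>") auto
  have tot: "\<Theta> \<delta> - \<Theta> (-\<delta>) \<le> 2 * \<delta>"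
  proof -
    obtain z where "\<Theta> \<delta> - \<Theta> (-\<delta>) = (\<delta> - (-\<delta>)) * tent \<delta> 0 z" using mvt[of "-\<delta>" \<delta>] assms by auto
    moreover have "(\<delta> - (-\<delta>)) * tent \<delta> 0 z \<le> (\<delta> - (-\<delta>)) * 1"
      using assms tent_bounds(2) by (intro mult_left_mono) auto
    ultimately show ?thesis by simp
  qed
  have range: "\<Theta> (-\<delta>) \<le> \<Theta> u" "\<Theta> u \<le> \<Theta> \<delta>" for u
    using mono[of "-\<delta>" u] mono[of u \<delta>] left[of u] right[of u] by (force simp: not_le)+
  show ?thesis
  proof (rule that[of "\<lambda>u. \<Theta> (u - s) - \<Theta> (u - t)"])
    fix u
    have sh: "((\<lambda>u. \<Theta> (u - c)) has_real_derivative tent \<delta> c u) (at u)" for c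
    proof -
      have "((\<lambda>u. u - c) has_real_derivative 1) (at u)" by (auto intro!: derivative_eq_intros)
      from DERIV_chain2[OF \<Theta> this] show ?thesis by (simp add: tent_def)
    qed
    show "((\<lambda>u. \<Theta> (u - s) - \<Theta> (u - t)) has_real_derivative tent \<delta> s u - tent \<delta> t u) (at u)"
      by (intro DERIV_diff sh)
    show "\<bar>\<Theta> (u - s) - \<Theta> (u - t)\<bar> \<le> 2 * \<delta>" using range[of "u - s"] range[of "u - t"] tot by linarith
    assume "\<bar>u - s\<bar> > \<bar>s - t\<bar> + \<delta>"
    then have "u - s \<ge> \<delta> \<and> u - t \<ge> \<delta> \<or> u - s \<le> -\<delta> \<and> u - t \<le> -\<delta>" by (auto simp: abs_real_def split: if_splits)
    then show "\<Theta> (u - s) - \<Theta> (u - t) = 0" using left right by (metis cancel_comm_monoid_add_class.diff_cancel)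
  qed
qed

lemma measure_density_indicator:
  assumes "A \<in> sets M" "B \<in> sets M"
  shows "measure (density M (indicator B)) A = measure M (A \<inter> B)"
  using emeasure_density_indicator[OF assms] by (simp add: measure_def)

lemma (in finite_measure) finite_measure_density_indicator:
  assumes "B \<in> sets M" shows "finite_measure (density M (indicator B))"
  by (rule finite_measureI) (use emeasure_density_indicator[OF sets.top assms] in simp)

section \<open>Variation, finiteness and atoms of slices\<close>

context divfree
begin

text \<open>The BV property of slices in the metric sense: after division by \<delta>, the change of
  the slice tested with a function of slope of order \<open>1 / \<rho>\<close> is at most that slope
  times the mass of the slab containing both levels.\<close>

lemma slice_difference:
  obtains L where "L > 0"
    "\<And>x \<rho> \<delta> s t i. \<rho> > 0 \<Longrightarrow> cube x \<rho> \<subseteq> \<Omega> \<Longrightarrow> \<delta> > 0 \<Longrightarrow>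
      \<bar>(\<integral>y. cube_bump x \<rho> y * tent \<delta> s (y $ i) * a y $ i \<partial>\<nu>) - (\<integral>y. cube_bump x \<rho> y * tent \<delta> t (y $ i) * a y $ i \<partial>\<nu>)\<bar>
       \<le> 2 * \<delta> * (L / \<rho>) * measure \<nu> {y. \<bar>y $ i - s\<bar> \<le> \<bar>s - t\<bar> + \<delta>}"
proof -
  obtain L where L: "L > 0" "\<And>(z::real^'n) \<rho> x i. \<rho> > 0 \<Longrightarrow> \<bar>partial_deriv i (cube_bump z \<rho>) x\<bar> \<le> L / \<rho>"
    using cube_bump_partial_bound by blast
  have gr: "norm (grad (cube_bump z \<rho>) x) \<le> CARD('n) * L / \<rho>" if "\<rho> > 0" for z x :: "real^'n" and \<rho>
  proof -
    have "norm (grad (cube_bump z \<rho>) x) \<le> (\<Sum>j\<in>UNIV. \<bar>grad (cube_bump z \<rho>) x $ j\<bar>)" by (rule norm_le_l1_cart)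
    also have "\<dots> \<le> (\<Sum>j\<in>(UNIV::'n set). L / \<rho>)" using L(2)[OF that] by (intro sum_mono) (simp add: grad_def)
    finally show ?thesis by simp
  qed
  show ?thesis
  proof (rule that[of "CARD('n) * L"])
    fix x :: "real^'n" and \<rho> \<delta> s t :: real and i :: 'n assume \<rho>: "\<rho> > 0" "cube x \<rho> \<subseteq> \<Omega>" and \<delta>: "\<delta> > (0::real)"
    obtain \<Psi> where \<Psi>: "\<And>u. (\<Psi> has_real_derivative tent \<delta> s u - tent \<delta> t u) (at u)"
      "\<And>u. \<bar>\<Psi> u\<bar> \<le> 2 * \<delta>" "\<And>u. \<bar>u - s\<bar> > \<bar>s - t\<bar> + \<delta> \<Longrightarrow> \<Psi> u = 0"
      using tent_difference_antiderivative[OF \<delta>] by blast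
    have \<Psi>c: "continuous_on UNIV \<Psi>"
      by (rule DERIV_continuous_on) (use \<Psi>(1) in \<open>auto intro: has_field_derivative_at_within\<close>)
    let ?\<phi> = "cube_bump x \<rho>"
    have test: "test_fun \<Omega> ?\<phi>" by (rule test_fun_cube_bump[OF \<rho>])
    have tc: "continuous_on UNIV (\<lambda>u. tent \<delta> s u - tent \<delta> t u)"
      by (intro continuous_on_diff continuous_on_tent)
    note int = by_parts_integrable(1)[OF test continuous_on_tent continuous_on_tent]
    let ?S = "{y. \<bar>y $ i - s\<bar> \<le> \<bar>s - t\<bar> + \<delta>}"
    have S [measurable]: "?S \<in> sets borel" by measurable
    have "(\<integral>y. ?\<phi> y * tent \<delta> s (y $ i) * a y $ i \<partial>\<nu>) - (\<integral>y. ?\<phi> y * tent \<delta> t (y $ i) * a y $ i \<partial>\<nu>)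
        = (\<integral>y. ?\<phi> y * (tent \<delta> s (y $ i) - tent \<delta> t (y $ i)) * a y $ i \<partial>\<nu>)"
      using int by (subst Bochner_Integration.integral_diff[symmetric]) (auto simp: algebra_simps)
    also have "\<dots> = - (\<integral>y. \<Psi> (y $ i) * (grad ?\<phi> y \<bullet> a y) \<partial>\<nu>)"
      by (rule by_parts[OF test tc \<Psi>(1)])
    also have "\<bar>\<dots>\<bar> \<le> (\<integral>y. \<bar>\<Psi> (y $ i) * (grad ?\<phi> y \<bullet> a y)\<bar> \<partial>\<nu>)"
      by (simp add: integral_abs_bound)
    also have "\<dots> \<le> (\<integral>y. 2 * \<delta> * (CARD('n) * L / \<rho>) * indicator ?S y \<partial>\<nu>)"
    proof (rule integral_mono_AE)
      show "AE y in \<nu>. \<bar>\<Psi> (y $ i) * (grad ?\<phi> y \<bullet> a y)\<bar> \<le> 2 * \<delta> * (CARD('n) * L / \<rho>) * indicator ?S y"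
        using a_bound
      proof eventually_elim
        fix y assume a1: "norm (a y) \<le> 1"
        have "norm (grad ?\<phi> y) * norm (a y) \<le> (CARD('n) * L / \<rho>) * 1"
          using gr[OF \<rho>(1), of x y] a1 L(1) \<rho>(1) by (intro mult_mono) auto
        then have "\<bar>grad ?\<phi> y \<bullet> a y\<bar> \<le> CARD('n) * L / \<rho>"
          using Cauchy_Schwarz_ineq2[of "grad ?\<phi> y" "a y"] by simp
        then have "\<bar>\<Psi> (y $ i)\<bar> * \<bar>grad ?\<phi> y \<bullet> a y\<bar> \<le> 2 * \<delta> * (CARD('n) * L / \<rho>)"
          using \<Psi>(2)[of "y $ i"] \<delta> by (intro mult_mono) auto
        then show "\<bar>\<Psi> (y $ i) * (grad ?\<phi> y \<bullet> a y)\<bar> \<le> 2 * \<delta> * (CARD('n) * L / \<rho>) * indicator ?S y"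
          using \<Psi>(3)[of "y $ i"] by (cases "y \<in> ?S") (auto simp: abs_mult)
      qed
      show "integrable \<nu> (\<lambda>y. \<bar>\<Psi> (y $ i) * (grad ?\<phi> y \<bullet> a y)\<bar>)"
        by (intro integrable_abs by_parts_integrable(2)[OF test continuous_on_tent \<Psi>c])
      show "integrable \<nu> (\<lambda>y. 2 * \<delta> * (CARD('n) * L / \<rho>) * indicator ?S y)"
        by (intro integrable_mult_right integrable_real_indicator) (auto simp: sets_nu emeasure_eq_measure)
    qed
    also have "\<dots> = 2 * \<delta> * (CARD('n) * L / \<rho>) * measure \<nu> ?S"
      by (simp add: sets_nu)
    finally show "\<bar>(\<integral>y. ?\<phi> y * tent \<delta> s (y $ i) * a y $ i \<partial>\<nu>) - (\<integral>y. ?\<phi> y * tent \<delta> t (y $ i) * a y $ i \<partial>\<nu>)\<bar>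
       \<le> 2 * \<delta> * (CARD('n) * L / \<rho>) * measure \<nu> ?S" .
  qed (use L in simp)
qed

lemma AE_finite_fibres:
  assumes "K \<subseteq> \<Omega>" "hausdorff1 K < \<infinity>" "\<And>x. x \<in> K \<Longrightarrow> a x $ i \<noteq> 0"
  shows "AE x in \<nu>. x \<in> K \<longrightarrow> finite {y\<in>K. y $ i = x $ i}"
proof -
  have "negligible {t. infinite {x\<in>K. x $ i = t}}"
    by (rule negligible_infinite_fibres[OF _ assms(2)]) (metis dist_vec_nth_le dist_real_def)
  from AE_null_projection[OF this, of i] show ?thesis
    by eventually_elim (use assms in auto)
qed

lemma AE_slab_bound:
  shows "AE x in \<nu>. x \<in> \<Omega> \<longrightarrow> a x $ i \<noteq> 0 \<longrightarrow> (\<exists>M>0. \<forall>d>0. measure \<nu> {y. \<bar>y $ i - x $ i\<bar> \<le> d} \<le> M * d)"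
proof -
  let ?m = "distr \<nu> borel (\<lambda>y. y $ i)"
  have meas: "(\<lambda>y. y $ i) \<in> measurable \<nu> borel" by measurable
  have "negligible {s. \<forall>M>0. \<exists>d>0. measure ?m {s - d..s + d} > M * d}"
    by (rule negligible_infinite_maximal) (auto intro!: finite_measure_distr finite_measure_axioms meas)
  from AE_null_projection[OF this, of i] show ?thesis
  proof eventually_elim
    case (elim x)
    have "{y. \<bar>y $ i - x $ i\<bar> \<le> d} = (\<lambda>y. y $ i) -` {x $ i - d..x $ i + d} \<inter> space \<nu>" for d
      by (auto simp: abs_le_iff)
    then have "measure ?m {x $ i - d..x $ i + d} = measure \<nu> {y. \<bar>y $ i - x $ i\<bar> \<le> d}" for d
      by (simp add: measure_distr[OF meas])
    with elim show ?case by (simp add: not_less) (metis not_le)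
  qed
qed

lemma AE_zero_slab_density:
  assumes E: "E \<in> sets borel" "E \<subseteq> \<Omega>" "\<And>x. x \<in> E \<Longrightarrow> a x $ i \<noteq> 0"
  shows "AE x in \<nu>. x \<in> E \<longrightarrow> zero_slab_density (density \<nu> (indicator (- E))) (\<lambda>y. y $ i) x"
proof -
  have "negligible ((\<lambda>y. y $ i) ` {x\<in>E. \<not> zero_slab_density (density \<nu> (indicator (- E))) (\<lambda>y. y $ i) x})"
  proof (rule negligible_projection_not_zero_slab_density)
    show "emeasure (density \<nu> (indicator (- E))) E = 0"
      using E(1) by (subst emeasure_density_indicator) (auto simp: sets_nu)
  qed (use E(1) in \<open>auto intro!: finite_measure_density_indicator continuous_intros simp: sets_nu\<close>)
  from AE_null_projection[OF this, of i] show ?thesis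
    by eventually_elim (use E in auto)
qed

text \<open>The projection of \<nu> restricted to \<open>K \<inter> Q\<close> has positive upper
  density at almost all of its points, for all \<open>Q\<close> in a countable basis at once. For
  \<open>x\<close> with finite fibre in \<open>K\<close>, a set \<open>Q\<close> isolating
  \<open>x\<close> from the rest of the fibre shows that this density sits at \<open>x\<close>
  itself.\<close>

lemma AE_slice_atom:
  assumes K: "compact K" "K \<subseteq> \<Omega>" "hausdorff1 K < \<infinity>" "\<And>x. x \<in> K \<Longrightarrow> a x $ i \<noteq> 0"
  shows "AE x in \<nu>. x \<in> K \<longrightarrow> (\<exists>\<epsilon>>0. \<forall>r>0. \<forall>d0>0. \<exists>d. 0 < d \<and> d < d0 \<and>
     \<epsilon> * d \<le> measure \<nu> (K \<inter> ball x r \<inter> {y. \<bar>y $ i - x $ i\<bar> \<le> d}))"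
proof -
  obtain \<B> :: "(real^'n) set set" where \<B>: "countable \<B>" "topological_basis \<B>" using ex_countable_basis by blast
  have Kb [measurable]: "K \<in> sets borel" using K(1) by (rule borel_compact)
  have "AE x in \<nu>. x \<in> K \<inter> Q \<longrightarrow> (\<exists>\<epsilon>>0. \<forall>d0>0. \<exists>d. 0 < d \<and> d < d0 \<and>
     \<epsilon> * d \<le> measure \<nu> (K \<inter> Q \<inter> {y. \<bar>y $ i - x $ i\<bar> \<le> d}))" if "Q \<in> \<B>" for Q
  proof -
    have Q: "open Q" using \<B>(2) that by (rule topological_basis_open)
    have KQ [measurable]: "K \<inter> Q \<in> sets \<nu>" using Q by (simp add: sets_nu)
    let ?\<nu> = "restrict_space \<nu> (K \<inter> Q)"
    let ?m = "distr ?\<nu> borel (\<lambda>y. y $ i)"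
    have meas: "(\<lambda>y. y $ i) \<in> measurable ?\<nu> borel"
      by (intro measurable_restrict_space1) measurable
    have "AE s in ?m. \<exists>\<epsilon>>0. \<forall>d0>0. \<exists>d. 0 < d \<and> d < d0 \<and> measure ?m {s - d..s + d} \<ge> \<epsilon> * d"
      by (rule AE_positive_upper_density) (auto intro!: finite_measure.finite_measure_distr finite_measure_restrict_space finite_measure_axioms meas)
    from AE_distrD[OF meas this]
    have "AE x in \<nu>. x \<in> K \<inter> Q \<longrightarrow> (\<exists>\<epsilon>>0. \<forall>d0>0. \<exists>d. 0 < d \<and> d < d0 \<and> measure ?m {x $ i - d..x $ i + d} \<ge> \<epsilon> * d)"
      using KQ by (simp add: AE_restrict_space_iff)
    moreover have "measure ?m {x $ i - d..x $ i + d} = measure \<nu> (K \<inter> Q \<inter> {y. \<bar>y $ i - x $ i\<bar> \<le> d})" for x d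
    proof -
      have "(\<lambda>y. y $ i) -` {x $ i - d..x $ i + d} \<inter> space ?\<nu> = K \<inter> Q \<inter> {y. \<bar>y $ i - x $ i\<bar> \<le> d}"
        by (auto simp: abs_le_iff space_restrict_space)
      moreover have "measure ?\<nu> (K \<inter> Q \<inter> {y. \<bar>y $ i - x $ i\<bar> \<le> d}) = measure \<nu> (K \<inter> Q \<inter> {y. \<bar>y $ i - x $ i\<bar> \<le> d})"
        by (rule measure_restrict_space) (use KQ in auto)
      ultimately show ?thesis by (simp add: measure_distr[OF meas])
    qed
    ultimately show ?thesis by simp
  qed
  then have "AE x in \<nu>. \<forall>Q\<in>\<B>. x \<in> K \<inter> Q \<longrightarrow> (\<exists>\<epsilon>>0. \<forall>d0>0. \<exists>d. 0 < d \<and> d < d0 \<and>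
     \<epsilon> * d \<le> measure \<nu> (K \<inter> Q \<inter> {y. \<bar>y $ i - x $ i\<bar> \<le> d}))"
    using \<B>(1) by (simp add: AE_ball_countable)
  moreover have "AE x in \<nu>. x \<in> K \<longrightarrow> finite {y\<in>K. y $ i = x $ i}"
    by (rule AE_finite_fibres) (use K in auto)
  ultimately show ?thesis
  proof eventually_elim
    case (elim x)
    show ?case
    proof
      assume x: "x \<in> K"
      have "finite ({y\<in>K. y $ i = x $ i} - {x})" using elim(2) x by simp
      then obtain r0 where r0: "r0 > 0" "\<And>y. y \<in> K \<Longrightarrow> y $ i = x $ i \<Longrightarrow> y \<noteq> x \<Longrightarrow> r0 \<le> dist x y"
        using finite_set_avoid[of "{y\<in>K. y $ i = x $ i} - {x}" x] by auto
      obtain Q where Q: "Q \<in> \<B>" "x \<in> Q" "Q \<subseteq> ball x (r0 / 2)"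
        using topological_basisE[OF \<B>(2) open_ball, of x x "r0 / 2"] r0(1) by auto
      obtain \<epsilon> where \<epsilon>: "\<epsilon> > 0" "\<And>d0. d0 > 0 \<Longrightarrow> \<exists>d. 0 < d \<and> d < d0 \<and>
         \<epsilon> * d \<le> measure \<nu> (K \<inter> Q \<inter> {y. \<bar>y $ i - x $ i\<bar> \<le> d})" using elim(1) x Q by auto
      show "\<exists>\<epsilon>>0. \<forall>r>0. \<forall>d0>0. \<exists>d. 0 < d \<and> d < d0 \<and>
         \<epsilon> * d \<le> measure \<nu> (K \<inter> ball x r \<inter> {y. \<bar>y $ i - x $ i\<bar> \<le> d})"
      proof (rule exI[of _ \<epsilon>], intro conjI allI impI \<epsilon>(1))
        fix r d0 :: real assume r: "r > 0" and d0: "d0 > 0"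
        \<comment> \<open>Within half the isolation radius the fibre consists of \<open>x\<close>
          alone, so thin slabs of this part of \<open>K\<close> fall into any prescribed ball around
          \<open>x\<close>. This is why \<epsilon> can be fixed before \<open>r\<close>.\<close>
        have "\<exists>d1>0. \<forall>y\<in>K \<inter> cball x (r0 / 2). \<bar>y $ i - x $ i\<bar> < d1 \<longrightarrow> y \<in> ball x r"
        proof (rule slab_shrink)
          show "compact (K \<inter> cball x (r0 / 2))" using K(1) by (intro compact_Int compact_cball)
          fix y assume y: "y \<in> K \<inter> cball x (r0 / 2)" "y $ i = x $ i"
          then have "y = x" using r0(2)[of y] r0(1) by force
          then show "y \<in> ball x r" using r by simp
        qed (auto intro!: continuous_intros)
        then obtain d1 where d1: "d1 > 0" "\<And>y. y \<in> K \<Longrightarrow> dist x y \<le> r0 / 2 \<Longrightarrow> \<bar>y $ i - x $ i\<bar> < d1 \<Longrightarrow> y \<in> ball x r"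
          by auto
        obtain d where d: "0 < d" "d < min d0 d1" "\<epsilon> * d \<le> measure \<nu> (K \<inter> Q \<inter> {y. \<bar>y $ i - x $ i\<bar> \<le> d})"
          using \<epsilon>(2)[of "min d0 d1"] d0 d1(1) by auto
        note d(3)
        also have "measure \<nu> (K \<inter> Q \<inter> {y. \<bar>y $ i - x $ i\<bar> \<le> d}) \<le> measure \<nu> (K \<inter> ball x r \<inter> {y. \<bar>y $ i - x $ i\<bar> \<le> d})"
        proof (rule finite_measure_mono)
          show "K \<inter> Q \<inter> {y. \<bar>y $ i - x $ i\<bar> \<le> d} \<subseteq> K \<inter> ball x r \<inter> {y. \<bar>y $ i - x $ i\<bar> \<le> d}"
            using d1(2) d(2) Q(3) by fastforce
          show "K \<inter> ball x r \<inter> {y. \<bar>y $ i - x $ i\<bar> \<le> d} \<in> sets \<nu>" unfolding sets_nu by measurable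
        qed
        finally show "\<exists>d. 0 < d \<and> d < d0 \<and> \<epsilon> * d \<le> measure \<nu> (K \<inter> ball x r \<inter> {y. \<bar>y $ i - x $ i\<bar> \<le> d})"
          using d by auto
      qed
    qed
  qed
qed

end

section \<open>Lipschitz graphs through regular points\<close>

context divfree
begin

text \<open>The almost-everywhere properties of slices with explicit constants, so that two points
  satisfying them with the same constants can be compared: maximal bound \<open>M\<close>, atom of
  size \<epsilon>, little mass off \<open>K\<close> near the point, and isolation in the fibre up to
  distance \<open>r\<close>. The 48 makes the losses in that comparison at most half of the
  gain.\<close>

definition slice_regular :: "'n \<Rightarrow> (real^'n) set \<Rightarrow> real \<Rightarrow> real \<Rightarrow> real \<Rightarrow> real \<Rightarrow> real^'n \<Rightarrow> bool" where
  "slice_regular i K c \<epsilon> M r x \<longleftrightarrow> x \<in> K \<and> cball x r \<subseteq> \<Omega> \<and>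
     (\<forall>d>0. measure \<nu> {y. \<bar>y $ i - x $ i\<bar> \<le> d} \<le> M * d) \<and>
     (\<forall>r'>0. \<forall>d0>0. \<exists>d. 0 < d \<and> d < d0 \<and> \<epsilon> * d \<le> measure \<nu> (K \<inter> ball x r' \<inter> {y. \<bar>y $ i - x $ i\<bar> \<le> d})) \<and>
     (\<exists>d0>0. \<forall>d. 0 < d \<and> d < d0 \<longrightarrow> measure \<nu> (ball x r \<inter> {y. \<bar>y $ i - x $ i\<bar> \<le> d} - K) \<le> c * \<epsilon> / 48 * d) \<and>
     (\<forall>y\<in>K. y $ i = x $ i \<longrightarrow> dist x y < r \<longrightarrow> y = x)"

text \<open>Two regular points whose separation is not controlled by that of their \<open>i\<close>-th coordinates
  would allow the slice to lose the atom at the first point on a short interval, which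
  \<open>slice_difference\<close> forbids.\<close>

lemma slice_regular_graph:
  obtains L where "L > 0"
    "\<And>i K c \<epsilon> M r x y. compact K \<Longrightarrow> c > 0 \<Longrightarrow> (\<And>z. z \<in> K \<Longrightarrow> c \<le> a z $ i) \<Longrightarrow> \<epsilon> > 0 \<Longrightarrow> M > 0 \<Longrightarrow> r > 0 \<Longrightarrow>
      slice_regular i K c \<epsilon> M r x \<Longrightarrow> slice_regular i K c \<epsilon> M r y \<Longrightarrow> (CARD('n) + 1) * dist x y < r / 2 \<Longrightarrow>
      norm (x - y) \<le> CARD('n) * (32 * L * M / (c * \<epsilon>)) * \<bar>x $ i - y $ i\<bar>"
proof -
  obtain L where L: "L > 0"
    "\<And>x \<rho> \<delta> s t i. \<rho> > 0 \<Longrightarrow> cube x \<rho> \<subseteq> \<Omega> \<Longrightarrow> \<delta> > 0 \<Longrightarrow>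
      \<bar>(\<integral>y. cube_bump x \<rho> y * tent \<delta> s (y $ i) * a y $ i \<partial>\<nu>) - (\<integral>y. cube_bump x \<rho> y * tent \<delta> t (y $ i) * a y $ i \<partial>\<nu>)\<bar>
       \<le> 2 * \<delta> * (L / \<rho>) * measure \<nu> {y. \<bar>y $ i - s\<bar> \<le> \<bar>s - t\<bar> + \<delta>}"
    using slice_difference by blast
  show ?thesis
  proof (rule that[OF L(1)])
    fix i :: 'n and K :: "(real^'n) set" and c \<epsilon> M r :: real and x y :: "real^'n"
    assume K: "compact K" and c: "c > 0" "\<And>z. z \<in> K \<Longrightarrow> c \<le> a z $ i" and \<epsilon>: "\<epsilon> > 0" and M: "M > 0" and r: "r > 0"
      and rx: "slice_regular i K c \<epsilon> M r x" and ry: "slice_regular i K c \<epsilon> M r y"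
      and xy: "(CARD('n) + 1) * dist x y < r / 2"
    \<comment> \<open>The slice at \<open>x\<close> will be at least
      \<open>c * \<epsilon> / 4 * d - 2 * \<eta> * d\<close> and the slice at \<open>y\<close> at
      most \<open>4 * \<eta> * d\<close>. With this \<eta> the gap is still
      \<open>c * \<epsilon> / 8 * d\<close>.\<close>
    define \<eta> where "\<eta> = c * \<epsilon> / 48"
    have \<eta>: "\<eta> > 0" using c \<epsilon> by (simp add: \<eta>_def)
    have K' [measurable]: "K \<in> sets borel" using K by (rule borel_compact)
    \<comment> \<open>The maximum-norm distance puts \<open>y\<close> on the boundary of the cube
      about \<open>x\<close>, so the bump of this radius is 1 at \<open>x\<close> and 0 at
      \<open>y\<close>.\<close>
    define \<rho> where "\<rho> = Max (range (\<lambda>l. \<bar>x $ l - y $ l\<bar>))"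
    have \<rho>_ge: "\<bar>x $ l - y $ l\<bar> \<le> \<rho>" for l unfolding \<rho>_def by (intro Max_ge) auto
    have "\<rho> \<in> range (\<lambda>l. \<bar>x $ l - y $ l\<bar>)" unfolding \<rho>_def by (rule Max_in) auto
    then obtain j where j: "\<rho> = \<bar>x $ j - y $ j\<bar>" by (rule rangeE)
    have norm_le: "norm (x - y) \<le> CARD('n) * \<rho>"
    proof -
      have "norm (x - y) \<le> (\<Sum>l\<in>UNIV. \<bar>(x - y) $ l\<bar>)" by (rule norm_le_l1_cart)
      also have "\<dots> \<le> (\<Sum>l\<in>(UNIV::'n set). \<rho>)" using \<rho>_ge by (intro sum_mono) auto
      finally show ?thesis by simp
    qed
    have \<rho>_le: "\<rho> \<le> dist x y" unfolding j dist_norm using component_le_norm_cart[of "x - y" j] by simp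
    have key: "\<rho> \<le> 32 * L * M / (c * \<epsilon>) * \<bar>x $ i - y $ i\<bar>"
    proof (cases "\<rho> = 0")
      case True
      then show ?thesis using L(1) M c \<epsilon> by simp
    next
      case False
      then have \<rho>: "\<rho> > 0" using j by simp
      let ?\<phi> = "cube_bump x \<rho>"
      have nr: "CARD('n) * \<rho> \<le> CARD('n) * dist x y" using \<rho>_le by (intro mult_left_mono) auto
      \<comment> \<open>The smallness of \<open>dist x y\<close> is spent here and in
        \<open>cub_y\<close>: the support of the bump must stay in the ball where mass off
        \<open>K\<close> is controlled around \<open>x\<close>, and in half of the corresponding
        ball around \<open>y\<close>.\<close>
      have cub_x: "cube x \<rho> \<subseteq> ball x r"
      proof
        fix u assume "u \<in> cube x \<rho>"
        then have "dist x u \<le> CARD('n) * \<rho>" using cube_subset_cball[of x \<rho>] by auto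
        then have "dist x u \<le> CARD('n) * dist x y" using nr by (rule order_trans)
        moreover have "0 \<le> CARD('n) * dist x y" "0 \<le> dist x y" by auto
        ultimately have "dist x u < r" using xy r unfolding of_nat_add of_nat_1 distrib_right by linarith
        then show "u \<in> ball x r" by simp
      qed
      have cub_y: "dist y u \<le> r / 2" if "u \<in> cube x \<rho>" for u
      proof -
        have "dist x u \<le> CARD('n) * \<rho>" using that cube_subset_cball[of x \<rho>] by auto
        then have "dist x u \<le> CARD('n) * dist x y" using nr by (rule order_trans)
        moreover have "dist y u \<le> dist x y + dist x u" using dist_triangle[of y u x] by (simp add: dist_commute)
        ultimately show ?thesis using xy unfolding of_nat_add of_nat_1 distrib_right by linarith
      qed
      have supp: "?\<phi> u = 0" if "u \<notin> cube x \<rho>" for u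
        using that cube_bump_support[OF \<rho>, of x] closure_subset[of "{u. ?\<phi> u \<noteq> 0}"] by blast
      have cub_O: "cube x \<rho> \<subseteq> \<Omega>" using cub_x rx ball_subset_cball unfolding slice_regular_def by blast
      have \<phi>c: "continuous_on UNIV ?\<phi>" by (intro smooth_fun_continuous smooth_fun_cube_bump)
      have [measurable]: "?\<phi> \<in> borel_measurable borel" using \<phi>c by (rule borel_measurable_continuous_onI)
      have \<phi>y: "?\<phi> y = 0" using j by (intro cube_bump_eq_0[OF \<rho>, of _ j]) (simp add: abs_minus_commute)
      have "open {u. 1 / 2 < ?\<phi> u}" by (intro open_Collect_less continuous_intros \<phi>c)
      moreover have "x \<in> {u. 1 / 2 < ?\<phi> u}" by simp
      ultimately obtain \<kappa> where \<kappa>0: "\<kappa> > 0" "ball x \<kappa> \<subseteq> {u. 1 / 2 < ?\<phi> u}"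
        unfolding open_contains_ball by blast
      then have \<kappa>: "\<kappa> > 0" "\<And>u. u \<in> ball x \<kappa> \<Longrightarrow> 1 / 2 < ?\<phi> u" by blast+
      \<comment> \<open>The only point of \<open>K\<close> near \<open>y\<close> at the level of
        \<open>y\<close> is \<open>y\<close> itself, where the bump vanishes; so in thin slabs the
        bump is below \<open>\<eta> / M\<close> on this part of \<open>K\<close>, which compensates
        slab mass up to \<open>2 * M * d\<close>.\<close>
      have "\<exists>d1>0. \<forall>u\<in>K \<inter> cball y (r / 2). \<bar>u $ i - y $ i\<bar> < d1 \<longrightarrow> u \<in> {u. ?\<phi> u < \<eta> / M}"
      proof (rule slab_shrink)
        show "compact (K \<inter> cball y (r / 2))" using K by (intro compact_Int compact_cball)
        show "open {u. ?\<phi> u < \<eta> / M}" by (intro open_Collect_less continuous_intros \<phi>c)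
        fix u assume "u \<in> K \<inter> cball y (r / 2)" "u $ i = y $ i"
        then have "u = y" using ry r unfolding slice_regular_def by auto
        then show "u \<in> {u. ?\<phi> u < \<eta> / M}" using \<phi>y \<eta> M by simp
      qed (auto intro!: continuous_intros)
      then obtain d1 where d1: "d1 > 0" "\<And>u. u \<in> K \<Longrightarrow> dist y u \<le> r / 2 \<Longrightarrow> \<bar>u $ i - y $ i\<bar> < d1 \<Longrightarrow> ?\<phi> u < \<eta> / M"
        by auto
      obtain dx where dx: "dx > 0" "\<And>d. 0 < d \<Longrightarrow> d < dx \<Longrightarrow> measure \<nu> (ball x r \<inter> {u. \<bar>u $ i - x $ i\<bar> \<le> d} - K) \<le> \<eta> * d"
        using rx unfolding slice_regular_def \<eta>_def by blast
      obtain dy where dy: "dy > 0" "\<And>d. 0 < d \<Longrightarrow> d < dy \<Longrightarrow> measure \<nu> (ball y r \<inter> {u. \<bar>u $ i - y $ i\<bar> \<le> d} - K) \<le> \<eta> * d"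
        using ry unfolding slice_regular_def \<eta>_def by blast
      \<comment> \<open>The auxiliary \<open>e\<close> bounds the width \<open>d\<close>, which
        cannot be prescribed: the atom at \<open>x\<close> is only visible at suitable arbitrarily
        small widths. In the end \<open>e\<close> tends to 0.\<close>
      have bound: "c * \<epsilon> / 8 \<le> 4 * L * M / \<rho> * (\<bar>x $ i - y $ i\<bar> + 2 * e)" if e: "e > 0" for e
      proof -
        define e' where "e' = min (min e (d1 / 2)) (min (dx / 2) (dy / 2))"
        have "e' > 0" using e d1 dx dy by (simp add: e'_def)
        then obtain d where d: "0 < d" "d < e'" "\<epsilon> * d \<le> measure \<nu> (K \<inter> ball x \<kappa> \<inter> {u. \<bar>u $ i - x $ i\<bar> \<le> d})"
          using rx \<kappa>(1) unfolding slice_regular_def by blast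
        have ds: "d < e" "2 * d < d1" "2 * d < dx" "2 * d < dy" using d(2) by (auto simp: e'_def)
        define F where "F s u = ?\<phi> u * tent (2 * d) s (u $ i) * a u $ i" for s u
        have Fint: "integrable \<nu> (F s)" for s unfolding F_def[abs_def]
          by (rule by_parts_integrable(1)[OF test_fun_cube_bump[OF \<rho> cub_O] continuous_on_tent continuous_on_tent])
        have Fabs: "\<bar>F s u\<bar> \<le> 1" if "norm (a u) \<le> 1" for s u
        proof -
          have "\<bar>a u $ i\<bar> \<le> 1" using that component_le_norm_cart[of "a u" i] by linarith
          then have "\<bar>?\<phi> u\<bar> * \<bar>tent (2 * d) s (u $ i)\<bar> * \<bar>a u $ i\<bar> \<le> 1 * 1 * 1"
            using d(1) cube_bump_nonneg[of x \<rho> u] cube_bump_le_1[of x \<rho> u] tent_bounds[of "2 * d" s "u $ i"]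
            by (intro mult_mono mult_nonneg_nonneg) auto
          then show ?thesis by (simp add: F_def abs_mult)
        qed
        have Fsupp: "F s u = 0" if "u \<notin> cube x \<rho> \<or> \<bar>u $ i - s\<bar> > 2 * d" for s u
          using that supp[of u] tent_bounds(3)[of "2 * d" "u $ i" s] d(1) by (auto simp: F_def)
        let ?S1 = "K \<inter> ball x \<kappa> \<inter> {u. \<bar>u $ i - x $ i\<bar> \<le> d}"
        let ?S2 = "ball x r \<inter> {u. \<bar>u $ i - x $ i\<bar> \<le> 2 * d} - K"
        let ?S3 = "{u. \<bar>u $ i - y $ i\<bar> \<le> 2 * d}"
        let ?S4 = "ball y r \<inter> {u. \<bar>u $ i - y $ i\<bar> \<le> 2 * d} - K"
        have [measurable]: "?S1 \<in> sets borel" "?S2 \<in> sets borel" "?S3 \<in> sets borel" "?S4 \<in> sets borel" by measurable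
        have iint: "integrable \<nu> (\<lambda>u. indicator S u :: real)" if "S \<in> sets borel" for S
          using that by (intro integrable_real_indicator) (auto simp: sets_nu emeasure_eq_measure)
        \<comment> \<open>The factor 1/4 is 1/2 from the bump near \<open>x\<close> times 1/2 from
          the tent of half-width \<open>2 * d\<close> on the slab of half-width \<open>d\<close>. On
          \<open>K\<close> the integrand is nonnegative, so nothing there cancels the atom; off
          \<open>K\<close> it is at least -1.\<close>
        have "c / 4 * measure \<nu> ?S1 - measure \<nu> ?S2 = (\<integral>u. c / 4 * indicator ?S1 u - indicator ?S2 u \<partial>\<nu>)"
          by (subst Bochner_Integration.integral_diff) (auto intro!: iint integrable_mult_right)
        also have "\<dots> \<le> (\<integral>u. F (x $ i) u \<partial>\<nu>)"
        proof (rule integral_mono_AE)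
          show "integrable \<nu> (\<lambda>u. c / 4 * indicator ?S1 u - indicator ?S2 u)"
            by (intro Bochner_Integration.integrable_diff integrable_mult_right iint) auto
          show "AE u in \<nu>. c / 4 * indicator ?S1 u - indicator ?S2 u \<le> F (x $ i) u"
            using a_bound
          proof eventually_elim
            fix u assume a1: "norm (a u) \<le> 1"
            show "c / 4 * indicator ?S1 u - indicator ?S2 u \<le> F (x $ i) u"
            proof (cases "u \<in> K")
              case True
              have pos: "0 \<le> a u $ i" using c True by force
              have nn: "0 \<le> F (x $ i) u" unfolding F_def
                by (intro mult_nonneg_nonneg cube_bump_nonneg tent_bounds pos)
              show ?thesis
              proof (cases "u \<in> ?S1")
                case S1: True
                have "1 / 2 * (1 / 2) * c \<le> F (x $ i) u" unfolding F_def
                  using S1 c(2)[OF True] c(1) d(1) \<kappa>(2)[of u] tent_half[of "2 * d" "u $ i" "x $ i"]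
                  by (intro mult_mono) (auto intro!: mult_nonneg_nonneg cube_bump_nonneg tent_bounds)
                then show ?thesis using S1 True by simp
              next
                case S1: False
                then have "indicator ?S1 u = (0::real)" "indicator ?S2 u = (0::real)" using True by (auto split: split_indicator)
                then show ?thesis using nn by simp
              qed
            next
              case False
              show ?thesis
              proof (cases "u \<in> ?S2")
                case True
                then show ?thesis using False Fabs[OF a1, of "x $ i"] by (simp add: abs_le_iff)
              next
                case S2: False
                then have "F (x $ i) u = 0" using False cub_x by (intro Fsupp) auto
                then show ?thesis using S2 False by simp
              qed
            qed
          qed
        qed (rule Fint)
        finally have Nx: "c / 4 * (\<epsilon> * d) - \<eta> * (2 * d) \<le> (\<integral>u. F (x $ i) u \<partial>\<nu>)"
          using mult_left_mono[OF d(3), of "c / 4"] dx(2)[of "2 * d"] ds d(1) c(1) by linarith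
        \<comment> \<open>The matching upper bound at the level of \<open>y\<close>: the part on
          \<open>K\<close> is small because of the bump, the part off \<open>K\<close> because of
          its small slab mass. Each contributes \<open>2 * \<eta> * d\<close>.\<close>
        have "(\<integral>u. F (y $ i) u \<partial>\<nu>) \<le> (\<integral>u. \<eta> / M * indicator ?S3 u + indicator ?S4 u \<partial>\<nu>)"
        proof (rule integral_mono_AE)
          show "integrable \<nu> (\<lambda>u. \<eta> / M * indicator ?S3 u + indicator ?S4 u)"
            by (intro Bochner_Integration.integrable_add integrable_mult_right iint) auto
          show "AE u in \<nu>. F (y $ i) u \<le> \<eta> / M * indicator ?S3 u + indicator ?S4 u"
            using a_bound
          proof eventually_elim
            fix u assume a1: "norm (a u) \<le> 1"
            have nn: "0 \<le> \<eta> / M * indicator ?S3 u + indicator ?S4 u" using \<eta> M by simp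
            show "F (y $ i) u \<le> \<eta> / M * indicator ?S3 u + indicator ?S4 u"
            proof (cases "u \<notin> cube x \<rho> \<or> \<bar>u $ i - y $ i\<bar> > 2 * d")
              case True
              then show ?thesis using nn Fsupp by simp
            next
              case False
              then have yu: "dist y u \<le> r / 2" "\<bar>u $ i - y $ i\<bar> < d1" "u \<in> ?S3" using cub_y ds by auto
              show ?thesis
              proof (cases "u \<in> K")
                case True
                have ai: "a u $ i \<le> 1" using a1 component_le_norm_cart[of "a u" i] by linarith
                have "F (y $ i) u \<le> \<eta> / M * 1 * 1" unfolding F_def
                  using d1(2)[OF True yu(1,2)] ai tent_bounds(2)[of "2 * d" "y $ i" "u $ i"] d(1) \<eta> M c True
                  by (intro mult_mono mult_nonneg_nonneg cube_bump_nonneg tent_bounds) force+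
                then show ?thesis using yu(3) True by simp
              next
                case False
                then have "u \<in> ?S4" using yu r by auto
                then show ?thesis using Fabs[OF a1, of "y $ i"] \<eta> M yu(3) by (simp add: abs_le_iff) (smt (verit) divide_pos_pos)
              qed
            qed
          qed
        qed (rule Fint)
        also have "\<dots> = \<eta> / M * measure \<nu> ?S3 + measure \<nu> ?S4"
          by (subst Bochner_Integration.integral_add) (auto intro!: iint integrable_mult_right)
        also have "\<dots> \<le> \<eta> / M * (M * (2 * d)) + \<eta> * (2 * d)"
        proof (intro add_mono mult_left_mono)
          show "measure \<nu> ?S3 \<le> M * (2 * d)" using ry d(1) unfolding slice_regular_def by auto
        qed (use dy(2)[of "2 * d"] ds d(1) \<eta> M in auto)
        also have "\<dots> = 4 * \<eta> * d" using M by simp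
        finally have Ny: "(\<integral>u. F (y $ i) u \<partial>\<nu>) \<le> 4 * \<eta> * d" .
        have "(\<integral>u. F (x $ i) u \<partial>\<nu>) - (\<integral>u. F (y $ i) u \<partial>\<nu>)
            \<le> 2 * (2 * d) * (L / \<rho>) * measure \<nu> {u. \<bar>u $ i - x $ i\<bar> \<le> \<bar>x $ i - y $ i\<bar> + 2 * d}"
          using L(2)[OF \<rho> cub_O, where \<delta>="2 * d" and i=i and s="x $ i" and t="y $ i"] d(1) unfolding F_def by linarith
        also have "\<dots> \<le> 2 * (2 * d) * (L / \<rho>) * (M * (\<bar>x $ i - y $ i\<bar> + 2 * d))"
        proof (rule mult_left_mono)
          show "measure \<nu> {u. \<bar>u $ i - x $ i\<bar> \<le> \<bar>x $ i - y $ i\<bar> + 2 * d} \<le> M * (\<bar>x $ i - y $ i\<bar> + 2 * d)"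
            using rx d(1) unfolding slice_regular_def by auto
        qed (use d(1) L(1) \<rho> in auto)
        finally have "c / 4 * (\<epsilon> * d) - \<eta> * (2 * d) - 4 * \<eta> * d
            \<le> 2 * (2 * d) * (L / \<rho>) * (M * (\<bar>x $ i - y $ i\<bar> + 2 * d))" using Nx Ny by linarith
        then have "d * (c * \<epsilon> / 8) \<le> d * (4 * L * M / \<rho> * (\<bar>x $ i - y $ i\<bar> + 2 * d))"
          unfolding \<eta>_def by (simp add: field_simps)
        then have "c * \<epsilon> / 8 \<le> 4 * L * M / \<rho> * (\<bar>x $ i - y $ i\<bar> + 2 * d)"
          using d(1) by (simp only: mult_le_cancel_left_pos)
        also have "\<dots> \<le> 4 * L * M / \<rho> * (\<bar>x $ i - y $ i\<bar> + 2 * e)"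
          using ds(1) L(1) M \<rho> by (intro mult_left_mono) auto
        finally show ?thesis .
      qed
      have "c * \<epsilon> / 8 \<le> 4 * L * M / \<rho> * \<bar>x $ i - y $ i\<bar>"
      proof (rule field_le_epsilon)
        fix e :: real assume "e > 0"
        define B where "B = 4 * L * M / \<rho>"
        have "B > 0" using L(1) M \<rho> by (simp add: B_def)
        then have "B * (\<bar>x $ i - y $ i\<bar> + 2 * (e / (2 * B))) = B * \<bar>x $ i - y $ i\<bar> + e"
          by (simp add: distrib_left)
        then show "c * \<epsilon> / 8 \<le> 4 * L * M / \<rho> * \<bar>x $ i - y $ i\<bar> + e"
          using bound[of "e / (2 * B)"] \<open>e > 0\<close> \<open>B > 0\<close> unfolding B_def[symmetric] by simp
      qed
      then show ?thesis using c(1) \<epsilon> \<rho> by (simp add: field_simps)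
    qed
    have "CARD('n) * \<rho> \<le> CARD('n) * (32 * L * M / (c * \<epsilon>) * \<bar>x $ i - y $ i\<bar>)"
      using key by (intro mult_left_mono) auto
    with norm_le show "norm (x - y) \<le> CARD('n) * (32 * L * M / (c * \<epsilon>)) * \<bar>x $ i - y $ i\<bar>"
      by (simp add: mult.assoc)
  qed
qed

text \<open>Rounding the pointwise constants to \<open>1 / Suc p\<close> and \<open>Suc q\<close>
  leaves countably many classes, inside each of which two points can be compared.\<close>

lemma AE_slice_regular:
  assumes K: "compact K" "K \<subseteq> \<Omega>" "hausdorff1 K < \<infinity>" and c: "c > 0" "\<And>x. x \<in> K \<Longrightarrow> c \<le> a x $ i"
  shows "AE x in \<nu>. x \<in> K \<longrightarrow> (\<exists>p q. slice_regular i K c (1 / Suc p) (Suc q) (1 / Suc q) x)"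
proof -
  have K' [measurable]: "K \<in> sets borel" using K(1) by (rule borel_compact)
  have nz: "a x $ i \<noteq> 0" if "x \<in> K" for x using c that by force
  have "AE x in \<nu>. x \<in> K \<longrightarrow> finite {y\<in>K. y $ i = x $ i}"
    by (rule AE_finite_fibres) (use K nz in auto)
  moreover have "AE x in \<nu>. x \<in> K \<longrightarrow> (\<exists>\<epsilon>>0. \<forall>r>0. \<forall>d0>0. \<exists>d. 0 < d \<and> d < d0 \<and>
     \<epsilon> * d \<le> measure \<nu> (K \<inter> ball x r \<inter> {y. \<bar>y $ i - x $ i\<bar> \<le> d}))"
    by (rule AE_slice_atom) (use K nz in auto)
  moreover have "AE x in \<nu>. x \<in> K \<longrightarrow> zero_slab_density (density \<nu> (indicator (- K))) (\<lambda>y. y $ i) x"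
    by (rule AE_zero_slab_density) (use K K' nz in auto)
  ultimately show ?thesis using AE_slab_bound[of i]
  proof eventually_elim
    case (elim x)
    show ?case
    proof
      assume x: "x \<in> K"
      then have xO: "x \<in> \<Omega>" using K by blast
      obtain M where M: "M > 0" "\<And>d. d > 0 \<Longrightarrow> measure \<nu> {y. \<bar>y $ i - x $ i\<bar> \<le> d} \<le> M * d"
        using elim(4) xO nz[OF x] by blast
      obtain \<epsilon> where \<epsilon>: "\<epsilon> > 0" "\<And>r d0. r > 0 \<Longrightarrow> d0 > 0 \<Longrightarrow> \<exists>d. 0 < d \<and> d < d0 \<and>
         \<epsilon> * d \<le> measure \<nu> (K \<inter> ball x r \<inter> {y. \<bar>y $ i - x $ i\<bar> \<le> d})" using elim(2) x by blast
      have "finite ({y\<in>K. y $ i = x $ i} - {x})" using elim(1) x by simp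
      then obtain r0 where r0: "r0 > 0" "\<And>y. y \<in> K \<Longrightarrow> y $ i = x $ i \<Longrightarrow> y \<noteq> x \<Longrightarrow> r0 \<le> dist x y"
        using finite_set_avoid[of "{y\<in>K. y $ i = x $ i} - {x}" x] by auto
      obtain r1 where r1: "r1 > 0" "cball x r1 \<subseteq> \<Omega>" using bspec[OF open_Omega[unfolded open_contains_cball] xO] by blast
      obtain p where p: "1 / Suc p < \<epsilon>" using nat_approx_posE[OF \<epsilon>(1)] by blast
      have "c * (1 / Suc p) / 48 > 0" using c(1) by simp
      then obtain r2 d2 where r2: "r2 > 0" "d2 > 0" "\<And>d. 0 < d \<Longrightarrow> d < d2 \<Longrightarrow>
         measure (density \<nu> (indicator (- K))) (ball x r2 \<inter> {y. \<bar>y $ i - x $ i\<bar> \<le> d}) \<le> c * (1 / Suc p) / 48 * d"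
        using zero_slab_densityE[OF mp[OF elim(3) x]] by blast
      \<comment> \<open>A single \<open>q\<close> has to serve as maximal bound and, through
        \<open>1 / Suc q\<close>, as radius for isolation, containment in \<Omega> and slab density;
        the entry \<open>1 / M\<close> gives \<open>M \<le> Suc q\<close>.\<close>
      define m where "m = min (min r0 r1) (min r2 (1 / M))"
      have "m > 0" using r0 r1 r2 M by (simp add: m_def)
      then obtain q where q: "1 / Suc q < m" using nat_approx_posE by blast
      then have q': "1 / Suc q < r0" "1 / Suc q < r1" "1 / Suc q < r2" "1 / Suc q < 1 / M" by (auto simp: m_def)
      have Mq: "M \<le> Suc q" using q'(4) M(1) by (simp add: field_simps)
      have "slice_regular i K c (1 / Suc p) (Suc q) (1 / Suc q) x"
        unfolding slice_regular_def
      proof (intro conjI x allI impI ballI)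
        show "cball x (1 / Suc q) \<subseteq> \<Omega>" using r1 q'(2) subset_cball[of "1 / Suc q" r1 x] by auto
        show "measure \<nu> {y. \<bar>y $ i - x $ i\<bar> \<le> d} \<le> real (Suc q) * d" if "d > 0" for d
          using M(2)[OF that] mult_right_mono[OF Mq, of d] that by linarith
        show "\<exists>d. 0 < d \<and> d < d0 \<and> 1 / real (Suc p) * d \<le> measure \<nu> (K \<inter> ball x r' \<inter> {y. \<bar>y $ i - x $ i\<bar> \<le> d})"
          if rd: "r' > 0" "d0 > 0" for r' d0
        proof -
          obtain d where d: "0 < d" "d < d0" "\<epsilon> * d \<le> measure \<nu> (K \<inter> ball x r' \<inter> {y. \<bar>y $ i - x $ i\<bar> \<le> d})"
            using \<epsilon>(2)[OF rd] by blast
          have "1 / real (Suc p) * d \<le> \<epsilon> * d" using p d(1) by (intro mult_right_mono) auto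
          with d show ?thesis by (meson order_trans)
        qed
        show "\<exists>d0>0. \<forall>d. 0 < d \<and> d < d0 \<longrightarrow> measure \<nu> (ball x (1 / Suc q) \<inter> {y. \<bar>y $ i - x $ i\<bar> \<le> d} - K)
            \<le> c * (1 / real (Suc p)) / 48 * d"
        proof (intro exI[of _ d2] conjI allI impI r2(2))
          fix d assume d: "0 < d \<and> d < d2"
          have "measure \<nu> (ball x (1 / Suc q) \<inter> {y. \<bar>y $ i - x $ i\<bar> \<le> d} - K)
             \<le> measure \<nu> (ball x r2 \<inter> {y. \<bar>y $ i - x $ i\<bar> \<le> d} \<inter> (- K))"
          proof (rule finite_measure_mono)
            show "ball x (1 / Suc q) \<inter> {y. \<bar>y $ i - x $ i\<bar> \<le> d} - K \<subseteq> ball x r2 \<inter> {y. \<bar>y $ i - x $ i\<bar> \<le> d} \<inter> (- K)"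
              using q'(3) by auto
            show "ball x r2 \<inter> {y. \<bar>y $ i - x $ i\<bar> \<le> d} \<inter> (- K) \<in> sets \<nu>" unfolding sets_nu by measurable
          qed
          also have "\<dots> = measure (density \<nu> (indicator (- K))) (ball x r2 \<inter> {y. \<bar>y $ i - x $ i\<bar> \<le> d})"
            by (rule measure_density_indicator[symmetric]) (simp_all add: sets_nu)
          also have "\<dots> \<le> c * (1 / real (Suc p)) / 48 * d" using r2(3) d by blast
          finally show "measure \<nu> (ball x (1 / Suc q) \<inter> {y. \<bar>y $ i - x $ i\<bar> \<le> d} - K) \<le> c * (1 / real (Suc p)) / 48 * d" .
        qed
        show "y = x" if "y \<in> K" "y $ i = x $ i" "dist x y < 1 / Suc q" for y
          using r0(2)[OF that(1,2)] q'(1) that(3) by linarith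
      qed
      then show "\<exists>p q. slice_regular i K c (1 / Suc p) (Suc q) (1 / Suc q) x" by blast
    qed
  qed
qed

text \<open>Balls about a countable dense set cut each regularity class into pieces so small that
  any two of their points can be compared; each piece then lies on one graph.\<close>

lemma lipschitz_graphs_cover:
  assumes K: "compact K" "K \<subseteq> \<Omega>" "hausdorff1 K < \<infinity>" and c: "c > 0" "\<And>x. x \<in> K \<Longrightarrow> c \<le> a x $ i"
  shows "\<exists>\<G>. countable \<G> \<and> (\<forall>\<gamma>\<in>\<G>. (\<exists>L. L-lipschitz_on UNIV \<gamma>) \<and> (\<forall>t. \<gamma> t $ i = t)) \<and>
     (AE x in \<nu>. x \<in> K \<longrightarrow> (\<exists>\<gamma>\<in>\<G>. x \<in> range \<gamma>))"
proof -
  obtain L where L: "L > 0"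
    "\<And>i K c \<epsilon> M r x y. compact K \<Longrightarrow> c > 0 \<Longrightarrow> (\<And>z. z \<in> K \<Longrightarrow> c \<le> a z $ i) \<Longrightarrow> \<epsilon> > 0 \<Longrightarrow> M > 0 \<Longrightarrow> r > 0 \<Longrightarrow>
      slice_regular i K c \<epsilon> M r x \<Longrightarrow> slice_regular i K c \<epsilon> M r y \<Longrightarrow> (CARD('n) + 1) * dist x y < r / 2 \<Longrightarrow>
      norm (x - y) \<le> CARD('n) * (32 * L * M / (c * \<epsilon>)) * \<bar>x $ i - y $ i\<bar>"
    using slice_regular_graph by blast
  obtain D :: "(real^'n) set" where D: "countable D" "\<And>X. open X \<Longrightarrow> X \<noteq> {} \<Longrightarrow> \<exists>d\<in>D. d \<in> X"
    using countable_dense_exists by metis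
  \<comment> \<open>Two points of a ball of this radius are less than \<open>2 * R q\<close> apart,
    and \<open>(n + 1) * 2 * R q\<close> is exactly half of \<open>1 / Suc q\<close>, the threshold
    for comparing regular points.\<close>
  define R where "R q = 1 / Suc q / (4 * (real CARD('n) + 1))" for q :: nat
  have R: "R q > 0" for q by (simp add: R_def)
  define P where "P p q z = {x. slice_regular i K c (1 / Suc p) (Suc q) (1 / Suc q) x} \<inter> ball z (R q)" for p q z
  have "\<exists>\<gamma> L'. L'-lipschitz_on UNIV \<gamma> \<and> (\<forall>t. \<gamma> t $ i = t) \<and> P p q z \<subseteq> range \<gamma>" for p q z
  proof (rule lipschitz_graph_cover)
    show "0 \<le> CARD('n) * (32 * L * Suc q / (c * (1 / Suc p)))" using L(1) c(1) by simp
    fix x y assume xy: "x \<in> P p q z" "y \<in> P p q z"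
    show "norm (x - y) \<le> CARD('n) * (32 * L * Suc q / (c * (1 / Suc p))) * \<bar>x $ i - y $ i\<bar>"
    proof (rule L(2)[OF K(1) c])
      have aux: "N * (2 * (w / (4 * N))) = w / 2" if "N > 0" for N w :: real using that by simp
      have "dist x y < 2 * R q" using xy dist_triangle_less_add[of x z "R q" y "R q"]
        by (simp add: P_def dist_commute)
      then have "(CARD('n) + 1) * dist x y < (CARD('n) + 1) * (2 * R q)" by (intro mult_strict_left_mono) auto
      also have "\<dots> = 1 / Suc q / 2" using aux[of "real CARD('n) + 1" "1 / Suc q"] unfolding R_def
        by (simp only: of_nat_add of_nat_1)
      finally show "(CARD('n) + 1) * dist x y < 1 / Suc q / 2" .
    qed (use xy in \<open>auto simp: P_def\<close>)
  qed
  then obtain \<gamma> where \<gamma>: "\<And>p q z. \<exists>L'. L'-lipschitz_on UNIV (\<gamma> p q z)" "\<And>p q z t. \<gamma> p q z t $ i = t"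
    "\<And>p q z. P p q z \<subseteq> range (\<gamma> p q z)" by metis
  define \<G> where "\<G> = (\<lambda>(p, q, z). \<gamma> p q z) ` (UNIV \<times> UNIV \<times> D)"
  have "AE x in \<nu>. x \<in> K \<longrightarrow> (\<exists>p q. slice_regular i K c (1 / Suc p) (Suc q) (1 / Suc q) x)"
    by (rule AE_slice_regular) (use K c in auto)
  then have "AE x in \<nu>. x \<in> K \<longrightarrow> (\<exists>\<gamma>\<in>\<G>. x \<in> range \<gamma>)"
  proof eventually_elim
    case (elim x)
    show ?case
    proof
      assume "x \<in> K"
      with elim obtain p q where pq: "slice_regular i K c (1 / Suc p) (Suc q) (1 / Suc q) x" by blast
      have "ball x (R q) \<noteq> {}" using R[of q] by simp
      then obtain z where z: "z \<in> D" "z \<in> ball x (R q)" using D(2)[OF open_ball] by blast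
      then have "x \<in> P p q z" using pq by (simp add: P_def dist_commute)
      then have "x \<in> range (\<gamma> p q z)" using \<gamma>(3) by blast
      moreover have "\<gamma> p q z \<in> \<G>" unfolding \<G>_def using z(1) by (intro image_eqI[of _ _ "(p, q, z)"]) auto
      ultimately show "\<exists>\<gamma>\<in>\<G>. x \<in> range \<gamma>" by blast
    qed
  qed
  moreover have "countable \<G>" unfolding \<G>_def using D(1) by (intro countable_image countable_SIGMA) auto
  ultimately show ?thesis using \<gamma>(1,2) by (intro exI[of _ \<G>]) (auto simp: \<G>_def)
qed

end

subsection \<open>Lebesgue points and differentiability of Lipschitz functions\<close>

lemma emeasure_density_real:
  fixes w :: "'a \<Rightarrow> real"
  assumes w: "integrable M w" "\<And>t. 0 \<le> w t" and S: "S \<in> sets M"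
  shows "emeasure (density M (\<lambda>t. ennreal (w t))) S = ennreal (\<integral>t. w t * indicator S t \<partial>M)"
proof -
  have [measurable]: "w \<in> borel_measurable M" using w(1) by simp
  have "emeasure (density M (\<lambda>t. ennreal (w t))) S = (\<integral>\<^sup>+t. ennreal (w t) * indicator S t \<partial>M)"
    using S by (subst emeasure_density) auto
  also have "\<dots> = (\<integral>\<^sup>+t. ennreal (w t * indicator S t) \<partial>M)"
    by (intro nn_integral_cong) (simp split: split_indicator)
  also have "\<dots> = ennreal (\<integral>t. w t * indicator S t \<partial>M)"
    by (rule nn_integral_eq_integral) (use w S in \<open>auto intro: integrable_mult_indicator[of S M w] integrable_real_mult_indicator\<close>)
  finally show ?thesis .
qed

definition lebesgue_point :: "(real \<Rightarrow> real) \<Rightarrow> real \<Rightarrow> bool" where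
  "lebesgue_point h s \<longleftrightarrow> (\<forall>\<epsilon>>0. \<exists>r0>0. \<forall>r. 0 < r \<and> r < r0 \<longrightarrow>
     (\<integral>t. \<bar>h t - h s\<bar> * indicator {s - r..s + r} t \<partial>lborel) \<le> \<epsilon> * r)"

text \<open>The slab-density lemma with the identity as projection. For rational
  \<open>a < b\<close>, almost every point of \<open>{a < h \<le> b}\<close> has negligible weighted
  mass of the complement around it, while on the set itself \<open>h\<close> oscillates by at most
  \<open>b - a\<close>.\<close>

lemma AE_lebesgue_point:
  assumes h: "integrable lborel h"
  shows "AE s in lborel. lebesgue_point h s"
proof -
  have [measurable]: "h \<in> borel_measurable borel" using h by simp
  define E where "E a b N = {t. a < h t \<and> h t \<le> b \<and> \<bar>t\<bar> < real N}" for a b N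
  have E [measurable]: "E a b N \<in> sets borel" for a b N unfolding E_def by measurable
  \<comment> \<open>The weight controls the oscillation off \<open>E a b N\<close>, since
    \<open>\<bar>h t - h s\<bar>\<close> is at most
    \<open>(1 + \<bar>h s\<bar>) * (1 + \<bar>h t\<bar>)\<close>.\<close>
  define w where "w a b N t = (1 + \<bar>h t\<bar>) * indicator ({- real N..real N} - E a b N) t" for a b N t
  have w_int: "integrable lborel (w a b N)" for a b N
  proof -
    have "integrable lborel (\<lambda>t. indicator ({- real N..real N} - E a b N) t + \<bar>h t\<bar> * indicator ({- real N..real N} - E a b N) t :: real)"
    proof (intro Bochner_Integration.integrable_add integrable_real_mult_indicator integrable_abs h integrable_real_indicator)
      have "emeasure lborel ({- real N..real N} - E a b N) \<le> emeasure lborel {- real N..real N}"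
        by (rule emeasure_mono) auto
      also have "\<dots> < \<infinity>" by simp
      finally show "emeasure lborel ({- real N..real N} - E a b N) < \<infinity>" .
    qed auto
    then show ?thesis by (simp add: w_def[abs_def] distrib_right)
  qed
  have w_nn: "0 \<le> w a b N t" for a b N t by (simp add: w_def)
  define m where "m a b N = density lborel (\<lambda>t. ennreal (w a b N t))" for a b N
  have em: "emeasure (m a b N) S = ennreal (\<integral>t. w a b N t * indicator S t \<partial>lborel)" if "S \<in> sets borel" for a b N S
    unfolding m_def by (rule emeasure_density_real[OF w_int w_nn]) (use that in simp)
  have neg: "negligible {s \<in> E a b N. \<not> zero_slab_density (m a b N) (\<lambda>t. t) s}" for a b N
  proof -
    have "finite_measure (m a b N)"
      by (rule finite_measureI) (use em[of UNIV a b N] in \<open>simp add: m_def\<close>)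
    moreover have "emeasure (m a b N) (E a b N) = 0"
    proof -
      have "(\<lambda>t. w a b N t * indicator (E a b N) t) = (\<lambda>t. 0)" by (auto simp: w_def split: split_indicator)
      then show ?thesis by (simp add: em)
    qed
    ultimately have "negligible ((\<lambda>t. t) ` {s \<in> E a b N. \<not> zero_slab_density (m a b N) (\<lambda>t. t) s})"
      by (intro negligible_projection_not_zero_slab_density) (auto simp: m_def)
    then show ?thesis by simp
  qed
  have "AE s in lebesgue. s \<notin> (\<Union>N. \<Union>a\<in>\<rat>. \<Union>b\<in>\<rat>. {s \<in> E a b N. \<not> zero_slab_density (m a b N) (\<lambda>t. t) s})"
  proof -
    have "negligible (\<Union>N. \<Union>a\<in>\<rat>. \<Union>b\<in>\<rat>. {s \<in> E a b N. \<not> zero_slab_density (m a b N) (\<lambda>t. t) s})"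
      using neg countable_rat by (intro negligible_countable_Union countable_UN) (auto intro!: negligible_countable_Union countable_UN)
    then show ?thesis unfolding negligible_iff_null_sets by (rule AE_not_in)
  qed
  then have "AE s in lborel. s \<notin> (\<Union>N. \<Union>a\<in>\<rat>. \<Union>b\<in>\<rat>. {s \<in> E a b N. \<not> zero_slab_density (m a b N) (\<lambda>t. t) s})"
    by (simp add: AE_completion_iff)
  then show ?thesis
  proof eventually_elim
    case (elim s)
    show ?case unfolding lebesgue_point_def
    proof (intro allI impI)
      fix \<epsilon> :: real assume \<epsilon>: "\<epsilon> > 0"
      \<comment> \<open>Half of the allowed error is \<open>b - a < \<epsilon> / 4\<close> times the
        length \<open>2 * d\<close>; the other half is reserved for the weighted mass, whose bound
        is divided by \<open>1 + \<bar>h s\<bar>\<close> for that purpose.\<close>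
      obtain a where a: "a \<in> \<rat>" "h s - \<epsilon> / 8 < a" "a < h s" using Rats_dense_in_real[of "h s - \<epsilon> / 8" "h s"] \<epsilon> by auto
      obtain b where b: "b \<in> \<rat>" "h s < b" "b < h s + \<epsilon> / 8" using Rats_dense_in_real[of "h s" "h s + \<epsilon> / 8"] \<epsilon> by auto
      obtain N :: nat where N: "\<bar>s\<bar> < N" using reals_Archimedean2 by blast
      have "s \<in> E a b N" using a b N by (simp add: E_def)
      then have "zero_slab_density (m a b N) (\<lambda>t. t) s" using elim a(1) b(1) by blast
      moreover have "\<epsilon> / (2 * (1 + \<bar>h s\<bar>)) > 0" using \<epsilon> by (simp add: add_pos_nonneg)
      ultimately obtain r d0 where rd: "r > 0" "d0 > 0" "\<And>d. 0 < d \<Longrightarrow> d < d0 \<Longrightarrow>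
         measure (m a b N) (ball s r \<inter> {y. \<bar>y - s\<bar> \<le> d}) \<le> \<epsilon> / (2 * (1 + \<bar>h s\<bar>)) * d"
        by (rule zero_slab_densityE) (rule that)
      show "\<exists>r0>0. \<forall>r. 0 < r \<and> r < r0 \<longrightarrow> (\<integral>t. \<bar>h t - h s\<bar> * indicator {s - r..s + r} t \<partial>lborel) \<le> \<epsilon> * r"
      proof (rule exI[of _ "min (min r d0) (N - \<bar>s\<bar>)"], intro conjI allI impI)
        show "0 < min (min r d0) (N - \<bar>s\<bar>)" using rd N by simp
        fix d assume d: "0 < d \<and> d < min (min r d0) (N - \<bar>s\<bar>)"
        let ?I = "{s - d..s + d}"
        have I: "ball s r \<inter> {y. \<bar>y - s\<bar> \<le> d} = ?I" using d by (auto simp: dist_real_def abs_le_iff)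
        have iI: "integrable lborel (\<lambda>t. indicator ?I t :: real)" 
          using d by (intro integrable_real_indicator) auto
        have wI: "integrable lborel (\<lambda>t. w a b N t * indicator ?I t)" by (intro integrable_real_mult_indicator w_int) auto
        have "(\<integral>t. \<bar>h t - h s\<bar> * indicator ?I t \<partial>lborel)
           \<le> (\<integral>t. (b - a) * indicator ?I t + (1 + \<bar>h s\<bar>) * (w a b N t * indicator ?I t) \<partial>lborel)"
        proof (rule integral_mono_AE)
          have "integrable lborel (\<lambda>t. \<bar>h t * indicator ?I t - h s * indicator ?I t\<bar>)"
            by (intro integrable_abs Bochner_Integration.integrable_diff integrable_real_mult_indicator h integrable_mult_right iI) auto
          moreover have "\<bar>h t * indicator ?I t - h s * indicator ?I t\<bar> = \<bar>h t - h s\<bar> * indicator ?I t" for t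
            by (simp split: split_indicator)
          ultimately show "integrable lborel (\<lambda>t. \<bar>h t - h s\<bar> * indicator ?I t)" by simp
          show "integrable lborel (\<lambda>t. (b - a) * indicator ?I t + (1 + \<bar>h s\<bar>) * (w a b N t * indicator ?I t))"
            by (intro Bochner_Integration.integrable_add integrable_mult_right iI wI)
          show "AE t in lborel. \<bar>h t - h s\<bar> * indicator ?I t \<le> (b - a) * indicator ?I t + (1 + \<bar>h s\<bar>) * (w a b N t * indicator ?I t)"
          proof (intro AE_I2)
            fix t
            show "\<bar>h t - h s\<bar> * indicator ?I t \<le> (b - a) * indicator ?I t + (1 + \<bar>h s\<bar>) * (w a b N t * indicator ?I t)"
            proof (cases "t \<in> ?I")
              case True
              then have tN: "\<bar>t\<bar> < N" using d by auto
              show ?thesis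
              proof (cases "t \<in> E a b N")
                case tE: True
                then have "\<bar>h t - h s\<bar> \<le> b - a" using a b by (auto simp: E_def)
                moreover have "0 \<le> (1 + \<bar>h s\<bar>) * w a b N t" using w_nn by simp
                ultimately show ?thesis using True by simp
              next
                case False
                then have "t \<in> {- real N..real N} - E a b N" using tN by auto
                then have "w a b N t = 1 + \<bar>h t\<bar>" by (simp add: w_def)
                moreover have "\<bar>h t - h s\<bar> \<le> (1 + \<bar>h s\<bar>) * (1 + \<bar>h t\<bar>)"
                proof -
                  have "(1 + \<bar>h s\<bar>) * (1 + \<bar>h t\<bar>) = 1 + \<bar>h s\<bar> + \<bar>h t\<bar> + \<bar>h s\<bar> * \<bar>h t\<bar>" by (simp add: algebra_simps)
                  moreover have "0 \<le> \<bar>h s\<bar> * \<bar>h t\<bar>" by simp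
                  ultimately show ?thesis by linarith
                qed
                ultimately show ?thesis using True a b by simp
              qed
            qed simp
          qed
        qed
        also have "\<dots> = (b - a) * (2 * d) + (1 + \<bar>h s\<bar>) * (\<integral>t. w a b N t * indicator ?I t \<partial>lborel)"
          using d iI wI by simp
        also have "(\<integral>t. w a b N t * indicator ?I t \<partial>lborel) = measure (m a b N) ?I"
          using w_nn by (simp add: measure_def em)
        also have "(b - a) * (2 * d) + (1 + \<bar>h s\<bar>) * measure (m a b N) ?I
            \<le> \<epsilon> / 4 * (2 * d) + (1 + \<bar>h s\<bar>) * (\<epsilon> / (2 * (1 + \<bar>h s\<bar>)) * d)"
          using rd(3)[of d] d a b unfolding I by (intro add_mono mult_right_mono mult_left_mono) auto
        also have "(1 + \<bar>h s\<bar>) * (\<epsilon> / (2 * (1 + \<bar>h s\<bar>)) * d) = \<epsilon> / 2 * d"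
        proof -
          have "x * (\<epsilon> / (2 * x) * d) = \<epsilon> / 2 * d" if "x > 0" for x using that by simp
          from this[of "1 + \<bar>h s\<bar>"] show ?thesis by (auto simp only: add_pos_nonneg zero_less_one abs_ge_zero)
        qed
        finally show "(\<integral>t. \<bar>h t - h s\<bar> * indicator ?I t \<partial>lborel) \<le> \<epsilon> * d" by (simp add: algebra_simps)
      qed
    qed
  qed
qed

section \<open>Differentiability of Lipschitz functions of one variable\<close>

lemma integrable_density_witness:
  fixes m :: "real measure"
  assumes fin: "finite_measure m" and sets_m: "sets m = sets borel" and ac: "absolutely_continuous lborel m"
  obtains G where "G \<in> borel_measurable borel" "\<And>t. 0 \<le> G t" "integrable lborel G" "m = density lborel (\<lambda>t. ennreal (G t))"
proof -
  interpret finite_measure m by fact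
  obtain g where g: "g \<in> borel_measurable lborel" "density lborel g = m"
    using sigma_finite_measure.Radon_Nikodym[OF sigma_finite_lborel ac] sets_m by auto
  have "emeasure m UNIV = (\<integral>\<^sup>+t. g t \<partial>lborel)" using g by (subst g(2)[symmetric], subst emeasure_density) auto
  then have fin_g: "(\<integral>\<^sup>+t. g t \<partial>lborel) \<noteq> \<infinity>" using emeasure_finite[of UNIV] by simp
  have AE: "AE t in lborel. g t \<noteq> \<infinity>" by (rule nn_integral_PInf_AE) (use g fin_g in auto)
  define G where "G t = enn2real (g t)" for t
  have [measurable]: "g \<in> borel_measurable borel" using g(1) by simp
  have Gm: "G \<in> borel_measurable borel" unfolding G_def[abs_def] by measurable
  have eq: "AE t in lborel. ennreal (G t) = g t" using AE by eventually_elim (simp add: G_def less_top)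
  have "density lborel (\<lambda>t. ennreal (G t)) = density lborel g"
    by (rule density_cong) (use Gm g eq in auto)
  moreover have "integrable lborel G"
  proof (rule integrableI_nonneg)
    have "(\<integral>\<^sup>+t. ennreal (G t) \<partial>lborel) = (\<integral>\<^sup>+t. g t \<partial>lborel)" by (rule nn_integral_cong_AE[OF eq])
    then show "(\<integral>\<^sup>+t. ennreal (G t) \<partial>lborel) < \<infinity>" using fin_g by (simp add: less_top)
  qed (use Gm in \<open>auto simp: G_def\<close>)
  ultimately show ?thesis using that[OF Gm] g(2) by (simp add: G_def)
qed

text \<open>A null set has open neighbourhoods of small Lebesgue measure. Inside one of them
  Vitali's comparison applies, because \<open>F\<close> grows by at most \<open>10 * L * r\<close>
  over a fivefold interval.\<close>

lemma absolutely_continuous_interval_measure: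
  fixes F :: "real \<Rightarrow> real"
  assumes mono: "\<And>u v. u \<le> v \<Longrightarrow> F u \<le> F v" and lip: "\<And>u v. u \<le> v \<Longrightarrow> F v - F u \<le> L * (v - u)" and L: "L > 0"
    and cont: "continuous_on UNIV F"
  shows "absolutely_continuous lborel (interval_measure F)"
  unfolding absolutely_continuous_def
proof
  fix N :: "real set" assume N: "N \<in> null_sets lborel"
  have "emeasure (interval_measure F) N \<le> 0 + ennreal e" if e: "e > 0" for e
  proof -
    have "N \<in> sets lebesgue" "e / (10 * L) > 0" using N e L by (auto simp: null_sets_def)
    then obtain U where U: "open U" "N \<subseteq> U" "emeasure lebesgue (U - N) < ennreal (e / (10 * L))"
      using sets_lebesgue_outer_open by metis
    have Ule: "emeasure lborel U \<le> ennreal (e / (10 * L))"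
    proof -
      have "emeasure lborel U = emeasure lborel (U - N)"
        using N U(1) by (subst emeasure_Diff_null_set) auto
      also have "\<dots> \<le> ennreal (e / (10 * L))" using U N by (auto simp: null_sets_def)
      finally show ?thesis .
    qed
    have "\<exists>r>0. r \<le> 1 \<and> cball s r \<subseteq> U" if s: "s \<in> N" for s
    proof -
      obtain r where "r > 0" "cball s r \<subseteq> U" using U(1)[unfolded open_contains_cball] s U(2) by blast
      then show ?thesis using subset_cball[of "min r 1" r s] by (intro exI[of _ "min r 1"]) auto
    qed
    then obtain r where r: "\<And>s. s \<in> N \<Longrightarrow> 0 < r s \<and> r s \<le> 1" "\<And>s. s \<in> N \<Longrightarrow> cball s (r s) \<subseteq> U" by metis
    have "\<exists>T\<in>sets borel. N \<subseteq> T \<and> emeasure (interval_measure F) T \<le> ennreal (10 * L) * emeasure lborel U"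
    proof (rule vitali_compare[where r=r, OF _ _ r(1) _ _ r(2)])
      fix s assume s: "s \<in> N"
      have "emeasure (interval_measure F) (cball s (5 * r s)) = ennreal (F (s + 5 * r s) - F (s - 5 * r s))"
        unfolding cball_eq_atLeastAtMost using r(1)[OF s] mono continuous_on_subset[OF cont]
        by (subst emeasure_interval_measure_Icc) auto
      also have "\<dots> \<le> ennreal (10 * L * (2 * r s))"
        using lip[of "s - 5 * r s" "s + 5 * r s"] r(1)[OF s] mult_pos_pos[OF L conjunct1[OF r(1)[OF s]]]
        by (intro ennreal_leI) (simp add: algebra_simps)
      also have "\<dots> = ennreal (10 * L) * emeasure lborel (cball s (r s))"
        using r(1)[OF s] L by (subst ennreal_mult) (auto simp: cball_eq_atLeastAtMost)
      finally show "emeasure (interval_measure F) (cball s (5 * r s)) \<le> ennreal (10 * L) * emeasure lborel (cball s (r s))" .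
    qed (use U in auto)
    then obtain T where T: "T \<in> sets borel" "N \<subseteq> T" "emeasure (interval_measure F) T \<le> ennreal (10 * L) * emeasure lborel U" by blast
    have "emeasure (interval_measure F) N \<le> emeasure (interval_measure F) T"
      using T by (intro emeasure_mono) auto
    also note T(3)
    also have "ennreal (10 * L) * emeasure lborel U \<le> ennreal (10 * L) * ennreal (e / (10 * L))"
      using Ule by (intro mult_left_mono) auto
    also have "\<dots> = ennreal e" using L e by (subst ennreal_mult[symmetric]) auto
    finally show ?thesis by simp
  qed
  then have "emeasure (interval_measure F) N \<le> 0" by (rule ennreal_le_epsilon)
  then show "N \<in> null_sets (interval_measure F)" using N by (auto simp: null_sets_def)
qed

text \<open>Adding \<open>L * t\<close> makes the function nondecreasing, so it has an absolutely
  continuous Stieltjes measure; at Lebesgue points of the density the difference quotients converge.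
  Restriction to bounded windows makes the density integrable.\<close>

lemma AE_differentiable_lipschitz:
  fixes f :: "real \<Rightarrow> real"
  assumes "L-lipschitz_on UNIV f"
  shows "AE s in lborel. \<exists>D. (f has_real_derivative D) (at s)"
proof -
  have L: "L \<ge> 0" using assms by (rule lipschitz_on_nonneg)
  have fl: "\<bar>f v - f u\<bar> \<le> L * \<bar>v - u\<bar>" for u v using lipschitz_onD[OF assms, of v u] by (simp add: dist_real_def)
  define F where "F t = f t + L * t" for t
  have mono: "F u \<le> F v" and lip: "F v - F u \<le> (2 * L + 1) * (v - u)" if "u \<le> v" for u v
    using fl[of v u] that by (auto simp: F_def algebra_simps abs_le_iff)
  have cont: "continuous_on UNIV F" unfolding F_def
    by (intro continuous_intros lipschitz_on_continuous_on[OF assms])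
  have rc: "continuous (at_right t) F" for t
    using cont by (simp add: continuous_on_eq_continuous_at continuous_at_imp_continuous_at_within)
  have ac: "absolutely_continuous lborel (interval_measure F)"
    by (rule absolutely_continuous_interval_measure[OF mono lip _ cont]) (use L in auto)
  have "AE s in lborel. \<bar>s\<bar> < real N \<longrightarrow> (\<exists>D. (F has_real_derivative D) (at s))" for N
  proof -
    let ?m = "density (interval_measure F) (indicator {- real N<..N})"
    have em: "emeasure ?m A = emeasure (interval_measure F) (A \<inter> {- real N<..N})" if "A \<in> sets borel" for A
      using that by (intro emeasure_density_indicator) auto
    have fin: "finite_measure ?m"
      by (rule finite_measureI) (simp add: em emeasure_interval_measure_Ioc mono rc)
    have "absolutely_continuous lborel ?m"
      unfolding absolutely_continuous_def
    proof
      fix A :: "real set" assume A: "A \<in> null_sets lborel"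
      then have nA: "A \<in> null_sets (interval_measure F)" using ac by (auto simp: absolutely_continuous_def)
      have "emeasure (interval_measure F) (A \<inter> {- real N<..N}) = 0"
        by (rule emeasure_eq_0[OF null_setsD2[OF nA] null_setsD1[OF nA]]) blast
      then show "A \<in> null_sets ?m" using A by (simp add: null_sets_def em)
    qed
    then obtain G where G: "G \<in> borel_measurable borel" "\<And>t. 0 \<le> G t" "integrable lborel G" "?m = density lborel (\<lambda>t. ennreal (G t))"
      by (rule integrable_density_witness[OF fin, rotated]) (rule that, assumption+, simp)
    have Fdiff: "F v - F u = (\<integral>t. G t * indicator {u<..v} t \<partial>lborel)" if "u \<le> v" "- real N \<le> u" "v \<le> real N" for u v
    proof -
      have "{u<..v} \<inter> {- real N<..N} = {u<..v}" using that by auto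
      then have "ennreal (F v - F u) = emeasure ?m {u<..v}"
        using that by (simp add: em emeasure_interval_measure_Ioc mono rc)
      also have "\<dots> = ennreal (\<integral>t. G t * indicator {u<..v} t \<partial>lborel)"
        unfolding G(4) by (rule emeasure_density_real[OF G(3,2)]) simp
      finally show ?thesis using mono[OF that(1)] G(2)
        by (subst (asm) ennreal_inj) (auto intro!: integral_nonneg_AE)
    qed
    show ?thesis using AE_lebesgue_point[OF G(3)]
    proof eventually_elim
      case (elim s)
      show ?case
      proof
        assume s: "\<bar>s\<bar> < real N"
        have approx: "\<bar>F v - F u - G s * (v - u)\<bar> \<le> (\<integral>t. \<bar>G t - G s\<bar> * indicator {s - d..s + d} t \<partial>lborel)"
          if "u \<le> v" "s - d \<le> u" "v \<le> s + d" "d < N - \<bar>s\<bar>" for u v d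
        proof -
          have i1: "integrable lborel (\<lambda>t. G t * indicator {u<..v} t)" by (intro integrable_real_mult_indicator G) auto
          have i2: "integrable lborel (\<lambda>t. G s * indicator {u<..v} t)"
            using \<open>u \<le> v\<close> by (intro integrable_mult_right integrable_real_indicator) auto
          have "F v - F u - G s * (v - u) = (\<integral>t. G t * indicator {u<..v} t \<partial>lborel) - (\<integral>t. G s * indicator {u<..v} t \<partial>lborel)"
            using that by (subst Fdiff) auto
          also have "\<dots> = (\<integral>t. G t * indicator {u<..v} t - G s * indicator {u<..v} t \<partial>lborel)"
            using i1 i2 by simp
          also have "\<bar>\<dots>\<bar> \<le> (\<integral>t. \<bar>G t * indicator {u<..v} t - G s * indicator {u<..v} t\<bar> \<partial>lborel)" by (rule integral_abs_bound)
          also have "\<dots> \<le> (\<integral>t. \<bar>G t * indicator {s - d..s + d} t - G s * indicator {s - d..s + d} t\<bar> \<partial>lborel)"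
            using that i1 i2
            by (intro integral_mono integrable_abs Bochner_Integration.integrable_diff integrable_real_mult_indicator G
                integrable_mult_right integrable_real_indicator) (auto split: split_indicator)
          also have "\<dots> = (\<integral>t. \<bar>G t - G s\<bar> * indicator {s - d..s + d} t \<partial>lborel)"
            by (intro Bochner_Integration.integral_cong) (auto split: split_indicator)
          finally show ?thesis .
        qed
        have "((\<lambda>z. (F (s + z) - F s) / z) \<longlongrightarrow> G s) (at 0)"
        proof (rule LIM_I)
          fix e :: real assume "e > 0"
          then obtain r0 where r0: "r0 > 0" "\<And>r. 0 < r \<Longrightarrow> r < r0 \<Longrightarrow>
            (\<integral>t. \<bar>G t - G s\<bar> * indicator {s - r..s + r} t \<partial>lborel) \<le> e / 2 * r"
            using elim unfolding lebesgue_point_def by (meson half_gt_zero)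
          show "\<exists>d>0. \<forall>z. z \<noteq> 0 \<and> norm (z - 0) < d \<longrightarrow> norm ((F (s + z) - F s) / z - G s) < e"
          proof (rule exI[of _ "min r0 (N - \<bar>s\<bar>)"], intro conjI allI impI)
            show "0 < min r0 (N - \<bar>s\<bar>)" using r0 s by simp
            fix z :: real assume z: "z \<noteq> 0 \<and> norm (z - 0) < min r0 (N - \<bar>s\<bar>)"
            have "\<bar>F (s + z) - F s - G s * z\<bar> \<le> (\<integral>t. \<bar>G t - G s\<bar> * indicator {s - \<bar>z\<bar>..s + \<bar>z\<bar>} t \<partial>lborel)"
            proof (cases "z > 0")
              case True
              then show ?thesis using approx[of s "s + z" "\<bar>z\<bar>"] z by simp
            next
              case False
              then show ?thesis using approx[of "s + z" s "\<bar>z\<bar>"] z by (simp add: abs_minus_commute algebra_simps)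
            qed
            also have "\<dots> \<le> e / 2 * \<bar>z\<bar>" using r0(2)[of "\<bar>z\<bar>"] z by simp
            finally have "\<bar>F (s + z) - F s - G s * z\<bar> / \<bar>z\<bar> \<le> e / 2" using z by (simp add: field_simps)
            moreover have "(F (s + z) - F s) / z - G s = (F (s + z) - F s - G s * z) / z" using z by (simp add: field_simps)
            ultimately have "norm ((F (s + z) - F s) / z - G s) \<le> e / 2" by (simp only: real_norm_def abs_divide)
            then show "norm ((F (s + z) - F s) / z - G s) < e" using \<open>e > 0\<close> by linarith
          qed
        qed
        then show "\<exists>D. (F has_real_derivative D) (at s)" by (auto simp: DERIV_def)
      qed
    qed
  qed
  then have "AE s in lborel. \<forall>N. \<bar>s\<bar> < real N \<longrightarrow> (\<exists>D. (F has_real_derivative D) (at s))"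
    unfolding AE_all_countable by blast
  then show ?thesis
  proof eventually_elim
    case (elim s)
    obtain N where "\<bar>s\<bar> < real N" using reals_Archimedean2 by blast
    with elim obtain D where D: "(F has_real_derivative D) (at s)" by blast
    have "((\<lambda>t. F t - L * t) has_real_derivative D - L) (at s)"
      using D by (auto intro!: derivative_eq_intros)
    then show ?case by (auto simp: F_def)
  qed
qed

subsection \<open>Blow-up along a Lipschitz graph\<close>

lemma compact_support_radius:
  fixes \<Phi> :: "'a::euclidean_space \<Rightarrow> real"
  assumes "continuous_on UNIV \<Phi>" "bounded {y. \<Phi> y \<noteq> 0}"
  obtains R B where "R > 0" "\<And>y. \<Phi> y \<noteq> 0 \<Longrightarrow> norm y \<le> R" "B > 0" "\<And>y. \<bar>\<Phi> y\<bar> \<le> B"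
proof -
  obtain R where R: "R > 0" "\<And>y. \<Phi> y \<noteq> 0 \<Longrightarrow> norm y \<le> R" using assms(2) unfolding bounded_pos by blast
  have "bounded (\<Phi> ` cball 0 R)"
    by (intro compact_imp_bounded compact_continuous_image continuous_on_subset[OF assms(1)]) auto
  then obtain B where B: "B > 0" "\<And>y. y \<in> cball 0 R \<Longrightarrow> \<bar>\<Phi> y\<bar> \<le> B" unfolding bounded_pos by auto
  have "\<bar>\<Phi> y\<bar> \<le> B" for y
    using R(2)[of y] B(2)[of y] B(1) by (cases "\<Phi> y = 0") auto
  with R B(1) show ?thesis using that by blast
qed

text \<open>Freezing \<open>h\<close> at \<open>s\<close> leaves an integral that converges after
  the substitution \<open>t = s + r z\<close>, by differentiability of \<gamma>; the remainder is
  controlled by the Lebesgue point. Since the \<open>i\<close>-th coordinate of \<gamma> is the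
  parameter, a rescaled test function sees only \<open>\<bar>t - s\<bar> \<le> R * r\<close>, which
  provides the dominating function.\<close>

lemma tendsto_blow_up_graph:
  fixes \<gamma> :: "real \<Rightarrow> real^'n"
  assumes \<gamma>i: "\<And>t. \<gamma> t $ i = t" and \<gamma>c: "continuous_on UNIV \<gamma>" and v: "(\<gamma> has_vector_derivative v) (at s)"
    and h: "integrable lborel h" "lebesgue_point h s"
    and \<Phi>: "continuous_on UNIV \<Phi>" "bounded {y. \<Phi> y \<noteq> 0}"
  shows "((\<lambda>r. (1 / r) * (\<integral>t. \<Phi> ((1 / r) *\<^sub>R (\<gamma> t - \<gamma> s)) * h t \<partial>lborel)) \<longlongrightarrow>
     h s * (\<integral>z. \<Phi> (z *\<^sub>R v) \<partial>lborel)) (at_right 0)"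
proof -
  obtain R B where RB: "R > 0" "\<And>y. \<Phi> y \<noteq> 0 \<Longrightarrow> norm y \<le> R" "B > 0" "\<And>y. \<bar>\<Phi> y\<bar> \<le> B"
    using compact_support_radius[OF \<Phi>] by blast
  have [measurable]: "\<Phi> \<in> borel_measurable borel" "\<gamma> \<in> borel_measurable borel"
    using \<Phi>(1) \<gamma>c by (auto intro: borel_measurable_continuous_onI)
  have [measurable]: "h \<in> borel_measurable borel" using h(1) by simp
  have near: "\<bar>t - s\<bar> \<le> R * r" if "\<Phi> ((1 / r) *\<^sub>R (\<gamma> t - \<gamma> s)) \<noteq> 0" "r > 0" for t r
  proof -
    have "\<bar>((1 / r) *\<^sub>R (\<gamma> t - \<gamma> s)) $ i\<bar> \<le> R"
      using component_le_norm_cart[of "(1 / r) *\<^sub>R (\<gamma> t - \<gamma> s)" i] RB(2)[OF that(1)] by linarith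
    then show ?thesis using that(2) by (simp add: \<gamma>i abs_mult field_simps)
  qed
  define I where "I r t = (indicator {s - R * r..s + R * r} t :: real)" for r t
  have Iint: "integrable lborel (I r)" if "r > 0" for r
    unfolding I_def[abs_def] using that RB(1) by (intro integrable_real_indicator) auto
  have \<Phi>I: "\<bar>\<Phi> ((1 / r) *\<^sub>R (\<gamma> t - \<gamma> s))\<bar> \<le> B * I r t" if "r > 0" for r t
  proof (cases "\<Phi> ((1 / r) *\<^sub>R (\<gamma> t - \<gamma> s)) = 0")
    case False
    then have "\<bar>t - s\<bar> \<le> R * r" using near that by blast
    then have "I r t = 1" by (auto simp: I_def abs_le_iff)
    then show ?thesis using RB(4) by simp
  qed (use RB(3) in \<open>simp add: I_def\<close>)
  have \<Phi>int: "integrable lborel (\<lambda>t. \<Phi> ((1 / r) *\<^sub>R (\<gamma> t - \<gamma> s)))" if "r > 0" for r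
    by (rule Bochner_Integration.integrable_bound[OF integrable_mult_right[OF Iint[OF that], of B]])
       (use \<Phi>I[OF that] RB(3) in \<open>auto simp: I_def\<close>)
  have \<Phi>hint: "integrable lborel (\<lambda>t. \<Phi> ((1 / r) *\<^sub>R (\<gamma> t - \<gamma> s)) * h t)" for r
  proof (rule Bochner_Integration.integrable_bound[OF integrable_mult_right[OF integrable_abs[OF h(1)], of B]])
    show "AE t in lborel. norm (\<Phi> ((1 / r) *\<^sub>R (\<gamma> t - \<gamma> s)) * h t) \<le> norm (B * \<bar>h t\<bar>)"
      using RB(3,4) by (intro AE_I2) (auto simp: abs_mult intro!: mult_right_mono)
  qed measurable
  have main: "((\<lambda>r. (1 / r) * (\<integral>t. \<Phi> ((1 / r) *\<^sub>R (\<gamma> t - \<gamma> s)) \<partial>lborel)) \<longlongrightarrow> (\<integral>z. \<Phi> (z *\<^sub>R v) \<partial>lborel)) (at_right 0)"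
  proof (rule tendsto_at_right_sequentially[OF zero_less_one])
    fix S :: "nat \<Rightarrow> real" assume S: "\<And>n. 0 < S n" "\<And>n. S n < 1" "decseq S" "S \<longlonglongrightarrow> 0"
    have sub: "(1 / r) * (\<integral>t. \<Phi> ((1 / r) *\<^sub>R (\<gamma> t - \<gamma> s)) \<partial>lborel) = (\<integral>z. \<Phi> ((1 / r) *\<^sub>R (\<gamma> (s + r * z) - \<gamma> s)) \<partial>lborel)"
      if "r > 0" for r
      using lborel_integral_real_affine[of r "\<lambda>t. \<Phi> ((1 / r) *\<^sub>R (\<gamma> t - \<gamma> s))" s] that by simp
    have "(\<lambda>n. \<integral>z. \<Phi> ((1 / S n) *\<^sub>R (\<gamma> (s + S n * z) - \<gamma> s)) \<partial>lborel) \<longlonglongrightarrow> (\<integral>z. \<Phi> (z *\<^sub>R v) \<partial>lborel)"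
    proof (rule integral_dominated_convergence[where w="\<lambda>z. B * indicator {-R..R} z"])
      show "integrable lborel (\<lambda>z. B * indicator {-R..R} z)"
        using RB(1) by (intro integrable_mult_right integrable_real_indicator) auto
      show "AE z in lborel. norm (\<Phi> ((1 / S n) *\<^sub>R (\<gamma> (s + S n * z) - \<gamma> s))) \<le> B * indicator {-R..R} z" for n
      proof (intro AE_I2)
        fix z
        show "norm (\<Phi> ((1 / S n) *\<^sub>R (\<gamma> (s + S n * z) - \<gamma> s))) \<le> B * indicator {-R..R} z"
        proof (cases "\<Phi> ((1 / S n) *\<^sub>R (\<gamma> (s + S n * z) - \<gamma> s)) = 0")
          case False
          have "\<bar>S n * z\<bar> \<le> R * S n" using near[OF False S(1)] by simp
          then have "\<bar>z\<bar> \<le> R" using S(1)[of n] by (simp add: abs_mult mult.commute)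
          then have "z \<in> {-R..R}" by (simp add: abs_le_iff)
          then show ?thesis using RB(4) by simp
        qed (use RB(3) in simp)
      qed
      show "AE z in lborel. (\<lambda>n. \<Phi> ((1 / S n) *\<^sub>R (\<gamma> (s + S n * z) - \<gamma> s))) \<longlonglongrightarrow> \<Phi> (z *\<^sub>R v)"
      proof (intro AE_I2 isCont_tendsto_compose[of _ \<Phi>])
        fix z
        show "isCont \<Phi> (z *\<^sub>R v)" using \<Phi>(1) by (simp add: continuous_on_eq_continuous_at)
        show "(\<lambda>n. (1 / S n) *\<^sub>R (\<gamma> (s + S n * z) - \<gamma> s)) \<longlonglongrightarrow> z *\<^sub>R v"
        proof (cases "z = 0")
          case False
          have "((\<lambda>h. norm (\<gamma> (s + h) - \<gamma> s - h *\<^sub>R v) / norm h) \<longlongrightarrow> 0) (at 0)"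
            using v unfolding has_vector_derivative_def has_derivative_at by blast
          then have "((\<lambda>h. norm ((1 / h) *\<^sub>R (\<gamma> (s + h) - \<gamma> s) - v)) \<longlongrightarrow> 0) (at 0)"
          proof (rule Lim_transform_eventually)
            show "\<forall>\<^sub>F h in at 0. norm (\<gamma> (s + h) - \<gamma> s - h *\<^sub>R v) / norm h = norm ((1 / h) *\<^sub>R (\<gamma> (s + h) - \<gamma> s) - v)"
              unfolding eventually_at
            proof (intro exI[of _ 1] conjI ballI impI)
              fix h :: real assume "h \<noteq> 0 \<and> dist h 0 < 1"
              then have "(1 / h) *\<^sub>R (\<gamma> (s + h) - \<gamma> s) - v = (1 / h) *\<^sub>R (\<gamma> (s + h) - \<gamma> s - h *\<^sub>R v)"
                by (simp add: scaleR_diff_right)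
              then show "norm (\<gamma> (s + h) - \<gamma> s - h *\<^sub>R v) / norm h = norm ((1 / h) *\<^sub>R (\<gamma> (s + h) - \<gamma> s) - v)"
                by simp
            qed simp
          qed
          then have "((\<lambda>h. (1 / h) *\<^sub>R (\<gamma> (s + h) - \<gamma> s)) \<longlongrightarrow> v) (at 0)"
            by (rule Lim_null[THEN iffD2, OF tendsto_norm_zero_cancel])
          moreover have "filterlim (\<lambda>n. S n * z) (at 0) sequentially"
            unfolding filterlim_at
          proof
            show "\<forall>\<^sub>F n in sequentially. S n * z \<in> UNIV \<and> S n * z \<noteq> 0"
              using False S(1) by (auto simp: less_imp_neq[symmetric])
            have "(\<lambda>n. S n * z) \<longlonglongrightarrow> 0 * z" by (intro tendsto_intros S(4))
            then show "(\<lambda>n. S n * z) \<longlonglongrightarrow> 0" by simp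
          qed
          ultimately have "(\<lambda>n. (1 / (S n * z)) *\<^sub>R (\<gamma> (s + S n * z) - \<gamma> s)) \<longlonglongrightarrow> v"
            by (rule filterlim_compose)
          then have "(\<lambda>n. z *\<^sub>R ((1 / (S n * z)) *\<^sub>R (\<gamma> (s + S n * z) - \<gamma> s))) \<longlonglongrightarrow> z *\<^sub>R v"
            by (intro tendsto_intros)
          then show ?thesis using False by simp
        qed simp
      qed
    qed measurable
    then show "(\<lambda>n. (1 / S n) * (\<integral>t. \<Phi> ((1 / S n) *\<^sub>R (\<gamma> t - \<gamma> s)) \<partial>lborel)) \<longlonglongrightarrow> (\<integral>z. \<Phi> (z *\<^sub>R v) \<partial>lborel)"
      unfolding sub[OF S(1)] .
  qed
  have err: "((\<lambda>r. (1 / r) * (\<integral>t. \<Phi> ((1 / r) *\<^sub>R (\<gamma> t - \<gamma> s)) * (h t - h s) \<partial>lborel)) \<longlongrightarrow> 0) (at_right 0)"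
  proof (rule tendstoI)
    fix e :: real assume e: "e > 0"
    have "e / (2 * B * R) > 0" using e RB by simp
    then obtain r0 where r0: "r0 > 0" "\<And>r. 0 < r \<Longrightarrow> r < r0 \<Longrightarrow>
       (\<integral>t. \<bar>h t - h s\<bar> * indicator {s - r..s + r} t \<partial>lborel) \<le> e / (2 * B * R) * r"
      using h(2) unfolding lebesgue_point_def by meson
    have "\<forall>\<^sub>F r in at_right 0. 0 < r \<and> r < r0 / R"
      using r0(1) RB(1) by (intro eventually_conj eventually_at_right_less eventually_at_right_real[of 0 "r0 / R", THEN eventually_mono]) auto
    then show "\<forall>\<^sub>F r in at_right 0. dist ((1 / r) * (\<integral>t. \<Phi> ((1 / r) *\<^sub>R (\<gamma> t - \<gamma> s)) * (h t - h s) \<partial>lborel)) 0 < e"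
    proof eventually_elim
      fix r assume r: "0 < r \<and> r < r0 / R"
      have Rr: "0 < R * r" "R * r < r0" using r RB(1) by (auto simp: field_simps)
      have hI: "integrable lborel (\<lambda>t. \<bar>h t - h s\<bar> * I r t)"
      proof -
        have "integrable lborel (\<lambda>t. \<bar>h t * I r t - h s * I r t\<bar>)" unfolding I_def
          using Rr by (intro integrable_abs Bochner_Integration.integrable_diff integrable_real_mult_indicator h(1)
             integrable_mult_right integrable_real_indicator) auto
        moreover have "\<bar>h t * I r t - h s * I r t\<bar> = \<bar>h t - h s\<bar> * I r t" for t
          by (simp add: I_def split: split_indicator)
        ultimately show ?thesis by simp
      qed
      have "\<bar>\<integral>t. \<Phi> ((1 / r) *\<^sub>R (\<gamma> t - \<gamma> s)) * (h t - h s) \<partial>lborel\<bar>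
         \<le> (\<integral>t. \<bar>\<Phi> ((1 / r) *\<^sub>R (\<gamma> t - \<gamma> s)) * (h t - h s)\<bar> \<partial>lborel)" by (rule integral_abs_bound)
      also have "\<dots> \<le> (\<integral>t. B * (\<bar>h t - h s\<bar> * I r t) \<partial>lborel)"
      proof (rule integral_mono)
        show "integrable lborel (\<lambda>t. \<bar>\<Phi> ((1 / r) *\<^sub>R (\<gamma> t - \<gamma> s)) * (h t - h s)\<bar>)"
          using Bochner_Integration.integrable_diff[OF \<Phi>hint[of r] integrable_mult_left[OF \<Phi>int[of r], of "h s"]] r
          by (intro integrable_abs) (simp add: algebra_simps)
        show "integrable lborel (\<lambda>t. B * (\<bar>h t - h s\<bar> * I r t))" by (intro integrable_mult_right hI)
        show "\<bar>\<Phi> ((1 / r) *\<^sub>R (\<gamma> t - \<gamma> s)) * (h t - h s)\<bar> \<le> B * (\<bar>h t - h s\<bar> * I r t)" for t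
          using mult_right_mono[OF \<Phi>I[of r t], of "\<bar>h t - h s\<bar>"] r by (simp add: abs_mult mult.commute mult.left_commute)
      qed
      also have "\<dots> = B * (\<integral>t. \<bar>h t - h s\<bar> * I r t \<partial>lborel)" by simp
      also have "\<dots> \<le> B * (e / (2 * B * R) * (R * r))"
        using r0(2)[OF Rr] RB(3) unfolding I_def by (intro mult_left_mono) auto
      also have "\<dots> = e / 2 * r" using RB by simp
      finally have "\<bar>\<integral>t. \<Phi> ((1 / r) *\<^sub>R (\<gamma> t - \<gamma> s)) * (h t - h s) \<partial>lborel\<bar> / r \<le> e / 2" using r by (simp add: field_simps)
      moreover have "dist ((1 / r) * (\<integral>t. \<Phi> ((1 / r) *\<^sub>R (\<gamma> t - \<gamma> s)) * (h t - h s) \<partial>lborel)) 0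
          = \<bar>\<integral>t. \<Phi> ((1 / r) *\<^sub>R (\<gamma> t - \<gamma> s)) * (h t - h s) \<partial>lborel\<bar> / r"
        using r by (simp add: abs_mult)
      ultimately show "dist ((1 / r) * (\<integral>t. \<Phi> ((1 / r) *\<^sub>R (\<gamma> t - \<gamma> s)) * (h t - h s) \<partial>lborel)) 0 < e"
        using e by linarith
    qed
  qed
  have "((\<lambda>r. h s * ((1 / r) * (\<integral>t. \<Phi> ((1 / r) *\<^sub>R (\<gamma> t - \<gamma> s)) \<partial>lborel))
      + (1 / r) * (\<integral>t. \<Phi> ((1 / r) *\<^sub>R (\<gamma> t - \<gamma> s)) * (h t - h s) \<partial>lborel)) \<longlongrightarrow> h s * (\<integral>z. \<Phi> (z *\<^sub>R v) \<partial>lborel) + 0) (at_right 0)"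
    by (intro tendsto_intros main err)
  moreover have "\<forall>\<^sub>F r in at_right 0. h s * ((1 / r) * (\<integral>t. \<Phi> ((1 / r) *\<^sub>R (\<gamma> t - \<gamma> s)) \<partial>lborel))
      + (1 / r) * (\<integral>t. \<Phi> ((1 / r) *\<^sub>R (\<gamma> t - \<gamma> s)) * (h t - h s) \<partial>lborel)
      = (1 / r) * (\<integral>t. \<Phi> ((1 / r) *\<^sub>R (\<gamma> t - \<gamma> s)) * h t \<partial>lborel)"
    using eventually_at_right_less[of 0]
  proof eventually_elim
    fix r :: real assume r: "0 < r"
    have "(\<integral>t. \<Phi> ((1 / r) *\<^sub>R (\<gamma> t - \<gamma> s)) * (h t - h s) \<partial>lborel)
       = (\<integral>t. \<Phi> ((1 / r) *\<^sub>R (\<gamma> t - \<gamma> s)) * h t - \<Phi> ((1 / r) *\<^sub>R (\<gamma> t - \<gamma> s)) * h s \<partial>lborel)"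
      by (simp add: right_diff_distrib)
    also have "\<dots> = (\<integral>t. \<Phi> ((1 / r) *\<^sub>R (\<gamma> t - \<gamma> s)) * h t \<partial>lborel) - (\<integral>t. \<Phi> ((1 / r) *\<^sub>R (\<gamma> t - \<gamma> s)) \<partial>lborel) * h s"
      using \<Phi>hint[of r] \<Phi>int[OF r] by simp
    finally have *: "(\<integral>t. \<Phi> ((1 / r) *\<^sub>R (\<gamma> t - \<gamma> s)) * (h t - h s) \<partial>lborel) = \<dots>" .
    have "X = Y - Z * H \<Longrightarrow> H * ((1 / r) * Z) + (1 / r) * X = (1 / r) * Y" for X Y Z H
      by (simp add: diff_divide_distrib mult.commute)
    from this[OF *] show "h s * ((1 / r) * (\<integral>t. \<Phi> ((1 / r) *\<^sub>R (\<gamma> t - \<gamma> s)) \<partial>lborel))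
      + (1 / r) * (\<integral>t. \<Phi> ((1 / r) *\<^sub>R (\<gamma> t - \<gamma> s)) * (h t - h s) \<partial>lborel)
      = (1 / r) * (\<integral>t. \<Phi> ((1 / r) *\<^sub>R (\<gamma> t - \<gamma> s)) * h t \<partial>lborel)" .
  qed
  ultimately show ?thesis
    using Lim_transform_eventually by fastforce
qed

subsection \<open>Tangents of matrix-valued divergence-free measures\<close>

text \<open>All rows are kept together because one tangent line has to serve them all; each row with
  either sign is an instance of the scalar locale.\<close>

locale vec_divfree = finite_measure \<nu>
  for \<nu> :: "(real^'n) measure" +
  fixes \<Omega> :: "(real^'n) set" and \<tau> :: "real^'n \<Rightarrow> real^'n^'N"
  assumes sets_nu [measurable_cong]: "sets \<nu> = sets borel"
    and open_Omega: "open \<Omega>"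
    and tau_meas [measurable]: "\<tau> \<in> borel_measurable borel"
    and tau_bound: "\<And>x. norm (\<tau> x) \<le> 1"
    and divfree: "\<And>\<phi> k. test_fun \<Omega> \<phi> \<Longrightarrow> (\<integral>x. grad \<phi> x \<bullet> (\<tau> x $ k) \<partial>\<nu>) = 0"
begin

lemma space_nu [simp]: "space \<nu> = UNIV"
  using sets_eq_imp_space_eq[OF sets_nu] by simp

lemma borel_nu: "f \<in> borel_measurable borel \<Longrightarrow> f \<in> borel_measurable \<nu>"
  using measurable_cong_sets[OF sets_nu refl] by blast

lemma tau_row_meas [measurable]: "(\<lambda>x. \<tau> x $ k) \<in> borel_measurable borel"
  by (rule measurable_compose[OF tau_meas]) (intro borel_measurable_continuous_onI continuous_intros)

lemma tau_entry_bound: "\<bar>\<tau> x $ k $ i\<bar> \<le> 1"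
  using component_le_norm_cart[of "\<tau> x $ k" i] Finite_Cartesian_Product.norm_nth_le[of "\<tau> x" k] tau_bound[of x]
  by linarith

lemma divfree_row:
  assumes "\<bar>\<sigma>\<bar> \<le> 1" shows "divfree \<nu> \<Omega> (\<lambda>x. \<sigma> *\<^sub>R (\<tau> x $ k))"
proof unfold_locales
  show "AE x in \<nu>. norm (\<sigma> *\<^sub>R (\<tau> x $ k)) \<le> 1"
  proof (intro AE_I2)
    fix x
    have "norm (\<tau> x $ k) \<le> 1"
      using Finite_Cartesian_Product.norm_nth_le[of "\<tau> x" k] tau_bound[of x] by linarith
    then have "\<bar>\<sigma>\<bar> * norm (\<tau> x $ k) \<le> 1 * 1" using assms by (intro mult_mono) auto
    then show "norm (\<sigma> *\<^sub>R (\<tau> x $ k)) \<le> 1" by simp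
  qed
  show "(\<integral>x. grad \<phi> x \<bullet> (\<sigma> *\<^sub>R (\<tau> x $ k)) \<partial>\<nu>) = 0" if "test_fun \<Omega> \<phi>" for \<phi>
    using divfree[OF that, of k] by simp
qed (use sets_nu open_Omega in auto)

end

text \<open>The rescaled test function lives in a ball of radius \<open>R * r\<close>, hence in a
  slab of that half-width, where the mass off \<open>E\<close> is of smaller order than
  \<open>r\<close>.\<close>

lemma zero_slab_density_blow_up:
  fixes \<nu> :: "(real^'n) measure"
  assumes "finite_measure \<nu>" and sets_nu: "sets \<nu> = sets borel" and E: "E \<in> sets borel"
    and z: "zero_slab_density (density \<nu> (indicator (- E))) (\<lambda>y. y $ i) x"
    and W: "W \<in> borel_measurable borel" "\<And>y. \<bar>W y\<bar> \<le> 1"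
    and \<Phi>: "continuous_on UNIV \<Phi>" "bounded {y. \<Phi> y \<noteq> 0}"
  shows "((\<lambda>r. (1 / r) * (\<integral>y. \<Phi> ((1 / r) *\<^sub>R (y - x)) * W y * indicator (- E) y \<partial>\<nu>)) \<longlongrightarrow> 0) (at_right 0)"
proof (rule tendstoI)
  interpret finite_measure \<nu> by fact
  fix e :: real assume e: "e > 0"
  obtain R B where RB: "R > 0" "\<And>y. \<Phi> y \<noteq> 0 \<Longrightarrow> norm y \<le> R" "B > 0" "\<And>y. \<bar>\<Phi> y\<bar> \<le> B"
    using compact_support_radius[OF \<Phi>] by blast
  have "e / (2 * B * R) > 0" using e RB by simp
  then obtain r0 d0 where rd: "r0 > 0" "d0 > 0" "\<And>d. 0 < d \<Longrightarrow> d < d0 \<Longrightarrow>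
     measure (density \<nu> (indicator (- E))) (ball x r0 \<inter> {y. \<bar>y $ i - x $ i\<bar> \<le> d}) \<le> e / (2 * B * R) * d"
    using zero_slab_densityE[OF z] by blast
  have "0 < min r0 d0 / R" using rd RB(1) by simp
  then have "\<forall>\<^sub>F r in at_right 0. r \<in> {0<..<min r0 d0 / R}" by (rule eventually_at_right_real)
  then show "\<forall>\<^sub>F r in at_right 0. dist ((1 / r) * (\<integral>y. \<Phi> ((1 / r) *\<^sub>R (y - x)) * W y * indicator (- E) y \<partial>\<nu>)) 0 < e"
  proof eventually_elim
    fix r assume r: "r \<in> {0<..<min r0 d0 / R}"
    then have Rr: "0 < R * r" "R * r < r0" "R * r < d0" "r > 0" using RB(1) by (auto simp: field_simps)
    let ?S = "ball x r0 \<inter> {y. \<bar>y $ i - x $ i\<bar> \<le> R * r} \<inter> (- E)"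
    have S: "?S \<in> sets \<nu>" using E unfolding sets_nu by measurable
    have pt: "\<bar>\<Phi> ((1 / r) *\<^sub>R (y - x)) * W y * indicator (- E) y\<bar> \<le> B * indicator ?S y" for y
    proof (cases "\<Phi> ((1 / r) *\<^sub>R (y - x)) = 0 \<or> y \<in> E")
      case True
      then show ?thesis using RB(3) by auto
    next
      case False
      then have "norm ((1 / r) *\<^sub>R (y - x)) \<le> R" using RB(2) by blast
      then have "1 / r * norm (y - x) \<le> R" using Rr(4) by (simp only: norm_scaleR) simp
      then have n: "norm (y - x) \<le> R * r" using Rr(4) by (simp add: field_simps)
      then have "y \<in> ball x r0" using Rr(2) by (simp add: dist_norm norm_minus_commute)
      moreover have "\<bar>y $ i - x $ i\<bar> \<le> R * r" using n component_le_norm_cart[of "y - x" i] by simp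
      ultimately have "indicator ?S y = (1::real)" using False by simp
      moreover have "\<bar>\<Phi> ((1 / r) *\<^sub>R (y - x))\<bar> * \<bar>W y\<bar> \<le> B * 1" using RB(3,4) W(2) by (intro mult_mono) auto
      ultimately show ?thesis using False by (simp add: abs_mult)
    qed
    have [measurable]: "\<Phi> \<in> borel_measurable borel" "E \<in> sets borel" "W \<in> borel_measurable borel"
      using \<Phi>(1) E W(1) by (auto intro: borel_measurable_continuous_onI)
    have iS: "integrable \<nu> (\<lambda>y. B * indicator ?S y)"
      using S by (intro integrable_mult_right integrable_real_indicator) (auto simp: emeasure_eq_measure)
    have "\<bar>\<integral>y. \<Phi> ((1 / r) *\<^sub>R (y - x)) * W y * indicator (- E) y \<partial>\<nu>\<bar>
       \<le> (\<integral>y. \<bar>\<Phi> ((1 / r) *\<^sub>R (y - x)) * W y * indicator (- E) y\<bar> \<partial>\<nu>)" by (rule integral_abs_bound)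
    also have "\<dots> \<le> (\<integral>y. B * indicator ?S y \<partial>\<nu>)"
    proof (rule integral_mono[OF _ iS pt])
      have "(\<lambda>y. \<Phi> ((1 / r) *\<^sub>R (y - x)) * W y * indicator (- E) y) \<in> borel_measurable \<nu>"
        unfolding measurable_cong_sets[OF sets_nu refl] by measurable
      then show "integrable \<nu> (\<lambda>y. \<bar>\<Phi> ((1 / r) *\<^sub>R (y - x)) * W y * indicator (- E) y\<bar>)"
      proof (intro integrable_abs Bochner_Integration.integrable_bound[OF iS] AE_I2)
        show "norm (\<Phi> ((1 / r) *\<^sub>R (y - x)) * W y * indicator (- E) y) \<le> norm (B * indicator ?S y)" for y
          using pt[of y] abs_ge_self[of "B * indicator ?S y"] unfolding real_norm_def by linarith
      qed
    qed
    also have "\<dots> = B * measure \<nu> ?S" using S by simp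
    also have "measure \<nu> ?S = measure (density \<nu> (indicator (- E))) (ball x r0 \<inter> {y. \<bar>y $ i - x $ i\<bar> \<le> R * r})"
      using E by (intro measure_density_indicator[symmetric]) (auto simp: sets_nu)
    also have "B * \<dots> \<le> B * (e / (2 * B * R) * (R * r))"
      using rd(3)[of "R * r"] Rr RB(3) by (intro mult_left_mono) auto
    also have "\<dots> = e / 2 * r" using RB by simp
    finally have "\<bar>\<integral>y. \<Phi> ((1 / r) *\<^sub>R (y - x)) * W y * indicator (- E) y \<partial>\<nu>\<bar> / r \<le> e / 2"
      using Rr(4) by (simp add: field_simps)
    moreover have "dist ((1 / r) * (\<integral>y. \<Phi> ((1 / r) *\<^sub>R (y - x)) * W y * indicator (- E) y \<partial>\<nu>)) 0
        = \<bar>\<integral>y. \<Phi> ((1 / r) *\<^sub>R (y - x)) * W y * indicator (- E) y \<partial>\<nu>\<bar> / r"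
      using Rr(4) by (simp add: abs_mult)
    ultimately show "dist ((1 / r) * (\<integral>y. \<Phi> ((1 / r) *\<^sub>R (y - x)) * W y * indicator (- E) y \<partial>\<nu>)) 0 < e"
      using e by linarith
  qed
qed

context divfree
begin

text \<open>On \<open>E\<close> a point is recovered from its \<open>i\<close>-th coordinate through
  \<gamma>, so integrals over \<open>E\<close> are integrals against the projection of \<nu>
  restricted to \<open>E\<close>. That projection is absolutely continuous, and a density is
  positive almost everywhere for the measure it defines.\<close>

lemma graph_density:
  assumes E: "E \<in> sets borel" "E \<subseteq> \<Omega>" "\<And>x. x \<in> E \<Longrightarrow> a x $ i \<noteq> 0"
    and \<gamma>: "\<And>t. \<gamma> t $ i = t" "continuous_on UNIV \<gamma>" "E \<subseteq> range \<gamma>"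
  obtains G :: "real \<Rightarrow> real" where "G \<in> borel_measurable borel" "\<And>t. 0 \<le> G t" "integrable lborel G"
    "\<And>W :: real^'n \<Rightarrow> real. W \<in> borel_measurable borel \<Longrightarrow> (\<integral>x. W x * indicator E x \<partial>\<nu>) = (\<integral>t. W (\<gamma> t) * G t \<partial>lborel)"
    "AE x in \<nu>. x \<in> E \<longrightarrow> G (x $ i) > 0"
proof -
  have En: "E \<in> sets \<nu>" using E by (simp add: sets_nu)
  have g_id: "\<gamma> (x $ i) = x" if "x \<in> E" for x using that \<gamma>(1,3) by auto
  let ?\<nu> = "restrict_space \<nu> E"
  let ?m = "distr ?\<nu> borel (\<lambda>x. x $ i)"
  have meas: "(\<lambda>x. x $ i) \<in> measurable ?\<nu> borel" by (intro measurable_restrict_space1) measurable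
  have [measurable]: "\<gamma> \<in> borel_measurable borel" using \<gamma>(2) by (rule borel_measurable_continuous_onI)
  have fin: "finite_measure ?m"
    using En by (intro finite_measure.finite_measure_distr finite_measure_restrict_space finite_measure_axioms meas) auto
  have ac: "absolutely_continuous lborel ?m"
    unfolding absolutely_continuous_def
  proof
    fix N :: "real set" assume N: "N \<in> null_sets lborel"
    then have [measurable]: "N \<in> sets borel" by (simp add: null_sets_def)
    have "negligible N" using N by (simp add: negligible_iff_null_sets null_sets_completionI)
    from AE_null_projection[OF this, of i] have "AE x in \<nu>. x \<notin> E \<inter> {x. x $ i \<in> N}"
      by eventually_elim (use E in auto)
    moreover have S: "E \<inter> {x. x $ i \<in> N} \<in> sets \<nu>" using E(1) unfolding sets_nu by measurable
    ultimately have "emeasure \<nu> (E \<inter> {x. x $ i \<in> N}) = 0"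
      by (subst (asm) AE_iff_measurable[OF S]) auto
    moreover have "emeasure ?m N = emeasure \<nu> (E \<inter> {x. x $ i \<in> N})"
    proof -
      have "(\<lambda>x. x $ i) -` N \<inter> space ?\<nu> = E \<inter> {x. x $ i \<in> N}" by (auto simp: space_restrict_space)
      then show ?thesis using En by (simp add: emeasure_distr[OF meas] emeasure_restrict_space)
    qed
    ultimately show "N \<in> null_sets ?m" by (simp add: null_sets_def)
  qed
  obtain G :: "real \<Rightarrow> real" where G: "G \<in> borel_measurable borel" "\<And>t. 0 \<le> G t" "integrable lborel G" "?m = density lborel (\<lambda>t. ennreal (G t))"
    by (rule integrable_density_witness[OF fin _ ac]) (simp, rule that)
  have int: "(\<integral>x. W x * indicator E x \<partial>\<nu>) = (\<integral>t. W (\<gamma> t) * G t \<partial>lborel)"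
    if [measurable]: "W \<in> borel_measurable borel" for W :: "real^'n \<Rightarrow> real"
  proof -
    have "(\<integral>x. W x * indicator E x \<partial>\<nu>) = (\<integral>x. W x \<partial>?\<nu>)"
      using En by (subst integral_restrict_space) (auto simp: mult.commute)
    also have "\<dots> = (\<integral>x. W (\<gamma> (x $ i)) \<partial>?\<nu>)"
      by (intro Bochner_Integration.integral_cong) (auto simp: space_restrict_space g_id)
    also have "\<dots> = (\<integral>t. W (\<gamma> t) \<partial>?m)" by (rule integral_distr[OF meas, symmetric]) measurable
    also have "\<dots> = (\<integral>t. G t *\<^sub>R W (\<gamma> t) \<partial>lborel)"
      unfolding G(4) using G(1,2) by (subst integral_density) auto
    finally show ?thesis by (simp add: mult.commute)
  qed
  have "AE s in ?m. G s > 0" unfolding G(4) using G(1) by (subst AE_density) auto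
  from AE_distrD[OF meas this] have "AE x in \<nu>. x \<in> E \<longrightarrow> G (x $ i) > 0"
    using En by (simp add: AE_restrict_space_iff)
  with int show ?thesis using that[OF G(1,2,3)] by blast
qed

lemma AE_project:
  assumes "AE s in lborel. P s"
  shows "AE x in \<nu>. x \<in> \<Omega> \<longrightarrow> a x $ i \<noteq> 0 \<longrightarrow> P (x $ i)"
proof -
  obtain N where N: "{s. \<not> P s} \<subseteq> N" "N \<in> null_sets lborel" using assms by (auto elim!: AE_E simp: null_sets_def)
  then have "negligible N" by (simp add: negligible_iff_null_sets null_sets_completionI)
  from AE_null_projection[OF this, of i] show ?thesis
    by eventually_elim (use N(1) in auto)
qed

text \<open>The multiplicity \<open>G\<close> and the direction \<open>v\<close> are fixed before
  the weight \<open>W\<close>; only the exceptional set depends on \<open>W\<close>. Thus the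
  entries of the rows and the indicator of a set, used as weights, all blow up along the same
  line.\<close>

lemma graph_blow_up:
  assumes E: "E \<in> sets borel" "E \<subseteq> \<Omega>" "\<And>x. x \<in> E \<Longrightarrow> a x $ i \<noteq> 0"
    and \<gamma>: "\<And>t. \<gamma> t $ i = t" "L-lipschitz_on UNIV \<gamma>" "E \<subseteq> range \<gamma>"
  shows "\<exists>(G :: real^'n \<Rightarrow> real) (v :: real^'n \<Rightarrow> real^'n). (AE x in \<nu>. x \<in> E \<longrightarrow> G x > 0) \<and> (\<forall>x. v x $ i = 1) \<and>
    (\<forall>W :: real^'n \<Rightarrow> real. W \<in> borel_measurable borel \<longrightarrow> (\<forall>x. \<bar>W x\<bar> \<le> 1) \<longrightarrow>
      (AE x in \<nu>. x \<in> E \<longrightarrow> (\<forall>\<Phi>. continuous_on UNIV \<Phi> \<longrightarrow> bounded {y. \<Phi> y \<noteq> 0} \<longrightarrow>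
       ((\<lambda>r. (1 / r) * (\<integral>y. \<Phi> ((1 / r) *\<^sub>R (y - x)) * W y \<partial>\<nu>)) \<longlongrightarrow>
          W x * G x * (\<integral>z. \<Phi> (z *\<^sub>R v x) \<partial>lborel)) (at_right 0))))"
proof -
  have \<gamma>c: "continuous_on UNIV \<gamma>" using \<gamma>(2) by (rule lipschitz_on_continuous_on)
  have [measurable]: "\<gamma> \<in> borel_measurable borel" using \<gamma>c by (rule borel_measurable_continuous_onI)
  have g_id: "\<gamma> (x $ i) = x" if "x \<in> E" for x using that \<gamma>(1,3) by auto
  obtain G :: "real \<Rightarrow> real" where G: "G \<in> borel_measurable borel" "\<And>t. 0 \<le> G t" "integrable lborel G"
    "\<And>W :: real^'n \<Rightarrow> real. W \<in> borel_measurable borel \<Longrightarrow> (\<integral>x. W x * indicator E x \<partial>\<nu>) = (\<integral>t. W (\<gamma> t) * G t \<partial>lborel)"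
    "AE x in \<nu>. x \<in> E \<longrightarrow> G (x $ i) > 0"
    using graph_density[OF E \<gamma>(1) \<gamma>c \<gamma>(3)] by blast
  have "AE s in lborel. \<exists>D. ((\<lambda>t. \<gamma> t $ j) has_real_derivative D) (at s)" for j
  proof (rule AE_differentiable_lipschitz)
    show "L-lipschitz_on UNIV (\<lambda>t. \<gamma> t $ j)"
    proof (rule lipschitz_onI)
      fix s t show "dist (\<gamma> s $ j) (\<gamma> t $ j) \<le> L * dist s t"
        using lipschitz_onD[OF \<gamma>(2), of s t] dist_vec_nth_le[of "\<gamma> s" j "\<gamma> t"] by simp
    qed (use \<gamma>(2) in \<open>rule lipschitz_on_nonneg\<close>)
  qed
  then have "AE s in lborel. \<forall>j. \<exists>D. ((\<lambda>t. \<gamma> t $ j) has_real_derivative D) (at s)"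
    by (simp add: AE_all_countable)
  then have diff: "AE s in lborel. \<exists>w. (\<gamma> has_vector_derivative w) (at s)"
  proof eventually_elim
    case (elim s)
    then obtain D where D: "\<And>j. ((\<lambda>t. \<gamma> t $ j) has_real_derivative D j) (at s)" by metis
    have "((\<lambda>t. \<chi> j. \<gamma> t $ j) has_vector_derivative (\<chi> j. D j)) (at s)"
      using D unfolding has_vector_derivative_def has_real_derivative_iff_has_vector_derivative
      by (subst has_derivative_componentwise_within) (auto simp: Basis_vec_def inner_axis)
    then show ?case by auto
  qed
  \<comment> \<open>The default \<open>axis i 1\<close> where \<gamma> is not differentiable keeps
    \<open>v x $ i = 1\<close> at every point; elsewhere this follows from \<gamma> being a
    graph.\<close>
  define v where "v x = (if \<exists>w. (\<gamma> has_vector_derivative w) (at (x $ i)) then vector_derivative \<gamma> (at (x $ i)) else axis i 1)" for x :: "real^'n"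
  have vd: "(\<gamma> has_vector_derivative v x) (at (x $ i))" if "\<exists>w. (\<gamma> has_vector_derivative w) (at (x $ i))" for x
    using that unfolding v_def by (auto simp: vector_derivative_works[symmetric] differentiableI_vector)
  have vi: "v x $ i = 1" for x
  proof (cases "\<exists>w. (\<gamma> has_vector_derivative w) (at (x $ i))")
    case True
    have "((\<lambda>t. \<gamma> t $ i) has_vector_derivative v x $ i) (at (x $ i))"
      by (rule bounded_linear.has_vector_derivative[OF bounded_linear_vec_nth vd[OF True]])
    then have "((\<lambda>t. t) has_real_derivative v x $ i) (at (x $ i))"
      by (simp add: \<gamma>(1) has_real_derivative_iff_has_vector_derivative)
    then show ?thesis using DERIV_ident DERIV_unique by blast
  qed (simp add: v_def)
  show ?thesis
  proof (intro exI[of _ "\<lambda>x. G (x $ i)"] exI[of _ v] conjI allI impI)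
    show "AE x in \<nu>. x \<in> E \<longrightarrow> G (x $ i) > 0" by (rule G(5))
    show "v x $ i = 1" for x by (rule vi)
    fix W :: "real^'n \<Rightarrow> real" assume W0: "W \<in> borel_measurable borel" "\<forall>x. \<bar>W x\<bar> \<le> 1"
    then have W: "W \<in> borel_measurable borel" "\<And>x. \<bar>W x\<bar> \<le> 1" by blast+
    have [measurable]: "W \<in> borel_measurable borel" by fact
    define h where "h t = W (\<gamma> t) * G t" for t
    have hint: "integrable lborel h"
    proof (rule Bochner_Integration.integrable_bound[OF G(3)])
      show "h \<in> borel_measurable lborel" unfolding h_def[abs_def] using G(1) by measurable
      show "AE t in lborel. norm (h t) \<le> norm (G t)"
        using W(2) G(2) by (intro AE_I2) (auto simp: h_def abs_mult intro!: mult_left_le_one_le)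
    qed
    have "AE x in \<nu>. x \<in> \<Omega> \<longrightarrow> a x $ i \<noteq> 0 \<longrightarrow> lebesgue_point h (x $ i)"
      by (rule AE_project[OF AE_lebesgue_point[OF hint]])
    moreover have "AE x in \<nu>. x \<in> \<Omega> \<longrightarrow> a x $ i \<noteq> 0 \<longrightarrow> (\<exists>w. (\<gamma> has_vector_derivative w) (at (x $ i)))"
      by (rule AE_project[OF diff])
    moreover have "AE x in \<nu>. x \<in> E \<longrightarrow> zero_slab_density (density \<nu> (indicator (- E))) (\<lambda>y. y $ i) x"
      by (rule AE_zero_slab_density) (use E in auto)
    ultimately show "AE x in \<nu>. x \<in> E \<longrightarrow> (\<forall>\<Phi>. continuous_on UNIV \<Phi> \<longrightarrow> bounded {y. \<Phi> y \<noteq> 0} \<longrightarrow>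
       ((\<lambda>r. (1 / r) * (\<integral>y. \<Phi> ((1 / r) *\<^sub>R (y - x)) * W y \<partial>\<nu>)) \<longlongrightarrow>
          W x * G (x $ i) * (\<integral>z. \<Phi> (z *\<^sub>R v x) \<partial>lborel)) (at_right 0))"
    proof eventually_elim
      case (elim x)
      show ?case
      proof (intro impI allI)
        fix \<Phi> :: "real^'n \<Rightarrow> real"
        assume x: "x \<in> E" and \<Phi>: "continuous_on UNIV \<Phi>" "bounded {y. \<Phi> y \<noteq> 0}"
        have [measurable]: "\<Phi> \<in> borel_measurable borel" using \<Phi>(1) by (rule borel_measurable_continuous_onI)
        have [measurable]: "E \<in> sets borel" by (rule E(1))
        have xO: "x \<in> \<Omega>" "a x $ i \<noteq> 0" using x E by auto
        obtain B where B: "\<And>y. \<bar>\<Phi> y\<bar> \<le> B" using compact_support_radius[OF \<Phi>] by metis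
        have "((\<lambda>r. (1 / r) * (\<integral>t. \<Phi> ((1 / r) *\<^sub>R (\<gamma> t - \<gamma> (x $ i))) * h t \<partial>lborel)) \<longlongrightarrow>
             h (x $ i) * (\<integral>z. \<Phi> (z *\<^sub>R v x) \<partial>lborel)) (at_right 0)"
          by (rule tendsto_blow_up_graph[OF \<gamma>(1) \<gamma>c _ hint _ \<Phi>]) (use elim xO vd in auto)
        moreover have "((\<lambda>r. (1 / r) * (\<integral>y. \<Phi> ((1 / r) *\<^sub>R (y - x)) * W y * indicator (- E) y \<partial>\<nu>)) \<longlongrightarrow> 0) (at_right 0)"
          by (rule zero_slab_density_blow_up[OF finite_measure_axioms sets_nu E(1) mp[OF elim(3) x] W \<Phi>])
        ultimately have lim: "((\<lambda>r. (1 / r) * (\<integral>t. \<Phi> ((1 / r) *\<^sub>R (\<gamma> t - \<gamma> (x $ i))) * h t \<partial>lborel)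
             + (1 / r) * (\<integral>y. \<Phi> ((1 / r) *\<^sub>R (y - x)) * W y * indicator (- E) y \<partial>\<nu>))
             \<longlongrightarrow> h (x $ i) * (\<integral>z. \<Phi> (z *\<^sub>R v x) \<partial>lborel) + 0) (at_right 0)"
          by (rule tendsto_add)
        have "(1 / r) * (\<integral>t. \<Phi> ((1 / r) *\<^sub>R (\<gamma> t - \<gamma> (x $ i))) * h t \<partial>lborel)
             + (1 / r) * (\<integral>y. \<Phi> ((1 / r) *\<^sub>R (y - x)) * W y * indicator (- E) y \<partial>\<nu>)
             = (1 / r) * (\<integral>y. \<Phi> ((1 / r) *\<^sub>R (y - x)) * W y \<partial>\<nu>)" for r
        proof -
          have bd: "\<bar>\<Phi> ((1 / r) *\<^sub>R (y - x)) * W y\<bar> \<le> B" for y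
            using mult_mono[OF B[of "(1 / r) *\<^sub>R (y - x)"] W(2)[of y]] B[of 0] by (simp add: abs_mult)
          have i: "integrable \<nu> (\<lambda>y. \<Phi> ((1 / r) *\<^sub>R (y - x)) * W y)"
            by (rule integrable_const_bound[of _ B]) (use bd in \<open>auto intro!: borel_nu\<close>)
          have "(\<integral>t. \<Phi> ((1 / r) *\<^sub>R (\<gamma> t - \<gamma> (x $ i))) * h t \<partial>lborel)
              = (\<integral>y. \<Phi> ((1 / r) *\<^sub>R (y - x)) * W y * indicator E y \<partial>\<nu>)"
            by (subst G(4)) (simp_all add: h_def g_id[OF x] mult.assoc)
          moreover have "(\<integral>y. \<Phi> ((1 / r) *\<^sub>R (y - x)) * W y * indicator E y \<partial>\<nu>)
              + (\<integral>y. \<Phi> ((1 / r) *\<^sub>R (y - x)) * W y * indicator (- E) y \<partial>\<nu>)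
              = (\<integral>y. \<Phi> ((1 / r) *\<^sub>R (y - x)) * W y * indicator E y + \<Phi> ((1 / r) *\<^sub>R (y - x)) * W y * indicator (- E) y \<partial>\<nu>)"
            using E(1) by (intro Bochner_Integration.integral_add[symmetric] integrable_real_mult_indicator i) (auto simp: sets_nu)
          moreover have "\<dots> = (\<integral>y. \<Phi> ((1 / r) *\<^sub>R (y - x)) * W y \<partial>\<nu>)"
            by (intro Bochner_Integration.integral_cong) (auto split: split_indicator)
          moreover have "A = E' \<Longrightarrow> E' + C = S' \<Longrightarrow> S' = T' \<Longrightarrow> (1 / r) * A + (1 / r) * C = (1 / r) * T'"
            for A E' C S' T' :: real by (simp flip: add_divide_distrib)
          ultimately show ?thesis by blast
        qed
        with lim show "((\<lambda>r. (1 / r) * (\<integral>y. \<Phi> ((1 / r) *\<^sub>R (y - x)) * W y \<partial>\<nu>)) \<longlongrightarrow>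
          W x * G (x $ i) * (\<integral>z. \<Phi> (z *\<^sub>R v x) \<partial>lborel)) (at_right 0)"
          by (simp add: h_def g_id[OF x])
      qed
    qed
  qed
qed

end

lemma cube_bump_line_integral_pos:
  fixes v :: "real^'n"
  assumes "v $ i = 1"
  shows "(\<integral>z. cube_bump 0 1 (z *\<^sub>R v) \<partial>lborel) > 0"
proof -
  let ?f = "\<lambda>z. cube_bump 0 1 (z *\<^sub>R v)"
  have c: "continuous_on UNIV ?f"
    by (rule continuous_on_compose2[OF smooth_fun_continuous[OF smooth_fun_cube_bump]]) (auto intro!: continuous_intros)
  have [measurable]: "?f \<in> borel_measurable borel" using c by (rule borel_measurable_continuous_onI)
  have "open {z. 1 / 2 < ?f z}" by (intro open_Collect_less continuous_intros c)
  moreover have "0 \<in> {z. 1 / 2 < ?f z}" by simp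
  ultimately obtain \<kappa> where \<kappa>: "\<kappa> > 0" "cball 0 \<kappa> \<subseteq> {z. 1 / 2 < ?f z}" unfolding open_contains_cball by blast
  have out: "?f z = 0" if "\<bar>z\<bar> \<ge> 1" for z
    using that assms by (intro cube_bump_eq_0[of 1 _ i]) auto
  have int: "integrable lborel ?f"
  proof (rule Bochner_Integration.integrable_bound[of _ "\<lambda>z. indicator {-1..1} z :: real"])
    show "AE z in lborel. norm (?f z) \<le> norm (indicator {-1..1} z :: real)"
    proof (intro AE_I2)
      fix z show "norm (?f z) \<le> norm (indicator {-1..1} z :: real)"
        using out[of z] cube_bump_le_1[of 0 1 "z *\<^sub>R v"] cube_bump_nonneg[of 0 1 "z *\<^sub>R v"]
        by (cases "\<bar>z\<bar> \<ge> 1") (auto simp: indicator_def)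
    qed
  qed (auto intro!: integrable_real_indicator)
  have "0 < (\<integral>z. 1 / 2 * indicator {-\<kappa>..\<kappa>} z \<partial>lborel :: real)" using \<kappa>(1) by simp
  also have "\<dots> \<le> (\<integral>z. ?f z \<partial>lborel)"
  proof (rule integral_mono[OF _ int])
    show "integrable lborel (\<lambda>z. 1 / 2 * indicator {-\<kappa>..\<kappa>} z :: real)"
      using \<kappa>(1) by (intro integrable_mult_right integrable_real_indicator) auto
    fix z show "1 / 2 * indicator {-\<kappa>..\<kappa>} z \<le> ?f z"
      using \<kappa>(2) cube_bump_nonneg[of 0 1 "z *\<^sub>R v"] by (cases "z \<in> {-\<kappa>..\<kappa>}") (auto simp: cball_eq_atLeastAtMost less_imp_le)
  qed
  finally show ?thesis .
qed

lemma partial_deriv_rescale: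
  assumes "smooth_fun \<Phi>" "r > 0"
  shows "partial_deriv m (\<lambda>y. \<Phi> ((1 / r) *\<^sub>R (y - x))) y = (1 / r) * partial_deriv m \<Phi> ((1 / r) *\<^sub>R (y - x))"
proof (rule partial_deriv_eqI)
  have "((\<lambda>t. \<Phi> ((1 / r) *\<^sub>R (y - x) + (t / r) *\<^sub>R axis m 1)) has_real_derivative
      partial_deriv m \<Phi> ((1 / r) *\<^sub>R (y - x)) * (1 / r)) (at 0)"
    by (rule DERIV_chain2[where f="\<lambda>t. \<Phi> ((1 / r) *\<^sub>R (y - x) + t *\<^sub>R axis m 1)" and g="\<lambda>t. t / r"])
       (use partial_deriv_works[OF assms(1), of "(1 / r) *\<^sub>R (y - x)" m] assms(2) in \<open>auto intro!: derivative_eq_intros\<close>)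
  moreover have "(1 / r) *\<^sub>R (y + t *\<^sub>R axis m 1 - x) = (1 / r) *\<^sub>R (y - x) + (t / r) *\<^sub>R axis m 1" for t
    by (simp add: algebra_simps)
  ultimately show "((\<lambda>t. \<Phi> ((1 / r) *\<^sub>R (y + t *\<^sub>R axis m 1 - x))) has_real_derivative
      (1 / r) * partial_deriv m \<Phi> ((1 / r) *\<^sub>R (y - x))) (at 0)" by (simp add: mult.commute)
qed

context vec_divfree
begin

text \<open>Testing the blow-up limit with \<open>(y\<^sub>j - v\<^sub>j y\<^sub>i)\<close> times a bump, which vanishes on the limit line
  \<open>span {v}\<close>, leaves only the transversal component of the rows.\<close>

lemma blow_up_rows_tangential:
  assumes x: "x \<in> \<Omega>" and v: "v $ i = 1" and G: "G > 0"
    and lim: "\<And>\<Phi> m. continuous_on UNIV \<Phi> \<Longrightarrow> bounded {y. \<Phi> y \<noteq> 0} \<Longrightarrow>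
       ((\<lambda>r. (1 / r) * (\<integral>y. \<Phi> ((1 / r) *\<^sub>R (y - x)) * (\<tau> y $ l $ m) \<partial>\<nu>)) \<longlongrightarrow>
          (\<tau> x $ l $ m) * G * (\<integral>z. \<Phi> (z *\<^sub>R v) \<partial>lborel)) (at_right 0)"
  shows "\<tau> x $ l = (\<tau> x $ l $ i) *\<^sub>R v"
proof -
  have "\<tau> x $ l $ j = \<tau> x $ l $ i * v $ j" for j
  proof -
    define f where "f y = y $ j - v $ j * y $ i" for y :: "real^'n"
    have fbl: "bounded_linear f" unfolding f_def[abs_def]
      by (intro bounded_linear_sub bounded_linear_vec_nth bounded_linear_const_mult)
    have fs: "smooth_fun f" by (rule smooth_fun_bounded_linear[OF fbl])
    have fp: "partial_deriv m f y = (if m = j then 1 else 0) - v $ j * (if m = i then 1 else 0)" for m y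
    proof (rule partial_deriv_eqI)
      have "f (y + t *\<^sub>R axis m 1) = f y + t * ((if m = j then 1 else 0) - v $ j * (if m = i then 1 else 0))" for t
        by (auto simp: f_def axis_def algebra_simps)
      then show "((\<lambda>t. f (y + t *\<^sub>R axis m 1)) has_real_derivative
          (if m = j then 1 else 0) - v $ j * (if m = i then 1 else 0)) (at 0)"
        by (auto intro!: derivative_eq_intros)
    qed
    define \<Phi> where "\<Phi> y = cube_bump 0 1 y * f y" for y
    have \<Phi>t: "test_fun UNIV \<Phi>" unfolding \<Phi>_def[abs_def]
      by (intro test_fun_mult test_fun_cube_bump fs) auto
    have \<Phi>s: "smooth_fun \<Phi>" using \<Phi>t by (rule test_fun_smooth)
    have \<Phi>supp: "y \<in> cube 0 1" if "\<Phi> y \<noteq> 0" for y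
      using that cube_bump_support[of 1 "0::real^'n"] closure_subset[of "{y::real^'n. cube_bump 0 1 y \<noteq> 0}"]
      by (auto simp: \<Phi>_def)
    have Dc: "continuous_on UNIV (partial_deriv m \<Phi>)" for m
      by (intro smooth_fun_continuous smooth_fun_partial_deriv \<Phi>s)
    have Db: "bounded {y. partial_deriv m \<Phi> y \<noteq> 0}" for m
    proof (rule bounded_subset)
      show "bounded (closure {y. \<Phi> y \<noteq> 0})" using \<Phi>t by (auto simp: test_fun_def compact_imp_bounded)
      show "{y. partial_deriv m \<Phi> y \<noteq> 0} \<subseteq> closure {y. \<Phi> y \<noteq> 0}" using partial_deriv_outside_support by blast
    qed
    define c where "c = (\<integral>z. cube_bump 0 1 (z *\<^sub>R v) \<partial>lborel)"
    have c: "c > 0" unfolding c_def by (rule cube_bump_line_integral_pos[OF v])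
    \<comment> \<open>On the line spanned by \<open>v\<close> the linear factor \<open>f\<close>
      vanishes, because \<open>v $ i = 1\<close>; by the Leibniz rule only its constant gradient
      times the bump remains.\<close>
    have Dline: "(\<integral>z. partial_deriv m \<Phi> (z *\<^sub>R v) \<partial>lborel) = ((if m = j then 1 else 0) - v $ j * (if m = i then 1 else 0)) * c" for m
    proof -
      have "partial_deriv m \<Phi> (z *\<^sub>R v) = ((if m = j then 1 else 0) - v $ j * (if m = i then 1 else 0)) * cube_bump 0 1 (z *\<^sub>R v)" for z
        unfolding \<Phi>_def[abs_def] partial_deriv_mult[OF smooth_fun_cube_bump fs] fp
        by (simp add: f_def v)
      then show ?thesis by (simp add: c_def)
    qed
    have "((\<lambda>r. \<Sum>m\<in>UNIV. (1 / r) * (\<integral>y. partial_deriv m \<Phi> ((1 / r) *\<^sub>R (y - x)) * (\<tau> y $ l $ m) \<partial>\<nu>)) \<longlongrightarrow>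
        (\<Sum>m\<in>UNIV. \<tau> x $ l $ m * G * (\<integral>z. partial_deriv m \<Phi> (z *\<^sub>R v) \<partial>lborel))) (at_right 0)"
      by (intro tendsto_sum lim Dc Db)
    \<comment> \<open>For small \<open>r\<close> the rescaled function has support in \<Omega>, so
      the divergence equation makes the whole sum vanish before the limit is taken.\<close>
    moreover have "\<forall>\<^sub>F r in at_right 0. (\<Sum>m\<in>UNIV. (1 / r) * (\<integral>y. partial_deriv m \<Phi> ((1 / r) *\<^sub>R (y - x)) * (\<tau> y $ l $ m) \<partial>\<nu>)) = 0"
    proof -
      obtain e where e: "e > 0" "cball x e \<subseteq> \<Omega>" using bspec[OF open_Omega[unfolded open_contains_cball] x] by blast
      have "0 < e / CARD('n)" using e(1) by simp
      then have "\<forall>\<^sub>F r in at_right 0. r \<in> {0<..<e / CARD('n)}" by (rule eventually_at_right_real)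
      then show ?thesis
      proof eventually_elim
        fix r assume r: "r \<in> {0<..<e / CARD('n)}"
        then have r0: "r > 0" and "CARD('n) * r \<le> e" by (auto simp: field_simps)
        then have cub: "cube x r \<subseteq> \<Omega>" using cube_subset_cball[of x r] e(2) subset_cball[of "CARD('n) * r" e x] by blast
        let ?\<phi> = "\<lambda>y. \<Phi> ((1 / r) *\<^sub>R (y - x))"
        have sm: "smooth_fun ?\<phi>"
          using smooth_fun_affine_compose[OF \<Phi>s bounded_linear_scaleR_right, of "1 / r" "- (1 / r) *\<^sub>R x"]
          by (simp add: scaleR_diff_right)
        have "{y. ?\<phi> y \<noteq> 0} \<subseteq> cube x r"
        proof
          fix y assume "y \<in> {y. ?\<phi> y \<noteq> 0}"
          then have "(1 / r) *\<^sub>R (y - x) \<in> cube 0 1" using \<Phi>supp by blast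
          then show "y \<in> cube x r" using r0 by (auto simp: cube_def abs_mult field_simps)
        qed
        then have cl: "closure {y. ?\<phi> y \<noteq> 0} \<subseteq> cube x r"
          by (rule closure_minimal) (intro compact_imp_closed compact_cube)
        have "test_fun \<Omega> ?\<phi>"
          using sm cl cub compact_closure_subset[OF compact_cube cl] by (auto simp: test_fun_def)
        from divfree[OF this, of l]
        have "0 = (\<integral>y. (\<Sum>m\<in>UNIV. (1 / r) * (partial_deriv m \<Phi> ((1 / r) *\<^sub>R (y - x)) * (\<tau> y $ l $ m))) \<partial>\<nu>)"
          by (simp add: inner_vec_def grad_def partial_deriv_rescale[OF \<Phi>s r0])
        also have "\<dots> = (\<Sum>m\<in>UNIV. (\<integral>y. (1 / r) * (partial_deriv m \<Phi> ((1 / r) *\<^sub>R (y - x)) * (\<tau> y $ l $ m)) \<partial>\<nu>))"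
        proof (rule Bochner_Integration.integral_sum)
          fix m
          obtain B where B: "\<And>y. \<bar>partial_deriv m \<Phi> y\<bar> \<le> B" using compact_support_radius[OF Dc Db] by metis
          have [measurable]: "partial_deriv m \<Phi> \<in> borel_measurable borel"
            using Dc by (rule borel_measurable_continuous_onI)
          have [measurable]: "(\<lambda>y. \<tau> y $ l $ m) \<in> borel_measurable borel"
            by (rule measurable_compose[OF tau_row_meas borel_measurable_vec_component])
          have "integrable \<nu> (\<lambda>y. partial_deriv m \<Phi> ((1 / r) *\<^sub>R (y - x)) * (\<tau> y $ l $ m))"
          proof (rule integrable_const_bound[of _ B])
            show "AE y in \<nu>. norm (partial_deriv m \<Phi> ((1 / r) *\<^sub>R (y - x)) * (\<tau> y $ l $ m)) \<le> B"
            proof (intro AE_I2)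
              fix y show "norm (partial_deriv m \<Phi> ((1 / r) *\<^sub>R (y - x)) * (\<tau> y $ l $ m)) \<le> B"
                using mult_mono[OF B[of "(1 / r) *\<^sub>R (y - x)"] tau_entry_bound[of y l m]] B[of 0] by (simp add: abs_mult)
            qed
          qed (rule borel_nu, measurable)
          then show "integrable \<nu> (\<lambda>y. (1 / r) * (partial_deriv m \<Phi> ((1 / r) *\<^sub>R (y - x)) * (\<tau> y $ l $ m)))"
            by (rule integrable_mult_right)
        qed
        finally show "(\<Sum>m\<in>UNIV. (1 / r) * (\<integral>y. partial_deriv m \<Phi> ((1 / r) *\<^sub>R (y - x)) * (\<tau> y $ l $ m) \<partial>\<nu>)) = 0" by simp
      qed
    qed
    then have "((\<lambda>r. \<Sum>m\<in>UNIV. (1 / r) * (\<integral>y. partial_deriv m \<Phi> ((1 / r) *\<^sub>R (y - x)) * (\<tau> y $ l $ m) \<partial>\<nu>)) \<longlongrightarrow> 0) (at_right 0)"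
      by (rule tendsto_eventually)
    ultimately have "(\<Sum>m\<in>UNIV. \<tau> x $ l $ m * G * (((if m = j then 1 else 0) - v $ j * (if m = i then 1 else 0)) * c)) = 0"
      unfolding Dline by (intro tendsto_unique[OF trivial_limit_at_right_real])
    also have "(\<Sum>m\<in>UNIV. \<tau> x $ l $ m * G * (((if m = j then 1 else 0) - v $ j * (if m = i then 1 else 0)) * c))
       = (\<Sum>m\<in>UNIV. (if m = j then \<tau> x $ l $ m * (G * c) else 0) - (if m = i then \<tau> x $ l $ m * (v $ j * (G * c)) else 0))"
      by (intro sum.cong) (auto simp: algebra_simps)
    also have "\<dots> = (\<tau> x $ l $ j - \<tau> x $ l $ i * v $ j) * (G * c)"
      by (simp add: sum_subtractf algebra_simps)
    finally show ?thesis using G c by simp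
  qed
  then show ?thesis unfolding vec_eq_iff vector_scaleR_component real_scaleR_def by blast
qed

text \<open>The measure blown up is \<nu> restricted to the larger set \<open>A\<close>, while the
  points \<open>x\<close> run through the piece \<open>E\<close> on one graph: the mass of
  \<open>A - E\<close> disappears in the limit. Taking \<open>W\<close> to be the indicator of
  \<open>A\<close> gives the tangent line, and taking the matrix entries gives the direction of the
  rows.\<close>

lemma graph_tangent:
  assumes E: "E \<in> sets borel" "E \<subseteq> \<Omega>" "\<And>x. x \<in> E \<Longrightarrow> \<tau> x $ k $ i \<noteq> 0"
    and \<gamma>: "\<And>t. \<gamma> t $ i = t" "L-lipschitz_on UNIV \<gamma>" "E \<subseteq> range \<gamma>"
    and A: "A \<in> sets borel" "E \<subseteq> A"
  shows "AE x in \<nu>. x \<in> E \<longrightarrow> (\<exists>\<theta>>0. \<exists>v. norm v = 1 \<and>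
     (\<forall>\<Phi>. continuous_on UNIV \<Phi> \<longrightarrow> bounded {y. \<Phi> y \<noteq> 0} \<longrightarrow>
       ((\<lambda>r. (1 / r) * (\<integral>y. \<Phi> ((1 / r) *\<^sub>R (y - x)) * indicator A y \<partial>\<nu>)) \<longlongrightarrow>
          \<theta> * (\<integral>t. \<Phi> (t *\<^sub>R v) \<partial>lborel)) (at_right 0)) \<and> (\<forall>l. \<tau> x $ l \<in> span {v}))"
proof -
  interpret D: divfree \<nu> \<Omega> "\<lambda>x. 1 *\<^sub>R (\<tau> x $ k)" by (rule divfree_row) simp
  have nz: "(1 *\<^sub>R (\<tau> x $ k)) $ i \<noteq> 0" if "x \<in> E" for x using E(3)[OF that] by simp
  have "\<exists>(G :: real^'n \<Rightarrow> real) (v :: real^'n \<Rightarrow> real^'n). (AE x in \<nu>. x \<in> E \<longrightarrow> G x > 0) \<and> (\<forall>x. v x $ i = 1) \<and>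
    (\<forall>W :: real^'n \<Rightarrow> real. W \<in> borel_measurable borel \<longrightarrow> (\<forall>x. \<bar>W x\<bar> \<le> 1) \<longrightarrow>
      (AE x in \<nu>. x \<in> E \<longrightarrow> (\<forall>\<Phi>. continuous_on UNIV \<Phi> \<longrightarrow> bounded {y. \<Phi> y \<noteq> 0} \<longrightarrow>
       ((\<lambda>r. (1 / r) * (\<integral>y. \<Phi> ((1 / r) *\<^sub>R (y - x)) * W y \<partial>\<nu>)) \<longlongrightarrow>
          W x * G x * (\<integral>z. \<Phi> (z *\<^sub>R v x) \<partial>lborel)) (at_right 0))))"
    by (rule D.graph_blow_up[OF E(1,2) _ \<gamma>(1) \<gamma>(2,3)]) (rule nz)
  then obtain G :: "real^'n \<Rightarrow> real" and v :: "real^'n \<Rightarrow> real^'n"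
    where Gv: "AE x in \<nu>. x \<in> E \<longrightarrow> G x > 0" "\<forall>x. v x $ i = 1"
    "\<forall>W :: real^'n \<Rightarrow> real. W \<in> borel_measurable borel \<longrightarrow> (\<forall>x. \<bar>W x\<bar> \<le> 1) \<longrightarrow>
      (AE x in \<nu>. x \<in> E \<longrightarrow> (\<forall>\<Phi>. continuous_on UNIV \<Phi> \<longrightarrow> bounded {y. \<Phi> y \<noteq> 0} \<longrightarrow>
       ((\<lambda>r. (1 / r) * (\<integral>y. \<Phi> ((1 / r) *\<^sub>R (y - x)) * W y \<partial>\<nu>)) \<longlongrightarrow>
          W x * G x * (\<integral>z. \<Phi> (z *\<^sub>R v x) \<partial>lborel)) (at_right 0)))"
    by (elim exE conjE)
  have "AE x in \<nu>. \<forall>l m. x \<in> E \<longrightarrow> (\<forall>\<Phi>. continuous_on UNIV \<Phi> \<longrightarrow> bounded {y. \<Phi> y \<noteq> 0} \<longrightarrow>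
       ((\<lambda>r. (1 / r) * (\<integral>y. \<Phi> ((1 / r) *\<^sub>R (y - x)) * (\<tau> y $ l $ m) \<partial>\<nu>)) \<longlongrightarrow>
          \<tau> x $ l $ m * G x * (\<integral>z. \<Phi> (z *\<^sub>R v x) \<partial>lborel)) (at_right 0))"
    unfolding AE_all_countable
    by (intro allI Gv(3)[rule_format] tau_entry_bound measurable_compose[OF tau_row_meas borel_measurable_vec_component])
  moreover have "AE x in \<nu>. x \<in> E \<longrightarrow> (\<forall>\<Phi>. continuous_on UNIV \<Phi> \<longrightarrow> bounded {y. \<Phi> y \<noteq> 0} \<longrightarrow>
       ((\<lambda>r. (1 / r) * (\<integral>y. \<Phi> ((1 / r) *\<^sub>R (y - x)) * indicator A y \<partial>\<nu>)) \<longlongrightarrow>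
          indicator A x * G x * (\<integral>z. \<Phi> (z *\<^sub>R v x) \<partial>lborel)) (at_right 0))"
    by (rule Gv(3)[rule_format]) (use A in \<open>auto simp: indicator_def\<close>)
  ultimately show ?thesis using Gv(1)
  proof eventually_elim
    case (elim x)
    show ?case
    proof
      assume x: "x \<in> E"
      then have xO: "x \<in> \<Omega>" and G: "G x > 0" and xA: "x \<in> A" using E elim(3) A by auto
      have row: "\<tau> x $ l = (\<tau> x $ l $ i) *\<^sub>R v x" for l
        by (rule blow_up_rows_tangential[OF xO spec[OF Gv(2)] G]) (use elim(1) x in blast)
      have "v x \<noteq> 0" using spec[OF Gv(2), of x] by auto
      then have n: "norm (v x) > 0" by simp
      define w where "w = (1 / norm (v x)) *\<^sub>R v x"
      have vw: "v x = norm (v x) *\<^sub>R w" using n by (simp add: w_def)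
      show "\<exists>\<theta>>0. \<exists>v. norm v = 1 \<and>
         (\<forall>\<Phi>. continuous_on UNIV \<Phi> \<longrightarrow> bounded {y. \<Phi> y \<noteq> 0} \<longrightarrow>
         ((\<lambda>r. (1 / r) * (\<integral>y. \<Phi> ((1 / r) *\<^sub>R (y - x)) * indicator A y \<partial>\<nu>)) \<longlongrightarrow>
          \<theta> * (\<integral>t. \<Phi> (t *\<^sub>R v) \<partial>lborel)) (at_right 0)) \<and> (\<forall>l. \<tau> x $ l \<in> span {v})"
      proof (rule exI[of _ "G x / norm (v x)"], rule conjI, use G n in simp, rule exI[of _ w], intro conjI allI impI)
        show "norm w = 1" using n by (simp add: w_def)
        show "\<tau> x $ l \<in> span {w}" for l
          by (subst row, subst vw) (intro span_scale span_base, simp)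
        fix \<Phi> :: "real^'n \<Rightarrow> real" assume \<Phi>: "continuous_on UNIV \<Phi>" "bounded {y. \<Phi> y \<noteq> 0}"
        have "(\<integral>t. \<Phi> (t *\<^sub>R w) \<partial>lborel) = norm (v x) * (\<integral>z. \<Phi> ((norm (v x) * z) *\<^sub>R w) \<partial>lborel)"
          using lborel_integral_real_affine[of "norm (v x)" "\<lambda>t. \<Phi> (t *\<^sub>R w)" 0] n by simp
        also have "(\<lambda>z. \<Phi> ((norm (v x) * z) *\<^sub>R w)) = (\<lambda>z. \<Phi> (z *\<^sub>R v x))"
          by (subst (2) vw) (simp add: mult.commute)
        finally have "G x / norm (v x) * (\<integral>t. \<Phi> (t *\<^sub>R w) \<partial>lborel) = indicator A x * G x * (\<integral>z. \<Phi> (z *\<^sub>R v x) \<partial>lborel)"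
          using n xA by simp
        moreover have "((\<lambda>r. (1 / r) * (\<integral>y. \<Phi> ((1 / r) *\<^sub>R (y - x)) * indicator A y \<partial>\<nu>)) \<longlongrightarrow>
          indicator A x * G x * (\<integral>z. \<Phi> (z *\<^sub>R v x) \<partial>lborel)) (at_right 0)" using elim(2) x \<Phi> by blast
        ultimately show "((\<lambda>r. (1 / r) * (\<integral>y. \<Phi> ((1 / r) *\<^sub>R (y - x)) * indicator A y \<partial>\<nu>)) \<longlongrightarrow>
          G x / norm (v x) * (\<integral>t. \<Phi> (t *\<^sub>R w) \<partial>lborel)) (at_right 0)" by simp
      qed
    qed
  qed
qed

end

subsection \<open>Rectifiability\<close>

lemma hausdorff1_mono: "S \<subseteq> T \<Longrightarrow> hausdorff1 S \<le> hausdorff1 T"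
  unfolding hausdorff1_def by (intro SUP_mono' INF_superset_mono) auto

context vec_divfree
begin

definition line_tangent :: "(real^'n) set \<Rightarrow> real^'n \<Rightarrow> bool" where
  "line_tangent A x \<longleftrightarrow> (\<exists>\<theta>>0. \<exists>v. norm v = 1 \<and>
     (\<forall>\<Phi>. continuous_on UNIV \<Phi> \<longrightarrow> bounded {y. \<Phi> y \<noteq> 0} \<longrightarrow>
       ((\<lambda>r. (1 / r) * (\<integral>y. \<Phi> ((1 / r) *\<^sub>R (y - x)) * indicator A y \<partial>\<nu>)) \<longlongrightarrow>
          \<theta> * (\<integral>t. \<Phi> (t *\<^sub>R v) \<partial>lborel)) (at_right 0)) \<and> (\<forall>l. \<tau> x $ l \<in> span {v}))"

text \<open>\<open>A\<close> is the set whose restricted measure must have tangents,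
  \<open>S\<close> the set of points examined. Separating the two permits countable decompositions
  in \<open>S\<close> with \<open>A\<close> fixed.\<close>

definition rect_good :: "(real^'n) set \<Rightarrow> (real^'n) set \<Rightarrow> bool" where
  "rect_good A S \<longleftrightarrow> (\<exists>\<G>. countable \<G> \<and> (\<forall>f\<in>\<G>. \<exists>L. L-lipschitz_on UNIV (f :: real \<Rightarrow> real^'n)) \<and>
     (AE x in \<nu>. x \<in> S \<longrightarrow> (\<exists>f\<in>\<G>. x \<in> range f) \<and> line_tangent A x))"

lemma rect_good_UN:
  assumes "countable I" "\<And>i. i \<in> I \<Longrightarrow> rect_good A (S i)"
  shows "rect_good A (\<Union>i\<in>I. S i)"
proof -
  have "\<exists>\<G>. \<forall>i\<in>I. countable (\<G> i) \<and> (\<forall>f\<in>\<G> i. \<exists>L. L-lipschitz_on UNIV (f :: real \<Rightarrow> real^'n)) \<and>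
     (AE x in \<nu>. x \<in> S i \<longrightarrow> (\<exists>f\<in>\<G> i. x \<in> range f) \<and> line_tangent A x)"
    using assms(2) unfolding rect_good_def by (intro bchoice) blast
  then obtain \<G> where all: "\<forall>i\<in>I. countable (\<G> i) \<and> (\<forall>f\<in>\<G> i. \<exists>L. L-lipschitz_on UNIV (f :: real \<Rightarrow> real^'n)) \<and>
     (AE x in \<nu>. x \<in> S i \<longrightarrow> (\<exists>f\<in>\<G> i. x \<in> range f) \<and> line_tangent A x)" by (elim exE)
  have \<G>: "\<And>i. i \<in> I \<Longrightarrow> countable (\<G> i)" "\<And>i f. i \<in> I \<Longrightarrow> f \<in> \<G> i \<Longrightarrow> \<exists>L. L-lipschitz_on UNIV f"
    "\<And>i. i \<in> I \<Longrightarrow> AE x in \<nu>. x \<in> S i \<longrightarrow> (\<exists>f\<in>\<G> i. x \<in> range f) \<and> line_tangent A x"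
    using bspec[OF all] by simp_all
  have "AE x in \<nu>. \<forall>i\<in>I. x \<in> S i \<longrightarrow> (\<exists>f\<in>\<G> i. x \<in> range f) \<and> line_tangent A x"
    using \<G>(3) by (simp add: AE_ball_countable assms(1))
  then have "AE x in \<nu>. x \<in> (\<Union>i\<in>I. S i) \<longrightarrow> (\<exists>f\<in>(\<Union>i\<in>I. \<G> i). x \<in> range f) \<and> line_tangent A x"
    by eventually_elim blast
  then show ?thesis unfolding rect_good_def
    by (intro exI[of _ "\<Union>i\<in>I. \<G> i"]) (use assms(1) \<G>(1,2) in auto)
qed

lemma rect_good_AE:
  assumes "rect_good A S'" "AE x in \<nu>. x \<in> S \<longrightarrow> x \<in> S'"
  shows "rect_good A S"
proof -
  obtain \<G> where \<G>: "countable \<G>" "\<forall>f\<in>\<G>. \<exists>L. L-lipschitz_on UNIV (f :: real \<Rightarrow> real^'n)"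
     "AE x in \<nu>. x \<in> S' \<longrightarrow> (\<exists>f\<in>\<G>. x \<in> range f) \<and> line_tangent A x"
    using assms(1) unfolding rect_good_def by blast
  from \<G>(3) assms(2) have "AE x in \<nu>. x \<in> S \<longrightarrow> (\<exists>f\<in>\<G>. x \<in> range f) \<and> line_tangent A x"
    by eventually_elim blast
  with \<G>(1,2) show ?thesis unfolding rect_good_def by blast
qed

text \<open>Almost all of \<open>K\<close> lies on countably many graphs, and each intersection of
  \<open>K\<close> with one graph is a Borel piece on which the tangent is known.\<close>

lemma rect_good_compact:
  assumes K: "compact K" "K \<subseteq> \<Omega>" "hausdorff1 K < \<infinity>" and \<sigma>: "\<bar>\<sigma>\<bar> \<le> 1"
    and c: "c > 0" "\<And>x. x \<in> K \<Longrightarrow> c \<le> \<sigma> * \<tau> x $ k $ i"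
    and A: "A \<in> sets borel" "K \<subseteq> A"
  shows "rect_good A K"
proof -
  interpret D: divfree \<nu> \<Omega> "\<lambda>x. \<sigma> *\<^sub>R (\<tau> x $ k)" by (rule divfree_row[OF \<sigma>])
  have "c \<le> (\<sigma> *\<^sub>R (\<tau> x $ k)) $ i" if "x \<in> K" for x using c(2)[OF that] by simp
  from D.lipschitz_graphs_cover[OF K c(1) this]
  obtain \<G> where \<G>: "countable \<G>" "\<And>\<gamma>. \<gamma> \<in> \<G> \<Longrightarrow> \<exists>L. L-lipschitz_on UNIV \<gamma>" "\<And>\<gamma> t. \<gamma> \<in> \<G> \<Longrightarrow> \<gamma> t $ i = t"
     "AE x in \<nu>. x \<in> K \<longrightarrow> (\<exists>\<gamma>\<in>\<G>. x \<in> range \<gamma>)"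
    by blast
  have "AE x in \<nu>. x \<in> K \<inter> range \<gamma> \<longrightarrow> line_tangent A x" if g: "\<gamma> \<in> \<G>" for \<gamma>
  proof -
    obtain L where L: "L-lipschitz_on UNIV \<gamma>" using \<G>(2)[OF g] by blast
    have "continuous_on UNIV (\<lambda>x. \<gamma> (x $ i))"
      by (rule continuous_on_compose2[OF lipschitz_on_continuous_on[OF L]]) (auto intro!: continuous_intros)
    then have "closed {x. \<gamma> (x $ i) = x}" by (intro closed_Collect_eq continuous_on_id)
    \<comment> \<open>A graph over the \<open>i\<close>-th coordinate is the set of points
      reproduced by projecting and lifting, hence closed.\<close>
    moreover have "range \<gamma> = {x. \<gamma> (x $ i) = x}" using \<G>(3)[OF g] by (auto, metis rangeI)
    ultimately have "K \<inter> range \<gamma> \<in> sets borel" using K(1) by (simp add: borel_closed closed_Int compact_imp_closed)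
    then show ?thesis unfolding line_tangent_def
    proof (rule graph_tangent[where k=k and i=i, OF _ _ _ \<G>(3)[OF g] L])
      show "\<tau> x $ k $ i \<noteq> 0" if "x \<in> K \<inter> range \<gamma>" for x using c(1) c(2)[of x] that by auto
    qed (use K A in auto)
  qed
  then have "AE x in \<nu>. \<forall>\<gamma>\<in>\<G>. x \<in> K \<inter> range \<gamma> \<longrightarrow> line_tangent A x"
    unfolding AE_ball_countable[OF \<G>(1)] by blast
  with \<G>(4) have "AE x in \<nu>. x \<in> K \<longrightarrow> (\<exists>f\<in>\<G>. x \<in> range f) \<and> line_tangent A x"
    by eventually_elim blast
  with \<G>(1,2) show ?thesis unfolding rect_good_def by blast
qed

lemma AE_compact_exhaustion:
  assumes S: "S \<in> sets borel"
  obtains K :: "nat \<Rightarrow> (real^'n) set" where "\<And>q. compact (K q)" "\<And>q. K q \<subseteq> S" "AE x in \<nu>. x \<in> S \<longrightarrow> x \<in> (\<Union>q. K q)"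
proof -
  have "\<exists>K. compact K \<and> K \<subseteq> S \<and> measure \<nu> S - e < measure \<nu> K" if "e > 0" for e
  proof (rule ccontr)
    assume no: "\<not> ?thesis"
    have "measure \<nu> S - e \<ge> 0" using no[unfolded not_ex, rule_format, of "{}"] by simp
    have "emeasure \<nu> S = (SUP K \<in> {K. K \<subseteq> S \<and> compact K}. emeasure \<nu> K)"
      by (rule inner_regular) (use S in \<open>auto simp: sets_nu emeasure_eq_measure\<close>)
    also have "\<dots> \<le> ennreal (measure \<nu> S - e)"
    proof (rule SUP_least, clarify)
      fix K assume "K \<subseteq> S" "compact K"
      then have "measure \<nu> K \<le> measure \<nu> S - e" using no by (meson not_le)
      then show "emeasure \<nu> K \<le> ennreal (measure \<nu> S - e)" by (simp add: emeasure_eq_measure ennreal_leI)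
    qed
    finally have "measure \<nu> S \<le> measure \<nu> S - e" using \<open>measure \<nu> S - e \<ge> 0\<close> by (simp add: emeasure_eq_measure)
    with that show False by simp
  qed
  then have "\<exists>K. compact K \<and> K \<subseteq> S \<and> measure \<nu> S - 1 / Suc q < measure \<nu> K" for q by simp
  then obtain K where K: "\<And>q. compact (K q)" "\<And>q. K q \<subseteq> S" "\<And>q. measure \<nu> S - 1 / Suc q < measure \<nu> (K q)" by metis
  have Kb: "K q \<in> sets \<nu>" for q using K(1) by (simp add: sets_nu borel_compact)
  have Sb: "S \<in> sets \<nu>" using S by (simp add: sets_nu)
  let ?N = "S - (\<Union>q. K q)"
  have N: "?N \<in> sets \<nu>" using Kb Sb by auto
  have "measure \<nu> ?N \<le> 1 / Suc q" for q
  proof -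
    have "measure \<nu> ?N \<le> measure \<nu> (S - K q)" by (rule finite_measure_mono) (use Sb Kb in auto)
    also have "\<dots> = measure \<nu> S - measure \<nu> (K q)" by (rule finite_measure_Diff) (use Sb Kb K in auto)
    also have "\<dots> \<le> 1 / Suc q" using K(3)[of q] by linarith
    finally show ?thesis .
  qed
  note small = this
  have "measure \<nu> ?N \<le> 0"
  proof (rule field_le_epsilon)
    fix e :: real assume "e > 0"
    then obtain q where "1 / Suc q < e" by (rule nat_approx_posE)
    with small[of q] show "measure \<nu> ?N \<le> 0 + e" by linarith
  qed
  then have "?N \<in> null_sets \<nu>" using N by (auto simp: null_sets_def emeasure_eq_measure measure_le_0_iff)
  then have "AE x in \<nu>. x \<in> S \<longrightarrow> x \<in> (\<Union>q. K q)" by (rule AE_I') auto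
  with K(1,2) show ?thesis by (rule that)
qed

text \<open>Where the matrix has norm 1 some entry is nonzero, so \<open>A\<close> splits by row,
  column, sign and threshold \<open>1 / Suc j\<close> into countably many pieces; inner regularity
  replaces each piece by compact sets, up to a null set.\<close>

lemma rect_good_self:
  assumes A: "A \<in> sets borel" "A \<subseteq> \<Omega>" "hausdorff1 A < \<infinity>" and \<tau>1: "AE x in \<nu>. norm (\<tau> x) = 1"
  shows "rect_good A A"
proof -
  define S where "S = (\<lambda>(k, i, \<sigma>, j). {x\<in>A. 1 / Suc j \<le> \<sigma> * \<tau> x $ k $ i})"
  define I where "I = (UNIV :: 'N set) \<times> (UNIV :: 'n set) \<times> {1, -1 :: real} \<times> (UNIV :: nat set)"
  have "rect_good A (\<Union>t\<in>I. S t)"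
  proof (rule rect_good_UN)
    show "countable I" unfolding I_def by (intro countable_SIGMA) auto
    fix t assume "t \<in> I"
    then obtain k i \<sigma> j where t: "t = (k, i, \<sigma>, j)" "\<bar>\<sigma>\<bar> \<le> 1" unfolding I_def by auto
    have [measurable]: "(\<lambda>x. \<tau> x $ k $ i) \<in> borel_measurable borel"
      by (rule measurable_compose[OF tau_row_meas borel_measurable_vec_component])
    have [measurable]: "A \<in> sets borel" by (rule A(1))
    have "{x\<in>A. 1 / Suc j \<le> \<sigma> * \<tau> x $ k $ i} \<in> sets borel" by measurable
    then have "S t \<in> sets borel" by (simp add: t S_def)
    then obtain K where K: "\<And>q::nat. compact (K q)" "\<And>q. K q \<subseteq> S t" "AE x in \<nu>. x \<in> S t \<longrightarrow> x \<in> (\<Union>q. K q)"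
      using AE_compact_exhaustion[of "S t"] by auto
    have "rect_good A (\<Union>q. K q)"
    proof (rule rect_good_UN)
      fix q
      have KA: "K q \<subseteq> A" using K(2)[of q] by (auto simp: S_def t)
      show "rect_good A (K q)"
      proof (rule rect_good_compact[OF K(1) _ _ t(2), of _ "1 / Suc j" k i])
        show "hausdorff1 (K q) < \<infinity>" using hausdorff1_mono[OF KA] A(3) by (rule le_less_trans)
        show "1 / Suc j \<le> \<sigma> * \<tau> x $ k $ i" if "x \<in> K q" for x using K(2)[of q] that by (auto simp: S_def t)
      qed (use KA A in auto)
    qed simp
    then show "rect_good A (S t)" using K(3) by (rule rect_good_AE)
  qed
  then show ?thesis
  proof (rule rect_good_AE)
    show "AE x in \<nu>. x \<in> A \<longrightarrow> x \<in> (\<Union>t\<in>I. S t)"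
      using \<tau>1
    proof eventually_elim
      case (elim x)
      show ?case
      proof
        assume x: "x \<in> A"
        have "\<tau> x \<noteq> 0" using elim by auto
        then obtain k i where ki: "\<tau> x $ k $ i \<noteq> 0" by (auto simp: vec_eq_iff)
        define \<sigma> :: real where "\<sigma> = (if \<tau> x $ k $ i > 0 then 1 else -1)"
        have "\<sigma> * \<tau> x $ k $ i > 0" using ki by (simp add: \<sigma>_def)
        then obtain j where "1 / Suc j < \<sigma> * \<tau> x $ k $ i" using nat_approx_posE by blast
        then have "x \<in> S (k, i, \<sigma>, j)" using x by (simp add: S_def)
        moreover have "(k, i, \<sigma>, j) \<in> I" by (simp add: I_def \<sigma>_def)
        ultimately show "x \<in> (\<Union>t\<in>I. S t)" by blast
      qed
    qed
  qed
qed

text \<open>Coordinate projections do not increase distances, so every projection of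
  \<open>B\<close> is null; at almost every point some entry of \<tau> is nonzero, and the
  projection along that entry excludes the point from \<open>B\<close>.\<close>

lemma hausdorff1_null_imp_null:
  assumes \<tau>1: "AE x in \<nu>. norm (\<tau> x) = 1" and B: "B \<in> sets borel" "hausdorff1 B = 0"
  shows "emeasure \<nu> (B \<inter> \<Omega>) = 0"
proof -
  have "AE x in \<nu>. x \<in> \<Omega> \<longrightarrow> \<tau> x $ k $ i \<noteq> 0 \<longrightarrow> x $ i \<notin> (\<lambda>x. x $ i) ` B" for k i
  proof -
    interpret D: divfree \<nu> \<Omega> "\<lambda>x. 1 *\<^sub>R (\<tau> x $ k)" by (rule divfree_row) simp
    have "negligible ((\<lambda>x. x $ i) ` B)"
      by (rule negligible_projection_hausdorff1_null[OF _ B(2)]) (metis dist_vec_nth_le dist_real_def)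
    from D.AE_null_projection[OF this, of i] show ?thesis by simp
  qed
  then have "AE x in \<nu>. \<forall>k i. x \<in> \<Omega> \<longrightarrow> \<tau> x $ k $ i \<noteq> 0 \<longrightarrow> x $ i \<notin> (\<lambda>x. x $ i) ` B"
    unfolding AE_all_countable by blast
  with \<tau>1 have "AE x in \<nu>. x \<notin> B \<inter> \<Omega>"
  proof eventually_elim
    case (elim x)
    have "\<tau> x \<noteq> 0" using elim(1) by auto
    then obtain k i where "\<tau> x $ k $ i \<noteq> 0" by (auto simp: vec_eq_iff)
    with elim(2) show ?case by blast
  qed
  moreover have "B \<inter> \<Omega> \<in> sets \<nu>" using B open_Omega by (simp add: sets_nu)
  ultimately show ?thesis by (subst (asm) AE_iff_measurable[of "B \<inter> \<Omega>"]) auto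
qed

end

theorem mainTheorem15:
  fixes \<Omega> :: "(real^'n) set"
    and u0 :: "real^'n \<Rightarrow> real^'N"
    and p :: "nat \<Rightarrow> real"
    and u :: "nat \<Rightarrow> real^'n \<Rightarrow> real^'N"
    and Du :: "nat \<Rightarrow> real^'n \<Rightarrow> real^'n^'N"
    and mu_inf :: "(real^'n) measure"
    and F_inf :: "real^'n \<Rightarrow> real^'n^'N"
    and normT :: "(real^'n) measure"
    and Tvec :: "real^'n \<Rightarrow> real^'n^'N"
  assumes dom: "bounded_smooth_domain \<Omega>"
    and lip: "\<exists>L. L-lipschitz_on UNIV u0"
    and einf_pos: "e_inf \<Omega> u0 > 0"
    and p_ge: "\<forall>l. p l \<ge> 2"
    and p_lim: "filterlim p at_top sequentially"
    and minim: "\<forall>l. is_minimiser \<Omega> u0 (p l) (u l) (Du l)"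
    and weak: "\<exists>u_inf Du_inf. \<forall>q\<ge>1. W1p \<Omega> q u_inf Du_inf \<and>
                  weak_Lq \<Omega> q u u_inf \<and> weak_Lq \<Omega> q Du Du_inf"
    and mconv: "mf_conv \<Omega> (\<lambda>l. mu_p \<Omega> (p l) (Du l)) Du mu_inf F_inf"
    and mu_borel: "sets mu_inf = sets borel"
    and T_borel: "sets normT = sets borel"
    and T_fin: "emeasure normT UNIV < \<infinity>"
    and T_supp: "emeasure normT (UNIV - closure \<Omega>) = 0"
    and Tvec_meas: "Tvec \<in> borel_measurable normT"
    and Tvec_norm: "AE x in normT. norm (Tvec x) = 1"
    and T_repr: "\<forall>k (\<omega> :: real^'n \<Rightarrow> real^'n). continuous_on (closure \<Omega>) \<omega> \<longrightarrow>
        (LINT x:closure \<Omega>|mu_inf. \<omega> x \<bullet> (F_inf x $ k)) = (LINT x:closure \<Omega>|normT. \<omega> x \<bullet> (Tvec x $ k))"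
  shows "(\<forall>B\<in>sets borel. hausdorff1 B = 0 \<longrightarrow> emeasure normT (B \<inter> \<Omega>) = 0) \<and>
         (\<forall>A. A \<in> sets (completion normT) \<longrightarrow> A \<subseteq> \<Omega> \<longrightarrow> hausdorff1 A < \<infinity> \<longrightarrow>
            countably_rect1_measure (density (completion normT) (indicator A)) \<and>
            (AE x in normT. x \<in> A \<longrightarrow>
               approx_tangent_contains (density (completion normT) (indicator A)) x (\<lambda>k. Tvec x $ k)))"
proof -
  have Om: "open \<Omega>" "bounded \<Omega>" "\<Omega> \<noteq> {}" using dom by (auto simp: bounded_smooth_domain_def)
  \<comment> \<open>A version of \<open>Tvec\<close> bounded by 1 at every point, so that
    integrability and weight bounds hold without exceptional sets.\<close>
  define \<tau> where "\<tau> x = (if norm (Tvec x) \<le> 1 then Tvec x else 0)" for x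
  have Tb [measurable]: "Tvec \<in> borel_measurable borel"
    using Tvec_meas measurable_cong_sets[OF T_borel refl] by blast
  have space_T: "space normT = UNIV" using sets_eq_imp_space_eq[OF T_borel] by simp
  have \<tau>T: "AE x in normT. \<tau> x = Tvec x" using Tvec_norm by eventually_elim (simp add: \<tau>_def)
  have \<tau>1: "AE x in normT. norm (\<tau> x) = 1" using Tvec_norm by eventually_elim (simp add: \<tau>_def)
  have \<tau>b [measurable]: "\<tau> \<in> borel_measurable borel" unfolding \<tau>_def[abs_def] by measurable
  \<comment> \<open>Weak convergence with \<eta> = 0 and the one-row matrix of
    \<open>grad \<phi>\<close>: the approximating integrals all vanish by the Euler-Lagrange
    equation, so the limit does, and \<open>T_repr\<close> rewrites it in terms of
    \<open>normT\<close>.\<close>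
  have div: "(\<integral>x. grad \<phi> x \<bullet> (\<tau> x $ k) \<partial>normT) = 0" if \<phi>: "test_fun \<Omega> \<phi>" for \<phi> k
  proof -
    have gc: "continuous_on S (grad \<phi>)" for S
      using continuous_on_grad[OF test_fun_smooth[OF \<phi>]] by (rule continuous_on_subset) simp
    have mfp: "mf_pair \<Omega> (mu_p \<Omega> (p l) (Du l)) (Du l)" for l using mconv unfolding mf_conv_def by blast
    \<comment> \<open>Sobolev membership gives measurability on \<Omega> only; on the whole space it
      comes from \<open>mf_pair\<close>, since \<open>mu_p\<close> has the Lebesgue measurable
      sets.\<close>
    have DuL: "Du l \<in> borel_measurable lebesgue" for l
    proof -
      have "Du l \<in> borel_measurable (mu_p \<Omega> (p l) (Du l))" using mfp[of l] unfolding mf_pair_def by blast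
      moreover have "sets (mu_p \<Omega> (p l) (Du l)) = sets lebesgue" by (simp add: mu_p_def)
      ultimately show ?thesis using measurable_cong_sets[OF _ refl] by blast
    qed
    have conv: "\<And>(\<eta> :: real^'n \<Rightarrow> real) (\<phi> :: real^'n \<Rightarrow> real^'n^'N).
        continuous_on (closure \<Omega>) \<eta> \<Longrightarrow> continuous_on (closure \<Omega>) \<phi> \<Longrightarrow>
        (\<lambda>l. LINT x:closure \<Omega>|mu_p \<Omega> (p l) (Du l). \<eta> x + Du l x \<bullet> \<phi> x)
          \<longlonglongrightarrow> (LINT x:closure \<Omega>|mu_inf. \<eta> x + F_inf x \<bullet> \<phi> x)"
      using mconv unfolding mf_conv_def by blast
    have "(\<lambda>l. LINT x:closure \<Omega>|mu_p \<Omega> (p l) (Du l). 0 + Du l x \<bullet> row_mat k (grad \<phi> x))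
        \<longlonglongrightarrow> (LINT x:closure \<Omega>|mu_inf. 0 + F_inf x \<bullet> row_mat k (grad \<phi> x))"
      by (rule conv[of "\<lambda>_. 0" "\<lambda>x. row_mat k (grad \<phi> x)", OF continuous_on_const continuous_on_row_mat[OF gc]])
    moreover have "(LINT x:closure \<Omega>|mu_p \<Omega> (p l) (Du l). 0 + Du l x \<bullet> row_mat k (grad \<phi> x)) = 0" for l
      by (rule integral_mu_p_eq_0[OF Om _ _ DuL \<phi>]) (use p_ge minim in auto)
    ultimately have "(LINT x:closure \<Omega>|mu_inf. F_inf x \<bullet> row_mat k (grad \<phi> x)) = 0"
      by (simp add: LIMSEQ_const_iff)
    then have "(LINT x:closure \<Omega>|mu_inf. grad \<phi> x \<bullet> (F_inf x $ k)) = 0"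
      by (simp add: inner_row_mat inner_commute)
    moreover have "(LINT x:closure \<Omega>|mu_inf. grad \<phi> x \<bullet> (F_inf x $ k)) = (LINT x:closure \<Omega>|normT. grad \<phi> x \<bullet> (Tvec x $ k))"
      by (rule T_repr[rule_format]) (rule gc)
    ultimately have z: "(LINT x:closure \<Omega>|normT. grad \<phi> x \<bullet> (Tvec x $ k)) = 0" by (simp only:)
    have [measurable]: "grad \<phi> \<in> borel_measurable borel" using gc by (rule borel_measurable_continuous_onI)
    have row: "(\<lambda>x. h x $ k) \<in> borel_measurable borel" if "h \<in> borel_measurable borel" for h :: "real^'n \<Rightarrow> real^'n^'N"
      by (rule measurable_compose[OF that]) (intro borel_measurable_continuous_onI continuous_intros)
    \<comment> \<open>The restriction to the closure of \<Omega> is harmless because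
      \<open>grad \<phi>\<close> vanishes outside the support.\<close>
    have "(\<integral>x. grad \<phi> x \<bullet> (\<tau> x $ k) \<partial>normT) = (\<integral>x. indicator (closure \<Omega>) x *\<^sub>R (grad \<phi> x \<bullet> (Tvec x $ k)) \<partial>normT)"
    proof (rule integral_cong_AE)
      show "(\<lambda>x. grad \<phi> x \<bullet> (\<tau> x $ k)) \<in> borel_measurable normT"
        unfolding measurable_cong_sets[OF T_borel refl] by (intro borel_measurable_inner row) auto
      show "(\<lambda>x. indicator (closure \<Omega>) x *\<^sub>R (grad \<phi> x \<bullet> (Tvec x $ k))) \<in> borel_measurable normT"
        unfolding measurable_cong_sets[OF T_borel refl]
        by (intro borel_measurable_scaleR borel_measurable_indicator borel_measurable_inner row) auto
      show "AE x in normT. grad \<phi> x \<bullet> (\<tau> x $ k) = indicator (closure \<Omega>) x *\<^sub>R (grad \<phi> x \<bullet> (Tvec x $ k))"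
        using \<tau>T
      proof eventually_elim
        case (elim x)
        have "grad \<phi> x = 0" if "x \<notin> closure \<Omega>"
          using that \<phi> closure_subset[of \<Omega>] by (intro grad_outside_support) (auto simp: test_fun_def)
        then show ?case using elim by (cases "x \<in> closure \<Omega>") auto
      qed
    qed
    with z show ?thesis by (simp add: set_lebesgue_integral_def)
  qed
  interpret vec_divfree normT \<Omega> \<tau>
  proof (intro vec_divfree.intro vec_divfree_axioms.intro finite_measureI)
    show "emeasure normT (space normT) \<noteq> \<infinity>" using T_fin by (simp add: space_T)
    show "norm (\<tau> x) \<le> 1" for x by (simp add: \<tau>_def)
  qed (use T_borel Om(1) \<tau>b div in auto)
  let ?C = "completion normT"
  have rect: "countably_rect1_measure (density ?C (indicator A)) \<and>
      (AE x in normT. x \<in> A \<longrightarrow> approx_tangent_contains (density ?C (indicator A)) x (\<lambda>k. Tvec x $ k))"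
    if A: "A \<in> sets ?C" "A \<subseteq> \<Omega>" "hausdorff1 A < \<infinity>" for A
  proof -
    let ?M = "density ?C (indicator A)"
    \<comment> \<open>A measurable set of the completion is a Borel set up to a null set; everything
      is proved for the Borel part \<open>S\<close> and carried over to \<open>A\<close>, whose
      restricted measure has the same integrals.\<close>
    obtain S N N' where S: "A = S \<union> N" "N \<subseteq> N'" "N' \<in> null_sets normT" "S \<in> sets normT"
      using sets_completionE[OF A(1)] .
    have Sb: "S \<in> sets borel" using S(4) by (simp add: T_borel)
    have AS: "AE x in normT. x \<in> A \<longleftrightarrow> x \<in> S"
      using AE_not_in[OF S(3)] by eventually_elim (use S(1,2) in auto)
    have "rect_good S S"
      by (rule rect_good_self[OF Sb _ _ \<tau>1]) (use A S(1) hausdorff1_mono[of S A] in \<open>auto intro: le_less_trans\<close>)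
    then obtain \<G> where \<G>: "countable \<G>" "\<forall>f\<in>\<G>. \<exists>L. L-lipschitz_on UNIV (f :: real \<Rightarrow> real^'n)"
      "AE x in normT. x \<in> S \<longrightarrow> (\<exists>f\<in>\<G>. x \<in> range f) \<and> line_tangent S x"
      unfolding rect_good_def by blast
    have emM: "emeasure ?M B = emeasure ?C (B \<inter> A)" if "B \<in> sets ?C" for B
      by (rule emeasure_density_indicator[OF that A(1)])
    have null: "emeasure ?M B = 0" if B: "B \<in> sets borel" "AE x in normT. x \<notin> B \<inter> A" for B
    proof -
      have BC: "B \<in> sets ?C" using B(1) by (simp add: T_borel sets_completionI_sets)
      have "AE x in ?C. x \<notin> B \<inter> A" using B(2) by (simp add: AE_completion_iff)
      moreover have "B \<inter> A \<in> sets ?C" using BC A(1) by blast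
      ultimately have "emeasure ?C (B \<inter> A) = 0" by (subst (asm) AE_iff_measurable[of "B \<inter> A"]) (auto simp: space_T)
      then show ?thesis by (simp add: emM[OF BC])
    qed
    have "countably_rect1_measure ?M"
      unfolding countably_rect1_measure_def
    proof (intro conjI ballI impI)
      fix B :: "(real^'n) set" assume B: "B \<in> sets borel" "hausdorff1 B = 0"
      have BO: "B \<inter> \<Omega> \<in> sets normT" using B(1) Om(1) by (simp add: T_borel)
      have "B \<inter> \<Omega> \<in> null_sets normT" using hausdorff1_null_imp_null[OF \<tau>1 B] BO by (simp add: null_sets_def)
      from AE_not_in[OF this] show "emeasure ?M B = 0"
        by (intro null B(1)) (auto elim!: eventually_mono dest: subsetD[OF A(2)])
    next
      \<comment> \<open>A constant curve is added so that the family is nonempty and can be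
        enumerated by the natural numbers.\<close>
      define \<G>' where "\<G>' = insert (\<lambda>_. 0) \<G>"
      define f where "f = from_nat_into \<G>'"
      have ne: "\<G>' \<noteq> {}" "countable \<G>'" using \<G>(1) by (auto simp: \<G>'_def)
      have rf: "range f = \<G>'" unfolding f_def using ne by (rule range_from_nat_into)
      have lip: "\<exists>L. L-lipschitz_on UNIV (f i)" for i
      proof -
        have "f i \<in> \<G>'" using rf by blast
        then show ?thesis using \<G>(2) lipschitz_on_constant[of UNIV "0 :: real^'n"] unfolding \<G>'_def by auto
      qed
      have fb: "range (f i) \<in> sets borel" for i
      proof -
        obtain L where "L-lipschitz_on UNIV (f i)" using lip by blast
        then have c: "continuous_on UNIV (f i)" by (rule lipschitz_on_continuous_on)
        \<comment> \<open>The range of a continuous curve need not be closed, but as a countable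
          union of compact images it is Borel.\<close>
        have "range (f i) = (\<Union>n::nat. f i ` {- real n..real n})"
        proof -
          have "\<exists>n::nat. t \<in> {- real n..real n}" for t :: real
          proof -
            obtain n :: nat where "\<bar>t\<bar> \<le> real n" using real_arch_simple by blast
            then have "t \<in> {- real n..real n}" by auto
            then show ?thesis ..
          qed
          then show ?thesis by fast
        qed
        moreover have "f i ` {- real n..real n} \<in> sets borel" for n :: nat
          by (intro borel_compact compact_continuous_image continuous_on_subset[OF c]) auto
        ultimately show ?thesis by auto
      qed
      let ?R = "UNIV - ({} \<union> (\<Union>i. range (f i)))"
      have R: "?R \<in> sets borel" using fb by auto
      have "AE x in normT. x \<notin> ?R \<inter> A"
        using \<G>(3) AS
      proof eventually_elim
        case (elim x)
        show ?case
        proof (cases "x \<in> A")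
          case True
          then obtain g where "g \<in> \<G>" "x \<in> range g" using elim by blast
          then have "g \<in> range f" unfolding rf \<G>'_def by blast
          then show ?thesis using \<open>x \<in> range g\<close> by blast
        qed simp
      qed
      then have "emeasure ?M ?R = 0" by (rule null[OF R])
      moreover have "?R \<in> sets ?M" using R by (simp add: T_borel sets_completionI_sets)
      moreover have "hausdorff1 ({} :: (real^'n) set) = 0"
        unfolding hausdorff1_def by (intro antisym[OF SUP_least] zero_le INF_lower2[of "\<lambda>_. {}"]) auto
      ultimately show "\<exists>E0 (f :: nat \<Rightarrow> real \<Rightarrow> real^'n). E0 \<in> sets borel \<and> hausdorff1 E0 = 0 \<and>
        (\<forall>i. \<exists>L. L-lipschitz_on UNIV (f i)) \<and>
        UNIV - (E0 \<union> (\<Union>i. range (f i))) \<in> sets ?M \<and>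
        emeasure ?M (UNIV - (E0 \<union> (\<Union>i. range (f i)))) = 0"
        using lip by (intro exI[of _ "{}"] exI[of _ f]) auto
    qed
    moreover have "AE x in normT. x \<in> A \<longrightarrow> approx_tangent_contains ?M x (\<lambda>k. Tvec x $ k)"
      using \<G>(3) AS \<tau>T
    proof eventually_elim
      case (elim x)
      show ?case
      proof
        assume "x \<in> A"
        then have "line_tangent S x" using elim by blast
        then obtain \<theta> v where \<theta>v: "\<theta> > 0" "norm v = 1"
          "\<And>\<Phi>. continuous_on UNIV \<Phi> \<Longrightarrow> bounded {y. \<Phi> y \<noteq> 0} \<Longrightarrow>
             ((\<lambda>r. (1 / r) * (\<integral>y. \<Phi> ((1 / r) *\<^sub>R (y - x)) * indicator S y \<partial>normT)) \<longlongrightarrow>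
             \<theta> * (\<integral>t. \<Phi> (t *\<^sub>R v) \<partial>lborel)) (at_right 0)" "\<And>l. \<tau> x $ l \<in> span {v}"
          unfolding line_tangent_def by blast
        have int: "(\<integral>y. g y \<partial>?M) = (\<integral>y. g y * indicator S y \<partial>normT)" if g: "g \<in> borel_measurable borel" for g :: "real^'n \<Rightarrow> real"
        proof -
          have gT: "g \<in> borel_measurable normT" using g unfolding measurable_cong_sets[OF T_borel refl] .
          then have gC: "g \<in> borel_measurable ?C" by (rule measurable_completion)
          have iT: "(\<lambda>y. g y * indicator S y) \<in> borel_measurable normT"
            using gT S(4) by (intro borel_measurable_times borel_measurable_indicator)
          have "?M = density ?C (\<lambda>y. ennreal (indicator A y))" by (simp add: ennreal_indicator)
          then have "(\<integral>y. g y \<partial>?M) = (\<integral>y. indicator A y *\<^sub>R g y \<partial>?C)"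
            using A(1) gC by (simp only:) (subst integral_density, auto)
          also have "\<dots> = (\<integral>y. g y * indicator S y \<partial>?C)"
          proof (rule integral_cong_AE)
            show "(\<lambda>y. indicator A y *\<^sub>R g y) \<in> borel_measurable ?C"
              using A(1) gC by (intro borel_measurable_scaleR borel_measurable_indicator)
            show "(\<lambda>y. g y * indicator S y) \<in> borel_measurable ?C" using iT by (rule measurable_completion)
            show "AE y in ?C. indicator A y *\<^sub>R g y = g y * indicator S y"
              unfolding AE_completion_iff using AS by eventually_elim (simp add: indicator_def)
          qed
          also have "\<dots> = (\<integral>y. g y * indicator S y \<partial>normT)" by (rule integral_completion[OF iT])
          finally show ?thesis .
        qed
        show "approx_tangent_contains ?M x (\<lambda>k. Tvec x $ k)"
          unfolding approx_tangent_contains_def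
        proof (rule exI[of _ \<theta>], rule conjI[OF \<theta>v(1)], rule exI[of _ v], intro conjI allI impI \<theta>v(2))
          show "Tvec x $ l \<in> span {v}" for l using \<theta>v(4)[of l] elim(3) by simp
          fix \<Phi> :: "real^'n \<Rightarrow> real" assume \<Phi>: "continuous_on UNIV \<Phi>" "bounded {y. \<Phi> y \<noteq> 0}"
          have "(\<lambda>y. \<Phi> ((1 / r) *\<^sub>R (y - x))) \<in> borel_measurable borel" for r
            by (intro borel_measurable_continuous_onI continuous_on_compose2[OF \<Phi>(1)] continuous_intros) auto
          then show "((\<lambda>r. (1 / r) * (\<integral>y. \<Phi> ((1 / r) *\<^sub>R (y - x)) \<partial>?M)) \<longlongrightarrow>
             \<theta> * (\<integral>t. \<Phi> (t *\<^sub>R v) \<partial>lborel)) (at_right 0)"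
            using \<theta>v(3)[OF \<Phi>] by (simp add: int)
        qed
      qed
    qed
    ultimately show ?thesis ..
  qed
  show ?thesis
    using hausdorff1_null_imp_null[OF \<tau>1] rect by blast
qed

end
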